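(* Let $\mathcal A=kQ/I$ be a string algebra over an algebraically closed field $k$ and let $(b,m)$ and $(c,n)$ be bands. There are $X\in\mathcal F(b,m)$ and $Y\in\mathcal F(c,n)$ with $\operatorname{Ext}^1_{\mathcal A}(X,Y)=0$ if and only if the pair $([(b,m)],[(c,n)])$ is not extendable.
   Context: String algebras. $k$ is an algebraically closed field. $Q=(Q_0,Q_1,s,t)$ is a quiver with finite sets $Q_0$ of vertices and $Q_1$ of arrows, and source/target maps $s,t:Q_1\to Q_0$. A path is either $1_u$ ($u\in Q_0$) or a finite sequence of arrows $\alpha_1\cdots\alpha_n$ with $s(\alpha_i)=t(\alpha_{i+1})$. The path algebra $kQ$ has the paths as basis, and the product of paths $p,q$ is the concatenation $pq$ if $s(p)=t(q)$ and $0$ otherwise. $\mathcal A=kQ/I$ is a string algebra if: $I$ is an admissible ideal ($(kQ^+)^n\subseteq I\subseteq (kQ^+)^2$ for some $n$, where $kQ^+$ is the ideal generated by the arrows); $I$ is generated by a set of paths; at every vertex at most two arrows start and at most two arrows end; for each arrow $\alpha$ there is at most one arrow $\beta$ with $s(\alpha)=t(\beta)$ and $\alpha\beta\notin I$; for each arrow $\beta$ there is at most one arrow $\alpha$ with $s(\alpha)=t(\beta)$ and $\alpha\beta\notin I$. Strings. Let $Q_1^{-1}=\{\alpha^{-1}:\alpha\in Q_1\}$ be formal inverses, $s(\alpha^{-1})=t(\alpha)$, $t(\alpha^{-1})=s(\alpha)$, $(\alpha^{-1})^{-1}=\alpha$. A string is either a trivial string $1_u$ ($u\in Q_0$) or a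 word $\alpha_1\cdots\alpha_n$ in letters of $Q_1\cup Q_1^{-1}$ with $s(\alpha_i)=t(\alpha_{i+1})$ and $\alpha_i\ne\alpha_{i+1}^{-1}$, such that no subword $\alpha_i\cdots\alpha_j$ and no inverse $\alpha_j^{-1}\cdots\alpha_i^{-1}$ of a subword belongs to $I$. For $c=\alpha_1\cdots\alpha_n$: $t(c)=t(\alpha_1)$, $s(c)=s(\alpha_n)$, length $l(c)=n$, $c^{-1}=\alpha_n^{-1}\cdots\alpha_1^{-1}$; for $c=1_u$: $s(c)=t(c)=u$, $l(c)=0$, $c^{-1}=c$. Trivial strings act as identities for concatenation. Quasi-bands and bands. A quasi-band $(b,m)$ is a map $b:\mathbb Z\to Q_1\cup Q_1^{-1}$ with an integer $m\ge1$ such that $b(i)=b(i+m)$ for all $i$ and $b(i)b(i+1)\cdots b(i+n)$ is a string for all $i\in\mathbb Z$, $n\ge0$. One writes $(b,m)=b(1)\cdots b(m)$; an equality $(b,sm)=x$ with $x$ a word means $b(1)\cdots b(sm)=x$. A word of length $n$ is called a quasi-band if its $n$-periodic extension $c:\mathbb Z\to Q_1\cup Q_1^{-1}$ (with $c(1)\cdots c(n)$ the word) gives a quasi-band $(c,n)$. A quasi-band $(b,m)$ is a band if $(b,m')$ is not a quasi-band for $0<m'<m$. $(b,m)\sim(b',m')$ means $m=m'$ and there is $i\in\mathbb Z$ with either $b(j)=b'(i+j)$ for all $j$, or $b(j)=b'(i-j)^{-1}$ for all $j$; $[(b,m)]$ is the equivalence class. Band modules. For a quasi-band $(b,m)$,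 $M(b)$ is the $\mathcal A$-module with basis $\{e_i:i\in\mathbb Z\}$ where $1_ue_i=e_i$ if $u=s(b(i))$ and $0$ otherwise, and an arrow $\alpha$ acts by $\alpha e_{i-1}=e_i$ if $b(i)=\alpha^{-1}$, $\alpha e_i=e_{i-1}$ if $b(i)=\alpha$, and by $0$ on basis vectors not covered by these rules. For $\lambda\in k^*$, $M(b,m,\lambda)=M(b)/\operatorname{span}\{e_i-\lambda e_{i+m}:i\in\mathbb Z\}$, an $m$-dimensional module. Families. $\operatorname{mod}(\mathcal A,d)$ is the affine variety of $k$-algebra homomorphisms $\mathcal A\to M_d(k)$; its points are $d$-dimensional left $\mathcal A$-modules. For a quasi-band $(b,m)$, $\mathcal F(b,m)\subseteq\operatorname{mod}(\mathcal A,m)$ is the set of points isomorphic to $M(b,m,\lambda)$ for some $\lambda\in k^*$. Extendable pairs. A pair of bands $((b,m),(c,n))$ is extendable if there are $s,t\ge1$, strings $u,v,w$ and arrows $\alpha,\beta,\gamma,\delta$ with $(b,sm)=w\beta u\alpha^{-1}$ and $(c,tn)=w\delta^{-1}v\gamma$ such that $c(1)\cdots c(n)b(1)\cdots b(m)$ is a quasi-band. A pair $(B,C)$ of equivalence classes of bands is extendable if some $((b,m),(c,n))$ with $(b,m)\in B$, $(c,n)\in C$ is extendable. *)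

theory Defs
  imports
    "HOL-Library.Poly_Mapping"
    "HOL-Library.Sublist"
    "HOL-Computational_Algebra.Polynomial"
    "HOL-Algebra.Ideal_Product"
    "HOL-Algebra.QuotRing"
    "HOL-Algebra.Module"
    "Graph_Theory.Digraph"
    "Jordan_Normal_Form.Matrix"
begin

section \<open>Finitely supported functions as vector spaces\<close>

definition pscale :: "'k::comm_ring_1 \<Rightarrow> ('x \<Rightarrow>\<^sub>0 'k) \<Rightarrow> ('x \<Rightarrow>\<^sub>0 'k)" where
  "pscale c v = Poly_Mapping.map ((*) c) v"

text \<open>The linear map sending the basis vector \<open>Poly_Mapping.single x 1\<close> to \<open>f x\<close>.\<close>

definition lin_ext :: "('x \<Rightarrow> ('y \<Rightarrow>\<^sub>0 'k)) \<Rightarrow> ('x \<Rightarrow>\<^sub>0 'k) \<Rightarrow> ('y \<Rightarrow>\<^sub>0 'k::comm_ring_1)" where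
  "lin_ext f v = (\<Sum>x\<in>Poly_Mapping.keys v. pscale (Poly_Mapping.lookup v x) (f x))"


section \<open>Paths and words\<close>

text \<open>
  A quiver is a \<^typ>\<open>('v, 'a) pre_digraph\<close> satisfying \<^locale>\<open>fin_digraph\<close>; the source of an
  arrow is its \<^const>\<open>tail\<close>, its target is its \<^const>\<open>head\<close>.

  \<open>Triv u\<close> is \<open>1\<^sub>u\<close> and \<open>Walk [x\<^sub>1, \<dots>, x\<^sub>n]\<close> is \<open>x\<^sub>1 \<cdots> x\<^sub>n\<close>. Words are read from right to left: the
  source of \<open>x\<^sub>i\<close> is the target of \<open>x\<^sub>i\<^sub>+\<^sub>1\<close>. The same type serves for paths (letters are arrows)
  and for strings (letters are arrows and formal inverses of arrows). The list is meant to be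
  nonempty, which the predicates for paths and strings below demand.
\<close>

datatype ('v, 'l) walk = Triv 'v | Walk "'l list"

type_synonym ('v, 'a) path = "('v, 'a) walk"

datatype 'a letter = Arr 'a | Inv 'a

fun linv :: "'a letter \<Rightarrow> 'a letter" where
  "linv (Arr a) = Inv a"
| "linv (Inv a) = Arr a"

fun lsrc :: "('v, 'a) pre_digraph \<Rightarrow> 'a letter \<Rightarrow> 'v" where
  "lsrc Q (Arr a) = tail Q a"
| "lsrc Q (Inv a) = head Q a"

fun ltgt :: "('v, 'a) pre_digraph \<Rightarrow> 'a letter \<Rightarrow> 'v" where
  "ltgt Q (Arr a) = head Q a"
| "ltgt Q (Inv a) = tail Q a"

definition letters :: "('v, 'a) pre_digraph \<Rightarrow> 'a letter set" where
  "letters Q = Arr ` arcs Q \<union> Inv ` arcs Q"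

text \<open>In the following, \<open>s\<close> and \<open>t\<close> are the source and target maps of the letters.\<close>

fun walk_src :: "('l \<Rightarrow> 'v) \<Rightarrow> ('v, 'l) walk \<Rightarrow> 'v" where
  "walk_src s (Triv u) = u"
| "walk_src s (Walk xs) = s (last xs)"

fun walk_tgt :: "('l \<Rightarrow> 'v) \<Rightarrow> ('v, 'l) walk \<Rightarrow> 'v" where
  "walk_tgt t (Triv u) = u"
| "walk_tgt t (Walk xs) = t (hd xs)"

fun walk_append :: "('v, 'l) walk \<Rightarrow> ('v, 'l) walk \<Rightarrow> ('v, 'l) walk" where
  "walk_append (Triv u) q = q"
| "walk_append p (Triv u) = p"
| "walk_append (Walk xs) (Walk ys) = Walk (xs @ ys)"

definition walk_comp ::
  "('l \<Rightarrow> 'v) \<Rightarrow> ('l \<Rightarrow> 'v) \<Rightarrow> ('v, 'l) walk \<Rightarrow> ('v, 'l) walk \<Rightarrow> ('v, 'l) walk option" where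
  "walk_comp s t p q = (if walk_src s p = walk_tgt t q then Some (walk_append p q) else None)"

text \<open>The concatenation of a nonempty list of words, if it is defined.\<close>

fun walk_concat ::
  "('l \<Rightarrow> 'v) \<Rightarrow> ('l \<Rightarrow> 'v) \<Rightarrow> ('v, 'l) walk list \<Rightarrow> ('v, 'l) walk option" where
  "walk_concat s t [] = None"
| "walk_concat s t [p] = Some p"
| "walk_concat s t (p # q # ps) = Option.bind (walk_concat s t (q # ps)) (walk_comp s t p)"

fun is_path :: "('v, 'a) pre_digraph \<Rightarrow> ('v, 'a) path \<Rightarrow> bool" where
  "is_path Q (Triv u) \<longleftrightarrow> u \<in> verts Q"
| "is_path Q (Walk as) \<longleftrightarrow>
     as \<noteq> [] \<and> set as \<subseteq> arcs Q \<and> successively (\<lambda>a b. tail Q a = head Q b) as"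


section \<open>Path algebras, their quotients, and string algebras\<close>

type_synonym ('v, 'a, 'k) kpath = "('v, 'a) path \<Rightarrow>\<^sub>0 'k"

definition path_prod ::
  "('v, 'a) pre_digraph \<Rightarrow> ('v, 'a) path \<Rightarrow> ('v, 'a) path \<Rightarrow> ('v, 'a, 'k::comm_ring_1) kpath" where
  "path_prod Q p q =
     (case walk_comp (tail Q) (head Q) p q of None \<Rightarrow> 0 | Some r \<Rightarrow> Poly_Mapping.single r 1)"

definition path_algebra ::
  "('v, 'a) pre_digraph \<Rightarrow> ('k::comm_ring_1, ('v, 'a, 'k) kpath) module" where
  "path_algebra Q =
     \<lparr> carrier = {x. Poly_Mapping.keys x \<subseteq> {p. is_path Q p}},
       mult = (\<lambda>x y. lin_ext (\<lambda>p. lin_ext (\<lambda>q. path_prod Q p q) y) x),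
       one = (\<Sum>u\<in>verts Q. Poly_Mapping.single (Triv u) 1),
       zero = 0,
       add = (+),
       smult = pscale \<rparr>"

text \<open>The ring \<^term>\<open>R Quot I\<close> together with the induced scalar multiplication.\<close>

definition quotient_algebra :: "('k, 'x) module \<Rightarrow> 'x set \<Rightarrow> ('k, 'x set) module" where
  "quotient_algebra R I =
     \<lparr> carrier = carrier (R Quot I),
       mult = mult (R Quot I),
       one = one (R Quot I),
       zero = zero (R Quot I),
       add = add (R Quot I),
       smult = (\<lambda>c X. \<Union>x\<in>X. I +>\<^bsub>R\<^esub> (c \<odot>\<^bsub>R\<^esub> x)) \<rparr>"

definition basis_path :: "('v, 'a) path \<Rightarrow> ('v, 'a, 'k::comm_ring_1) kpath" where
  "basis_path p = Poly_Mapping.single p 1"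

definition arrow_ideal :: "('v, 'a) pre_digraph \<Rightarrow> ('v, 'a, 'k::comm_ring_1) kpath set" where
  "arrow_ideal Q = genideal (path_algebra Q) ((\<lambda>a. basis_path (Walk [a])) ` arcs Q)"

definition ideal_power :: "('x, 'y) ring_scheme \<Rightarrow> 'x set \<Rightarrow> nat \<Rightarrow> 'x set" where
  "ideal_power R J n = ((\<lambda>K. ideal_prod R K J) ^^ n) (carrier R)"

definition admissible_ideal ::
  "('v, 'a) pre_digraph \<Rightarrow> ('v, 'a, 'k::comm_ring_1) kpath set \<Rightarrow> bool" where
  "admissible_ideal Q I \<longleftrightarrow>
     ideal I (path_algebra Q) \<and>
     I \<subseteq> ideal_power (path_algebra Q) (arrow_ideal Q) 2 \<and>
     (\<exists>n. ideal_power (path_algebra Q) (arrow_ideal Q) n \<subseteq> I)"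

definition string_algebra ::
  "('v, 'a) pre_digraph \<Rightarrow> ('v, 'a, 'k::comm_ring_1) kpath set \<Rightarrow> bool" where
  "string_algebra Q I \<longleftrightarrow>
     fin_digraph Q \<and>
     admissible_ideal Q I \<and>
     (\<exists>P. P \<subseteq> {p. is_path Q p} \<and> I = genideal (path_algebra Q) (basis_path ` P)) \<and>
     (\<forall>v\<in>verts Q. out_degree Q v \<le> 2 \<and> in_degree Q v \<le> 2) \<and>
     (\<forall>a\<in>arcs Q. \<exists>\<^sub>\<le>\<^sub>1 b. b \<in> arcs Q \<and> tail Q a = head Q b \<and> basis_path (Walk [a, b]) \<notin> I) \<and>
     (\<forall>b\<in>arcs Q. \<exists>\<^sub>\<le>\<^sub>1 a. a \<in> arcs Q \<and> tail Q a = head Q b \<and> basis_path (Walk [a, b]) \<notin> I)"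


section \<open>Strings, quasi-bands and bands\<close>

text \<open>A word can only belong to \<open>I\<close> if all of its letters are arrows.\<close>

definition word_in :: "('v, 'a, 'k::comm_ring_1) kpath set \<Rightarrow> 'a letter list \<Rightarrow> bool" where
  "word_in I xs \<longleftrightarrow> (\<exists>as. xs = map Arr as \<and> basis_path (Walk as) \<in> I)"

fun is_string ::
  "('v, 'a) pre_digraph \<Rightarrow> ('v, 'a, 'k::comm_ring_1) kpath set \<Rightarrow> ('v, 'a letter) walk \<Rightarrow> bool" where
  "is_string Q I (Triv u) \<longleftrightarrow> u \<in> verts Q"
| "is_string Q I (Walk xs) \<longleftrightarrow>
     xs \<noteq> [] \<and> set xs \<subseteq> letters Q \<and>
     successively (\<lambda>x y. lsrc Q x = ltgt Q y \<and> x \<noteq> linv y) xs \<and>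
     (\<forall>ys. ys \<noteq> [] \<and> sublist ys xs \<longrightarrow> \<not> word_in I ys \<and> \<not> word_in I (map linv (rev ys)))"

type_synonym 'a qband = "(int \<Rightarrow> 'a letter) \<times> nat"

fun quasi_band ::
  "('v, 'a) pre_digraph \<Rightarrow> ('v, 'a, 'k::comm_ring_1) kpath set \<Rightarrow> 'a qband \<Rightarrow> bool" where
  "quasi_band Q I (b, m) \<longleftrightarrow>
     m \<ge> 1 \<and> (\<forall>i. b i = b (i + int m)) \<and>
     (\<forall>i. \<forall>n::nat. is_string Q I (Walk (map b [i..i + int n])))"

definition word_qband :: "'a letter list \<Rightarrow> 'a qband" where
  "word_qband xs = ((\<lambda>i. xs ! nat ((i - 1) mod int (length xs))), length xs)"

fun band ::
  "('v, 'a) pre_digraph \<Rightarrow> ('v, 'a, 'k::comm_ring_1) kpath set \<Rightarrow> 'a qband \<Rightarrow> bool" where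
  "band Q I (b, m) \<longleftrightarrow>
     quasi_band Q I (b, m) \<and> (\<forall>m'. 0 < m' \<and> m' < m \<longrightarrow> \<not> quasi_band Q I (b, m'))"

definition qband_rel ::
  "('v, 'a) pre_digraph \<Rightarrow> ('v, 'a, 'k::comm_ring_1) kpath set \<Rightarrow> ('a qband \<times> 'a qband) set" where
  "qband_rel Q I =
     {((b, m), (b', m')) | b m b' m'.
        quasi_band Q I (b, m) \<and> quasi_band Q I (b', m') \<and> m = m' \<and>
        (\<exists>i. (\<forall>j. b j = b' (i + j)) \<or> (\<forall>j. b j = linv (b' (i - j))))}"

definition qband_class ::
  "('v, 'a) pre_digraph \<Rightarrow> ('v, 'a, 'k::comm_ring_1) kpath set \<Rightarrow> 'a qband \<Rightarrow> 'a qband set" where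
  "qband_class Q I B = qband_rel Q I `` {B}"

definition extendable ::
  "('v, 'a) pre_digraph \<Rightarrow> ('v, 'a, 'k::comm_ring_1) kpath set \<Rightarrow> 'a qband \<Rightarrow> 'a qband \<Rightarrow> bool" where
  "extendable Q I B C \<longleftrightarrow>
     (case (B, C) of ((b, m), (c, n)) \<Rightarrow>
       band Q I (b, m) \<and> band Q I (c, n) \<and>
       (\<exists>(s::nat)\<ge>1. \<exists>(t::nat)\<ge>1. \<exists>u v w.
        \<exists>\<alpha>\<in>arcs Q. \<exists>\<beta>\<in>arcs Q. \<exists>\<gamma>\<in>arcs Q. \<exists>\<delta>\<in>arcs Q.
          is_string Q I u \<and> is_string Q I v \<and> is_string Q I w \<and>
          walk_concat (lsrc Q) (ltgt Q) [w, Walk [Arr \<beta>], u, Walk [Inv \<alpha>]] =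
            Some (Walk (map b [1..int (s * m)])) \<and>
          walk_concat (lsrc Q) (ltgt Q) [w, Walk [Inv \<delta>], v, Walk [Arr \<gamma>]] =
            Some (Walk (map c [1..int (t * n)]))) \<and>
       quasi_band Q I (word_qband (map c [1..int n] @ map b [1..int m])))"

definition extendable_classes ::
  "('v, 'a) pre_digraph \<Rightarrow> ('v, 'a, 'k::comm_ring_1) kpath set \<Rightarrow>
   'a qband set \<Rightarrow> 'a qband set \<Rightarrow> bool" where
  "extendable_classes Q I BB CC \<longleftrightarrow> (\<exists>B\<in>BB. \<exists>C\<in>CC. extendable Q I B C)"


section \<open>Left modules\<close>

text \<open>
  Modules over a not necessarily commutative ring \<open>R\<close>. They are stored in the record type
  \<^typ>\<open>('r, 'x) module\<close>, whose fields \<^const>\<open>mult\<close> and \<^const>\<open>one\<close> play no role here and are ignored by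
  all notions below. For a \<open>k\<close>-algebra \<open>R\<close>, the \<open>k\<close>-vector space structure of a module is the one
  given by \<open>k \<rightarrow> R\<close>, so that \<open>R\<close>-linear maps are automatically \<open>k\<close>-linear.
\<close>

locale left_module = R?: ring R + M?: abelian_group M
  for R :: "('r, 's) ring_scheme" (structure) and M :: "('r, 'x) module" (structure) +
  assumes lsmult_closed: "\<lbrakk>a \<in> carrier R; x \<in> carrier M\<rbrakk> \<Longrightarrow> a \<odot>\<^bsub>M\<^esub> x \<in> carrier M"
    and lsmult_l_distr: "\<lbrakk>a \<in> carrier R; b \<in> carrier R; x \<in> carrier M\<rbrakk> \<Longrightarrow>
      (a \<oplus>\<^bsub>R\<^esub> b) \<odot>\<^bsub>M\<^esub> x = (a \<odot>\<^bsub>M\<^esub> x) \<oplus>\<^bsub>M\<^esub> (b \<odot>\<^bsub>M\<^esub> x)"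
    and lsmult_r_distr: "\<lbrakk>a \<in> carrier R; x \<in> carrier M; y \<in> carrier M\<rbrakk> \<Longrightarrow>
      a \<odot>\<^bsub>M\<^esub> (x \<oplus>\<^bsub>M\<^esub> y) = (a \<odot>\<^bsub>M\<^esub> x) \<oplus>\<^bsub>M\<^esub> (a \<odot>\<^bsub>M\<^esub> y)"
    and lsmult_assoc: "\<lbrakk>a \<in> carrier R; b \<in> carrier R; x \<in> carrier M\<rbrakk> \<Longrightarrow>
      (a \<otimes>\<^bsub>R\<^esub> b) \<odot>\<^bsub>M\<^esub> x = a \<odot>\<^bsub>M\<^esub> (b \<odot>\<^bsub>M\<^esub> x)"
    and lsmult_one: "x \<in> carrier M \<Longrightarrow> \<one>\<^bsub>R\<^esub> \<odot>\<^bsub>M\<^esub> x = x"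

definition lmod_hom ::
  "('r, 's) ring_scheme \<Rightarrow> ('r, 'x) module \<Rightarrow> ('r, 'y) module \<Rightarrow> ('x \<Rightarrow> 'y) set" where
  "lmod_hom R M N =
     {f. f \<in> carrier M \<rightarrow> carrier N \<and>
         (\<forall>x\<in>carrier M. \<forall>y\<in>carrier M. f (x \<oplus>\<^bsub>M\<^esub> y) = f x \<oplus>\<^bsub>N\<^esub> f y) \<and>
         (\<forall>a\<in>carrier R. \<forall>x\<in>carrier M. f (a \<odot>\<^bsub>M\<^esub> x) = a \<odot>\<^bsub>N\<^esub> f x)}"

definition lmod_iso ::
  "('r, 's) ring_scheme \<Rightarrow> ('r, 'x) module \<Rightarrow> ('r, 'y) module \<Rightarrow> ('x \<Rightarrow> 'y) set" where
  "lmod_iso R M N = {f \<in> lmod_hom R M N. bij_betw f (carrier M) (carrier N)}"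

definition lmod_quot :: "('r, 'x) module \<Rightarrow> 'x set \<Rightarrow> ('r, 'x set) module" where
  "lmod_quot M N =
     \<lparr> carrier = a_rcosets\<^bsub>M\<^esub> N,
       mult = undefined,
       one = undefined,
       zero = N,
       add = set_add M,
       smult = (\<lambda>a X. \<Union>x\<in>X. N +>\<^bsub>M\<^esub> (a \<odot>\<^bsub>M\<^esub> x)) \<rparr>"

definition lmod_sum :: "('r, 'x) module \<Rightarrow> ('r, 'y) module \<Rightarrow> ('r, 'x \<times> 'y) module" where
  "lmod_sum M N =
     \<lparr> carrier = carrier M \<times> carrier N,
       mult = undefined,
       one = undefined,
       zero = (\<zero>\<^bsub>M\<^esub>, \<zero>\<^bsub>N\<^esub>),
       add = (\<lambda>(x, y) (x', y'). (x \<oplus>\<^bsub>M\<^esub> x', y \<oplus>\<^bsub>N\<^esub> y')),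
       smult = (\<lambda>a (x, y). (a \<odot>\<^bsub>M\<^esub> x, a \<odot>\<^bsub>N\<^esub> y)) \<rparr>"


section \<open>First extension groups\<close>

text \<open>
  \<open>Ext\<^sup>1(X, Y)\<close> in the sense of Yoneda: equivalence classes of short exact sequences
  \<open>0 \<rightarrow> Y \<rightarrow> E \<rightarrow> X \<rightarrow> 0\<close>, where the zero element is the class of the split sequence. The middle term
  lives on the type \<^typ>\<open>'y \<times> 'x\<close>. This is no restriction: choosing a set-theoretic section of
  \<open>E \<rightarrow> X\<close> identifies the underlying set of any \<open>E\<close> with \<open>Y \<times> X\<close>, and the module structure can be
  transported.
\<close>

type_synonym ('r, 'x, 'y) extension =
  "('r, 'y \<times> 'x) module \<times> ('y \<Rightarrow> 'y \<times> 'x) \<times> ('y \<times> 'x \<Rightarrow> 'x)"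

definition extensions ::
  "('r, 's) ring_scheme \<Rightarrow> ('r, 'x) module \<Rightarrow> ('r, 'y) module \<Rightarrow> ('r, 'x, 'y) extension set" where
  "extensions R X Y =
     {(E, f, g). left_module R E \<and> f \<in> lmod_hom R Y E \<and> g \<in> lmod_hom R E X \<and>
        inj_on f (carrier Y) \<and> g ` carrier E = carrier X \<and>
        f ` carrier Y = {e \<in> carrier E. g e = \<zero>\<^bsub>X\<^esub>}}"

definition extension_rel ::
  "('r, 's) ring_scheme \<Rightarrow> ('r, 'x) module \<Rightarrow> ('r, 'y) module \<Rightarrow>
   (('r, 'x, 'y) extension \<times> ('r, 'x, 'y) extension) set" where
  "extension_rel R X Y =
     {((E, f, g), (E', f', g')) | E f g E' f' g'.
        (E, f, g) \<in> extensions R X Y \<and> (E', f', g') \<in> extensions R X Y \<and>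
        (\<exists>h\<in>lmod_iso R E E'.
           (\<forall>y\<in>carrier Y. h (f y) = f' y) \<and> (\<forall>e\<in>carrier E. g' (h e) = g e))}"

definition Ext1 ::
  "('r, 's) ring_scheme \<Rightarrow> ('r, 'x) module \<Rightarrow> ('r, 'y) module \<Rightarrow> ('r, 'x, 'y) extension set set" where
  "Ext1 R X Y = extensions R X Y // extension_rel R X Y"

definition Ext1_zero ::
  "('r, 's) ring_scheme \<Rightarrow> ('r, 'x) module \<Rightarrow> ('r, 'y) module \<Rightarrow> ('r, 'x, 'y) extension set" where
  "Ext1_zero R X Y = extension_rel R X Y `` {(lmod_sum Y X, (\<lambda>y. (y, \<zero>\<^bsub>X\<^esub>)), snd)}"


section \<open>Band modules and their families\<close>

type_synonym ('v, 'a, 'k) quot_elt = "('v, 'a, 'k) kpath set"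

abbreviation string_alg ::
  "('v, 'a) pre_digraph \<Rightarrow> ('v, 'a, 'k::comm_ring_1) kpath set \<Rightarrow>
   ('k, ('v, 'a, 'k) quot_elt) module" where
  "string_alg Q I \<equiv> quotient_algebra (path_algebra Q) I"

text \<open>The action of an arrow on the basis vector \<open>e\<^sub>i\<close>.\<close>

definition band_arrow :: "(int \<Rightarrow> 'a letter) \<Rightarrow> 'a \<Rightarrow> int \<Rightarrow> (int \<Rightarrow>\<^sub>0 'k::comm_ring_1)" where
  "band_arrow b a i =
     (if b (i + 1) = Inv a then Poly_Mapping.single (i + 1) 1
      else if b i = Arr a then Poly_Mapping.single (i - 1) 1
      else 0)"

fun band_path ::
  "('v, 'a) pre_digraph \<Rightarrow> (int \<Rightarrow> 'a letter) \<Rightarrow> ('v, 'a) path \<Rightarrow>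
   (int \<Rightarrow>\<^sub>0 'k::comm_ring_1) \<Rightarrow> (int \<Rightarrow>\<^sub>0 'k)" where
  "band_path Q b (Triv u) v =
     lin_ext (\<lambda>i. if u = lsrc Q (b i) then Poly_Mapping.single i 1 else 0) v"
| "band_path Q b (Walk as) v = foldr (\<lambda>a. lin_ext (band_arrow b a)) as v"

definition band_action ::
  "('v, 'a) pre_digraph \<Rightarrow> (int \<Rightarrow> 'a letter) \<Rightarrow> ('v, 'a, 'k::comm_ring_1) kpath \<Rightarrow>
   (int \<Rightarrow>\<^sub>0 'k) \<Rightarrow> (int \<Rightarrow>\<^sub>0 'k)" where
  "band_action Q b x v = lin_ext (\<lambda>p. band_path Q b p v) x"

text \<open>
  \<open>M(b)\<close> as a module over \<open>kQ/I\<close>. For a quasi-band all representatives of a coset act in the same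
  way, and \<^const>\<open>the_elem\<close> picks the common value.
\<close>

definition band_module ::
  "('v, 'a) pre_digraph \<Rightarrow> (int \<Rightarrow> 'a letter) \<Rightarrow>
   (('v, 'a, 'k::comm_ring_1) quot_elt, int \<Rightarrow>\<^sub>0 'k) module" where
  "band_module Q b =
     \<lparr> carrier = UNIV,
       mult = undefined,
       one = undefined,
       zero = 0,
       add = (+),
       smult = (\<lambda>X v. the_elem ((\<lambda>x. band_action Q b x v) ` X)) \<rparr>"

definition band_module_quot ::
  "('v, 'a) pre_digraph \<Rightarrow> (int \<Rightarrow> 'a letter) \<Rightarrow> nat \<Rightarrow> 'k::comm_ring_1 \<Rightarrow>
   (('v, 'a, 'k) quot_elt, (int \<Rightarrow>\<^sub>0 'k) set) module" where
  "band_module_quot Q b m l =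
     lmod_quot (band_module Q b)
       (Modules.module.span pscale
         {Poly_Mapping.single i 1 - pscale l (Poly_Mapping.single (i + int m) 1) | i. True})"

text \<open>
  The points of \<open>mod(A, d)\<close>: unital \<open>k\<close>-algebra homomorphisms from \<open>A\<close> to the \<open>d \<times> d\<close> matrices, taken
  to be \<^const>\<open>undefined\<close> outside the carrier of \<open>A\<close>.
\<close>

definition mod_variety :: "('k::field, 'x) module \<Rightarrow> nat \<Rightarrow> ('x \<Rightarrow> 'k mat) set" where
  "mod_variety A d =
     {\<rho> \<in> Ring.ring_hom A (ring_mat TYPE('k) d ()) \<inter> extensional (carrier A).
        \<forall>c. \<forall>a\<in>carrier A. \<rho> (c \<odot>\<^bsub>A\<^esub> a) = c \<cdot>\<^sub>m \<rho> a}"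

text \<open>The left module on \<open>k\<^sup>d\<close> given by a point of \<open>mod(A, d)\<close>.\<close>

definition point_module :: "nat \<Rightarrow> ('x \<Rightarrow> 'k::field mat) \<Rightarrow> ('x, 'k vec) module" where
  "point_module d \<rho> =
     \<lparr> carrier = carrier_vec d,
       mult = undefined,
       one = undefined,
       zero = 0\<^sub>v d,
       add = (+),
       smult = (\<lambda>a v. \<rho> a *\<^sub>v v) \<rparr>"

definition band_family ::
  "('v, 'a) pre_digraph \<Rightarrow> ('v, 'a, 'k::field) kpath set \<Rightarrow> (int \<Rightarrow> 'a letter) \<Rightarrow> nat \<Rightarrow>
   (('v, 'a, 'k) quot_elt \<Rightarrow> 'k mat) set" where
  "band_family Q I b m =
     {\<rho> \<in> mod_variety (string_alg Q I) m.
        \<exists>l. l \<noteq> 0 \<and> lmod_iso (string_alg Q I) (point_module m \<rho>) (band_module_quot Q b m l) \<noteq> {}}"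

end

theory Submission
  imports Defs "HOL-Library.Function_Algebras"
begin

text \<open>
  A module in \<open>\<F>(b, m)\<close> consists of the functions \<open>\<phi> : \<int> \<rightarrow> k\<close> with \<open>\<phi>(i + m) = \<lambda> \<phi>(i)\<close>, on which the arrows act by
  moving along the word \<open>b\<close>. Hence an extension of \<open>X\<close> by \<open>Y\<close> amounts to coefficients
  \<open>Z\<^sub>a(i, j)\<close> (arrow \<open>a\<close>, position \<open>i\<close> on \<open>b\<close>, position \<open>j\<close> on \<open>c\<close>), quasi-periodic in \<open>i\<close> and \<open>j\<close>, for
  which every path in \<open>I\<close> acts by zero, and it splits iff these are the coboundary of some \<open>h(i, j)\<close>.
  The equations for \<open>h\<close> only relate \<open>h(i, j)\<close> to its neighbours along a common subword of \<open>b\<close>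
  and \<open>c\<close> or \<open>c\<inverse>\<close>, so they decouple into chains, one for each maximal common subword; an end of a
  chain may prescribe the value of \<open>h\<close> there.

  If the pair is extendable with common word \<open>w\<close>, then the extension that glues \<open>\<beta>\<close> and
  \<open>\<delta>\<close> at the last position of \<open>w\<close> is compatible with the relations, but both ends of the chain of
  \<open>w\<close> prescribe values, and these disagree. If the pair is not extendable, then a chain whose two ends
  both prescribe a value comes with a relation that runs across \<open>w\<close>, and this relation makes the two values
  compatible. Chains can only be cyclic if \<open>b\<close> and \<open>c\<close> agree up to a shift or an inversion; they are
  solvable as soon as \<open>\<lambda> \<noteq> \<mu>\<close> and \<open>\<lambda> \<mu> \<noteq> 1\<close>.
\<close>

section \<open>The path algebra\<close>

text \<open>Extendability asks for more than a common word \<open>w\<close> with suitable letters at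
  its ends: \<open>cb\<close> must be a quasi-band. Neither \<open>b\<close> nor \<open>c\<close>
  contains a relation, so one in \<open>cb\<close> has to cross a seam, and it must contain all of
  \<open>w\<close> and one letter more, since otherwise agreement on \<open>w\<close> would place it
  inside \<open>b\<close> or \<open>c\<close> alone. Expanding the cocycle on such a relation by the
  Leibniz rule gives one linear equation between the two ends of the chain of \<open>w\<close>.
  Conversely, the absence of such relations is what makes the glued arrows define a module. The
  gluing needs opposite signs at \<beta> and \<delta>: a relation containing
  \<open>\<delta>\<beta>\<close> can pass from \<open>b\<close> to \<open>c\<close> at either arrow,
  and the two contributions must cancel.

  A chain may follow \<open>c\<close> or its inverse, and at a single position up to four arrows can
  prescribe a value. That these values agree needs non-extendability for both orientations at once.
  Therefore chains are solved for one fixed orientation under a consistency hypothesis, and the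
  result is used for \<open>c\<close> and for its inverse together.\<close>

lemma lookup_pscale [simp]: "Poly_Mapping.lookup (pscale c v) x = c * Poly_Mapping.lookup v x"
  by (simp add: pscale_def Poly_Mapping.map.rep_eq when_def)

lemma pscale_zero_left [simp]: "pscale 0 v = 0"
  and pscale_zero_right [simp]: "pscale c 0 = 0"
  and pscale_one [simp]: "pscale 1 v = v"
  and pscale_add_right: "pscale c (v + w) = pscale c v + pscale c w"
  and pscale_add_left: "pscale (c + d) v = pscale c v + pscale d v"
  and pscale_pscale: "pscale c (pscale d v) = pscale (c * d) v"
  by (rule poly_mapping_eqI; simp add: lookup_add algebra_simps)+

lemma pscale_single: "pscale c (Poly_Mapping.single x d) = Poly_Mapping.single x (c * d)"
  by (rule poly_mapping_eqI) (simp add: lookup_single when_def)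

lemma keys_pscale: "Poly_Mapping.keys (pscale c v) \<subseteq> Poly_Mapping.keys v"
  by (auto simp: in_keys_iff)

section \<open>Linear functionals on finitely supported functions\<close>

definition lsum :: "('x \<Rightarrow>\<^sub>0 'k) \<Rightarrow> ('x \<Rightarrow> 'k) \<Rightarrow> 'k::comm_ring_1" where
  "lsum v f = (\<Sum>x\<in>Poly_Mapping.keys v. Poly_Mapping.lookup v x * f x)"

lemma lsum_superset:
  assumes "finite S" "Poly_Mapping.keys v \<subseteq> S"
  shows "lsum v f = (\<Sum>x\<in>S. Poly_Mapping.lookup v x * f x)"
  unfolding lsum_def by (rule sum.mono_neutral_left) (use assms in \<open>auto simp: in_keys_iff\<close>)

lemma lsum_zero [simp]: "lsum 0 f = 0"
  by (simp add: lsum_def)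

lemma lsum_single [simp]: "lsum (Poly_Mapping.single x c) f = c * f x"
  using lsum_superset[of "{x}" "Poly_Mapping.single x c" f] by simp

lemma lsum_add: "lsum (v + w) f = lsum v f + lsum w f"
proof -
  let ?S = "Poly_Mapping.keys v \<union> Poly_Mapping.keys w"
  have "Poly_Mapping.keys (v + w) \<subseteq> ?S" by (rule Poly_Mapping.keys_add)
  then have "lsum u f = (\<Sum>x\<in>?S. Poly_Mapping.lookup u x * f x)" if "u \<in> {v, w, v + w}" for u
    using that by (intro lsum_superset) auto
  then show ?thesis
    by (simp add: lookup_add distrib_right sum.distrib)
qed

lemma lsum_pscale: "lsum (pscale c v) f = c * lsum v f"
  using lsum_superset[of "Poly_Mapping.keys v" "pscale c v" f, OF _ keys_pscale]
  by (simp add: lsum_def sum_distrib_left mult.assoc)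

lemma lsum_sum: "lsum (sum v A) f = (\<Sum>x\<in>A. lsum (v x) f)"
  by (induction A rule: infinite_finite_induct) (auto simp: lsum_add)

lemma lsum_cong: "(\<And>x. x \<in> Poly_Mapping.keys v \<Longrightarrow> f x = g x) \<Longrightarrow> lsum v f = lsum v g"
  by (simp add: lsum_def)

lemma lsum_add_fun: "lsum v (\<lambda>x. f x + g x) = lsum v f + lsum v g"
  by (simp add: lsum_def distrib_left sum.distrib)

lemma lsum_scale_fun: "lsum v (\<lambda>x. c * f x) = c * lsum v f"
  by (simp add: lsum_def sum_distrib_left mult.left_commute)

lemma lookup_sum': "Poly_Mapping.lookup (sum f A) y = (\<Sum>x\<in>A. Poly_Mapping.lookup (f x) y)"
  by (induction A rule: infinite_finite_induct) (auto simp: lookup_add)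

text \<open>Passing to coefficients turns identities between elements into scalar ones: together
  with \<open>lsum_lin_ext\<close> the nested \<open>lin_ext\<close> in a product becomes a nested
  \<open>lsum\<close>.\<close>

lemma lookup_lin_ext:
  "Poly_Mapping.lookup (lin_ext f v) y = lsum v (\<lambda>x. Poly_Mapping.lookup (f x) y)"
  by (simp add: lin_ext_def lsum_def lookup_sum')

lemma lsum_lin_ext: "lsum (lin_ext f v) g = lsum v (\<lambda>x. lsum (f x) g)"
  by (simp add: lin_ext_def lsum_sum lsum_pscale, simp add: lsum_def)

lemma lin_ext_single [simp]: "lin_ext f (Poly_Mapping.single x c) = pscale c (f x)"
  by (rule poly_mapping_eqI) (simp add: lookup_lin_ext)

lemma lin_ext_pscale: "lin_ext f (pscale c v) = pscale c (lin_ext f v)"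
  by (rule poly_mapping_eqI) (simp add: lookup_lin_ext lsum_pscale)

text \<open>Every element is the finite sum of its monomials. The bound on the support is carried
  through the induction, so that in the \<open>add\<close> case both summands may be assumed to lie
  in the span of S, for instance in the path algebra.\<close>

lemma poly_mapping_span_induct [consumes 1, case_names zero add single]:
  fixes x :: "'x \<Rightarrow>\<^sub>0 'k::comm_monoid_add"
  assumes "Poly_Mapping.keys x \<subseteq> S"
    and "P 0"
    and "\<And>x y. Poly_Mapping.keys x \<subseteq> S \<Longrightarrow> Poly_Mapping.keys y \<subseteq> S \<Longrightarrow> P x \<Longrightarrow> P y \<Longrightarrow> P (x + y)"
    and "\<And>c p. p \<in> S \<Longrightarrow> P (Poly_Mapping.single p c)"
  shows "P x"
proof -
  have eq: "x = (\<Sum>p\<in>Poly_Mapping.keys x. Poly_Mapping.single p (Poly_Mapping.lookup x p))"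
    by (rule poly_mapping_eqI)
      (auto simp: lookup_sum' lookup_single when_def in_keys_iff if_distrib sum.delta cong: if_cong)
  have "P (\<Sum>p\<in>A. Poly_Mapping.single p (Poly_Mapping.lookup x p)) \<and>
      Poly_Mapping.keys (\<Sum>p\<in>A. Poly_Mapping.single p (Poly_Mapping.lookup x p)) \<subseteq> S"
    if "finite A" "A \<subseteq> S" for A
    using that
  proof (induction A rule: finite_induct)
    case empty
    then show ?case using assms(2) by simp
  next
    case (insert p A)
    have k: "Poly_Mapping.keys (Poly_Mapping.single p (Poly_Mapping.lookup x p)) \<subseteq> S"
      "Poly_Mapping.keys (\<Sum>p\<in>A. Poly_Mapping.single p (Poly_Mapping.lookup x p)) \<subseteq> S"
      using insert by auto
    have "P (\<Sum>p\<in>insert p A. Poly_Mapping.single p (Poly_Mapping.lookup x p))"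
      unfolding sum.insert[OF insert(1,2)]
      by (rule assms(3)[OF k]) (use insert assms(4) in auto)
    moreover have "Poly_Mapping.keys (\<Sum>p\<in>insert p A. Poly_Mapping.single p (Poly_Mapping.lookup x p)) \<subseteq> S"
      unfolding sum.insert[OF insert(1,2)]
      by (rule order_trans[OF Poly_Mapping.keys_add]) (rule Un_least[OF k])
    ultimately show ?case by blast
  qed
  from this[of "Poly_Mapping.keys x"] show ?thesis
    using assms(1) eq by simp
qed

section \<open>Product and unit of the path algebra\<close>

lemma path_algebra_simps:
  "carrier (path_algebra Q) = {x. Poly_Mapping.keys x \<subseteq> {p. is_path Q p}}"
  "mult (path_algebra Q) x y = lin_ext (\<lambda>p. lin_ext (\<lambda>q. path_prod Q p q) y) x"
  "one (path_algebra Q) = (\<Sum>u\<in>verts Q. Poly_Mapping.single (Triv u) 1)"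
  "zero (path_algebra Q) = 0"
  "add (path_algebra Q) x y = x + y"
  "smult (path_algebra Q) c x = pscale c x"
  by (simp_all add: path_algebra_def)

lemma single_mult_single:
  "mult (path_algebra Q) (Poly_Mapping.single p c) (Poly_Mapping.single q d) =
   pscale (c * d) (path_prod Q p q)"
  by (simp add: path_algebra_simps pscale_pscale)

lemma single_in_path_algebra [simp]:
  "is_path Q p \<Longrightarrow> Poly_Mapping.single p c \<in> carrier (path_algebra Q)"
  by (auto simp: path_algebra_simps)

lemma path_algebra_add_closed:
  "x \<in> carrier (path_algebra Q) \<Longrightarrow> y \<in> carrier (path_algebra Q) \<Longrightarrow> x + y \<in> carrier (path_algebra Q)"
  using Poly_Mapping.keys_add[of x y] by (auto simp: path_algebra_simps)

lemma path_algebra_pscale_closed: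
  "x \<in> carrier (path_algebra Q) \<Longrightarrow> pscale c x \<in> carrier (path_algebra Q)"
  using keys_pscale[of c x] by (auto simp: path_algebra_simps)

text \<open>Exactly one trivial path composes with a given path from the left, the one at its
  target, so the sum over all vertices is a left unit. The point is that scalars act through ring
  elements: a module over the ring \<open>kQ/I\<close>, such as the middle term of an extension,
  carries its vector space structure already.\<close>

lemma pscale_one_mult:
  assumes "finite (verts Q)" "wf_digraph Q" "x \<in> carrier (path_algebra Q)"
  shows "mult (path_algebra Q) (pscale c (one (path_algebra Q))) x = pscale c x"
proof -
  have unit: "(\<Sum>u\<in>verts Q. lin_ext (path_prod Q (Triv u)) x) = x"
  proof -
    have "(\<Sum>u\<in>verts Q. lsum x (\<lambda>q. Poly_Mapping.lookup (path_prod Q (Triv u) q) r)) =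
        Poly_Mapping.lookup x r" for r
    proof -
      have "(\<Sum>u\<in>verts Q. lsum x (\<lambda>q. Poly_Mapping.lookup (path_prod Q (Triv u) q) r)) =
          lsum x (\<lambda>q. \<Sum>u\<in>verts Q. Poly_Mapping.lookup (path_prod Q (Triv u) q) r)"
        unfolding lsum_def by (subst sum.swap) (simp add: sum_distrib_left)
      also have "\<dots> = lsum x (\<lambda>q. if q = r then 1 else 0)"
      proof (rule lsum_cong)
        fix q assume "q \<in> Poly_Mapping.keys x"
        then have q: "is_path Q q" using assms(3) by (auto simp: path_algebra_simps)
        then have tgt: "walk_tgt (head Q) q \<in> verts Q"
          using wf_digraph.head_in_verts[OF assms(2)] hd_in_set by (cases q) auto
        have "Poly_Mapping.lookup (path_prod Q (Triv u) q) r =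
            (if u = walk_tgt (head Q) q then (if q = r then 1 else 0 :: 'c) else 0)" for u
          by (simp add: path_prod_def walk_comp_def lookup_single when_def)
        then show "(\<Sum>u\<in>verts Q. Poly_Mapping.lookup (path_prod Q (Triv u) q) r) =
            (if q = r then 1 else 0 :: 'c)"
          using tgt assms(1) by simp
      qed
      also have "\<dots> = Poly_Mapping.lookup x r"
        by (auto simp: lsum_def in_keys_iff if_distrib sum.delta cong: if_cong)
      finally show ?thesis .
    qed
    then show ?thesis
      by (intro poly_mapping_eqI) (simp add: lookup_sum' lookup_lin_ext)
  qed
  have "mult (path_algebra Q) (one (path_algebra Q)) x = x"
    using unit by (intro poly_mapping_eqI)
      (simp add: path_algebra_simps lookup_lin_ext lsum_sum lookup_sum' poly_mapping_eq_iff fun_eq_iff)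
  then show ?thesis
    by (simp add: path_algebra_simps lin_ext_pscale)
qed

section \<open>Representations on spaces of functions\<close>

definition fscale :: "'k \<Rightarrow> ('i \<Rightarrow> 'k) \<Rightarrow> 'i \<Rightarrow> 'k::comm_ring_1" where
  "fscale c \<phi> = (\<lambda>i. c * \<phi> i)"

lemma fscale_apply [simp]: "fscale c \<phi> i = c * \<phi> i"
  by (simp add: fscale_def)

lemma fscale_simps [simp]: "fscale 0 \<phi> = 0" "fscale 1 \<phi> = \<phi>" "fscale c 0 = 0"
  by (auto simp: fun_eq_iff)

definition lin_op :: "(('i \<Rightarrow> 'k) \<Rightarrow> 'j \<Rightarrow> 'k::comm_ring_1) \<Rightarrow> bool" where
  "lin_op f \<longleftrightarrow> (\<forall>\<phi> \<psi>. f (\<phi> + \<psi>) = f \<phi> + f \<psi>) \<and> (\<forall>c \<phi>. f (fscale c \<phi>) = fscale c (f \<phi>))"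

lemma lin_op_zero: "lin_op f \<Longrightarrow> f 0 = 0"
  unfolding lin_op_def by (metis fscale_simps(1))

lemma lin_op_add: "lin_op f \<Longrightarrow> f (\<phi> + \<psi>) = f \<phi> + f \<psi>"
  and lin_op_scale: "lin_op f \<Longrightarrow> f (fscale c \<phi>) = fscale c (f \<phi>)"
  by (simp_all only: lin_op_def)

lemma lin_op_comp: "lin_op f \<Longrightarrow> lin_op g \<Longrightarrow> lin_op (\<lambda>\<phi>. f (g \<phi>))"
  by (simp add: lin_op_def)

lemma lin_op_lsum:
  assumes "lin_op f"
  shows "f (\<lambda>i. lsum x (\<lambda>p. F p i)) = (\<lambda>i. lsum x (\<lambda>p. f (F p) i))"
proof -
  have "f (\<lambda>i. \<Sum>p\<in>A. c p * F p i) = (\<lambda>i. \<Sum>p\<in>A. c p * f (F p) i)" if "finite A" for A c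
    using that
  proof (induction A rule: finite_induct)
    case empty
    then show ?case using lin_op_zero[OF assms] by (simp add: zero_fun_def)
  next
    case (insert p A)
    have eq: "(\<lambda>i. \<Sum>p\<in>insert p A. c p * F p i) = fscale (c p) (F p) + (\<lambda>i. \<Sum>p\<in>A. c p * F p i)"
      using insert by (auto simp: fun_eq_iff)
    have "f (\<lambda>i. \<Sum>p\<in>insert p A. c p * F p i) = fscale (c p) (f (F p)) + f (\<lambda>i. \<Sum>p\<in>A. c p * F p i)"
      unfolding eq using assms by (simp add: lin_op_def)
    then show ?case
      using insert by (simp add: fun_eq_iff)
  qed
  then show ?thesis unfolding lsum_def by simp
qed

fun path_act :: "('i \<Rightarrow> 'v) \<Rightarrow> ('a \<Rightarrow> ('i \<Rightarrow> 'k) \<Rightarrow> 'i \<Rightarrow> 'k) \<Rightarrow> ('v, 'a) path \<Rightarrow>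
    ('i \<Rightarrow> 'k) \<Rightarrow> 'i \<Rightarrow> 'k::comm_ring_1" where
  "path_act \<nu> T (Triv u) \<phi> = (\<lambda>i. if \<nu> i = u then \<phi> i else 0)"
| "path_act \<nu> T (Walk as) \<phi> = foldr T as \<phi>"

definition act :: "('i \<Rightarrow> 'v) \<Rightarrow> ('a \<Rightarrow> ('i \<Rightarrow> 'k) \<Rightarrow> 'i \<Rightarrow> 'k) \<Rightarrow> ('v, 'a, 'k) kpath \<Rightarrow>
    ('i \<Rightarrow> 'k) \<Rightarrow> 'i \<Rightarrow> 'k::comm_ring_1" where
  "act \<nu> T x \<phi> = (\<lambda>i. lsum x (\<lambda>p. path_act \<nu> T p \<phi> i))"

lemma act_single: "act \<nu> T (Poly_Mapping.single p c) \<phi> = fscale c (path_act \<nu> T p \<phi>)"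
  by (simp add: act_def fscale_def)

lemma act_add_left: "act \<nu> T (x + y) \<phi> = act \<nu> T x \<phi> + act \<nu> T y \<phi>"
  by (simp add: act_def fun_eq_iff lsum_add)

lemma act_pscale: "act \<nu> T (pscale c x) \<phi> = fscale c (act \<nu> T x \<phi>)"
  by (simp add: act_def fun_eq_iff lsum_pscale)

lemma act_zero_left: "act \<nu> T 0 \<phi> = 0"
  by (simp add: act_def fun_eq_iff)

text \<open>Vectors are arbitrary functions on the positions, because the quotients
  \<open>M(b, m, \<lambda>)\<close> will be realised by quasi-periodic functions, which have
  infinite support. The last two axioms say that an arrow sees only the component at its tail and
  lands in the component at its head; this is what makes paths multiply correctly.\<close>

locale quiver_rep =
  fixes Q :: "('v, 'a) pre_digraph"
    and \<nu> :: "'i \<Rightarrow> 'v"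
    and T :: "'a \<Rightarrow> ('i \<Rightarrow> 'k) \<Rightarrow> 'i \<Rightarrow> 'k::comm_ring_1"
  assumes fin_quiver: "fin_digraph Q"
    and vertex_in: "\<nu> i \<in> verts Q"
    and arrow_lin: "lin_op (T a)"
    and arrow_head: "a \<in> arcs Q \<Longrightarrow> T a \<phi> i \<noteq> 0 \<Longrightarrow> \<nu> i = head Q a"
    and arrow_tail: "a \<in> arcs Q \<Longrightarrow> (\<And>i. \<nu> i = tail Q a \<Longrightarrow> \<phi> i = 0) \<Longrightarrow> T a \<phi> = 0"
begin

lemma path_act_lin: "lin_op (path_act \<nu> T p)"
proof (cases p)
  case (Triv u)
  then show ?thesis by (auto simp: lin_op_def fun_eq_iff)
next
  case (Walk as)
  have "lin_op (foldr T as)"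
  proof (induction as)
    case Nil
    then show ?case by (simp add: lin_op_def)
  next
    case (Cons a as)
    then show ?case using lin_op_comp[OF arrow_lin Cons.IH, of a] by (simp add: comp_def)
  qed
  then show ?thesis using Walk by (simp add: lin_op_def)
qed

lemma act_lin: "lin_op (act \<nu> T x)"
proof -
  have "act \<nu> T x (\<phi> + \<psi>) = act \<nu> T x \<phi> + act \<nu> T x \<psi>" for \<phi> \<psi>
    using path_act_lin by (simp add: act_def fun_eq_iff lin_op_def lsum_add_fun)
  moreover have "act \<nu> T x (fscale c \<phi>) = fscale c (act \<nu> T x \<phi>)" for c \<phi>
    using path_act_lin by (simp add: act_def fun_eq_iff lin_op_def lsum_scale_fun)
  ultimately show ?thesis by (simp add: lin_op_def)
qed

lemma path_act_tgt:
  assumes "is_path Q p" "path_act \<nu> T p \<phi> i \<noteq> 0"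
  shows "\<nu> i = walk_tgt (head Q) p"
proof (cases p)
  case (Walk as)
  then show ?thesis
    using assms arrow_head by (cases as) auto
qed (use assms in \<open>auto split: if_splits\<close>)

lemma path_act_src:
  assumes "is_path Q p" "\<And>i. \<nu> i = walk_src (tail Q) p \<Longrightarrow> \<phi> i = 0"
  shows "path_act \<nu> T p \<phi> = 0"
proof (cases p)
  case (Walk as)
  then obtain bs a where as: "as = bs @ [a]"
    using assms(1) by (cases as rule: rev_cases) auto
  have "T a \<phi> = 0"
    using assms Walk as by (intro arrow_tail) auto
  moreover have "foldr T bs 0 = 0"
    using lin_op_zero[OF path_act_lin[of "Walk bs"]] by simp
  ultimately show ?thesis using Walk as by simp
qed (use assms in \<open>auto simp: fun_eq_iff\<close>)

lemma path_act_src_cong: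
  assumes "is_path Q p" "\<And>i. \<nu> i = walk_src (tail Q) p \<Longrightarrow> \<phi> i = \<psi> i"
  shows "path_act \<nu> T p \<phi> = path_act \<nu> T p \<psi>"
proof -
  have "path_act \<nu> T p (\<phi> + fscale (-1) \<psi>) = 0"
    using assms by (intro path_act_src) auto
  then show ?thesis
    using path_act_lin[of p] by (auto simp: lin_op_def fun_eq_iff)
qed

text \<open>If the paths do not compose, the image of q is supported at the target of q, where p
  sees nothing; this matches the zero product. If they do, a trivial factor may be dropped because
  the other path is already confined to that vertex.\<close>

lemma path_act_mult:
  assumes "is_path Q p" "is_path Q q"
  shows "path_act \<nu> T p (path_act \<nu> T q \<phi>) i = lsum (path_prod Q p q) (\<lambda>r. path_act \<nu> T r \<phi> i)"
proof (cases "walk_src (tail Q) p = walk_tgt (head Q) q")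
  case False
  have "path_act \<nu> T p (path_act \<nu> T q \<phi>) = 0"
    by (rule path_act_src[OF assms(1)]) (use path_act_tgt[OF assms(2)] False in metis)
  then show ?thesis using False by (simp add: path_prod_def walk_comp_def)
next
  case True
  have "path_act \<nu> T p (path_act \<nu> T q \<phi>) = path_act \<nu> T (walk_append p q) \<phi>"
  proof (cases p)
    case (Triv u)
    then show ?thesis using path_act_tgt[OF assms(2)] True by (fastforce simp: fun_eq_iff)
  next
    case (Walk as)
    show ?thesis
    proof (cases q)
      case (Triv u)
      have "path_act \<nu> T p (path_act \<nu> T q \<phi>) = path_act \<nu> T p \<phi>"
        by (rule path_act_src_cong[OF assms(1)]) (use True Triv in auto)
      then show ?thesis using Triv Walk by simp
    qed (use Walk in auto)
  qed
  then show ?thesis using True by (simp add: path_prod_def walk_comp_def)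
qed

lemma act_mult:
  assumes "x \<in> carrier (path_algebra Q)" "y \<in> carrier (path_algebra Q)"
  shows "act \<nu> T (mult (path_algebra Q) x y) \<phi> = act \<nu> T x (act \<nu> T y \<phi>)"
proof
  fix i
  have "act \<nu> T (mult (path_algebra Q) x y) \<phi> i =
      lsum x (\<lambda>p. lsum y (\<lambda>q. lsum (path_prod Q p q) (\<lambda>r. path_act \<nu> T r \<phi> i)))"
    by (simp add: act_def path_algebra_simps lsum_lin_ext)
  also have "\<dots> = lsum x (\<lambda>p. lsum y (\<lambda>q. path_act \<nu> T p (path_act \<nu> T q \<phi>) i))"
    using assms by (intro lsum_cong) (auto simp: path_algebra_simps path_act_mult subset_iff)
  also have "\<dots> = lsum x (\<lambda>p. path_act \<nu> T p (act \<nu> T y \<phi>) i)"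
    unfolding act_def by (subst lin_op_lsum[OF path_act_lin]) simp
  finally show "act \<nu> T (mult (path_algebra Q) x y) \<phi> i = act \<nu> T x (act \<nu> T y \<phi>) i"
    by (simp add: act_def)
qed

lemma act_one: "act \<nu> T (one (path_algebra Q)) \<phi> = \<phi>"
proof
  fix i
  have "finite (verts Q)" using fin_quiver by (rule fin_digraph.finite_verts)
  then show "act \<nu> T (one (path_algebra Q)) \<phi> i = \<phi> i"
    using vertex_in[of i] by (simp add: act_def path_algebra_simps lsum_sum)
qed

end

section \<open>Invariant subspaces and their annihilators\<close>

locale quiver_subrep = quiver_rep Q \<nu> T
  for Q :: "('v, 'a) pre_digraph"
    and \<nu> :: "'i \<Rightarrow> 'v"
    and T :: "'a \<Rightarrow> ('i \<Rightarrow> 'k) \<Rightarrow> 'i \<Rightarrow> 'k::comm_ring_1" +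
  fixes S :: "('i \<Rightarrow> 'k) set"
  assumes sub_zero: "0 \<in> S"
    and sub_add: "\<phi> \<in> S \<Longrightarrow> \<psi> \<in> S \<Longrightarrow> \<phi> + \<psi> \<in> S"
    and sub_scale: "\<phi> \<in> S \<Longrightarrow> fscale c \<phi> \<in> S"
    and sub_vertex: "\<phi> \<in> S \<Longrightarrow> (\<lambda>i. if \<nu> i = u then \<phi> i else 0) \<in> S"
    and sub_arrow: "\<phi> \<in> S \<Longrightarrow> T a \<phi> \<in> S"
begin

lemma sub_path: "\<phi> \<in> S \<Longrightarrow> path_act \<nu> T p \<phi> \<in> S"
proof (cases p)
  case (Walk as)
  assume \<phi>: "\<phi> \<in> S"
  have "foldr T as \<phi> \<in> S" by (induction as) (auto intro: sub_arrow \<phi>)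
  then show ?thesis using Walk by simp
qed (auto intro: sub_vertex)

lemma sub_act:
  assumes "\<phi> \<in> S"
  shows "act \<nu> T x \<phi> \<in> S"
proof -
  have "Poly_Mapping.keys x \<subseteq> UNIV" by simp
  then show ?thesis
  proof (induction rule: poly_mapping_span_induct)
    case zero
    show ?case unfolding act_zero_left by (rule sub_zero)
  next
    case (add x y)
    then show ?case unfolding act_add_left by (intro sub_add)
  next
    case (single c p)
    show ?case unfolding act_single by (intro sub_scale sub_path assms)
  qed
qed

text \<open>The elements acting by zero on S form a two-sided ideal, so it is enough to know this
  for the generators. Invariance of S is used for products with the annihilating factor on the
  left.\<close>

lemma genideal_acts_zero:
  assumes ring: "ring (path_algebra Q :: ('k, ('v, 'a, 'k) kpath) module)"
    and P: "P \<subseteq> {p. is_path Q p}"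
    and zero: "\<And>p \<phi>. p \<in> P \<Longrightarrow> \<phi> \<in> S \<Longrightarrow> path_act \<nu> T p \<phi> = 0"
    and x: "x \<in> genideal (path_algebra Q) (basis_path ` P)" and "\<phi> \<in> S"
  shows "act \<nu> T x \<phi> = 0"
proof -
  let ?R = "path_algebra Q :: ('k, ('v, 'a, 'k) kpath) module"
  interpret R: ring ?R by (rule ring)
  let ?N = "{x \<in> carrier ?R. \<forall>\<phi>\<in>S. act \<nu> T x \<phi> = 0}"
  have zero_lin: "act \<nu> T y 0 = 0" for y using act_lin lin_op_zero by blast
  have "ideal ?N ?R"
  proof (rule idealI[OF ring])
    have inv: "inv\<^bsub>add_monoid ?R\<^esub> a = pscale (-1) a" if a: "a \<in> carrier ?R" for a
    proof -
      have "a \<oplus>\<^bsub>?R\<^esub> pscale (-1) a = \<zero>\<^bsub>?R\<^esub>"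
        by (rule poly_mapping_eqI) (simp add: path_algebra_simps lookup_add)
      then have "\<ominus>\<^bsub>?R\<^esub> a = pscale (-1) a"
        using R.minus_equality[of "pscale (-1) a" a] path_algebra_pscale_closed[OF a] a
        by (metis R.a_comm)
      then show ?thesis by (simp add: a_inv_def)
    qed
    show "subgroup ?N (add_monoid ?R)"
    proof (rule subgroup.intro)
      show "\<one>\<^bsub>add_monoid ?R\<^esub> \<in> ?N"
        using R.zero_closed by (simp add: path_algebra_simps(4) act_zero_left)
      show "inv\<^bsub>add_monoid ?R\<^esub> x \<in> ?N" if "x \<in> ?N" for x
        using that inv[of x] path_algebra_pscale_closed[of x Q "-1"] by (simp add: act_pscale)
    qed (auto simp: act_add_left path_algebra_simps(5) path_algebra_add_closed)
  next
    fix a x assume "a \<in> ?N" "x \<in> carrier ?R"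
    then show "x \<otimes>\<^bsub>?R\<^esub> a \<in> ?N" by (auto simp: act_mult zero_lin)
  next
    fix a x assume "a \<in> ?N" "x \<in> carrier ?R"
    then show "a \<otimes>\<^bsub>?R\<^esub> x \<in> ?N" by (auto simp: act_mult sub_act)
  qed
  moreover have "basis_path ` P \<subseteq> ?N"
    using P zero by (auto simp: basis_path_def act_single)
  ultimately have "genideal ?R (basis_path ` P) \<subseteq> ?N" by (rule R.genideal_minimal)
  then show ?thesis using x \<open>\<phi> \<in> S\<close> by blast
qed

end

section \<open>Modules over the quotient algebra\<close>

lemma quotient_algebra_simps:
  "carrier (quotient_algebra R I) = carrier (R Quot I)"
  "mult (quotient_algebra R I) = mult (R Quot I)"
  "one (quotient_algebra R I) = one (R Quot I)"
  "zero (quotient_algebra R I) = zero (R Quot I)"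
  "add (quotient_algebra R I) = add (R Quot I)"
  by (simp_all add: quotient_algebra_def)

lemma ring_quotient_algebra:
  assumes "ideal I R"
  shows "ring (quotient_algebra R I)"
proof (rule ringI)
  interpret q: ring "R Quot I" by (rule ideal.quotient_is_ring[OF assms])
  show "abelian_group (quotient_algebra R I)"
    by (rule abelian_groupI)
      (auto simp: quotient_algebra_simps q.a_assoc q.a_comm q.a_lcomm intro: q.l_neg)
  show "Group.monoid (quotient_algebra R I)"
    by (rule monoidI) (simp_all add: quotient_algebra_simps q.m_assoc)
qed (simp_all add: quotient_algebra_simps ring.ring_simprules[OF ideal.quotient_is_ring[OF assms]])

section \<open>Computing with cosets of the ideal\<close>

locale quiver_quotient =
  fixes Q :: "('v, 'a) pre_digraph" and I :: "('v, 'a, 'k::comm_ring_1) kpath set"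
  assumes quiver: "fin_digraph Q" and I: "ideal I (path_algebra Q)"
begin

abbreviation kQ :: "('k, ('v, 'a, 'k) kpath) module" where "kQ \<equiv> path_algebra Q"

definition coset :: "('v, 'a, 'k) kpath \<Rightarrow> ('v, 'a, 'k) kpath set" where
  "coset x = I +>\<^bsub>kQ\<^esub> x"

sublocale I: ideal I kQ by (rule I)

lemma ring_string_alg: "ring (string_alg Q I)"
  by (rule ring_quotient_algebra[OF I])

lemma coset_in [simp]: "x \<in> carrier kQ \<Longrightarrow> coset x \<in> carrier (string_alg Q I)"
  by (simp add: quotient_algebra_simps FactRing_def coset_def I.a_rcosetsI I.a_subset)

lemma cosetE:
  assumes "A \<in> carrier (string_alg Q I)"
  obtains x where "x \<in> carrier kQ" "A = coset x"
  using assms by (auto simp: quotient_algebra_simps FactRing_def A_RCOSETS_def' coset_def)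

lemma coset_mult:
  "x \<in> carrier kQ \<Longrightarrow> y \<in> carrier kQ \<Longrightarrow>
    mult (string_alg Q I) (coset x) (coset y) = coset (mult kQ x y)"
  by (simp add: quotient_algebra_simps FactRing_def coset_def I.rcoset_mult_add)

lemma coset_add:
  "x \<in> carrier kQ \<Longrightarrow> y \<in> carrier kQ \<Longrightarrow>
    add (string_alg Q I) (coset x) (coset y) = coset (x + y)"
  using I.a_rcos_sum[of x y] by (simp add: quotient_algebra_simps FactRing_def coset_def path_algebra_simps)

lemma coset_one: "one (string_alg Q I) = coset (one kQ)"
  by (simp add: quotient_algebra_simps FactRing_def coset_def)

lemma coset_self: "x \<in> carrier kQ \<Longrightarrow> x \<in> coset x"
  by (simp add: coset_def I.a_rcos_self)

lemma coset_ideal: "x \<in> I \<Longrightarrow> coset x = coset 0"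
  using I.a_rcos_const[of x] I.a_rcos_const[of 0] additive_subgroup.zero_closed[OF I.additive_subgroup_axioms]
  by (simp add: coset_def path_algebra_simps)

lemma coset_elem:
  assumes "x \<in> carrier kQ" "y \<in> coset x"
  obtains z where "z \<in> I" "y = z + x" "y \<in> carrier kQ"
  using assms I.a_elemrcos_carrier[of x y] by (auto simp: coset_def a_r_coset_def' path_algebra_simps(5))

text \<open>Scaling by c is multiplication by the ring element c times 1, so an ideal of the ring is
  also a subspace.\<close>

lemma ideal_pscale: "x \<in> I \<Longrightarrow> pscale c x \<in> I"
  using I.I_l_closed[of x "pscale c (one kQ)"] pscale_one_mult[of Q x c]
    fin_digraph.finite_verts[OF quiver] quiver path_algebra_pscale_closed[OF I.one_closed]
  by (simp add: I.a_Hcarr fin_digraph_def)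

text \<open>The definition unites the cosets of \<open>pscale c y\<close> over all representatives
  y. They coincide since two representatives differ by an element of I and I is closed under
  scaling.\<close>

lemma coset_smult:
  assumes x: "x \<in> carrier kQ"
  shows "c \<odot>\<^bsub>string_alg Q I\<^esub> coset x = coset (pscale c x)"
proof -
  have "coset (pscale c y) = coset (pscale c x)" if "y \<in> coset x" for y
  proof -
    from that obtain z where z: "z \<in> I" "y = z + x" "y \<in> carrier kQ"
      using coset_elem[OF x] by blast
    have zc: "pscale c z \<in> I" using z ideal_pscale by blast
    have "coset (pscale c y) = coset (pscale c z) <+>\<^bsub>kQ\<^esub> coset (pscale c x)"
      using I.a_rcos_sum[of "pscale c z" "pscale c x"] zc x z
      by (simp add: coset_def path_algebra_pscale_closed I.a_Hcarr pscale_add_right path_algebra_simps(5))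
    also have "\<dots> = coset 0 <+>\<^bsub>kQ\<^esub> coset (pscale c x)" using coset_ideal[OF zc] by simp
    also have "\<dots> = coset (pscale c x)"
      using I.a_rcos_sum[of 0 "pscale c x"] x I.zero_closed
      by (simp add: coset_def path_algebra_pscale_closed path_algebra_simps(4,5))
    finally show ?thesis .
  qed
  then have "(\<Union>y\<in>coset x. coset (pscale c y)) = coset (pscale c x)"
    using coset_self[OF x] by blast
  then show ?thesis
    by (simp add: quotient_algebra_def path_algebra_simps(6) coset_def)
qed

end

section \<open>Extensions and splittings\<close>

lemma (in abelian_monoid) add_interchange:
  assumes "a \<in> carrier G" "b \<in> carrier G" "c \<in> carrier G" "d \<in> carrier G"
  shows "(a \<oplus> b) \<oplus> (c \<oplus> d) = (a \<oplus> c) \<oplus> (b \<oplus> d)"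
  using assms by (simp add: a_ac)

context left_module
begin

lemma lsmult_zero_right [simp]:
  assumes "a \<in> carrier R"
  shows "a \<odot>\<^bsub>M\<^esub> \<zero>\<^bsub>M\<^esub> = \<zero>\<^bsub>M\<^esub>"
proof -
  have "a \<odot>\<^bsub>M\<^esub> \<zero>\<^bsub>M\<^esub> \<oplus>\<^bsub>M\<^esub> a \<odot>\<^bsub>M\<^esub> \<zero>\<^bsub>M\<^esub> = a \<odot>\<^bsub>M\<^esub> \<zero>\<^bsub>M\<^esub>"
    using lsmult_r_distr[OF assms M.zero_closed M.zero_closed] by simp
  then show ?thesis
    using M.add.l_cancel_one[of "a \<odot>\<^bsub>M\<^esub> \<zero>\<^bsub>M\<^esub>" "a \<odot>\<^bsub>M\<^esub> \<zero>\<^bsub>M\<^esub>"] assms lsmult_closed by simp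
qed

lemma lsmult_zero_left [simp]:
  assumes "x \<in> carrier M"
  shows "\<zero>\<^bsub>R\<^esub> \<odot>\<^bsub>M\<^esub> x = \<zero>\<^bsub>M\<^esub>"
proof -
  have "\<zero>\<^bsub>R\<^esub> \<odot>\<^bsub>M\<^esub> x \<oplus>\<^bsub>M\<^esub> \<zero>\<^bsub>R\<^esub> \<odot>\<^bsub>M\<^esub> x = \<zero>\<^bsub>R\<^esub> \<odot>\<^bsub>M\<^esub> x"
    using lsmult_l_distr[OF R.zero_closed R.zero_closed assms] by simp
  then show ?thesis
    using M.add.l_cancel_one[of "\<zero>\<^bsub>R\<^esub> \<odot>\<^bsub>M\<^esub> x" "\<zero>\<^bsub>R\<^esub> \<odot>\<^bsub>M\<^esub> x"] assms lsmult_closed by simp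
qed

lemma lsmult_finsum:
  assumes "finite A" "a \<in> carrier R" "\<And>i. i \<in> A \<Longrightarrow> F i \<in> carrier M"
  shows "a \<odot>\<^bsub>M\<^esub> finsum M F A = finsum M (\<lambda>i. a \<odot>\<^bsub>M\<^esub> F i) A"
  using assms
  by (induction A rule: finite_induct) (simp_all add: lsmult_r_distr lsmult_closed Pi_def)

end

lemma left_module_lmod_sum:
  assumes "left_module R Y" "left_module R X"
  shows "left_module R (lmod_sum Y X)"
proof -
  interpret X: left_module R X by fact
  interpret Y: left_module R Y by fact
  have "abelian_group (lmod_sum Y X)"
  proof (rule abelian_groupI)
    fix z assume z: "z \<in> carrier (lmod_sum Y X)"
    then show "\<exists>w\<in>carrier (lmod_sum Y X). w \<oplus>\<^bsub>lmod_sum Y X\<^esub> z = \<zero>\<^bsub>lmod_sum Y X\<^esub>"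
      by (intro bexI[of _ "(\<ominus>\<^bsub>Y\<^esub> fst z, \<ominus>\<^bsub>X\<^esub> snd z)"])
        (auto simp: lmod_sum_def X.M.l_neg Y.M.l_neg)
  qed (auto simp: lmod_sum_def X.M.a_assoc Y.M.a_assoc X.M.a_comm Y.M.a_comm X.M.a_lcomm Y.M.a_lcomm)
  then show ?thesis
    by (intro left_module.intro left_module_axioms.intro X.R.ring_axioms)
      (auto simp: lmod_sum_def X.lsmult_closed Y.lsmult_closed X.lsmult_l_distr Y.lsmult_l_distr
        X.lsmult_r_distr Y.lsmult_r_distr X.lsmult_assoc Y.lsmult_assoc X.lsmult_one Y.lsmult_one)
qed

lemma lmod_hom_closed: "f \<in> lmod_hom R M N \<Longrightarrow> x \<in> carrier M \<Longrightarrow> f x \<in> carrier N"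
  and lmod_hom_add: "f \<in> lmod_hom R M N \<Longrightarrow> x \<in> carrier M \<Longrightarrow> y \<in> carrier M \<Longrightarrow>
    f (x \<oplus>\<^bsub>M\<^esub> y) = f x \<oplus>\<^bsub>N\<^esub> f y"
  and lmod_hom_smult: "f \<in> lmod_hom R M N \<Longrightarrow> a \<in> carrier R \<Longrightarrow> x \<in> carrier M \<Longrightarrow>
    f (a \<odot>\<^bsub>M\<^esub> x) = a \<odot>\<^bsub>N\<^esub> f x"
  by (auto simp: lmod_hom_def)

lemma lmod_hom_zero:
  assumes "left_module R M" "left_module R N" "f \<in> lmod_hom R M N"
  shows "f \<zero>\<^bsub>M\<^esub> = \<zero>\<^bsub>N\<^esub>"
proof -
  interpret M: left_module R M by fact
  interpret N: left_module R N by fact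
  have "f (\<zero>\<^bsub>R\<^esub> \<odot>\<^bsub>M\<^esub> \<zero>\<^bsub>M\<^esub>) = \<zero>\<^bsub>R\<^esub> \<odot>\<^bsub>N\<^esub> f \<zero>\<^bsub>M\<^esub>"
    by (rule lmod_hom_smult[OF assms(3)]) auto
  then show ?thesis
    using lmod_hom_closed[OF assms(3) M.M.zero_closed] by simp
qed

lemma lmod_iso_inverse:
  assumes h: "h \<in> lmod_iso R M N" and M: "left_module R M"
  shows "inv_into (carrier M) h \<in> lmod_iso R N M"
proof -
  interpret M: left_module R M by fact
  have hom: "h \<in> lmod_hom R M N" and bij: "bij_betw h (carrier M) (carrier N)"
    using h by (auto simp: lmod_iso_def)
  let ?i = "inv_into (carrier M) h"
  have i: "?i x \<in> carrier M" "h (?i x) = x" if "x \<in> carrier N" for x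
    using that bij by (auto simp: bij_betw_def inv_into_into f_inv_into_f)
  have eq: "?i x = y" if "h y = x" "y \<in> carrier M" for x y
    using that bij by (auto simp: bij_betw_def)
  have "?i (x \<oplus>\<^bsub>N\<^esub> y) = ?i x \<oplus>\<^bsub>M\<^esub> ?i y" if "x \<in> carrier N" "y \<in> carrier N" for x y
    by (rule eq) (simp_all add: lmod_hom_add[OF hom] i that)
  moreover have "?i (a \<odot>\<^bsub>N\<^esub> x) = a \<odot>\<^bsub>M\<^esub> ?i x" if "a \<in> carrier R" "x \<in> carrier N" for a x
    by (rule eq) (simp_all add: lmod_hom_smult[OF hom] i that M.lsmult_closed)
  ultimately have "?i \<in> lmod_hom R N M"
    using i(1) by (simp add: lmod_hom_def)
  then show ?thesis
    using bij_betw_inv_into[OF bij] by (simp add: lmod_iso_def)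
qed

lemma lmod_iso_comp:
  assumes "h \<in> lmod_iso R M N" "h' \<in> lmod_iso R N L"
  shows "h' \<circ> h \<in> lmod_iso R M L"
  using assms bij_betw_trans[of h "carrier M" "carrier N" h' "carrier L"]
  by (auto simp: lmod_iso_def lmod_hom_def Pi_def)

text \<open>The isomorphism is \<open>f y + s x\<close>. It is onto because
  \<open>e - s (g e)\<close> lies in the kernel of g and hence in the image of f.\<close>

lemma split_iso:
  assumes X: "left_module R X" and Y: "left_module R Y" and ext: "(E, f, g) \<in> extensions R X Y"
    and s: "s \<in> lmod_hom R X E" "\<And>x. x \<in> carrier X \<Longrightarrow> g (s x) = x"
  obtains h where "h \<in> lmod_iso R (lmod_sum Y X) E"
    "\<And>y. y \<in> carrier Y \<Longrightarrow> h (y, \<zero>\<^bsub>X\<^esub>) = f y"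
    "\<And>z. z \<in> carrier (lmod_sum Y X) \<Longrightarrow> g (h z) = snd z"
proof -
  interpret X: left_module R X by fact
  interpret Y: left_module R Y by fact
  have E: "left_module R E" and f: "f \<in> lmod_hom R Y E" and g: "g \<in> lmod_hom R E X"
    and inj: "inj_on f (carrier Y)" and ker: "f ` carrier Y = {e \<in> carrier E. g e = \<zero>\<^bsub>X\<^esub>}"
    using ext by (auto simp: extensions_def)
  interpret E: left_module R E by (rule E)
  note fc = lmod_hom_closed[OF f] and sc = lmod_hom_closed[OF s(1)] and gc = lmod_hom_closed[OF g]
  have gf: "g (f y) = \<zero>\<^bsub>X\<^esub>" if "y \<in> carrier Y" for y using ker that by blast
  define h where "h = (\<lambda>(y, x). f y \<oplus>\<^bsub>E\<^esub> s x)"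
  have gh: "g (h z) = snd z" if "z \<in> carrier (lmod_sum Y X)" for z
    using that by (auto simp: h_def lmod_sum_def lmod_hom_add[OF g] fc sc gf s(2))
  have "h (z \<oplus>\<^bsub>lmod_sum Y X\<^esub> w) = h z \<oplus>\<^bsub>E\<^esub> h w"
    if "z \<in> carrier (lmod_sum Y X)" "w \<in> carrier (lmod_sum Y X)" for z w
  proof -
    have z: "fst z \<in> carrier Y" "snd z \<in> carrier X" and w: "fst w \<in> carrier Y" "snd w \<in> carrier X"
      using that by (auto simp: lmod_sum_def)
    have "h (z \<oplus>\<^bsub>lmod_sum Y X\<^esub> w) = (f (fst z) \<oplus>\<^bsub>E\<^esub> f (fst w)) \<oplus>\<^bsub>E\<^esub> (s (snd z) \<oplus>\<^bsub>E\<^esub> s (snd w))"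
      using z w by (simp add: h_def lmod_sum_def case_prod_unfold lmod_hom_add[OF f] lmod_hom_add[OF s(1)])
    also have "\<dots> = h z \<oplus>\<^bsub>E\<^esub> h w"
      using E.M.add_interchange[OF fc[OF z(1)] fc[OF w(1)] sc[OF z(2)] sc[OF w(2)]]
      by (simp add: h_def case_prod_unfold)
    finally show ?thesis .
  qed
  moreover have "h (a \<odot>\<^bsub>lmod_sum Y X\<^esub> z) = a \<odot>\<^bsub>E\<^esub> h z"
    if "a \<in> carrier R" "z \<in> carrier (lmod_sum Y X)" for a z
    using that by (auto simp: h_def lmod_sum_def fc sc lmod_hom_smult[OF f] lmod_hom_smult[OF s(1)]
        E.lsmult_r_distr)
  moreover have "h z \<in> carrier E" if "z \<in> carrier (lmod_sum Y X)" for z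
    using that by (auto simp: h_def lmod_sum_def fc sc)
  ultimately have "h \<in> lmod_hom R (lmod_sum Y X) E"
    by (simp add: lmod_hom_def)
  moreover have "inj_on h (carrier (lmod_sum Y X))"
  proof (rule inj_onI)
    fix z z' assume z: "z \<in> carrier (lmod_sum Y X)" "z' \<in> carrier (lmod_sum Y X)" "h z = h z'"
    then have "snd z = snd z'" using gh by metis
    moreover have zc: "fst z \<in> carrier Y" "fst z' \<in> carrier Y" "snd z' \<in> carrier X"
      using z by (auto simp: lmod_sum_def)
    moreover have "f (fst z) \<oplus>\<^bsub>E\<^esub> s (snd z') = f (fst z') \<oplus>\<^bsub>E\<^esub> s (snd z')"
      using z(3) \<open>snd z = snd z'\<close> by (simp add: h_def case_prod_unfold)
    then have "f (fst z) = f (fst z')"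
      using zc fc sc E.M.add.right_cancel by metis
    then have "fst z = fst z'" using inj_onD[OF inj] zc by metis
    ultimately show "z = z'" by (simp add: prod_eq_iff)
  qed
  moreover have "carrier E \<subseteq> h ` carrier (lmod_sum Y X)"
  proof
    fix e assume e: "e \<in> carrier E"
    let ?k = "e \<ominus>\<^bsub>E\<^esub> s (g e)"
    have k: "?k \<in> carrier E" using e gc sc by simp
    have e_eq: "e = ?k \<oplus>\<^bsub>E\<^esub> s (g e)" using e gc sc by (simp add: E.M.minus_eq E.M.a_assoc E.M.l_neg)
    have "g e = g ?k \<oplus>\<^bsub>X\<^esub> g e"
      by (rule trans[OF arg_cong[OF e_eq, of g]])
        (simp only: lmod_hom_add[OF g k sc[OF gc[OF e]]] s(2)[OF gc[OF e]])
    then have "g ?k = \<zero>\<^bsub>X\<^esub>" using gc[OF k] gc[OF e] X.M.add.r_cancel_one[OF gc[OF e] gc[OF k]] by simp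
    with k have "?k \<in> f ` carrier Y" unfolding ker by simp
    then obtain y where y: "y \<in> carrier Y" "f y = ?k" by (metis imageE)
    have "h (y, g e) = e"
      unfolding h_def prod.case y(2) by (rule e_eq[symmetric])
    moreover have "(y, g e) \<in> carrier (lmod_sum Y X)"
      using y gc[OF e] by (simp add: lmod_sum_def)
    ultimately show "e \<in> h ` carrier (lmod_sum Y X)" by force
  qed
  moreover have "h z \<in> carrier E" if "z \<in> carrier (lmod_sum Y X)" for z
    using that by (auto simp: h_def lmod_sum_def fc sc)
  ultimately have "h \<in> lmod_iso R (lmod_sum Y X) E"
    by (auto simp: lmod_iso_def bij_betw_def)
  moreover have "h (y, \<zero>\<^bsub>X\<^esub>) = f y" if "y \<in> carrier Y" for y
    using that by (simp add: h_def fc lmod_hom_zero[OF X E s(1)])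
  ultimately show ?thesis using that gh by blast
qed

lemma extension_relI:
  assumes "(E, f, g) \<in> extensions R X Y" "(E', f', g') \<in> extensions R X Y" "h \<in> lmod_iso R E E'"
    and "\<And>y. y \<in> carrier Y \<Longrightarrow> h (f y) = f' y" "\<And>e. e \<in> carrier E \<Longrightarrow> g' (h e) = g e"
  shows "((E, f, g), (E', f', g')) \<in> extension_rel R X Y"
  unfolding extension_rel_def mem_Collect_eq
  by (intro exI[of _ E] exI[of _ f] exI[of _ g] exI[of _ E'] exI[of _ f'] exI[of _ g'] conjI refl
      assms(1,2) bexI[OF _ assms(3)] ballI assms(4,5))

text \<open>An isomorphism with the direct sum, restricted to the summand X, is a section.
  Conversely, sections identify any two extensions through the direct sum, so there is a single
  class, and it is the zero class because the direct sum is itself an extension.\<close>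

theorem Ext1_trivial_iff:
  assumes X: "left_module R X" and Y: "left_module R Y"
  shows "Ext1 R X Y = {Ext1_zero R X Y} \<longleftrightarrow>
    (\<forall>(E, f, g)\<in>extensions R X Y. \<exists>s\<in>lmod_hom R X E. \<forall>x\<in>carrier X. g (s x) = x)"
proof -
  interpret X: left_module R X by fact
  interpret Y: left_module R Y by fact
  let ?S = "(lmod_sum Y X, (\<lambda>y. (y, \<zero>\<^bsub>X\<^esub>)), snd)"
  let ?r = "extension_rel R X Y"
  have S: "?S \<in> extensions R X Y"
  proof -
    have "(\<lambda>y. (y, \<zero>\<^bsub>X\<^esub>)) ` carrier Y = {e \<in> carrier (lmod_sum Y X). snd e = \<zero>\<^bsub>X\<^esub>}"
      by (auto simp: lmod_sum_def)
    moreover have "snd ` carrier (lmod_sum Y X) = carrier X"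
      using Y.M.zero_closed by (force simp: lmod_sum_def)
    ultimately show ?thesis
      using left_module_lmod_sum[OF Y X]
      by (auto simp: extensions_def lmod_hom_def inj_on_def) (auto simp: lmod_sum_def)
  qed
  have refl: "(e, e) \<in> ?r" if "e \<in> extensions R X Y" for e
  proof -
    obtain E f g where e: "e = (E, f, g)" by (cases e)
    have "(\<lambda>x. x) \<in> lmod_iso R E E" by (auto simp: lmod_iso_def lmod_hom_def bij_betw_def)
    then show ?thesis using that unfolding e by (intro extension_relI) auto
  qed
  show ?thesis
  proof
    assume *: "Ext1 R X Y = {Ext1_zero R X Y}"
    show "\<forall>(E, f, g)\<in>extensions R X Y. \<exists>s\<in>lmod_hom R X E. \<forall>x\<in>carrier X. g (s x) = x"
    proof clarify
      fix E f g assume e: "(E, f, g) \<in> extensions R X Y"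
      have "?r `` {(E, f, g)} \<in> Ext1 R X Y" using e by (auto simp: Ext1_def quotient_def)
      then have "?r `` {(E, f, g)} = ?r `` {?S}" using * by (simp add: Ext1_zero_def)
      then have "(?S, (E, f, g)) \<in> ?r" using refl[OF e] by blast
      then obtain h where h: "h \<in> lmod_iso R (lmod_sum Y X) E"
        and gh: "\<And>z. z \<in> carrier (lmod_sum Y X) \<Longrightarrow> g (h z) = snd z"
        by (auto simp: extension_rel_def)
      have hom: "h \<in> lmod_hom R (lmod_sum Y X) E" using h by (simp add: lmod_iso_def)
      have eqs: "(\<zero>\<^bsub>Y\<^esub>, x \<oplus>\<^bsub>X\<^esub> y) = (\<zero>\<^bsub>Y\<^esub>, x) \<oplus>\<^bsub>lmod_sum Y X\<^esub> (\<zero>\<^bsub>Y\<^esub>, y)"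
        "a \<in> carrier R \<Longrightarrow> (\<zero>\<^bsub>Y\<^esub>, a \<odot>\<^bsub>X\<^esub> x) = a \<odot>\<^bsub>lmod_sum Y X\<^esub> (\<zero>\<^bsub>Y\<^esub>, x)"
        "x \<in> carrier X \<Longrightarrow> (\<zero>\<^bsub>Y\<^esub>, x) \<in> carrier (lmod_sum Y X)" for x y a
        by (auto simp: lmod_sum_def)
      have "(\<lambda>x. h (\<zero>\<^bsub>Y\<^esub>, x)) \<in> lmod_hom R X E"
        unfolding lmod_hom_def
        by (auto simp: eqs(1,2) lmod_hom_add[OF hom] lmod_hom_smult[OF hom] eqs(3)
            intro: lmod_hom_closed[OF hom])
      then show "\<exists>s\<in>lmod_hom R X E. \<forall>x\<in>carrier X. g (s x) = x"
        using gh eqs(3) by (intro bexI[of _ "\<lambda>x. h (\<zero>\<^bsub>Y\<^esub>, x)"]) auto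
    qed
  next
    assume *: "\<forall>(E, f, g)\<in>extensions R X Y. \<exists>s\<in>lmod_hom R X E. \<forall>x\<in>carrier X. g (s x) = x"
    have rel: "(e, e') \<in> ?r" if e: "e \<in> extensions R X Y" and e': "e' \<in> extensions R X Y" for e e'
    proof -
      obtain E f g where eq: "e = (E, f, g)" by (cases e)
      obtain E' f' g' where eq': "e' = (E', f', g')" by (cases e')
      obtain s where s: "s \<in> lmod_hom R X E" "\<And>x. x \<in> carrier X \<Longrightarrow> g (s x) = x"
        using * e unfolding eq by blast
      obtain s' where s': "s' \<in> lmod_hom R X E'" "\<And>x. x \<in> carrier X \<Longrightarrow> g' (s' x) = x"
        using * e' unfolding eq' by blast
      obtain h where h: "h \<in> lmod_iso R (lmod_sum Y X) E"
        "\<And>y. y \<in> carrier Y \<Longrightarrow> h (y, \<zero>\<^bsub>X\<^esub>) = f y"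
        "\<And>z. z \<in> carrier (lmod_sum Y X) \<Longrightarrow> g (h z) = snd z"
        using split_iso[OF X Y e[unfolded eq] s] by blast
      obtain h' where h': "h' \<in> lmod_iso R (lmod_sum Y X) E'"
        "\<And>y. y \<in> carrier Y \<Longrightarrow> h' (y, \<zero>\<^bsub>X\<^esub>) = f' y"
        "\<And>z. z \<in> carrier (lmod_sum Y X) \<Longrightarrow> g' (h' z) = snd z"
        using split_iso[OF X Y e'[unfolded eq'] s'] by blast
      let ?i = "inv_into (carrier (lmod_sum Y X)) h"
      have bij: "bij_betw h (carrier (lmod_sum Y X)) (carrier E)" using h(1) by (simp add: lmod_iso_def)
      have "h' \<circ> ?i \<in> lmod_iso R E E'"
        by (rule lmod_iso_comp[OF lmod_iso_inverse[OF h(1) left_module_lmod_sum[OF Y X]] h'(1)])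
      moreover have "(h' \<circ> ?i) (f y) = f' y" if y: "y \<in> carrier Y" for y
      proof -
        have "(y, \<zero>\<^bsub>X\<^esub>) \<in> carrier (lmod_sum Y X)" using y by (simp add: lmod_sum_def)
        then have "?i (h (y, \<zero>\<^bsub>X\<^esub>)) = (y, \<zero>\<^bsub>X\<^esub>)"
          using bij by (simp add: bij_betw_def)
        then show ?thesis using h(2) h'(2) y by simp
      qed
      moreover have "g' ((h' \<circ> ?i) z) = g z" if z: "z \<in> carrier E" for z
      proof -
        have "?i z \<in> carrier (lmod_sum Y X)" "h (?i z) = z"
          using bij z by (auto simp: bij_betw_def inv_into_into f_inv_into_f)
        then show ?thesis using h(3)[of "?i z"] h'(3)[of "?i z"] by simp
      qed
      ultimately show ?thesis
        using e e' unfolding eq eq' by (intro extension_relI) auto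
    qed
    have sub: "?r \<subseteq> extensions R X Y \<times> extensions R X Y" by (auto simp: extension_rel_def)
    then have "?r `` {e} = extensions R X Y" if "e \<in> extensions R X Y" for e
      using rel that by blast
    then show "Ext1 R X Y = {Ext1_zero R X Y}"
      using S by (auto simp: Ext1_def Ext1_zero_def quotient_def)
  qed
qed

section \<open>Cocycles\<close>

context quiver_quotient
begin

text \<open>Coordinates replace an abstract module by a space of functions on which paths act
  explicitly. Since \<open>coset x\<close> is required to act as x for every representative x, the
  definition entails that I annihilates S. The closure conditions are included so that the module
  axioms can be derived from S.\<close>

definition coords :: "('i \<Rightarrow> 'v) \<Rightarrow> ('a \<Rightarrow> ('i \<Rightarrow> 'k) \<Rightarrow> 'i \<Rightarrow> 'k) \<Rightarrow> ('i \<Rightarrow> 'k) set \<Rightarrow>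
    (('v, 'a, 'k) quot_elt, 'x) module \<Rightarrow> ('x \<Rightarrow> 'i \<Rightarrow> 'k) \<Rightarrow> bool" where
  "coords \<nu> T S M \<Psi> \<longleftrightarrow>
     bij_betw \<Psi> (carrier M) S \<and> \<zero>\<^bsub>M\<^esub> \<in> carrier M \<and> \<Psi> \<zero>\<^bsub>M\<^esub> = 0 \<and>
     (\<forall>v\<in>carrier M. \<forall>w\<in>carrier M. v \<oplus>\<^bsub>M\<^esub> w \<in> carrier M \<and> \<Psi> (v \<oplus>\<^bsub>M\<^esub> w) = \<Psi> v + \<Psi> w) \<and>
     (\<forall>x\<in>carrier kQ. \<forall>v\<in>carrier M.
        coset x \<odot>\<^bsub>M\<^esub> v \<in> carrier M \<and> \<Psi> (coset x \<odot>\<^bsub>M\<^esub> v) = act \<nu> T x (\<Psi> v))"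

lemma coords_left_module:
  assumes sub: "quiver_subrep Q \<nu> T S" and co: "coords \<nu> T S M \<Psi>"
  shows "left_module (string_alg Q I) M"
proof -
  interpret quiver_subrep Q \<nu> T S by (rule sub)
  have bij: "bij_betw \<Psi> (carrier M) S" and zero: "\<zero>\<^bsub>M\<^esub> \<in> carrier M" "\<Psi> \<zero>\<^bsub>M\<^esub> = 0"
    and add: "\<And>v w. v \<in> carrier M \<Longrightarrow> w \<in> carrier M \<Longrightarrow> v \<oplus>\<^bsub>M\<^esub> w \<in> carrier M"
      "\<And>v w. v \<in> carrier M \<Longrightarrow> w \<in> carrier M \<Longrightarrow> \<Psi> (v \<oplus>\<^bsub>M\<^esub> w) = \<Psi> v + \<Psi> w"
    and smult: "\<And>x v. x \<in> carrier kQ \<Longrightarrow> v \<in> carrier M \<Longrightarrow> coset x \<odot>\<^bsub>M\<^esub> v \<in> carrier M"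
      "\<And>x v. x \<in> carrier kQ \<Longrightarrow> v \<in> carrier M \<Longrightarrow> \<Psi> (coset x \<odot>\<^bsub>M\<^esub> v) = act \<nu> T x (\<Psi> v)"
    using co by (auto simp: coords_def)
  have eqI: "v = w" if "v \<in> carrier M" "w \<in> carrier M" "\<Psi> v = \<Psi> w" for v w
    using that bij by (auto simp: bij_betw_def inj_on_def)
  have "abelian_group M"
  proof (rule abelian_groupI)
    fix v assume v: "v \<in> carrier M"
    then have "fscale (-1) (\<Psi> v) \<in> S" using bij sub_scale by (auto simp: bij_betw_def)
    then obtain w where w: "w \<in> carrier M" "\<Psi> w = fscale (-1) (\<Psi> v)"
      using bij by (auto simp: bij_betw_def image_iff)
    have "\<Psi> (w \<oplus>\<^bsub>M\<^esub> v) = \<Psi> \<zero>\<^bsub>M\<^esub>" using v w zero by (simp add: add fun_eq_iff)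
    then show "\<exists>w\<in>carrier M. w \<oplus>\<^bsub>M\<^esub> v = \<zero>\<^bsub>M\<^esub>"
      using v w zero add eqI by blast
  qed (auto intro!: eqI simp: add zero add_ac)
  moreover have "left_module_axioms (string_alg Q I) M"
  proof
    fix A v assume "A \<in> carrier (string_alg Q I)" "v \<in> carrier M"
    then show "A \<odot>\<^bsub>M\<^esub> v \<in> carrier M" by (auto elim!: cosetE simp: smult)
  next
    fix A B v assume "A \<in> carrier (string_alg Q I)" "B \<in> carrier (string_alg Q I)" and v: "v \<in> carrier M"
    then obtain x y where xy: "x \<in> carrier kQ" "y \<in> carrier kQ" "A = coset x" "B = coset y"
      by (auto elim!: cosetE)
    note c = xy v path_algebra_add_closed[OF xy(1,2)] I.m_closed[OF xy(1,2)]
    show "(A \<oplus>\<^bsub>string_alg Q I\<^esub> B) \<odot>\<^bsub>M\<^esub> v = A \<odot>\<^bsub>M\<^esub> v \<oplus>\<^bsub>M\<^esub> B \<odot>\<^bsub>M\<^esub> v"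
      by (rule eqI) (simp_all add: c coset_add smult add act_add_left)
    show "(A \<otimes>\<^bsub>string_alg Q I\<^esub> B) \<odot>\<^bsub>M\<^esub> v = A \<odot>\<^bsub>M\<^esub> (B \<odot>\<^bsub>M\<^esub> v)"
      by (rule eqI) (simp_all add: c coset_mult smult act_mult)
  next
    fix A v w assume "A \<in> carrier (string_alg Q I)" and v: "v \<in> carrier M" "w \<in> carrier M"
    then obtain x where x: "x \<in> carrier kQ" "A = coset x" by (auto elim!: cosetE)
    show "A \<odot>\<^bsub>M\<^esub> (v \<oplus>\<^bsub>M\<^esub> w) = A \<odot>\<^bsub>M\<^esub> v \<oplus>\<^bsub>M\<^esub> A \<odot>\<^bsub>M\<^esub> w"
      using act_lin by (intro eqI) (simp_all add: x v smult add lin_op_def)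
  next
    fix v assume "v \<in> carrier M"
    then show "\<one>\<^bsub>string_alg Q I\<^esub> \<odot>\<^bsub>M\<^esub> v = v"
      by (intro eqI) (simp_all add: coset_one smult act_one)
  qed
  ultimately show ?thesis
    by (intro left_module.intro ring_string_alg)
qed

lemma act_scalar:
  assumes "quiver_rep Q \<nu> T"
  shows "act \<nu> T (pscale c (one kQ)) \<phi> = fscale c \<phi>"
  using quiver_rep.act_one[OF assms] by (simp add: act_pscale)

lemma one_in [simp]: "pscale c (one kQ) \<in> carrier kQ"
  using path_algebra_pscale_closed I.one_closed by blast

lemma scalar_mult: "x \<in> carrier kQ \<Longrightarrow> mult kQ (pscale c (one kQ)) x = pscale c x"
  using pscale_one_mult quiver by (metis fin_digraph.finite_verts fin_digraph_def)

lemma mult_scalar: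
  assumes "x \<in> carrier kQ"
  shows "mult kQ x (pscale c (one kQ)) = pscale c x"
proof -
  have "mult kQ x (pscale c y) = pscale c (mult kQ x y)" for y
    by (rule poly_mapping_eqI)
      (simp add: path_algebra_simps lookup_lin_ext lin_ext_pscale lsum_scale_fun)
  then show ?thesis using assms by simp
qed

end

text \<open>A Yoneda extension is encoded by a derivation of kQ with values in the maps from SX to
  SY. Since it lives on kQ and not on the quotient, vanishing on I is one of its conditions.
  Vanishing on trivial paths and on scalars reflects a linear, vertex-homogeneous choice of section;
  k-linearity then follows from \<open>D_mult\<close> and \<open>D_scalar\<close>.\<close>

locale cocycle = quiver_quotient Q I + X: quiver_subrep Q \<nu>X TX SX + Y: quiver_subrep Q \<nu>Y TY SY
  for Q :: "('v, 'a) pre_digraph" and I :: "('v, 'a, 'k::comm_ring_1) kpath set"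
    and \<nu>X :: "'i \<Rightarrow> 'v" and TX SX and \<nu>Y :: "'j \<Rightarrow> 'v" and TY SY +
  fixes D :: "('v, 'a, 'k) kpath \<Rightarrow> ('i \<Rightarrow> 'k) \<Rightarrow> ('j \<Rightarrow> 'k)"
  assumes D_in: "x \<in> carrier kQ \<Longrightarrow> \<phi> \<in> SX \<Longrightarrow> D x \<phi> \<in> SY"
    and D_add_left: "x \<in> carrier kQ \<Longrightarrow> y \<in> carrier kQ \<Longrightarrow> \<phi> \<in> SX \<Longrightarrow> D (x + y) \<phi> = D x \<phi> + D y \<phi>"
    and D_add_right: "x \<in> carrier kQ \<Longrightarrow> \<phi> \<in> SX \<Longrightarrow> \<psi> \<in> SX \<Longrightarrow> D x (\<phi> + \<psi>) = D x \<phi> + D x \<psi>"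
    and D_mult: "x \<in> carrier kQ \<Longrightarrow> y \<in> carrier kQ \<Longrightarrow> \<phi> \<in> SX \<Longrightarrow>
      D (mult kQ x y) \<phi> = act \<nu>Y TY x (D y \<phi>) + D x (act \<nu>X TX y \<phi>)"
    and D_ideal: "x \<in> I \<Longrightarrow> \<phi> \<in> SX \<Longrightarrow> D x \<phi> = 0"
    and D_vertex: "u \<in> verts Q \<Longrightarrow> \<phi> \<in> SX \<Longrightarrow> D (basis_path (Triv u)) \<phi> = 0"
    and D_scalar: "\<phi> \<in> SX \<Longrightarrow> D (pscale c (one kQ)) \<phi> = 0"
begin

lemma D_pscale:
  assumes "x \<in> carrier kQ" "\<phi> \<in> SX"
  shows "D (pscale c x) \<phi> = fscale c (D x \<phi>)"
  using D_mult[of "pscale c (one kQ)" x \<phi>] assms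
  by (simp add: scalar_mult D_scalar X.sub_act act_scalar[OF Y.quiver_rep_axioms])

lemma D_scale_right:
  assumes "x \<in> carrier kQ" "\<phi> \<in> SX"
  shows "D x (fscale c \<phi>) = fscale c (D x \<phi>)"
  using D_mult[of x "pscale c (one kQ)" \<phi>] assms Y.act_lin[of x] lin_op_zero[of "act \<nu>Y TY x"]
    D_scalar[OF assms(2), of 1]
  by (simp add: mult_scalar D_pscale D_scalar act_scalar[OF X.quiver_rep_axioms])

lemma D_Cons:
  assumes "is_path Q (Walk (a # as))" "as \<noteq> []" "\<phi> \<in> SX"
  shows "D (basis_path (Walk (a # as))) \<phi> =
    TY a (D (basis_path (Walk as)) \<phi>) + D (basis_path (Walk [a])) (foldr TX as \<phi>)"
proof -
  have p: "is_path Q (Walk [a])" "is_path Q (Walk as)" and comp: "tail Q a = head Q (hd as)"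
    using assms by (auto simp: successively_Cons)
  have "mult kQ (basis_path (Walk [a])) (basis_path (Walk as)) = basis_path (Walk (a # as))"
    using comp unfolding basis_path_def single_mult_single
    by (simp add: path_prod_def walk_comp_def)
  then show ?thesis
    using D_mult[of "basis_path (Walk [a])" "basis_path (Walk as)" \<phi>] p assms(3)
    by (simp add: basis_path_def act_single del: is_path.simps)
qed

text \<open>Both sides obey the same Leibniz rule in x. So the equation passes from arrows to paths
  by splitting off the leftmost arrow, and from there to linear combinations.\<close>

lemma coboundary_from_arrows:
  assumes H_in: "\<And>\<phi>. \<phi> \<in> SX \<Longrightarrow> H \<phi> \<in> SY" and H: "lin_op H"
    and vertex: "\<And>u \<phi>. \<phi> \<in> SX \<Longrightarrow> u \<in> verts Q \<Longrightarrow>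
      H (path_act \<nu>X TX (Triv u) \<phi>) = path_act \<nu>Y TY (Triv u) (H \<phi>)"
    and arrow: "\<And>a \<phi>. \<phi> \<in> SX \<Longrightarrow> a \<in> arcs Q \<Longrightarrow>
      H (TX a \<phi>) = D (basis_path (Walk [a])) \<phi> + TY a (H \<phi>)"
    and x: "x \<in> carrier kQ" and \<phi>: "\<phi> \<in> SX"
  shows "H (act \<nu>X TX x \<phi>) = D x \<phi> + act \<nu>Y TY x (H \<phi>)"
proof -
  have walk: "H (foldr TX as \<phi>) = D (basis_path (Walk as)) \<phi> + foldr TY as (H \<phi>)"
    if "is_path Q (Walk as)" for as
    using that
  proof (induction as)
    case (Cons a as)
    show ?case
    proof (cases "as = []")
      case True
      then show ?thesis using Cons.prems arrow[OF \<phi>] by simp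
    next
      case False
      then have p: "is_path Q (Walk as)" "a \<in> arcs Q" using Cons.prems by (auto simp: successively_Cons)
      have "foldr TX as \<phi> \<in> SX" using X.sub_path[OF \<phi>, of "Walk as"] by simp
      have "H (foldr TX (a # as) \<phi>) =
          D (basis_path (Walk [a])) (foldr TX as \<phi>) + TY a (H (foldr TX as \<phi>))"
        using arrow[OF \<open>foldr TX as \<phi> \<in> SX\<close> p(2)] by simp
      also have "TY a (H (foldr TX as \<phi>)) =
          TY a (D (basis_path (Walk as)) \<phi>) + TY a (foldr TY as (H \<phi>))"
        unfolding Cons.IH[OF p(1)] by (rule lin_op_add[OF Y.arrow_lin])
      finally show ?thesis
        by (simp only: D_Cons[OF Cons.prems False \<phi>] foldr.simps comp_apply add_ac)
    qed
  qed simp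
  have "Poly_Mapping.keys x \<subseteq> {p. is_path Q p}" using x by (simp add: path_algebra_simps)
  then show ?thesis
  proof (induction rule: poly_mapping_span_induct)
    case zero
    have "D 0 \<phi> = 0" using D_pscale[of "one kQ" \<phi> 0] \<phi> by simp
    then show ?case by (simp only: act_zero_left lin_op_zero[OF H] add_0_left)
  next
    case (add x y)
    then have c: "x \<in> carrier kQ" "y \<in> carrier kQ" by (auto simp: path_algebra_simps)
    show ?case
      unfolding act_add_left lin_op_add[OF H] add(3,4) D_add_left[OF c \<phi>] by (simp only: add_ac)
  next
    case (single c p)
    have eq: "Poly_Mapping.single p c = pscale c (basis_path p)"
      by (simp add: basis_path_def pscale_single)
    have "basis_path p \<in> carrier kQ" using single by (simp add: basis_path_def)
    then have D: "D (Poly_Mapping.single p c) \<phi> = fscale c (D (basis_path p) \<phi>)"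
      unfolding eq using \<phi> by (rule D_pscale)
    have "H (path_act \<nu>X TX p \<phi>) = D (basis_path p) \<phi> + path_act \<nu>Y TY p (H \<phi>)"
    proof (cases p)
      case (Triv u)
      then show ?thesis using vertex[OF \<phi>, of u] D_vertex[of u \<phi>] single \<phi> by simp
    next
      case (Walk as)
      then show ?thesis using walk single by simp
    qed
    then have "H (act \<nu>X TX (Poly_Mapping.single p c) \<phi>) =
        fscale c (D (basis_path p) \<phi> + path_act \<nu>Y TY p (H \<phi>))"
      by (simp only: act_single lin_op_scale[OF H])
    also have "\<dots> = fscale c (D (basis_path p) \<phi>) + fscale c (path_act \<nu>Y TY p (H \<phi>))"
      by (simp add: fun_eq_iff distrib_left)
    finally show ?case by (simp only: D act_single)
  qed
qed

end

text \<open>A linear section \<sigma> of g, assembled from lifts of a basis, fails to be a module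
  map by \<open>x \<sigma>(\<phi>) - \<sigma>(x \<phi>)\<close>. This lies in the image of f and
  defines D. The equation for H says precisely that adding f H to \<sigma> repairs the
  defect.\<close>

lemma (in quiver_quotient) extension_cocycle:
  fixes X :: "(('v, 'a, 'k) quot_elt, 'x) module" and Y :: "(('v, 'a, 'k) quot_elt, 'y) module"
    and \<nu>X :: "'i \<Rightarrow> 'v" and \<nu>Y :: "'j \<Rightarrow> 'v"
  assumes ext: "(E, f, g) \<in> extensions (string_alg Q I) X Y"
    and SX: "quiver_subrep Q \<nu>X TX SX" and cX: "coords \<nu>X TX SX X \<Psi>X"
    and SY: "quiver_subrep Q \<nu>Y TY SY" and cY: "coords \<nu>Y TY SY Y \<Psi>Y"
    and B: "finite B" "\<And>i. i \<in> B \<Longrightarrow> \<epsilon> i \<in> SX"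
    and basis: "\<And>\<phi>. \<phi> \<in> SX \<Longrightarrow> \<phi> = (\<Sum>i\<in>B. fscale (\<phi> i) (\<epsilon> i))"
    and graded: "\<And>i. i \<in> B \<Longrightarrow> path_act \<nu>X TX (Triv (\<nu>X i)) (\<epsilon> i) = \<epsilon> i"
  obtains D where "cocycle Q I \<nu>X TX SX \<nu>Y TY SY D"
    and "(\<exists>H. lin_op H \<and> (\<forall>\<phi>\<in>SX. H \<phi> \<in> SY) \<and>
        (\<forall>x\<in>carrier kQ. \<forall>\<phi>\<in>SX. H (act \<nu>X TX x \<phi>) = D x \<phi> + act \<nu>Y TY x (H \<phi>))) \<Longrightarrow>
      (\<exists>s\<in>lmod_hom (string_alg Q I) X E. \<forall>x\<in>carrier X. g (s x) = x)"
proof -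
  let ?R = "string_alg Q I"
  interpret SX: quiver_subrep Q \<nu>X TX SX by (rule SX)
  interpret SY: quiver_subrep Q \<nu>Y TY SY by (rule SY)
  interpret X: left_module ?R X by (rule coords_left_module[OF SX cX])
  interpret Y: left_module ?R Y by (rule coords_left_module[OF SY cY])
  have E: "left_module ?R E" and f: "f \<in> lmod_hom ?R Y E" and g: "g \<in> lmod_hom ?R E X"
    and inj: "inj_on f (carrier Y)" and surj: "g ` carrier E = carrier X"
    and ker: "f ` carrier Y = {e \<in> carrier E. g e = \<zero>\<^bsub>X\<^esub>}"
    using ext by (auto simp: extensions_def)
  interpret E: left_module ?R E by (rule E)
  note fc = lmod_hom_closed[OF f] and gc = lmod_hom_closed[OF g]
  have bX: "bij_betw \<Psi>X (carrier X) SX" and \<Psi>Xz: "\<Psi>X \<zero>\<^bsub>X\<^esub> = 0"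
    and \<Psi>Xa: "\<And>v w. v \<in> carrier X \<Longrightarrow> w \<in> carrier X \<Longrightarrow> \<Psi>X (v \<oplus>\<^bsub>X\<^esub> w) = \<Psi>X v + \<Psi>X w"
    and \<Psi>Xm: "\<And>x v. x \<in> carrier kQ \<Longrightarrow> v \<in> carrier X \<Longrightarrow> \<Psi>X (coset x \<odot>\<^bsub>X\<^esub> v) = act \<nu>X TX x (\<Psi>X v)"
    using cX by (auto simp: coords_def)
  have bY: "bij_betw \<Psi>Y (carrier Y) SY" and \<Psi>Yz: "\<Psi>Y \<zero>\<^bsub>Y\<^esub> = 0"
    and \<Psi>Ya: "\<And>v w. v \<in> carrier Y \<Longrightarrow> w \<in> carrier Y \<Longrightarrow> \<Psi>Y (v \<oplus>\<^bsub>Y\<^esub> w) = \<Psi>Y v + \<Psi>Y w"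
    and \<Psi>Ym: "\<And>x v. x \<in> carrier kQ \<Longrightarrow> v \<in> carrier Y \<Longrightarrow> \<Psi>Y (coset x \<odot>\<^bsub>Y\<^esub> v) = act \<nu>Y TY x (\<Psi>Y v)"
    using cY by (auto simp: coords_def)
  have \<Psi>X_in: "\<Psi>X v \<in> SX" if "v \<in> carrier X" for v using bX that by (auto simp: bij_betw_def)
  have \<Psi>X_eqI: "v = w" if "v \<in> carrier X" "w \<in> carrier X" "\<Psi>X v = \<Psi>X w" for v w
    using that bX by (auto simp: bij_betw_def inj_on_def)
  define JX where "JX = inv_into (carrier X) \<Psi>X"
  have JX: "JX \<phi> \<in> carrier X" "\<Psi>X (JX \<phi>) = \<phi>" if "\<phi> \<in> SX" for \<phi>
    using bX that unfolding JX_def bij_betw_def by (auto intro: inv_into_into f_inv_into_f)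
  define JY where "JY = inv_into (carrier Y) \<Psi>Y"
  have JY: "JY \<psi> \<in> carrier Y" "\<Psi>Y (JY \<psi>) = \<psi>" if "\<psi> \<in> SY" for \<psi>
    using bY that unfolding JY_def bij_betw_def by (auto intro: inv_into_into f_inv_into_f)
  have JY_eqI: "JY \<psi> = y" if "y \<in> carrier Y" "\<Psi>Y y = \<psi>" for y \<psi>
    using bY that unfolding JY_def bij_betw_def by auto
  define F where "F \<psi> = f (JY \<psi>)" for \<psi>
  have Fc: "F \<psi> \<in> carrier E" if "\<psi> \<in> SY" for \<psi> using that JY fc by (simp add: F_def)
  have Fadd: "F (\<psi> + \<chi>) = F \<psi> \<oplus>\<^bsub>E\<^esub> F \<chi>" if "\<psi> \<in> SY" "\<chi> \<in> SY" for \<psi> \<chi>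
  proof -
    have "JY (\<psi> + \<chi>) = JY \<psi> \<oplus>\<^bsub>Y\<^esub> JY \<chi>" using that JY by (intro JY_eqI) (auto simp: \<Psi>Ya)
    then show ?thesis using that JY by (simp add: F_def lmod_hom_add[OF f])
  qed
  have Fsm: "F (act \<nu>Y TY x \<psi>) = coset x \<odot>\<^bsub>E\<^esub> F \<psi>" if "x \<in> carrier kQ" "\<psi> \<in> SY" for x \<psi>
  proof -
    have "JY (act \<nu>Y TY x \<psi>) = coset x \<odot>\<^bsub>Y\<^esub> JY \<psi>"
      using that JY by (intro JY_eqI) (auto simp: \<Psi>Ym Y.lsmult_closed)
    then show ?thesis using that JY by (simp add: F_def lmod_hom_smult[OF f])
  qed
  have F_inj: "\<psi> = \<chi>" if "\<psi> \<in> SY" "\<chi> \<in> SY" "F \<psi> = F \<chi>" for \<psi> \<chi>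
    using that JY inj unfolding F_def inj_on_def by metis
  have F_zero: "F 0 = \<zero>\<^bsub>E\<^esub>"
    using JY_eqI[OF Y.M.zero_closed \<Psi>Yz] lmod_hom_zero[OF _ E f] Y.left_module_axioms
    by (simp add: F_def)
  have gF: "g (F \<psi>) = \<zero>\<^bsub>X\<^esub>" if "\<psi> \<in> SY" for \<psi>
    using imageI[OF JY(1)[OF that], of f] unfolding ker F_def by simp
  have F_ker: "\<exists>\<psi>\<in>SY. F \<psi> = e" if "e \<in> carrier E" "g e = \<zero>\<^bsub>X\<^esub>" for e
  proof -
    have "e \<in> f ` carrier Y" unfolding ker using that by simp
    then obtain y where y: "y \<in> carrier Y" "f y = e" by (metis imageE)
    then have "\<Psi>Y y \<in> SY" "F (\<Psi>Y y) = e"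
      using bY JY_eqI[OF y(1) refl] by (auto simp: F_def bij_betw_def)
    then show ?thesis by blast
  qed
  \<comment> \<open>E is only given as a module over the quotient ring; scalars act on it through
    cosets of multiples of the unit.\<close>
  define sc where "sc c e = coset (pscale c (one kQ)) \<odot>\<^bsub>E\<^esub> e" for c e
  have scc: "sc c e \<in> carrier E" if "e \<in> carrier E" for c e
    using that by (simp add: sc_def E.lsmult_closed)
  have sc_add: "sc (c + d) e = sc c e \<oplus>\<^bsub>E\<^esub> sc d e" if "e \<in> carrier E" for c d e
    using that E.lsmult_l_distr[of "coset (pscale c (one kQ))" "coset (pscale d (one kQ))" e]
    by (simp add: sc_def coset_add pscale_add_left)
  have sc_sc: "sc c (sc d e) = sc (c * d) e" if "e \<in> carrier E" for c d e
    using that E.lsmult_assoc[of "coset (pscale c (one kQ))" "coset (pscale d (one kQ))" e]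
    by (simp add: sc_def coset_mult scalar_mult pscale_pscale)
  have coset0: "coset 0 = \<zero>\<^bsub>?R\<^esub>"
    using I.a_coset_add_zero[OF I.a_subset]
    by (simp add: coset_def quotient_algebra_simps FactRing_def path_algebra_simps(4))
  have sc0: "sc 0 e = \<zero>\<^bsub>E\<^esub>" if "e \<in> carrier E" for e
    using that by (simp add: sc_def coset0)
  have sc_comm: "coset x \<odot>\<^bsub>E\<^esub> sc c e = sc c (coset x \<odot>\<^bsub>E\<^esub> e)" if "x \<in> carrier kQ" "e \<in> carrier E" for x c e
    using that E.lsmult_assoc[of "coset x" "coset (pscale c (one kQ))" e]
      E.lsmult_assoc[of "coset (pscale c (one kQ))" "coset x" e]
    by (simp add: sc_def coset_mult scalar_mult mult_scalar)
  \<comment> \<open>Multiplying a lift of \<open>\<epsilon> i\<close> by the idempotent at the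
    vertex of i leaves it a lift, since \<open>\<epsilon> i\<close> is homogeneous, and makes it
    homogeneous. This is why the cocycle vanishes on trivial paths.\<close>
  have "\<exists>e. e \<in> carrier E \<and> g e = JX (\<epsilon> i) \<and>
      (\<forall>u\<in>verts Q. coset (basis_path (Triv u)) \<odot>\<^bsub>E\<^esub> e = (if \<nu>X i = u then e else \<zero>\<^bsub>E\<^esub>))"
    if i: "i \<in> B" for i
  proof -
    obtain e0 where e0: "e0 \<in> carrier E" "g e0 = JX (\<epsilon> i)"
      using surj JX(1)[OF B(2)[OF i]] by (metis imageE)
    define t where "t u = (basis_path (Triv u) :: ('v, 'a, 'k) kpath)" for u
    have tc: "t u \<in> carrier kQ" if "u \<in> verts Q" for u using that by (simp add: t_def basis_path_def)
    have vc: "\<nu>X i \<in> verts Q" by (rule SX.vertex_in)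
    let ?e = "coset (t (\<nu>X i)) \<odot>\<^bsub>E\<^esub> e0"
    have "g ?e = JX (\<epsilon> i)"
    proof (rule \<Psi>X_eqI)
      show "g ?e \<in> carrier X" using e0 tc[OF vc] gc by (simp add: E.lsmult_closed)
      show "JX (\<epsilon> i) \<in> carrier X" using JX B(2) i by blast
      have "act \<nu>X TX (t (\<nu>X i)) (\<epsilon> i) = path_act \<nu>X TX (Triv (\<nu>X i)) (\<epsilon> i)"
        by (simp only: t_def basis_path_def act_single fscale_simps)
      then show "\<Psi>X (g ?e) = \<Psi>X (JX (\<epsilon> i))"
        using e0 tc[OF vc] graded[OF i] JX[OF B(2)[OF i]]
        by (simp add: lmod_hom_smult[OF g] \<Psi>Xm del: path_act.simps)
    qed
    moreover have "coset (t u) \<odot>\<^bsub>E\<^esub> ?e = (if \<nu>X i = u then ?e else \<zero>\<^bsub>E\<^esub>)" if "u \<in> verts Q" for u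
    proof -
      have "coset (t u) \<odot>\<^bsub>E\<^esub> ?e = coset (mult kQ (t u) (t (\<nu>X i))) \<odot>\<^bsub>E\<^esub> e0"
        using E.lsmult_assoc[of "coset (t u)" "coset (t (\<nu>X i))" e0] tc vc that e0
        by (simp add: coset_mult)
      moreover have "mult kQ (t u) (t (\<nu>X i)) = (if \<nu>X i = u then t (\<nu>X i) else 0)"
        unfolding t_def basis_path_def single_mult_single by (simp add: path_prod_def walk_comp_def)
      ultimately show ?thesis using e0 by (simp add: coset0)
    qed
    ultimately show ?thesis
      using e0 tc[OF vc] by (intro exI[of _ ?e]) (simp add: t_def E.lsmult_closed)
  qed
  then obtain \<xi> where \<xi>c: "\<And>i. i \<in> B \<Longrightarrow> \<xi> i \<in> carrier E"
    and g\<xi>: "\<And>i. i \<in> B \<Longrightarrow> g (\<xi> i) = JX (\<epsilon> i)"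
    and \<xi>v: "\<And>i u. i \<in> B \<Longrightarrow> u \<in> verts Q \<Longrightarrow>
      coset (basis_path (Triv u)) \<odot>\<^bsub>E\<^esub> \<xi> i = (if \<nu>X i = u then \<xi> i else \<zero>\<^bsub>E\<^esub>)"
    by metis
  define \<sigma> where "\<sigma> \<phi> = finsum E (\<lambda>i. sc (\<phi> i) (\<xi> i)) B" for \<phi>
  have sc\<xi>: "(\<lambda>i. sc (\<phi> i) (\<xi> i)) \<in> B \<rightarrow> carrier E" for \<phi> using \<xi>c scc by auto
  have \<sigma>c: "\<sigma> \<phi> \<in> carrier E" for \<phi> unfolding \<sigma>_def by (rule E.M.finsum_closed[OF sc\<xi>])
  have \<sigma>_add: "\<sigma> (\<phi> + \<psi>) = \<sigma> \<phi> \<oplus>\<^bsub>E\<^esub> \<sigma> \<psi>" for \<phi> \<psi>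
  proof -
    have "\<sigma> (\<phi> + \<psi>) = finsum E (\<lambda>i. sc (\<phi> i) (\<xi> i) \<oplus>\<^bsub>E\<^esub> sc (\<psi> i) (\<xi> i)) B"
      unfolding \<sigma>_def using \<xi>c scc by (intro E.M.finsum_cong') (auto simp: sc_add)
    also have "\<dots> = \<sigma> \<phi> \<oplus>\<^bsub>E\<^esub> \<sigma> \<psi>"
      unfolding \<sigma>_def by (rule E.M.finsum_addf[OF sc\<xi> sc\<xi>])
    finally show ?thesis .
  qed
  have \<sigma>_scale: "\<sigma> (fscale c \<phi>) = sc c (\<sigma> \<phi>)" for c \<phi>
  proof -
    have "sc c (\<sigma> \<phi>) = finsum E (\<lambda>i. sc c (sc (\<phi> i) (\<xi> i))) B"
      unfolding \<sigma>_def sc_def[of c]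
      by (rule E.lsmult_finsum[OF B(1)]) (use \<xi>c scc in auto)
    also have "\<dots> = \<sigma> (fscale c \<phi>)"
      unfolding \<sigma>_def using \<xi>c scc by (intro E.M.finsum_cong') (auto simp: sc_sc)
    finally show ?thesis ..
  qed
  have \<sigma>_vertex: "coset (basis_path (Triv u)) \<odot>\<^bsub>E\<^esub> \<sigma> \<phi> = \<sigma> (path_act \<nu>X TX (Triv u) \<phi>)"
    if u: "u \<in> verts Q" for u \<phi>
  proof -
    have uc: "basis_path (Triv u) \<in> carrier kQ" using u by (simp add: basis_path_def)
    have "coset (basis_path (Triv u)) \<odot>\<^bsub>E\<^esub> \<sigma> \<phi> =
        finsum E (\<lambda>i. coset (basis_path (Triv u)) \<odot>\<^bsub>E\<^esub> sc (\<phi> i) (\<xi> i)) B"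
      unfolding \<sigma>_def by (rule E.lsmult_finsum[OF B(1)]) (use \<xi>c scc uc in auto)
    also have "\<dots> = \<sigma> (path_act \<nu>X TX (Triv u) \<phi>)"
      unfolding \<sigma>_def
    proof (rule E.M.finsum_cong'[OF refl sc\<xi>])
      fix i assume i: "i \<in> B"
      show "coset (basis_path (Triv u)) \<odot>\<^bsub>E\<^esub> sc (\<phi> i) (\<xi> i) = sc (path_act \<nu>X TX (Triv u) \<phi> i) (\<xi> i)"
        using i \<xi>c u uc by (simp add: sc_comm \<xi>v sc0) (simp add: sc_def)
    qed
    finally show ?thesis .
  qed
  have g\<sigma>: "g (\<sigma> \<phi>) = JX \<phi>" if \<phi>: "\<phi> \<in> SX" for \<phi>
  proof -
    have "\<Psi>X (g (finsum E (\<lambda>i. sc (\<phi> i) (\<xi> i)) A)) = (\<Sum>i\<in>A. fscale (\<phi> i) (\<epsilon> i))" if "A \<subseteq> B" for A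
      using finite_subset[OF that B(1)] that
    proof (induction A rule: finite_induct)
      case empty
      then show ?case using lmod_hom_zero[OF E _ g] X.left_module_axioms \<Psi>Xz by simp
    next
      case (insert i A)
      then have "i \<in> B" "A \<subseteq> B" by auto
      then have c: "\<xi> i \<in> carrier E" "sc (\<phi> i) (\<xi> i) \<in> carrier E"
        "(\<lambda>i. sc (\<phi> i) (\<xi> i)) \<in> A \<rightarrow> carrier E"
        by (auto intro!: \<xi>c scc Pi_I)
      have "\<Psi>X (g (sc (\<phi> i) (\<xi> i))) = fscale (\<phi> i) (\<epsilon> i)"
        using insert c JX[OF B(2)]
        by (simp add: sc_def lmod_hom_smult[OF g] gc \<Psi>Xm act_scalar[OF SX.quiver_rep_axioms] g\<xi>)
      then show ?case
        using insert c by (simp add: lmod_hom_add[OF g] \<Psi>Xa gc E.M.finsum_closed)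
    qed
    from this[of B] have "\<Psi>X (g (\<sigma> \<phi>)) = \<phi>" using basis[OF \<phi>] by (simp add: \<sigma>_def)
    then show ?thesis using \<Psi>X_eqI[OF gc[OF \<sigma>c] JX(1)[OF \<phi>]] JX(2)[OF \<phi>] by simp
  qed
  have "\<exists>\<psi>\<in>SY. coset x \<odot>\<^bsub>E\<^esub> \<sigma> \<phi> = \<sigma> (act \<nu>X TX x \<phi>) \<oplus>\<^bsub>E\<^esub> F \<psi>" if x: "x \<in> carrier kQ" and \<phi>: "\<phi> \<in> SX" for x \<phi>
  proof -
    let ?e = "coset x \<odot>\<^bsub>E\<^esub> \<sigma> \<phi>" and ?e' = "\<sigma> (act \<nu>X TX x \<phi>)"
    have c: "?e \<in> carrier E" "?e' \<in> carrier E" "?e \<ominus>\<^bsub>E\<^esub> ?e' \<in> carrier E"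
      using x \<sigma>c by (simp_all add: E.lsmult_closed)
    have e_eq: "?e = ?e' \<oplus>\<^bsub>E\<^esub> (?e \<ominus>\<^bsub>E\<^esub> ?e')"
      using c by (simp add: E.M.minus_eq E.M.a_comm[of ?e'] E.M.a_assoc E.M.l_neg)
    have "g ?e = coset x \<odot>\<^bsub>X\<^esub> JX \<phi>" using x \<sigma>c \<phi> by (simp add: lmod_hom_smult[OF g] g\<sigma>)
    also have "\<dots> = g ?e'"
      using JX[OF \<phi>] x SX.sub_act[OF \<phi>, of x] JX[OF SX.sub_act[OF \<phi>, of x]]
      by (intro \<Psi>X_eqI) (simp_all add: g\<sigma> X.lsmult_closed \<Psi>Xm)
    finally have "g ?e = g ?e'" .
    moreover have "g ?e = g ?e' \<oplus>\<^bsub>X\<^esub> g (?e \<ominus>\<^bsub>E\<^esub> ?e')"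
      by (rule trans[OF arg_cong[OF e_eq, of g] lmod_hom_add[OF g c(2,3)]])
    ultimately have "g (?e \<ominus>\<^bsub>E\<^esub> ?e') = \<zero>\<^bsub>X\<^esub>"
      using X.M.add.l_cancel_one[OF gc[OF c(2)] gc[OF c(3)]] by simp
    then obtain \<psi> where "\<psi> \<in> SY" "F \<psi> = ?e \<ominus>\<^bsub>E\<^esub> ?e'" using F_ker[OF c(3)] by blast
    then show ?thesis using e_eq by metis
  qed
  then obtain D where D_in: "\<And>x \<phi>. x \<in> carrier kQ \<Longrightarrow> \<phi> \<in> SX \<Longrightarrow> D x \<phi> \<in> SY"
    and D: "\<And>x \<phi>. x \<in> carrier kQ \<Longrightarrow> \<phi> \<in> SX \<Longrightarrow>
      coset x \<odot>\<^bsub>E\<^esub> \<sigma> \<phi> = \<sigma> (act \<nu>X TX x \<phi>) \<oplus>\<^bsub>E\<^esub> F (D x \<phi>)"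
    by metis
  have D_eqI: "D x \<phi> = \<psi>"
    if "x \<in> carrier kQ" "\<phi> \<in> SX" "\<psi> \<in> SY" "coset x \<odot>\<^bsub>E\<^esub> \<sigma> \<phi> = \<sigma> (act \<nu>X TX x \<phi>) \<oplus>\<^bsub>E\<^esub> F \<psi>" for x \<phi> \<psi>
  proof (rule F_inj[OF D_in[OF that(1,2)] that(3)])
    note c = \<sigma>c[of "act \<nu>X TX x \<phi>"] Fc[OF that(3)] Fc[OF D_in[OF that(1,2)]]
    have "F (D x \<phi>) \<oplus>\<^bsub>E\<^esub> \<sigma> (act \<nu>X TX x \<phi>) = F \<psi> \<oplus>\<^bsub>E\<^esub> \<sigma> (act \<nu>X TX x \<phi>)"
      using trans[OF that(4)[symmetric] D[OF that(1,2)]] c by (simp add: E.M.a_comm)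
    then show "F (D x \<phi>) = F \<psi>" using c by simp
  qed
  have cocycle: "cocycle Q I \<nu>X TX SX \<nu>Y TY SY D"
  proof (intro cocycle.intro cocycle_axioms.intro quiver_quotient_axioms SX SY)
    fix x \<phi> assume "x \<in> carrier kQ" "\<phi> \<in> SX"
    then show "D x \<phi> \<in> SY" by (rule D_in)
  next
    fix x y \<phi> assume x: "x \<in> carrier kQ" and y: "y \<in> carrier kQ" and \<phi>: "\<phi> \<in> SX"
    note c = \<sigma>c Fc[OF D_in[OF x \<phi>]] Fc[OF D_in[OF y \<phi>]]
    have "coset (x + y) \<odot>\<^bsub>E\<^esub> \<sigma> \<phi> = coset x \<odot>\<^bsub>E\<^esub> \<sigma> \<phi> \<oplus>\<^bsub>E\<^esub> coset y \<odot>\<^bsub>E\<^esub> \<sigma> \<phi>"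
      using E.lsmult_l_distr[of "coset x" "coset y" "\<sigma> \<phi>"] x y \<sigma>c by (simp add: coset_add)
    also have "\<dots> = \<sigma> (act \<nu>X TX (x + y) \<phi>) \<oplus>\<^bsub>E\<^esub> F (D x \<phi> + D y \<phi>)"
      using x y \<phi> c by (simp add: D act_add_left \<sigma>_add Fadd D_in E.M.add_interchange)
    finally show "D (x + y) \<phi> = D x \<phi> + D y \<phi>"
      using x y \<phi> by (intro D_eqI) (simp_all add: path_algebra_add_closed SY.sub_add D_in)
    note c' = Fc[OF SY.sub_act[OF D_in[OF y \<phi>]], of x] Fc[OF D_in[OF x SX.sub_act[OF \<phi>]], of y]
    have "coset (mult kQ x y) \<odot>\<^bsub>E\<^esub> \<sigma> \<phi> = coset x \<odot>\<^bsub>E\<^esub> (coset y \<odot>\<^bsub>E\<^esub> \<sigma> \<phi>)"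
      using E.lsmult_assoc[of "coset x" "coset y" "\<sigma> \<phi>"] x y \<sigma>c by (simp add: coset_mult)
    also have "\<dots> = coset x \<odot>\<^bsub>E\<^esub> \<sigma> (act \<nu>X TX y \<phi>) \<oplus>\<^bsub>E\<^esub> F (act \<nu>Y TY x (D y \<phi>))"
      using x y \<phi> c by (simp add: D E.lsmult_r_distr Fsm D_in)
    also have "\<dots> = \<sigma> (act \<nu>X TX (mult kQ x y) \<phi>) \<oplus>\<^bsub>E\<^esub>
        F (act \<nu>Y TY x (D y \<phi>) + D x (act \<nu>X TX y \<phi>))"
      using x y \<phi> c c' D[OF x SX.sub_act[OF \<phi>, of y]] D_in SX.sub_act SY.sub_act
      by (simp add: SX.act_mult Fadd E.M.a_ac)
    finally show "D (mult kQ x y) \<phi> = act \<nu>Y TY x (D y \<phi>) + D x (act \<nu>X TX y \<phi>)"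
      using x y \<phi> by (intro D_eqI) (simp_all add: I.m_closed SY.sub_add SY.sub_act SX.sub_act D_in)
  next
    fix x \<phi> \<psi> assume x: "x \<in> carrier kQ" and \<phi>: "\<phi> \<in> SX" and \<psi>: "\<psi> \<in> SX"
    note c = \<sigma>c Fc[OF D_in[OF x \<phi>]] Fc[OF D_in[OF x \<psi>]]
    have "coset x \<odot>\<^bsub>E\<^esub> \<sigma> (\<phi> + \<psi>) = coset x \<odot>\<^bsub>E\<^esub> \<sigma> \<phi> \<oplus>\<^bsub>E\<^esub> coset x \<odot>\<^bsub>E\<^esub> \<sigma> \<psi>"
      using x \<sigma>c by (simp add: \<sigma>_add E.lsmult_r_distr)
    also have "\<dots> = \<sigma> (act \<nu>X TX x (\<phi> + \<psi>)) \<oplus>\<^bsub>E\<^esub> F (D x \<phi> + D x \<psi>)"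
      using x \<phi> \<psi> c SX.act_lin[of x] by (simp add: D lin_op_def \<sigma>_add Fadd D_in E.M.add_interchange)
    finally show "D x (\<phi> + \<psi>) = D x \<phi> + D x \<psi>"
      using x \<phi> \<psi> by (intro D_eqI) (simp_all add: SX.sub_add SY.sub_add D_in)
  next
    fix x \<phi> assume x: "x \<in> I" and \<phi>: "\<phi> \<in> SX"
    have xc: "x \<in> carrier kQ" using x by (rule I.a_Hcarr)
    have "act \<nu>X TX x \<phi> = 0"
      using \<Psi>Xm[OF xc JX(1)[OF \<phi>]] JX[OF \<phi>] \<Psi>Xz by (simp add: coset_ideal[OF x] coset0)
    moreover have "\<sigma> 0 = \<zero>\<^bsub>E\<^esub>" using \<sigma>_scale[of 0 0] sc0[OF \<sigma>c] by simp
    ultimately show "D x \<phi> = 0"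
      using xc \<phi> \<sigma>c by (intro D_eqI) (simp_all add: coset_ideal[OF x] coset0 F_zero SY.sub_zero)
  next
    fix u \<phi> assume u: "u \<in> verts Q" and \<phi>: "\<phi> \<in> SX"
    have "act \<nu>X TX (basis_path (Triv u)) \<phi> = path_act \<nu>X TX (Triv u) \<phi>"
      by (simp only: basis_path_def act_single fscale_simps)
    then show "D (basis_path (Triv u)) \<phi> = 0"
      using u \<phi> \<sigma>c \<sigma>_vertex[OF u]
      by (intro D_eqI) (simp_all add: F_zero SY.sub_zero basis_path_def del: path_act.simps)
  next
    fix c \<phi> assume \<phi>: "\<phi> \<in> SX"
    show "D (pscale c (one kQ)) \<phi> = 0"
      using \<phi> \<sigma>c \<sigma>_scale[of c \<phi>]
      by (intro D_eqI) (simp_all add: F_zero SY.sub_zero act_scalar[OF SX.quiver_rep_axioms] sc_def E.lsmult_closed)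
  qed
  show ?thesis
  proof (rule that[OF cocycle])
    assume "\<exists>H. lin_op H \<and> (\<forall>\<phi>\<in>SX. H \<phi> \<in> SY) \<and>
        (\<forall>x\<in>carrier kQ. \<forall>\<phi>\<in>SX. H (act \<nu>X TX x \<phi>) = D x \<phi> + act \<nu>Y TY x (H \<phi>))"
    then obtain H where H: "lin_op H" "\<And>\<phi>. \<phi> \<in> SX \<Longrightarrow> H \<phi> \<in> SY"
      and HD: "\<And>x \<phi>. x \<in> carrier kQ \<Longrightarrow> \<phi> \<in> SX \<Longrightarrow> H (act \<nu>X TX x \<phi>) = D x \<phi> + act \<nu>Y TY x (H \<phi>)"
      by auto
    define s where "s v = \<sigma> (\<Psi>X v) \<oplus>\<^bsub>E\<^esub> F (H (\<Psi>X v))" for v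
    have FH: "F (H (\<Psi>X v)) \<in> carrier E" if "v \<in> carrier X" for v using that Fc H(2) \<Psi>X_in by blast
    have "s \<in> lmod_hom ?R X E"
      unfolding lmod_hom_def
    proof (intro CollectI conjI ballI Pi_I)
      fix v assume v: "v \<in> carrier X"
      then show "s v \<in> carrier E" using \<sigma>c FH by (simp add: s_def)
      fix w assume w: "w \<in> carrier X"
      show "s (v \<oplus>\<^bsub>X\<^esub> w) = s v \<oplus>\<^bsub>E\<^esub> s w"
        using v w H \<Psi>X_in \<sigma>c FH
        by (simp add: s_def \<Psi>Xa lin_op_def \<sigma>_add Fadd E.M.add_interchange)
    next
      fix A v assume A: "A \<in> carrier ?R" and v: "v \<in> carrier X"
      obtain x where x: "x \<in> carrier kQ" "A = coset x" using A by (rule cosetE)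
      note c = \<sigma>c Fc[OF D_in[OF x(1) \<Psi>X_in[OF v]]] Fc[OF SY.sub_act[OF H(2)[OF \<Psi>X_in[OF v]]], of x]
      have "s (A \<odot>\<^bsub>X\<^esub> v) = \<sigma> (act \<nu>X TX x (\<Psi>X v)) \<oplus>\<^bsub>E\<^esub> F (D x (\<Psi>X v) + act \<nu>Y TY x (H (\<Psi>X v)))"
        using x v \<Psi>X_in by (simp add: s_def \<Psi>Xm HD)
      also have "\<dots> = (\<sigma> (act \<nu>X TX x (\<Psi>X v)) \<oplus>\<^bsub>E\<^esub> F (D x (\<Psi>X v))) \<oplus>\<^bsub>E\<^esub> F (act \<nu>Y TY x (H (\<Psi>X v)))"
        using x v \<Psi>X_in H(2) SY.sub_act D_in c by (simp add: Fadd E.M.a_assoc)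
      also have "\<dots> = A \<odot>\<^bsub>E\<^esub> s v"
        using x v \<Psi>X_in[OF v] H(2) FH \<sigma>c
        by (simp add: s_def E.lsmult_r_distr D Fsm)
      finally show "s (A \<odot>\<^bsub>X\<^esub> v) = A \<odot>\<^bsub>E\<^esub> s v" .
    qed
    moreover have "g (s v) = v" if v: "v \<in> carrier X" for v
    proof -
      have "g (s v) = JX (\<Psi>X v)"
        using v \<sigma>c FH gF[OF H(2)] g\<sigma> \<Psi>X_in JX(1) by (simp add: s_def lmod_hom_add[OF g])
      then show ?thesis using \<Psi>X_eqI[OF JX(1)[OF \<Psi>X_in[OF v]] v] JX(2)[OF \<Psi>X_in[OF v]] by simp
    qed
    ultimately show "\<exists>s\<in>lmod_hom ?R X E. \<forall>x\<in>carrier X. g (s x) = x" by blast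
  qed
qed

section \<open>Words and quasi-bands\<close>

lemma linv_linv [simp]: "linv (linv x) = x"
  by (cases x) auto

lemma lsrc_linv [simp]: "lsrc Q (linv x) = ltgt Q x"
  and ltgt_linv [simp]: "ltgt Q (linv x) = lsrc Q x"
  by (cases x; simp)+

lemma linv_eq_iff [simp]: "linv x = linv y \<longleftrightarrow> x = y"
  by (metis linv_linv)

lemma linv_eq_simps [simp]: "linv x = Arr a \<longleftrightarrow> x = Inv a" "linv x = Inv a \<longleftrightarrow> x = Arr a"
  "Arr a = linv x \<longleftrightarrow> x = Inv a" "Inv a = linv x \<longleftrightarrow> x = Arr a"
  by (cases x; auto)+

lemma linv_in_letters [simp]: "linv x \<in> letters Q \<longleftrightarrow> x \<in> letters Q"
  by (cases x) (auto simp: letters_def)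

lemma letters_simps [simp]: "Arr a \<in> letters Q \<longleftrightarrow> a \<in> arcs Q" "Inv a \<in> letters Q \<longleftrightarrow> a \<in> arcs Q"
  by (auto simp: letters_def)

lemma periodic_int:
  fixes f :: "int \<Rightarrow> 'x"
  assumes "\<And>i. f (i + p) = f i"
  shows "f (i + k * p) = f i"
proof (induction k rule: int_induct[of _ 0])
  case (step1 k)
  then show ?case using assms[of "i + k * p"] by (simp add: algebra_simps)
next
  case (step2 k)
  then show ?case using assms[of "i + (k - 1) * p"] by (simp add: algebra_simps)
qed simp

lemma nth_map_upto: "r < length [i..j] \<Longrightarrow> map f [i..j] ! r = f (i + int r)"
  by (simp add: nth_upto)

lemma map_upto_eq_iff:
  "map f [i..i + int (length xs) - 1] = xs \<longleftrightarrow> (\<forall>r<length xs. f (i + int r) = xs ! r)"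
proof -
  have "length [i..i + int (length xs) - 1] = length xs" by simp
  then show ?thesis
    unfolding list_eq_iff_nth_eq length_map by (simp add: nth_map_upto)
qed

lemma sublist_map_upto:
  assumes "sublist ys (map f [i..j])" "ys \<noteq> []"
  obtains p where "i \<le> p" "p + int (length ys) - 1 \<le> j" "ys = map f [p..p + int (length ys) - 1]"
proof -
  obtain ps ss where eq: "map f [i..j] = ps @ ys @ ss" using assms(1) by (auto simp: sublist_def)
  then have len: "nat (j - i + 1) = length ps + length ys + length ss"
    by (metis add.assoc length_append length_map length_upto)
  have "f (i + int (length ps) + int r) = ys ! r" if "r < length ys" for r
  proof -
    have "map f [i..j] ! (length ps + r) = ys ! r"
      using that by (simp add: eq nth_append)
    then show ?thesis
      using that len by (subst (asm) nth_map_upto) (simp_all add: algebra_simps)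
  qed
  then have "ys = map f [i + int (length ps)..i + int (length ps) + int (length ys) - 1]"
    using map_upto_eq_iff[of f "i + int (length ps)" ys] by simp
  moreover have "length ys > 0" using assms(2) by simp
  with len have "i + int (length ps) + int (length ys) - 1 \<le> j" by linarith
  ultimately show ?thesis
    by (intro that[of "i + int (length ps)"]) auto
qed

section \<open>Relations and the branching conditions of a string algebra\<close>

locale string_quiver = fixes Q :: "('v, 'a) pre_digraph" and I :: "('v, 'a, 'k::field) kpath set"
  assumes string_algebra: "string_algebra Q I"
begin

lemma fin_quiver: "fin_digraph Q"
  and ideal_I: "ideal I (path_algebra Q)"
  using string_algebra by (auto simp: string_algebra_def admissible_ideal_def)

sublocale quiver_quotient Q I
  by (rule quiver_quotient.intro[OF fin_quiver ideal_I])

lemma arcs_in_verts: "a \<in> arcs Q \<Longrightarrow> tail Q a \<in> verts Q" "a \<in> arcs Q \<Longrightarrow> head Q a \<in> verts Q"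
  using fin_quiver wf_digraph.tail_in_verts wf_digraph.head_in_verts
  by (auto simp: fin_digraph_def)

definition rel :: "'a list \<Rightarrow> bool" where
  "rel as \<longleftrightarrow> basis_path (Walk as) \<in> I"

lemma at_most_two_out:
  assumes "a \<in> arcs Q" "b \<in> arcs Q" "c \<in> arcs Q" "tail Q a = tail Q b" "tail Q b = tail Q c"
  shows "a = b \<or> b = c \<or> a = c"
proof (rule ccontr)
  assume *: "\<not> ?thesis"
  have "{a, b, c} \<subseteq> out_arcs Q (tail Q a)" using assms by auto
  then have "card {a, b, c} \<le> card (out_arcs Q (tail Q a))"
    using fin_digraph.finite_out_arcs[OF fin_quiver] by (rule card_mono[rotated])
  moreover have "card {a, b, c} = 3" using * by auto
  moreover have "out_degree Q (tail Q a) \<le> 2"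
    using string_algebra arcs_in_verts(1)[OF assms(1)] by (auto simp: string_algebra_def)
  ultimately show False by (simp add: out_degree_def)
qed

lemma at_most_two_in:
  assumes "a \<in> arcs Q" "b \<in> arcs Q" "c \<in> arcs Q" "head Q a = head Q b" "head Q b = head Q c"
  shows "a = b \<or> b = c \<or> a = c"
proof (rule ccontr)
  assume *: "\<not> ?thesis"
  have "{a, b, c} \<subseteq> in_arcs Q (head Q a)" using assms by auto
  then have "card {a, b, c} \<le> card (in_arcs Q (head Q a))"
    using fin_digraph.finite_in_arcs[OF fin_quiver] by (rule card_mono[rotated])
  moreover have "card {a, b, c} = 3" using * by auto
  moreover have "in_degree Q (head Q a) \<le> 2"
    using string_algebra arcs_in_verts(2)[OF assms(1)] by (auto simp: string_algebra_def)
  ultimately show False by (simp add: in_degree_def)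
qed

lemma unique_before:
  assumes "a \<in> arcs Q" "b \<in> arcs Q" "b' \<in> arcs Q" "tail Q a = head Q b" "tail Q a = head Q b'"
    and "\<not> rel [a, b]" "\<not> rel [a, b']"
  shows "b = b'"
proof -
  have "\<exists>\<^sub>\<le>\<^sub>1 b. b \<in> arcs Q \<and> tail Q a = head Q b \<and> basis_path (Walk [a, b]) \<notin> I"
    using string_algebra assms(1) by (auto simp: string_algebra_def)
  then show ?thesis using assms unfolding Uniq_def rel_def by blast
qed

lemma unique_after:
  assumes "b \<in> arcs Q" "a \<in> arcs Q" "a' \<in> arcs Q" "tail Q a = head Q b" "tail Q a' = head Q b"
    and "\<not> rel [a, b]" "\<not> rel [a', b]"
  shows "a = a'"
proof -
  have "\<exists>\<^sub>\<le>\<^sub>1 a. a \<in> arcs Q \<and> tail Q a = head Q b \<and> basis_path (Walk [a, b]) \<notin> I"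
    using string_algebra assms(1) by (auto simp: string_algebra_def)
  then show ?thesis using assms unfolding Uniq_def rel_def by blast
qed

end

text \<open>Pulls a position back along a path: the coefficient at j after the path has acted is the
  old coefficient at \<open>pre b as j\<close>, or 0 if there is none
  (\<open>foldr_band_op\<close>). Since coefficients rather than basis vectors are tracked, the
  moves are opposite to those in the definition of \<open>M(b)\<close>.\<close>

fun pre :: "(int \<Rightarrow> 'a letter) \<Rightarrow> 'a list \<Rightarrow> int \<Rightarrow> int option" where
  "pre b [] j = Some j"
| "pre b (a # as) j =
    (if b (j + 1) = Arr a then pre b as (j + 1) else if b j = Inv a then pre b as (j - 1) else None)"

lemma pre_append: "pre b (as @ bs) j = Option.bind (pre b as j) (pre b bs)"
  by (induction as arbitrary: j) auto

definition band_op :: "(int \<Rightarrow> 'a letter) \<Rightarrow> 'a \<Rightarrow> (int \<Rightarrow> 'k) \<Rightarrow> int \<Rightarrow> 'k::zero" where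
  "band_op b a \<phi> = (\<lambda>j. case pre b [a] j of None \<Rightarrow> 0 | Some i \<Rightarrow> \<phi> i)"

lemma band_op_apply:
  "band_op b a \<phi> j = (if b (j + 1) = Arr a then \<phi> (j + 1) else if b j = Inv a then \<phi> (j - 1) else 0)"
  by (simp add: band_op_def)

lemma foldr_band_op:
  "foldr (band_op b) as \<phi> j = (case pre b as j of None \<Rightarrow> 0 | Some i \<Rightarrow> \<phi> i)"
  by (induction as arbitrary: j) (auto simp: band_op_apply)

definition quasi_periodic :: "nat \<Rightarrow> 'k \<Rightarrow> (int \<Rightarrow> 'k::field) set" where
  "quasi_periodic m l = {\<phi>. \<forall>i. \<phi> (i + int m) = l * \<phi> i}"

lemma quasi_periodic_shift:
  assumes "\<phi> \<in> quasi_periodic m l" "l \<noteq> 0"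
  shows "\<phi> (i + k * int m) = l powi k * \<phi> i"
proof (induction k rule: int_induct[of _ 0])
  case (step1 k)
  have "\<phi> ((i + k * int m) + int m) = l * \<phi> (i + k * int m)"
    using assms by (simp add: quasi_periodic_def)
  then show ?case using step1 assms(2) by (simp add: algebra_simps power_int_add)
next
  case (step2 k)
  have "\<phi> ((i + (k - 1) * int m) + int m) = l * \<phi> (i + (k - 1) * int m)"
    using assms by (simp add: quasi_periodic_def)
  then have "l * \<phi> (i + (k - 1) * int m) = l powi k * \<phi> i" using step2 by (simp add: algebra_simps)
  then show ?case using assms(2) by (simp add: power_int_diff field_simps)
qed simp

lemma fun_sum_apply: "(\<Sum>i\<in>A. f i) x = (\<Sum>i\<in>A. f i x)"
  for f :: "'i \<Rightarrow> 'j \<Rightarrow> 'k::comm_monoid_add"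
  by (induction A rule: infinite_finite_induct) auto

section \<open>A single quasi-band and its space of quasi-periodic functions\<close>

locale quasi_band_alg = string_quiver Q I
  for Q :: "('v, 'a) pre_digraph" and I :: "('v, 'a, 'k::field) kpath set" +
  fixes b :: "int \<Rightarrow> 'a letter" and m :: nat
  assumes quasi_band: "quasi_band Q I (b, m)"
begin

lemma m_pos: "m > 0"
  using quasi_band by simp

lemma shift [simp]: "b (i + k * int m) = b i"
  using quasi_band by (intro periodic_int) simp

lemma cong: "int m dvd i - j \<Longrightarrow> b i = b j"
  using shift[of j] by (metis add.commute diff_add_cancel dvdE mult.commute)

lemma string: "is_string Q I (Walk (map b [i..i + int n]))"
  using quasi_band unfolding quasi_band.simps by blast

lemma letter: "b i \<in> letters Q"
  using string[of i 0] by simp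

lemma arr_in: "b i = Arr a \<Longrightarrow> a \<in> arcs Q" and inv_in: "b i = Inv a \<Longrightarrow> a \<in> arcs Q"
  using letter[of i] by auto

lemma composable: "lsrc Q (b i) = ltgt Q (b (i + 1))"
  and reduced: "b i \<noteq> linv (b (i + 1))"
proof -
  have "[i..i + 1] = [i, i + 1]" by (simp add: upto.simps)
  then show "lsrc Q (b i) = ltgt Q (b (i + 1))" "b i \<noteq> linv (b (i + 1))"
    using string[of i 1] by simp_all
qed

lemma reduced_Arr: "b i = Arr a \<Longrightarrow> b (i + 1) \<noteq> Inv a"
  and reduced_Inv: "b i = Inv a \<Longrightarrow> b (i + 1) \<noteq> Arr a"
  using reduced[of i] by auto

lemma segment_not_in:
  assumes "n > 0"
  shows "\<not> word_in I (map b [i..i + int n - 1]) \<and>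
    \<not> word_in I (map linv (rev (map b [i..i + int n - 1])))"
proof -
  have "i + int (n - 1) = i + int n - 1" using assms by simp
  then have "is_string Q I (Walk (map b [i..i + int n - 1]))" using string[of i "n - 1"] by metis
  then show ?thesis unfolding is_string.simps by blast
qed

lemma no_rel_Arr:
  assumes "as \<noteq> []" "\<And>r. r < length as \<Longrightarrow> b (i + int r) = Arr (as ! r)"
  shows "\<not> rel as"
proof
  assume rel: "rel as"
  have "map b [i..i + int (length as) - 1] = map Arr as"
    using map_upto_eq_iff[of b i "map Arr as"] assms by simp
  then have "word_in I (map b [i..i + int (length as) - 1])"
    using rel by (auto simp: word_in_def rel_def)
  then show False
    using segment_not_in[of "length as" i] assms(1) by simp
qed

lemma no_rel_Inv:
  assumes "as \<noteq> []" "\<And>r. r < length as \<Longrightarrow> b (i - int r) = Inv (as ! r)"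
  shows "\<not> rel as"
proof
  assume rel: "rel as"
  let ?i = "i - int (length as) + 1"
  have "b (?i + int r) = Inv (rev as ! r)" if "r < length as" for r
    using assms(2)[of "length as - 1 - r"] that by (simp add: rev_nth of_nat_diff algebra_simps)
  then have "map b [?i..?i + int (length as) - 1] = map Inv (rev as)"
    using map_upto_eq_iff[of b ?i "map Inv (rev as)"] by simp
  then have "map linv (rev (map b [?i..?i + int (length as) - 1])) = map Arr as"
    by (simp add: rev_map)
  then have "word_in I (map linv (rev (map b [?i..?i + int (length as) - 1])))"
    using rel by (auto simp: word_in_def rel_def)
  then show False
    using segment_not_in[of "length as" ?i] assms(1) by simp
qed

abbreviation vertex :: "int \<Rightarrow> 'v" where "vertex i \<equiv> lsrc Q (b i)"

lemma vertex_Arr: "b (i + 1) = Arr a \<Longrightarrow> vertex i = head Q a" "b i = Arr a \<Longrightarrow> vertex i = tail Q a"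
  and vertex_Inv: "b i = Inv a \<Longrightarrow> vertex i = head Q a" "b (i + 1) = Inv a \<Longrightarrow> vertex i = tail Q a"
  using composable[of i] by auto

lemma vertex_in: "vertex i \<in> verts Q"
  using letter[of i] arcs_in_verts by (cases "b i") auto

text \<open>A path cannot turn around inside b: having moved across a direct letter, it would need
  an inverse letter at the same place to move back, and vice versa. So a path that acts nontrivially
  is read off from a direct or from an inverse subword.\<close>

lemma pre_word:
  assumes "pre b as j = Some i"
  shows "i = j + int (length as) \<and> (\<forall>r<length as. b (j + 1 + int r) = Arr (as ! r)) \<or>
    i = j - int (length as) \<and> (\<forall>r<length as. b (j - int r) = Inv (as ! r))"
  using assms
proof (induction as arbitrary: j)
  case (Cons a as)
  have all: "(\<forall>r<length (a # as). P r) \<longleftrightarrow> P 0 \<and> (\<forall>r<length as. P (Suc r))" for P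
    using less_Suc_eq_0_disj by auto
  show ?case
  proof (cases "b (j + 1) = Arr a")
    case True
    with Cons.prems have "pre b as (j + 1) = Some i" by simp
    from Cons.IH[OF this] have "i = j + 1 + int (length as) \<and> (\<forall>r<length as. b (j + 1 + 1 + int r) = Arr (as ! r)) \<or>
        i = j + 1 - int (length as) \<and> (\<forall>r<length as. b (j + 1 - int r) = Inv (as ! r))" by simp
    moreover have "as = []" if "\<forall>r<length as. b (j + 1 - int r) = Inv (as ! r)"
      using that True by (cases as) auto
    ultimately show ?thesis unfolding all using True by (auto simp: algebra_simps)
  next
    case False
    with Cons.prems have inv: "b j = Inv a" "pre b as (j - 1) = Some i" by (auto split: if_splits)
    from Cons.IH[OF inv(2)] have "i = j - 1 + int (length as) \<and> (\<forall>r<length as. b (j - 1 + 1 + int r) = Arr (as ! r)) \<or>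
        i = j - 1 - int (length as) \<and> (\<forall>r<length as. b (j - 1 - int r) = Inv (as ! r))" by simp
    moreover have "as = []" if "\<forall>r<length as. b (j - 1 + 1 + int r) = Arr (as ! r)"
      using that inv by (cases as) auto
    ultimately show ?thesis unfolding all using inv by (auto simp: algebra_simps)
  qed
qed simp

text \<open>A nontrivial action would exhibit the relation or its inverse as a subword of the
  quasi-band.\<close>

lemma pre_rel: "rel as \<Longrightarrow> as \<noteq> [] \<Longrightarrow> pre b as j = None"
  using pre_word[of as j] no_rel_Arr[of as "j + 1"] no_rel_Inv[of as j]
  by (cases "pre b as j") auto

lemma band_op_lin: "lin_op (band_op b a)"
  by (auto simp: lin_op_def fun_eq_iff band_op_apply)

lemma quiver_rep: "quiver_rep Q vertex (band_op b :: 'a \<Rightarrow> (int \<Rightarrow> 'k) \<Rightarrow> int \<Rightarrow> 'k)"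
proof (rule quiver_rep.intro)
  show "fin_digraph Q" by (rule fin_quiver)
  show "vertex i \<in> verts Q" for i by (rule vertex_in)
  show "lin_op (band_op b a :: (int \<Rightarrow> 'k) \<Rightarrow> int \<Rightarrow> 'k)" for a by (rule band_op_lin)
  show "vertex i = head Q a" if "band_op b a \<phi> i \<noteq> (0::'k)" for a \<phi> i
    using that vertex_Arr(1) vertex_Inv(1) by (auto simp: band_op_apply split: if_splits)
  show "band_op b a \<phi> = 0" if *: "\<And>i. vertex i = tail Q a \<Longrightarrow> \<phi> i = (0::'k)" for a \<phi>
  proof -
    have "band_op b a \<phi> i = 0" for i
      using *[of "i + 1"] *[of "i - 1"] vertex_Arr(2)[of "i + 1" a] vertex_Inv(2)[of "i - 1" a]
      by (simp add: band_op_apply)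
    then show ?thesis by (simp add: fun_eq_iff)
  qed
qed

lemma quiver_subrep: "quiver_subrep Q vertex (band_op b) (quasi_periodic m (l :: 'k))"
proof (intro quiver_subrep.intro quiver_subrep_axioms.intro quiver_rep)
  have shift1: "b (i + int m) = b i" for i using shift[of i 1] by simp
  then have shift2: "b (i + int m + 1) = b (i + 1)" for i using shift1[of "i + 1"] by (simp add: algebra_simps)
  fix \<phi> :: "int \<Rightarrow> 'k" assume \<phi>: "\<phi> \<in> quasi_periodic m l"
  have e: "\<phi> (i + int m + 1) = l * \<phi> (i + 1)" "\<phi> (i + int m - 1) = l * \<phi> (i - 1)" for i
    using \<phi>[unfolded quasi_periodic_def, simplified, rule_format, of "i + 1"]
      \<phi>[unfolded quasi_periodic_def, simplified, rule_format, of "i - 1"]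
    by (simp_all add: algebra_simps)
  show "band_op b a \<phi> \<in> quasi_periodic m l" for a
    using e by (auto simp: quasi_periodic_def band_op_apply shift1 shift2)
  show "(\<lambda>i. if vertex i = u then \<phi> i else 0) \<in> quasi_periodic m l" for u
    using \<phi> by (auto simp: quasi_periodic_def shift1)
qed (auto simp: quasi_periodic_def algebra_simps)

text \<open>The image of \<open>e_i\<close> in \<open>M(b, m, l)\<close>: the quasi-periodic
  function with value 1 at i that vanishes off the residue class of i. The defining relation of the
  quotient becomes \<open>delta_shift\<close>, and the functions with 0 \<le> i < m form a
  basis.\<close>

definition delta :: "'k \<Rightarrow> int \<Rightarrow> int \<Rightarrow> 'k" where
  "delta l i j = (if int m dvd j - i then l powi ((j - i) div int m) else 0)"

lemma delta_in: "l \<noteq> 0 \<Longrightarrow> delta l i \<in> quasi_periodic m l"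
proof -
  assume l: "l \<noteq> 0"
  have "(j + int m - i) div int m = (j - i) div int m + 1" for j
    using m_pos div_add_self2[of "int m" "j - i"] by (simp add: algebra_simps)
  moreover have "int m dvd j + int m - i \<longleftrightarrow> int m dvd j - i" for j
    by (metis add_diff_eq add.commute dvd_add_triv_left_iff)
  ultimately show ?thesis using l by (auto simp: quasi_periodic_def delta_def power_int_add)
qed

lemma delta_self [simp]: "delta l i i = 1"
  by (simp add: delta_def)

lemma delta_basis:
  assumes \<phi>: "\<phi> \<in> quasi_periodic m l" and l: "l \<noteq> 0"
  shows "\<phi> = (\<Sum>i\<in>{0..<int m}. fscale (\<phi> i) (delta l i))"
proof
  fix j
  let ?r = "j mod int m"
  have r: "?r \<in> {0..<int m}" using m_pos by simp
  have dvd_iff: "int m dvd j - i \<longleftrightarrow> i = ?r" if "i \<in> {0..<int m}" for i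
    using that r by (auto simp: mod_eq_dvd_iff[symmetric])
  have "(\<Sum>i\<in>{0..<int m}. fscale (\<phi> i) (delta l i)) j = (\<Sum>i\<in>{0..<int m}. \<phi> i * delta l i j)"
    by (simp add: fun_sum_apply)
  also have "\<dots> = (\<Sum>i\<in>{0..<int m}. if i = ?r then \<phi> i * delta l i j else 0)"
    by (intro sum.cong) (auto simp: delta_def dvd_iff)
  also have "\<dots> = \<phi> ?r * delta l ?r j" using r by simp
  also have "\<dots> = l powi (j div int m) * \<phi> ?r"
  proof -
    have "j - ?r = (j div int m) * int m" by (simp add: minus_mod_eq_div_mult)
    then show ?thesis using m_pos by (simp add: delta_def)
  qed
  also have "\<dots> = \<phi> j"
    using quasi_periodic_shift[OF \<phi> l, of ?r "j div int m"] by (simp add: mod_div_mult_eq)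
  finally show "\<phi> j = (\<Sum>i\<in>{0..<int m}. fscale (\<phi> i) (delta l i)) j" ..
qed

lemma delta_graded: "path_act vertex (band_op b) (Triv (vertex i)) (delta l i) = delta l i"
proof
  fix j
  show "path_act vertex (band_op b) (Triv (vertex i)) (delta l i) j = delta l i j"
    by (cases "int m dvd j - i") (simp_all add: cong[of j i] delta_def)
qed

lemma delta_shift:
  "l \<noteq> 0 \<Longrightarrow> delta l i = fscale l (delta l (i + int m))"
proof -
  assume l: "l \<noteq> 0"
  have "(j - (i + int m)) div int m = (j - i) div int m - 1" for j
    using m_pos div_add_self2[of "int m" "j - i - int m"] by (simp add: algebra_simps)
  moreover have "int m dvd j - (i + int m) \<longleftrightarrow> int m dvd j - i" for j
    using dvd_add_triv_left_iff[of "int m" "j - (i + int m)"] by (simp add: algebra_simps)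
  ultimately show ?thesis using l by (auto simp: fun_eq_iff delta_def power_int_diff)
qed

text \<open>The counterpart of \<open>pre\<close> on basis vectors: the position to which the arrow
  moves \<open>e_i\<close>. Reducedness of b prevents both tests from succeeding at once.\<close>

fun post :: "'a \<Rightarrow> int \<Rightarrow> int option" where
  "post a i = (if b (i + 1) = Inv a then Some (i + 1) else if b i = Arr a then Some (i - 1) else None)"

lemma band_op_delta:
  "band_op b a (delta l i) = (case post a i of None \<Rightarrow> 0 | Some i' \<Rightarrow> delta l i')"
proof
  fix j
  have c: "b (j + 1) = b i" if "int m dvd j - (i - 1)" using cong[of "j + 1" i] that by (simp add: algebra_simps)
  have c': "b j = b (i + 1)" if "int m dvd j - (i + 1)" using cong[of j "i + 1"] that by simp
  have d: "delta l i (j + 1) = delta l (i - 1) j" "delta l i (j - 1) = delta l (i + 1) j"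
    by (simp_all add: delta_def algebra_simps)
  have z: "delta l (i - 1) j = 0" if "b (j + 1) \<noteq> b i" using c that by (auto simp: delta_def)
  have z': "delta l (i + 1) j = 0" if "b j \<noteq> b (i + 1)" using c' that by (auto simp: delta_def)
  show "band_op b a (delta l i) j = (case post a i of None \<Rightarrow> 0 | Some i' \<Rightarrow> delta l i') j"
    using z z' reduced_Arr[of i a] reduced_Inv[of j a] by (auto simp: band_op_apply d)
qed

end

section \<open>Coordinates of band modules\<close>

context quiver_quotient
begin

lemma coords_iso:
  assumes h: "h \<in> lmod_iso (string_alg Q I) M N" and co: "coords \<nu> T S N \<Psi>"
    and zero: "\<zero>\<^bsub>M\<^esub> \<in> carrier M" "\<zero>\<^bsub>M\<^esub> \<oplus>\<^bsub>M\<^esub> \<zero>\<^bsub>M\<^esub> = \<zero>\<^bsub>M\<^esub>"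
    and add: "\<And>v w. v \<in> carrier M \<Longrightarrow> w \<in> carrier M \<Longrightarrow> v \<oplus>\<^bsub>M\<^esub> w \<in> carrier M"
    and smult: "\<And>A v. A \<in> carrier (string_alg Q I) \<Longrightarrow> v \<in> carrier M \<Longrightarrow> A \<odot>\<^bsub>M\<^esub> v \<in> carrier M"
  shows "coords \<nu> T S M (\<Psi> \<circ> h)"
proof -
  have hom: "h \<in> lmod_hom (string_alg Q I) M N" and bij: "bij_betw h (carrier M) (carrier N)"
    using h by (auto simp: lmod_iso_def)
  note hc = lmod_hom_closed[OF hom]
  have h0: "h \<zero>\<^bsub>M\<^esub> \<oplus>\<^bsub>N\<^esub> h \<zero>\<^bsub>M\<^esub> = h \<zero>\<^bsub>M\<^esub>"
    using lmod_hom_add[OF hom zero(1) zero(1)] by (simp only: zero(2))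
  have "\<Psi> (h \<zero>\<^bsub>M\<^esub> \<oplus>\<^bsub>N\<^esub> h \<zero>\<^bsub>M\<^esub>) = \<Psi> (h \<zero>\<^bsub>M\<^esub>) + \<Psi> (h \<zero>\<^bsub>M\<^esub>)"
    using co hc[OF zero(1)] unfolding coords_def by blast
  then have "\<Psi> (h \<zero>\<^bsub>M\<^esub>) = 0" unfolding h0 by (simp add: fun_eq_iff)
  then show ?thesis
    using co bij_betw_trans[OF bij, of \<Psi> S] zero(1)
    by (auto simp: coords_def add smult lmod_hom_add[OF hom] lmod_hom_smult[OF hom] hc)
qed

lemma coords_imp_iso:
  assumes M: "coords \<nu> T S M \<Psi>" and N: "coords \<nu> T S N \<Psi>'"
  shows "lmod_iso (string_alg Q I) M N \<noteq> {}"
proof -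
  have bM: "bij_betw \<Psi> (carrier M) S" and bN: "bij_betw \<Psi>' (carrier N) S"
    using M N by (auto simp: coords_def)
  define h where "h = inv_into (carrier N) \<Psi>' \<circ> \<Psi>"
  have bij: "bij_betw h (carrier M) (carrier N)"
    unfolding h_def by (rule bij_betw_trans[OF bM bij_betw_inv_into[OF bN]])
  have hc: "h v \<in> carrier N" "\<Psi>' (h v) = \<Psi> v" if "v \<in> carrier M" for v
    using that bM bN bij unfolding h_def bij_betw_def by (auto intro: f_inv_into_f)
  have eqI: "v = w" if "v \<in> carrier N" "w \<in> carrier N" "\<Psi>' v = \<Psi>' w" for v w
    using that bN by (auto simp: bij_betw_def inj_on_def)
  have "h (v \<oplus>\<^bsub>M\<^esub> w) = h v \<oplus>\<^bsub>N\<^esub> h w" if "v \<in> carrier M" "w \<in> carrier M" for v w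
    using that M N hc by (intro eqI) (auto simp: coords_def)
  moreover have "h (A \<odot>\<^bsub>M\<^esub> v) = A \<odot>\<^bsub>N\<^esub> h v"
    if A: "A \<in> carrier (string_alg Q I)" and v: "v \<in> carrier M" for A v
  proof -
    obtain x where "x \<in> carrier kQ" "A = coset x" using A by (rule cosetE)
    then show ?thesis using v M N hc by (intro eqI) (auto simp: coords_def)
  qed
  ultimately have "h \<in> lmod_iso (string_alg Q I) M N"
    using bij hc by (auto simp: lmod_iso_def lmod_hom_def)
  then show ?thesis by blast
qed

end

section \<open>Reduction of the ideal to relations of positive length\<close>

context string_quiver
begin

text \<open>I lies in the arrow ideal, which annihilates the one-dimensional representation at u
  with all arrows zero, whereas \<open>1_u\<close> acts there as the identity. The lemma excludes
  trivial paths from the generating set of I, which is only known to consist of paths.\<close>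

lemma Triv_notin_ideal:
  assumes u: "u \<in> verts Q"
  shows "basis_path (Triv u) \<notin> I"
proof
  assume mem: "basis_path (Triv u) \<in> I"
  let ?T = "\<lambda>(a::'a) (\<phi>::unit \<Rightarrow> 'k). (0 :: unit \<Rightarrow> 'k)"
  interpret S: quiver_subrep Q "\<lambda>_. u" ?T UNIV
    by (intro quiver_subrep.intro quiver_rep.intro quiver_subrep_axioms.intro fin_quiver u)
      (auto simp: lin_op_def fun_eq_iff)
  have gen: "(\<lambda>a. basis_path (Walk [a])) ` arcs Q \<subseteq> carrier kQ"
    by (auto simp: basis_path_def)
  then have arrow: "ideal (arrow_ideal Q) kQ"
    unfolding arrow_ideal_def by (rule I.genideal_ideal)
  have "I \<subseteq> ideal_power kQ (arrow_ideal Q) 2"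
    using string_algebra by (auto simp: string_algebra_def admissible_ideal_def)
  also have "\<dots> = ideal_prod kQ (ideal_prod kQ (carrier kQ) (arrow_ideal Q)) (arrow_ideal Q)"
    by (simp add: ideal_power_def numeral_2_eq_2)
  also have "\<dots> \<subseteq> arrow_ideal Q"
    using I.ideal_prod_inter[OF I.ideal_prod_is_ideal[OF I.oneideal arrow] arrow] by blast
  finally have "basis_path (Triv u) \<in> genideal kQ (basis_path ` (\<lambda>a. Walk [a]) ` arcs Q)"
    using mem by (auto simp: arrow_ideal_def image_image)
  then have "act (\<lambda>_. u) ?T (basis_path (Triv u)) 1 = 0"
    by (rule S.genideal_acts_zero[OF I.ring_axioms, rotated 2]) auto
  then show False by (simp add: basis_path_def act_single fun_eq_iff)
qed

lemma ideal_acts_zero: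
  assumes sub: "quiver_subrep Q \<nu> T S"
    and zero: "\<And>as \<phi>. rel as \<Longrightarrow> is_path Q (Walk as) \<Longrightarrow> \<phi> \<in> S \<Longrightarrow> foldr T as \<phi> = 0"
    and x: "x \<in> I" and \<phi>: "\<phi> \<in> S"
  shows "act \<nu> T x \<phi> = 0"
proof -
  interpret quiver_subrep Q \<nu> T S by (rule sub)
  obtain P where P: "P \<subseteq> {p. is_path Q p}" "I = genideal kQ (basis_path ` P)"
    using string_algebra by (auto simp: string_algebra_def)
  have "basis_path ` P \<subseteq> carrier kQ" using P(1) by (auto simp: basis_path_def)
  then have "basis_path ` P \<subseteq> I" unfolding P(2) by (rule I.genideal_self)
  show ?thesis
  proof (rule genideal_acts_zero[OF I.ring_axioms P(1) _ x[unfolded P(2)] \<phi>])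
    fix p \<psi> assume p: "p \<in> P" and \<psi>: "\<psi> \<in> S"
    then have path: "is_path Q p" and pI: "basis_path p \<in> I" using P(1) \<open>basis_path ` P \<subseteq> I\<close> by auto
    show "path_act \<nu> T p \<psi> = 0"
    proof (cases p)
      case (Triv u)
      then show ?thesis using Triv_notin_ideal[of u] path pI by simp
    next
      case (Walk as)
      then show ?thesis using zero[of as \<psi>] path pI \<psi> by (simp add: rel_def)
    qed
  qed
qed

end

section \<open>The modules M(b, m, l) in coordinates\<close>

context quasi_band_alg
begin

lemma ideal_kills: "x \<in> I \<Longrightarrow> act vertex (band_op b) x \<phi> = 0"
proof -
  assume x: "x \<in> I"
  have sub: "quiver_subrep Q vertex (band_op b) (UNIV :: (int \<Rightarrow> 'k) set)"
    by (intro quiver_subrep.intro quiver_subrep_axioms.intro quiver_rep) auto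
  show ?thesis
    by (rule ideal_acts_zero[OF sub _ x]) (auto simp: fun_eq_iff foldr_band_op pre_rel)
qed

text \<open>The assumptions make the assignment of \<open>e i\<close> to the basis vector i
  compatible with arrows and vertices, hence its linear extension is compatible with all paths. It
  is applied to unit vectors, which identifies \<open>band_action\<close> with the action on
  functions, and to \<open>delta l\<close>, which gives the projection to the quotient.\<close>

lemma lsum_band_path:
  fixes e :: "int \<Rightarrow> int \<Rightarrow> 'k"
  assumes arrow: "\<And>a i. band_op b a (e i) = (case post a i of None \<Rightarrow> 0 | Some i' \<Rightarrow> e i')"
    and triv: "\<And>u i. path_act vertex (band_op b) (Triv u) (e i) = (if vertex i = u then e i else 0)"
  shows "(\<lambda>j. lsum (band_path Q b p v) (\<lambda>i. e i j)) = path_act vertex (band_op b) p (\<lambda>j. lsum v (\<lambda>i. e i j))"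
proof (cases p)
  case (Triv u)
  have "lsum (if u = lsrc Q (b i) then Poly_Mapping.single i 1 else 0) (\<lambda>i. e i j) =
      path_act vertex (band_op b) (Triv u) (e i) j" for i j
    unfolding triv by auto
  then show ?thesis
    unfolding Triv band_path.simps lsum_lin_ext
    using lin_op_lsum[OF quiver_rep.path_act_lin[OF quiver_rep, of "Triv u"], of v e] by simp
next
  case (Walk as)
  have single: "lsum (band_arrow b a i) (\<lambda>i. e i j) = band_op b a (e i) j" for a i j
    unfolding arrow by (auto simp: band_arrow_def)
  have "(\<lambda>j. lsum (foldr (\<lambda>a. lin_ext (band_arrow b a)) as v) (\<lambda>i. e i j)) =
      foldr (band_op b) as (\<lambda>j. lsum v (\<lambda>i. e i j))"
  proof (induction as)
    case (Cons a as)
    show ?case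
      using lin_op_lsum[OF band_op_lin, of a _ e]
      by (simp add: lsum_lin_ext single Cons.IH[symmetric])
  qed simp
  then show ?thesis using Walk by simp
qed

lemma lsum_band_action:
  fixes e :: "int \<Rightarrow> int \<Rightarrow> 'k"
  assumes "\<And>a i. band_op b a (e i) = (case post a i of None \<Rightarrow> 0 | Some i' \<Rightarrow> e i')"
    and "\<And>u i. path_act vertex (band_op b) (Triv u) (e i) = (if vertex i = u then e i else 0)"
  shows "(\<lambda>j. lsum (band_action Q b x v) (\<lambda>i. e i j)) = act vertex (band_op b) x (\<lambda>j. lsum v (\<lambda>i. e i j))"
  using lsum_band_path[OF assms, of _ v]
  by (simp add: band_action_def lsum_lin_ext act_def fun_eq_iff)

lemma lookup_band_action:
  "Poly_Mapping.lookup (band_action Q b x v) =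
    act vertex (band_op b) x (Poly_Mapping.lookup v :: int \<Rightarrow> 'k)"
proof -
  let ?e = "\<lambda>i j. if i = j then 1 else 0 :: 'k"
  have eq: "Poly_Mapping.lookup w = (\<lambda>j. lsum w (\<lambda>i. ?e i j))" for w :: "int \<Rightarrow>\<^sub>0 'k"
    by (auto simp: fun_eq_iff lsum_def in_keys_iff if_distrib cong: if_cong)
  have arrow: "band_op b a (?e i) = (case post a i of None \<Rightarrow> 0 | Some i' \<Rightarrow> ?e i')" for a i
    using reduced_Arr[of i a] by (auto simp: fun_eq_iff band_op_apply dest: reduced_Inv)
  have triv: "path_act vertex (band_op b) (Triv u) (?e i) = (if vertex i = u then ?e i else 0)" for u i
    by (auto simp: fun_eq_iff)
  show ?thesis
    unfolding eq by (rule lsum_band_action[OF arrow triv])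
qed

definition proj :: "'k \<Rightarrow> (int \<Rightarrow>\<^sub>0 'k) \<Rightarrow> int \<Rightarrow> 'k" where
  "proj l v = (\<lambda>j. lsum v (\<lambda>i. delta l i j))"

lemma proj_add: "proj l (v + w) = proj l v + proj l w"
  by (simp add: proj_def fun_eq_iff lsum_add)

lemma proj_pscale: "proj l (pscale c v) = fscale c (proj l v)"
  by (simp add: proj_def fun_eq_iff lsum_pscale)

lemma proj_diff: "proj l (v - w) = proj l v - proj l w"
proof -
  have "proj l v = proj l (v - w) + proj l w"
    by (simp only: proj_add[symmetric] diff_add_cancel)
  then show ?thesis by (simp only: add_diff_cancel_right')
qed

lemma proj_single: "proj l (Poly_Mapping.single i c) = fscale c (delta l i)"
  by (simp add: proj_def fun_eq_iff)

lemma proj_in: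
  assumes "l \<noteq> 0"
  shows "proj l v \<in> quasi_periodic m l"
  using delta_in[OF assms] by (simp add: quasi_periodic_def proj_def lsum_scale_fun)

lemma proj_band_action:
  "proj l (band_action Q b x v) = act vertex (band_op b) x (proj l v)"
proof -
  have "path_act vertex (band_op b) (Triv u) (delta l i) = (if vertex i = u then delta l i else 0)" for u i
  proof (cases "vertex i = u")
    case True
    then show ?thesis using delta_graded[where l = l] by auto
  next
    case False
    then show ?thesis using cong by (auto simp: fun_eq_iff delta_def)
  qed
  then show ?thesis
    unfolding proj_def by (rule lsum_band_action[OF band_op_delta])
qed

text \<open>I annihilates \<open>M(b)\<close>, so all representatives of a coset act alike and
  \<open>the_elem\<close> is applied to a singleton.\<close>

lemma band_module_smult:
  assumes x: "x \<in> carrier kQ"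
  shows "coset x \<odot>\<^bsub>band_module Q b\<^esub> v = band_action Q b x v"
proof -
  have eq: "band_action Q b y v = band_action Q b x v" if y: "y \<in> coset x" for y
  proof -
    obtain z where z: "z \<in> I" "y = z + x" using coset_elem[OF x y] by blast
    have "act vertex (band_op b) y \<phi> = act vertex (band_op b) x \<phi>" for \<phi> :: "int \<Rightarrow> 'k"
      unfolding z(2) act_add_left ideal_kills[OF z(1)] by simp
    then show ?thesis by (intro poly_mapping_eqI) (simp add: lookup_band_action)
  qed
  have "(\<lambda>y. band_action Q b y v) ` coset x = (\<lambda>_. band_action Q b x v) ` coset x"
    by (rule image_cong[OF refl eq])
  also have "\<dots> = {band_action Q b x v}"
    using coset_self[OF x] by blast
  finally have "(\<lambda>y. band_action Q b y v) ` coset x = {band_action Q b x v}" .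
  then show ?thesis by (simp add: band_module_def)
qed

sublocale P: Modules.module "pscale :: 'k \<Rightarrow> (int \<Rightarrow>\<^sub>0 'k) \<Rightarrow> (int \<Rightarrow>\<^sub>0 'k)"
  by unfold_locales (simp_all add: pscale_add_left pscale_add_right pscale_pscale)

definition rels :: "'k \<Rightarrow> (int \<Rightarrow>\<^sub>0 'k) set" where
  "rels l = {Poly_Mapping.single i 1 - pscale l (Poly_Mapping.single (i + int m) 1) | i. True}"

lemma single_shift_in_span:
  assumes l: "l \<noteq> 0"
  shows "Poly_Mapping.single i 1 - pscale (l powi k) (Poly_Mapping.single (i + k * int m) 1) \<in> P.span (rels l)"
proof (induction k rule: int_induct[of _ 0])
  case base
  then show ?case by (simp add: P.span_zero)
next
  case (step1 k)
  let ?s = "\<lambda>i. Poly_Mapping.single i (1::'k)"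
  have "pscale (l powi k) (?s (i + k * int m) - pscale l (?s (i + k * int m + int m))) \<in> P.span (rels l)"
    by (intro P.span_scale P.span_base) (auto simp: rels_def)
  from P.span_add[OF step1(2) this] show ?case
    using l by (simp add: P.scale_right_diff_distrib pscale_pscale algebra_simps power_int_add)
next
  case (step2 k)
  let ?s = "\<lambda>i. Poly_Mapping.single i (1::'k)"
  let ?j = "i + (k - 1) * int m"
  have j: "?j + int m = i + k * int m" by (simp add: algebra_simps)
  have "?s ?j - pscale l (?s (?j + int m)) \<in> rels l" unfolding rels_def by blast
  then have "pscale (l powi (k - 1)) (?s ?j - pscale l (?s (?j + int m))) \<in> P.span (rels l)"
    by (intro P.span_scale P.span_base)
  then have "pscale (l powi (k - 1)) (?s ?j) - pscale (l powi k) (?s (i + k * int m)) \<in> P.span (rels l)"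
    unfolding j using l by (simp add: P.scale_right_diff_distrib pscale_pscale power_int_diff)
  from P.span_diff[OF step2(2) this] show ?case by simp
qed

text \<open>The relations are killed by \<open>delta_shift\<close>. Conversely \<open>nf\<close>
  moves each basis vector, modulo the relations, to its representative with index in
  \<open>{0..<m}\<close>; since \<open>nf\<close> is computed from the projection alone, a vector
  with zero projection has normal form 0.\<close>

lemma span_rels:
  assumes l: "l \<noteq> 0"
  shows "v \<in> P.span (rels l) \<longleftrightarrow> proj l v = 0"
proof
  assume "v \<in> P.span (rels l)"
  then show "proj l v = 0"
  proof (induction rule: P.span_induct)
    case base
    show ?case
      by (auto intro!: P.subspaceI simp: proj_add proj_pscale) (simp add: proj_def fun_eq_iff)
  next
    case (step x)
    then obtain i where x: "x = Poly_Mapping.single i 1 + pscale (-l) (Poly_Mapping.single (i + int m) 1)"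
      by (auto simp: rels_def pscale_single single_uminus)
    show ?case
      unfolding x proj_add proj_pscale proj_single delta_shift[OF l, of i] by (simp add: fun_eq_iff)
  qed
next
  assume *: "proj l v = 0"
  define nf where "nf w = (\<Sum>r\<in>{0..<int m}. Poly_Mapping.single r (proj l w r))" for w
  have "Poly_Mapping.keys v \<subseteq> UNIV" by simp
  then have "v - nf v \<in> P.span (rels l)"
  proof (induction rule: poly_mapping_span_induct)
    case zero
    then show ?case by (simp add: nf_def proj_def P.span_zero)
  next
    case (add x y)
    have "x + y - nf (x + y) = (x - nf x) + (y - nf y)"
      by (simp add: nf_def proj_add single_add sum.distrib)
    then show ?case using P.span_add[OF add(3,4)] by (simp only:)
  next
    case (single c i)
    let ?r = "i mod int m"
    have r: "?r \<in> {0..<int m}" using m_pos by simp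
    have "nf (Poly_Mapping.single i c) = (\<Sum>r\<in>{0..<int m}. if r = ?r then Poly_Mapping.single r (c * delta l i r) else 0)"
      unfolding nf_def proj_single using r
      by (intro sum.cong) (auto simp: delta_def mod_eq_dvd_iff[symmetric])
    also have "\<dots> = Poly_Mapping.single ?r (c * delta l i ?r)" using r by simp
    also have "delta l i ?r = l powi (- (i div int m))"
    proof -
      have "?r - i = (- (i div int m)) * int m" by (simp add: minus_div_mult_eq_mod[symmetric])
      then show ?thesis using m_pos by (simp add: delta_def del: mult_minus_left)
    qed
    finally have nf: "nf (Poly_Mapping.single i c) =
        pscale c (pscale (l powi (- (i div int m))) (Poly_Mapping.single (i + (- (i div int m)) * int m) 1))"
      by (simp add: pscale_single minus_div_mult_eq_mod)
    have eq: "Poly_Mapping.single i c - nf (Poly_Mapping.single i c) =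
        pscale c (Poly_Mapping.single i 1 -
          pscale (l powi (- (i div int m))) (Poly_Mapping.single (i + (- (i div int m)) * int m) 1))"
      unfolding nf P.scale_right_diff_distrib by (simp add: pscale_single)
    show ?case unfolding eq by (rule P.span_scale[OF single_shift_in_span[OF l]])
  qed
  moreover have "nf v = 0" using * by (simp add: nf_def)
  ultimately show "v \<in> P.span (rels l)" by simp
qed

text \<open>By \<open>span_rels\<close> the cosets forming the quotient are the fibres of
  \<open>proj\<close>, so each is named by the quasi-periodic function over which it lies.\<close>

lemma coords_band_module_quot:
  assumes l: "l \<noteq> 0"
  shows "\<exists>\<Psi>. coords vertex (band_op b) (quasi_periodic m l) (band_module_quot Q b m l) \<Psi>"
proof -
  let ?B = "band_module Q b" and ?N = "P.span (rels l)"
  let ?M = "band_module_quot Q b m l"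
  define fib where "fib \<phi> = {w. proj l w = \<phi>}" for \<phi>
  have M: "?M = lmod_quot ?B ?N" by (simp add: band_module_quot_def rels_def)
  have coset_N: "?N +>\<^bsub>?B\<^esub> v = fib (proj l v)" for v
  proof -
    have "?N +>\<^bsub>?B\<^esub> v = {n + v | n. n \<in> ?N}" by (auto simp: a_r_coset_def' band_module_def)
    also have "\<dots> = fib (proj l v)"
    proof (intro equalityI subsetI)
      fix w assume "w \<in> fib (proj l v)"
      then have "proj l (w - v) = 0" by (simp add: fib_def proj_diff)
      then have "w - v \<in> ?N" using span_rels[OF l] by blast
      moreover have "w = (w - v) + v" by simp
      ultimately show "w \<in> {n + v | n. n \<in> ?N}" by blast
    qed (auto simp: fib_def proj_add span_rels[OF l])
    finally show ?thesis .
  qed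
  have surj: "\<exists>v. proj l v = \<phi>" if "\<phi> \<in> quasi_periodic m l" for \<phi>
  proof -
    have "proj l (\<Sum>r\<in>{0..<int m}. Poly_Mapping.single r (\<phi> r)) = (\<Sum>r\<in>{0..<int m}. fscale (\<phi> r) (delta l r))"
      by (simp add: fun_eq_iff proj_def lsum_sum fun_sum_apply)
    then show ?thesis using delta_basis[OF that l] by metis
  qed
  have carrier: "carrier ?M = fib ` quasi_periodic m l"
  proof -
    have "carrier ?M = (\<lambda>v. fib (proj l v)) ` UNIV"
      by (auto simp: M lmod_quot_def A_RCOSETS_def' coset_N) (auto simp: band_module_def)
    also have "\<dots> = fib ` quasi_periodic m l" using surj proj_in[OF l] by force
    finally show ?thesis .
  qed
  define \<Psi> where "\<Psi> X = proj l (SOME w. w \<in> X)" for X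
  have \<Psi>: "\<Psi> (fib \<phi>) = \<phi>" if "\<phi> \<in> quasi_periodic m l" for \<phi>
    using surj[OF that] someI_ex[of "\<lambda>w. w \<in> fib \<phi>"] unfolding \<Psi>_def by (auto simp: fib_def)
  have sub: "quiver_subrep Q vertex (band_op b) (quasi_periodic m l)" by (rule quiver_subrep)
  note in_sub = quiver_subrep.sub_zero[OF sub] quiver_subrep.sub_add[OF sub] quiver_subrep.sub_act[OF sub]
  have zero: "\<zero>\<^bsub>?M\<^esub> = fib 0"
    using span_rels[OF l] by (auto simp: M lmod_quot_def fib_def)
  have add: "fib \<phi> \<oplus>\<^bsub>?M\<^esub> fib \<psi> = fib (\<phi> + \<psi>)"
    if \<phi>: "\<phi> \<in> quasi_periodic m l" for \<phi> \<psi>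
  proof -
    have "fib \<phi> \<oplus>\<^bsub>?M\<^esub> fib \<psi> = {v + w | v w. v \<in> fib \<phi> \<and> w \<in> fib \<psi>}"
      by (auto simp: M lmod_quot_def set_add_def' band_module_def)
    also have "\<dots> = fib (\<phi> + \<psi>)"
    proof (intro equalityI subsetI)
      fix u assume u: "u \<in> fib (\<phi> + \<psi>)"
      obtain v where v: "proj l v = \<phi>" using surj[OF \<phi>] by blast
      have "u - v \<in> fib \<psi>" using u v by (simp add: fib_def proj_diff)
      moreover have "u = v + (u - v)" by simp
      moreover have "v \<in> fib \<phi>" using v by (simp add: fib_def)
      ultimately show "u \<in> {v + w | v w. v \<in> fib \<phi> \<and> w \<in> fib \<psi>}" by blast
    qed (auto simp: fib_def proj_add)
    finally show ?thesis .
  qed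
  have smult: "coset x \<odot>\<^bsub>?M\<^esub> fib \<phi> = fib (act vertex (band_op b) x \<phi>)"
    if "\<phi> \<in> quasi_periodic m l" "x \<in> carrier kQ" for x \<phi>
  proof -
    have "coset x \<odot>\<^bsub>?M\<^esub> fib \<phi> = (\<Union>v\<in>fib \<phi>. fib (act vertex (band_op b) x (proj l v)))"
      using that(2) by (simp add: M lmod_quot_def coset_N band_module_smult proj_band_action)
    also have "\<dots> = fib (act vertex (band_op b) x \<phi>)"
      using surj[OF that(1)] by (auto simp: fib_def)
    finally show ?thesis .
  qed
  have "bij_betw \<Psi> (carrier ?M) (quasi_periodic m l)"
    unfolding carrier by (rule bij_betwI[of _ _ _ fib]) (auto simp: \<Psi>)
  then have "coords vertex (band_op b) (quasi_periodic m l) ?M \<Psi>"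
    unfolding coords_def carrier by (auto simp: zero add smult \<Psi> in_sub)
  then show ?thesis by blast
qed

lemma family_coords:
  assumes "\<rho> \<in> band_family Q I b m"
  obtains l \<Psi> where "l \<noteq> 0" "coords vertex (band_op b) (quasi_periodic m l) (point_module m \<rho>) \<Psi>"
proof -
  obtain l h where l: "l \<noteq> 0" and h: "h \<in> lmod_iso (string_alg Q I) (point_module m \<rho>) (band_module_quot Q b m l)"
    and \<rho>: "\<rho> \<in> mod_variety (string_alg Q I) m"
    using assms by (auto simp: band_family_def)
  obtain \<Psi> where \<Psi>: "coords vertex (band_op b) (quasi_periodic m l) (band_module_quot Q b m l) \<Psi>"
    using coords_band_module_quot[OF l] by blast
  have "\<rho> A \<in> carrier_mat m m" if "A \<in> carrier (string_alg Q I)" for A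
    using \<rho> that ring_hom_closed[of \<rho> "string_alg Q I" "ring_mat TYPE('k) m ()" A]
    by (simp add: mod_variety_def ring_mat_simps)
  then have "coords vertex (band_op b) (quasi_periodic m l) (point_module m \<rho>) (\<Psi> \<circ> h)"
    by (intro coords_iso[OF h \<Psi>]) (auto simp: point_module_def intro: mult_mat_vec_carrier)
  then show ?thesis using that l by blast
qed

lemma quasi_periodic_eqI:
  fixes l :: 'k
  assumes "\<phi> \<in> quasi_periodic m l" "\<psi> \<in> quasi_periodic m l" "l \<noteq> 0"
    and "\<And>r. r < m \<Longrightarrow> \<phi> (int r) = \<psi> (int r)"
  shows "\<phi> = \<psi>"
proof -
  have "(\<Sum>i\<in>{0..<int m}. fscale (\<phi> i) (delta l i)) = (\<Sum>i\<in>{0..<int m}. fscale (\<psi> i) (delta l i))"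
  proof (rule sum.cong[OF refl])
    fix i assume "i \<in> {0..<int m}"
    then show "fscale (\<phi> i) (delta l i) = fscale (\<psi> i) (delta l i)"
      using assms(4)[of "nat i"] by (simp add: nat_less_iff)
  qed
  then show ?thesis
    using delta_basis[OF assms(1,3)] delta_basis[OF assms(2,3)] by simp
qed

lemma sum_nat_int: "(\<Sum>i\<in>{0..<int m}. F i) = (\<Sum>r = 0..<m. F (int r))"
  by (rule sum.reindex_bij_witness[of _ int nat]) auto

lemma act_expand:
  assumes "\<phi> \<in> quasi_periodic m l" "l \<noteq> 0"
  shows "act vertex (band_op b) x \<phi> j = (\<Sum>r = 0..<m. \<phi> (int r) * act vertex (band_op b) x (delta l (int r)) j)"
proof -
  let ?A = "act vertex (band_op b) x :: (int \<Rightarrow> 'k) \<Rightarrow> _"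
  have lin: "lin_op ?A" by (rule quiver_rep.act_lin[OF quiver_rep])
  have "?A (\<Sum>i\<in>A. fscale (\<phi> i) (delta l i)) = (\<Sum>i\<in>A. fscale (\<phi> i) (?A (delta l i)))" if "finite A" for A
    using that
  proof (induction A rule: finite_induct)
    case empty
    show ?case unfolding sum.empty by (rule lin_op_zero[OF lin])
  next
    case (insert i A)
    show ?case
      unfolding sum.insert[OF insert(1,2)] lin_op_add[OF lin] lin_op_scale[OF lin] insert(3) ..
  qed
  from this[of "{0..<int m}"] have "?A \<phi> = (\<Sum>i\<in>{0..<int m}. fscale (\<phi> i) (?A (delta l i)))"
    using delta_basis[OF assms] by simp
  then have "?A \<phi> j = (\<Sum>i\<in>{0..<int m}. \<phi> i * ?A (delta l i) j)"
    by (simp add: fun_sum_apply)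
  then show ?thesis by (simp only: sum_nat_int)
qed

text \<open>The action is written in matrices with respect to
  \<open>delta l 0, ..., delta l (m - 1)\<close>. These functions are dual to evaluation at 0, ...,
  m - 1, so the entry (r, s) is the value at r of x applied to \<open>delta l s\<close>.\<close>

lemma family_exists:
  assumes l: "l \<noteq> 0"
  obtains \<rho> \<Psi> where "\<rho> \<in> band_family Q I b m"
    "coords vertex (band_op b) (quasi_periodic m l) (point_module m \<rho>) \<Psi>"
proof -
  let ?R = "string_alg Q I"
  define A where "A x = (act vertex (band_op b) x :: (int \<Rightarrow> 'k) \<Rightarrow> _)" for x
  define mt where "mt x = mat m m (\<lambda>(r, s). A x (delta l (int s)) (int r))" for x
  define \<rho> where "\<rho> = restrict (\<lambda>X. mt (SOME x. x \<in> X)) (carrier ?R)"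
  have mt_cong: "mt y = mt x" if x: "x \<in> carrier kQ" and y: "y \<in> coset x" for x y
  proof -
    obtain z where z: "z \<in> I" "y = z + x" using coset_elem[OF x y] by blast
    have "A y = A x"
      unfolding A_def z(2) by (rule ext) (simp only: act_add_left ideal_kills[OF z(1)] add_0_left)
    then show ?thesis by (simp add: mt_def)
  qed
  have \<rho>: "\<rho> (coset x) = mt x" if x: "x \<in> carrier kQ" for x
  proof -
    have "(SOME y. y \<in> coset x) \<in> coset x" using coset_self[OF x] by (rule someI)
    then show ?thesis using mt_cong[OF x] x by (simp add: \<rho>_def)
  qed
  note sub = quiver_subrep[of l]
  have A_in: "A x \<phi> \<in> quasi_periodic m l" if "\<phi> \<in> quasi_periodic m l" for x \<phi>
    unfolding A_def using quiver_subrep.sub_act[OF sub that] .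
  have "\<rho> \<in> mod_variety ?R m"
    unfolding mod_variety_def
  proof (intro CollectI conjI IntI allI ballI)
    show "\<rho> \<in> extensional (carrier ?R)" by (simp add: \<rho>_def)
    show "\<rho> \<in> Ring.ring_hom ?R (ring_mat TYPE('k) m ())"
    proof (rule ring_hom_memI)
      fix X assume "X \<in> carrier ?R"
      then obtain x where x: "x \<in> carrier kQ" "X = coset x" by (rule cosetE)
      then show "\<rho> X \<in> carrier (ring_mat TYPE('k) m ())"
        by (simp add: \<rho> mt_def ring_mat_simps)
      fix Y assume "Y \<in> carrier ?R"
      then obtain y where y: "y \<in> carrier kQ" "Y = coset y" by (rule cosetE)
      have "A (mult kQ x y) (delta l (int s)) (int r) =
          (\<Sum>t = 0..<m. A y (delta l (int s)) (int t) * A x (delta l (int t)) (int r))" for r s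
        unfolding A_def quiver_rep.act_mult[OF quiver_rep x(1) y(1)]
        by (rule act_expand[OF _ l]) (rule quiver_subrep.sub_act[OF sub delta_in[OF l]])
      then have "mt (mult kQ x y) = mt x * mt y"
        by (intro eq_matI) (auto simp: mt_def scalar_prod_def mult.commute intro!: sum.cong)
      then show "\<rho> (X \<otimes>\<^bsub>?R\<^esub> Y) = \<rho> X \<otimes>\<^bsub>ring_mat TYPE('k) m ()\<^esub> \<rho> Y"
        using x y I.m_closed[OF x(1) y(1)] by (simp add: coset_mult \<rho> ring_mat_simps)
      have "mt (x + y) = mt x + mt y"
        by (intro eq_matI) (auto simp: mt_def A_def act_add_left)
      then show "\<rho> (X \<oplus>\<^bsub>?R\<^esub> Y) = \<rho> X \<oplus>\<^bsub>ring_mat TYPE('k) m ()\<^esub> \<rho> Y"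
        using x y by (simp add: coset_add \<rho> ring_mat_simps path_algebra_add_closed)
    next
      have d: "delta l (int s) (int r) = (if r = s then 1 else 0)" if "r < m" "s < m" for r s
      proof -
        have "int m dvd int r - int s \<longleftrightarrow> r = s"
          using that by (auto simp: mod_eq_dvd_iff[symmetric])
        then show ?thesis by (auto simp: delta_def)
      qed
      have "mt (one kQ) = 1\<^sub>m m"
        by (intro eq_matI) (auto simp: mt_def A_def quiver_rep.act_one[OF quiver_rep] d)
      then show "\<rho> \<one>\<^bsub>?R\<^esub> = \<one>\<^bsub>ring_mat TYPE('k) m ()\<^esub>"
        using I.one_closed by (simp add: coset_one \<rho> ring_mat_simps)
    qed
    fix c X assume "X \<in> carrier ?R"
    then obtain x where x: "x \<in> carrier kQ" "X = coset x" by (rule cosetE)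
    have "mt (pscale c x) = c \<cdot>\<^sub>m mt x"
      by (intro eq_matI) (auto simp: mt_def A_def act_pscale)
    then show "\<rho> (c \<odot>\<^bsub>?R\<^esub> X) = c \<cdot>\<^sub>m \<rho> X"
      using x path_algebra_pscale_closed[OF x(1), of c] by (simp add: coset_smult \<rho>)
  qed
  moreover
  define \<Psi> where "\<Psi> v = (\<lambda>j. \<Sum>r = 0..<m. v $ r * delta l (int r) j)" for v
  have dQ: "delta l i (j + int m) = l * delta l i j" for i j
    using delta_in[OF l, of i] by (simp add: quasi_periodic_def)
  have \<Psi>_in: "\<Psi> v \<in> quasi_periodic m l" for v
    by (auto simp: quasi_periodic_def \<Psi>_def dQ sum_distrib_left mult_ac intro!: sum.cong)
  have \<Psi>_r: "\<Psi> v (int r) = v $ r" if r: "r < m" for v r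
  proof -
    have "\<Psi> v (int r) = (\<Sum>s = 0..<m. if s = r then v $ s else 0)"
      unfolding \<Psi>_def
    proof (intro sum.cong refl)
      fix s assume "s \<in> {0..<m}"
      then have "int m dvd int r - int s \<longleftrightarrow> s = r"
        using r by (auto simp: mod_eq_dvd_iff[symmetric])
      then show "v $ s * delta l (int s) (int r) = (if s = r then v $ s else 0)"
        by (auto simp: delta_def)
    qed
    then show ?thesis using r by simp
  qed
  have "bij_betw \<Psi> (carrier_vec m) (quasi_periodic m l)"
  proof (rule bij_betwI[of _ _ _ "\<lambda>\<phi>. vec m (\<lambda>r. \<phi> (int r))"])
    show "vec m (\<lambda>r. \<Psi> v (int r)) = v" if "v \<in> carrier_vec m" for v
      using that by (intro eq_vecI) (auto simp: \<Psi>_r)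
    show "\<Psi> (vec m (\<lambda>r. \<phi> (int r))) = \<phi>" if "\<phi> \<in> quasi_periodic m l" for \<phi>
      by (rule quasi_periodic_eqI[OF \<Psi>_in that l]) (simp add: \<Psi>_r)
  qed (auto simp: \<Psi>_in)
  moreover have "\<Psi> (mt x *\<^sub>v v) = A x (\<Psi> v)" if v: "v \<in> carrier_vec m" for x v
  proof (rule quasi_periodic_eqI[OF \<Psi>_in A_in[OF \<Psi>_in] l])
    fix r assume r: "r < m"
    have "A x (\<Psi> v) (int r) = (\<Sum>t = 0..<m. \<Psi> v (int t) * A x (delta l (int t)) (int r))"
      unfolding A_def by (rule act_expand[OF \<Psi>_in l])
    also have "\<dots> = (mt x *\<^sub>v v) $ r"
      using r v by (auto simp: mt_def \<Psi>_r scalar_prod_def mult.commute intro!: sum.cong)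
    finally show "\<Psi> (mt x *\<^sub>v v) (int r) = A x (\<Psi> v) (int r)"
      using r by (simp add: \<Psi>_r mt_def)
  qed
  moreover have "\<Psi> (v + w) = \<Psi> v + \<Psi> w" if "v \<in> carrier_vec m" "w \<in> carrier_vec m" for v w
    using that by (auto simp: \<Psi>_def fun_eq_iff distrib_right sum.distrib[symmetric] intro!: sum.cong)
  moreover have "\<Psi> (0\<^sub>v m) = 0" by (auto simp: \<Psi>_def fun_eq_iff)
  moreover have "mt x *\<^sub>v v \<in> carrier_vec m" for x v by (rule carrier_vecI) (simp add: mt_def)
  ultimately have co: "coords vertex (band_op b) (quasi_periodic m l) (point_module m \<rho>) \<Psi>"
    unfolding coords_def point_module_def by (simp add: \<rho> A_def[symmetric])
  obtain \<Psi>' where "coords vertex (band_op b) (quasi_periodic m l) (band_module_quot Q b m l) \<Psi>'"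
    using coords_band_module_quot[OF l] by blast
  then have "lmod_iso ?R (point_module m \<rho>) (band_module_quot Q b m l) \<noteq> {}"
    by (rule coords_imp_iso[OF co])
  with \<open>\<rho> \<in> mod_variety ?R m\<close> have "\<rho> \<in> band_family Q I b m"
    using l by (auto simp: band_family_def)
  then show ?thesis using that co by blast
qed

end

section \<open>Extendable pairs\<close>

context string_quiver
begin

text \<open>A finite subword is again a segment of b, so the string condition splits into conditions
  on neighbouring letters and on occurrences of relations, read forwards in direct letters or
  backwards in inverse ones.\<close>

lemma quasi_bandI:
  assumes m: "m \<ge> 1" and period: "\<And>i. b (i + int m) = b i" and letter: "\<And>i. b i \<in> letters Q"
    and comp: "\<And>i. lsrc Q (b i) = ltgt Q (b (i + 1))" and red: "\<And>i. b i \<noteq> linv (b (i + 1))"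
    and Arr: "\<And>as i. as \<noteq> [] \<Longrightarrow> (\<And>r. r < length as \<Longrightarrow> b (i + int r) = Arr (as ! r)) \<Longrightarrow> \<not> rel as"
    and Inv: "\<And>as i. as \<noteq> [] \<Longrightarrow> (\<And>r. r < length as \<Longrightarrow> b (i - int r) = Inv (as ! r)) \<Longrightarrow> \<not> rel as"
  shows "quasi_band Q I (b, m)"
proof -
  have "is_string Q I (Walk (map b [i..i + int n]))" for i n
  proof -
    have "successively (\<lambda>x y. lsrc Q x = ltgt Q y \<and> x \<noteq> linv y) (map b [i..i + int n])"
    proof -
      have "lsrc Q (b (i + int r)) = ltgt Q (b (i + int (Suc r))) \<and> b (i + int r) \<noteq> linv (b (i + int (Suc r)))" for r
        using comp[of "i + int r"] red[of "i + int r"] by (simp add: add.assoc add.commute[of 1])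
      then show ?thesis
        unfolding successively_conv_nth by (simp add: nth_upto del: of_nat_Suc)
    qed
    moreover have "\<not> word_in I ys \<and> \<not> word_in I (map linv (rev ys))"
      if ys: "ys \<noteq> []" "sublist ys (map b [i..i + int n])" for ys
    proof -
      obtain p where p: "ys = map b [p..p + int (length ys) - 1]"
        using sublist_map_upto[OF ys(2,1)] by metis
      have nth: "b (p + int r) = ys ! r" if "r < length ys" for r
        using map_upto_eq_iff[of b p ys] p that by metis
      have "\<not> word_in I ys"
      proof
        assume "word_in I ys"
        then obtain as where as: "ys = map Arr as" "rel as" by (auto simp: word_in_def rel_def)
        then show False using Arr[of as p] nth ys(1) by simp
      qed
      moreover have "\<not> word_in I (map linv (rev ys))"
      proof
        assume "word_in I (map linv (rev ys))"
        then obtain as where as: "map linv (rev ys) = map Arr as" "rel as" by (auto simp: word_in_def rel_def)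
        have len: "length as = length ys" using arg_cong[OF as(1), of length] by simp
        have "b (p + int (length ys) - 1 - int r) = Inv (as ! r)" if r: "r < length as" for r
        proof -
          have "linv (ys ! (length ys - 1 - r)) = Arr (as ! r)"
            using arg_cong[OF as(1), of "\<lambda>xs. xs ! r"] r len by (simp add: rev_nth)
          moreover have "b (p + int (length ys - 1 - r)) = ys ! (length ys - 1 - r)"
            by (rule nth) (use r len in simp)
          moreover have e: "p + int (length ys - 1 - r) = p + int (length ys) - 1 - int r"
            using r len by simp
          ultimately show ?thesis unfolding e by simp
        qed
        moreover have "as \<noteq> []" using ys(1) len by auto
        ultimately show False using Inv[of as "p + int (length ys) - 1"] as(2) by blast
      qed
      ultimately show ?thesis by blast
    qed
    moreover have "set (map b [i..i + int n]) \<subseteq> letters Q" "map b [i..i + int n] \<noteq> []"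
      using letter by auto
    ultimately show ?thesis unfolding is_string.simps by blast
  qed
  then show ?thesis using m period unfolding quasi_band.simps by (simp del: is_string.simps)
qed

lemma quasi_band_shift:
  assumes "quasi_band Q I (b, m)"
  shows "quasi_band Q I (\<lambda>j. b (k + j), m)"
proof -
  interpret B: quasi_band_alg Q I b m by unfold_locales (rule assms)
  show ?thesis
  proof (rule quasi_bandI)
    show "b (k + (i + int m)) = b (k + i)" for i using B.shift[of "k + i" 1] by (simp add: algebra_simps)
    show "\<not> rel as" if "as \<noteq> []" "\<And>r. r < length as \<Longrightarrow> b (k + (i + int r)) = Arr (as ! r)" for as i
      using that by (intro B.no_rel_Arr[of as "k + i"]) (auto simp: algebra_simps)
    show "\<not> rel as" if "as \<noteq> []" "\<And>r. r < length as \<Longrightarrow> b (k + (i - int r)) = Inv (as ! r)" for as i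
      using that by (intro B.no_rel_Inv[of as "k + i"]) (auto simp: algebra_simps)
  qed (use B.m_pos B.letter B.composable[of "k + _"] B.reduced[of "k + _"] in \<open>auto simp: add.assoc\<close>)
qed

lemma quasi_band_inverse:
  assumes "quasi_band Q I (b, m)"
  shows "quasi_band Q I (\<lambda>j. linv (b (k - j)), m)"
proof -
  interpret B: quasi_band_alg Q I b m by unfold_locales (rule assms)
  have k: "k - (i + 1) + 1 = k - i" for i by simp
  show ?thesis
  proof (rule quasi_bandI)
    show "linv (b (k - (i + int m))) = linv (b (k - i))" for i
      using B.shift[of "k - i" "-1"] by (simp add: algebra_simps)
    show "lsrc Q (linv (b (k - i))) = ltgt Q (linv (b (k - (i + 1))))" for i
      using B.composable[of "k - (i + 1)"] unfolding k by simp
    show "linv (b (k - i)) \<noteq> linv (linv (b (k - (i + 1))))" for i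
      using B.reduced[of "k - (i + 1)"] unfolding k by auto
    show "\<not> rel as" if "as \<noteq> []" "\<And>r. r < length as \<Longrightarrow> linv (b (k - (i + int r))) = Arr (as ! r)" for as i
      using that by (intro B.no_rel_Inv[of as "k - i"]) (auto simp: algebra_simps)
    show "\<not> rel as" if "as \<noteq> []" "\<And>r. r < length as \<Longrightarrow> linv (b (k - (i - int r))) = Inv (as ! r)" for as i
      using that by (intro B.no_rel_Arr[of as "k - i"]) (auto simp: algebra_simps)
  qed (use B.m_pos B.letter in auto)
qed

lemma band_shift:
  assumes "band Q I (b, m)"
  shows "band Q I (\<lambda>j. b (k + j), m)"
  unfolding band.simps
proof (intro conjI allI impI)
  show "quasi_band Q I (\<lambda>j. b (k + j), m)"
    using assms quasi_band_shift by (simp only: band.simps)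
  fix m' assume m': "0 < m' \<and> m' < m"
  show "\<not> quasi_band Q I (\<lambda>j. b (k + j), m')"
  proof
    assume "quasi_band Q I (\<lambda>j. b (k + j), m')"
    from quasi_band_shift[OF this, of "- k"] have "quasi_band Q I (b, m')"
      by (simp only: add_minus_cancel)
    then show False using assms m' by (simp only: band.simps)
  qed
qed

lemma band_inverse:
  assumes "band Q I (b, m)"
  shows "band Q I (\<lambda>j. linv (b (k - j)), m)"
  unfolding band.simps
proof (intro conjI allI impI)
  show "quasi_band Q I (\<lambda>j. linv (b (k - j)), m)"
    using assms quasi_band_inverse by (simp only: band.simps)
  fix m' assume m': "0 < m' \<and> m' < m"
  show "\<not> quasi_band Q I (\<lambda>j. linv (b (k - j)), m')"
  proof
    have eq: "k - (k - j) = j" for j by simp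
    assume "quasi_band Q I (\<lambda>j. linv (b (k - j)), m')"
    from quasi_band_inverse[OF this, of k] have "quasi_band Q I (b, m')"
      by (simp only: eq linv_linv)
    then show False using assms m' by (simp only: band.simps)
  qed
qed

lemma shift_in_class:
  assumes "quasi_band Q I (b, m)"
  shows "(\<lambda>j. b (k + j), m) \<in> qband_class Q I (b, m)"
proof -
  have "\<forall>j. b j = b (k + (-k + j))" by simp
  then show ?thesis
    using assms quasi_band_shift[OF assms, of k] unfolding qband_class_def qband_rel_def by blast
qed

lemma inverse_in_class:
  assumes "quasi_band Q I (b, m)"
  shows "(\<lambda>j. linv (b (k - j)), m) \<in> qband_class Q I (b, m)"
proof -
  have "\<forall>j. b j = linv (linv (b (k - (k - j))))" by simp
  then show ?thesis
    using assms quasi_band_inverse[OF assms, of k] unfolding qband_class_def qband_rel_def by blast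
qed

lemma in_classE:
  assumes "(b', m') \<in> qband_class Q I (b, m)"
  obtains (shift) k where "m' = m" "b' = (\<lambda>j. b (k + j))"
  | (inverse) k where "m' = m" "b' = (\<lambda>j. linv (b (k - j)))"
proof -
  obtain i where m: "m' = m" and i: "(\<forall>j. b j = b' (i + j)) \<or> (\<forall>j. b j = linv (b' (i - j)))"
    using assms by (auto simp: qband_class_def qband_rel_def)
  from i show ?thesis
  proof
    assume *: "\<forall>j. b j = b' (i + j)"
    have "b' j = b (- i + j)" for j using *[rule_format, of "- i + j"] by simp
    then show ?thesis using m shift[of "-i"] by blast
  next
    assume *: "\<forall>j. b j = linv (b' (i - j))"
    have "b' j = linv (b (i - j))" for j using *[rule_format, of "i - j"] by simp
    then show ?thesis using m inverse[of i] by blast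
  qed
qed

end

section \<open>From concatenated walks to letters of periodic words\<close>

fun walk_letters :: "('v, 'l) walk \<Rightarrow> 'l list" where
  "walk_letters (Triv u) = []"
| "walk_letters (Walk xs) = xs"

lemma walk_letters_append: "walk_letters (walk_append p q) = walk_letters p @ walk_letters q"
  by (cases "(p, q)" rule: walk_append.cases) auto

lemma walk_letters_concat:
  "walk_concat s t ps = Some p \<Longrightarrow> walk_letters p = concat (map walk_letters ps)"
proof (induction s t ps arbitrary: p rule: walk_concat.induct)
  case (3 s t p q ps)
  then show ?case
    by (auto simp: walk_comp_def walk_letters_append split: if_splits bind_splits)
qed auto

text \<open>Extracts the vertex condition between w and the letter behind it; for a trivial w this
  is all that ties w to the two bands.\<close>

lemma walk_concat_src:
  assumes "walk_concat s t (p # Walk [x] # ps) = Some r"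
  shows "walk_src s p = t x"
proof -
  obtain r' where r': "walk_concat s t (Walk [x] # ps) = Some r'" "walk_src s p = walk_tgt t r'"
    using assms by (auto simp: walk_comp_def split: if_splits bind_splits)
  have "walk_tgt t r' = t x"
  proof (cases ps)
    case (Cons q qs)
    then obtain r0 where "r' = walk_append (Walk [x]) r0"
      using r'(1) by (auto simp: walk_comp_def split: if_splits bind_splits)
    then show ?thesis by (cases r0) auto
  qed (use r'(1) in auto)
  then show ?thesis using r'(2) by simp
qed

definition word_prefix :: "('v, 'a) pre_digraph \<Rightarrow> (int \<Rightarrow> 'a letter) \<Rightarrow> nat \<Rightarrow> ('v, 'a letter) walk" where
  "word_prefix Q b l = (if l = 0 then Triv (lsrc Q (b 0)) else Walk (map b [1..int l]))"

text \<open>The part of extendability that concerns the common word, here of length l. By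
  periodicity the last letters of \<open>(b, sm)\<close> and \<open>(c, tn)\<close> are
  \<open>b 0\<close> and \<open>c 0\<close>, so the numbers s, t and the strings u, v no longer
  appear. For l = 0 the vertex condition is what remains of w.\<close>

definition overlap :: "('v, 'a) pre_digraph \<Rightarrow> (int \<Rightarrow> 'a letter) \<Rightarrow> (int \<Rightarrow> 'a letter) \<Rightarrow> nat \<Rightarrow> bool" where
  "overlap Q b c l \<longleftrightarrow> (\<exists>\<alpha>. b 0 = Inv \<alpha>) \<and> (\<exists>\<beta>. b (int l + 1) = Arr \<beta>) \<and>
     (\<exists>\<gamma>. c 0 = Arr \<gamma>) \<and> (\<exists>\<delta>. c (int l + 1) = Inv \<delta>) \<and>
     lsrc Q (b 0) = lsrc Q (c 0) \<and> (\<forall>i\<in>{1..int l}. b i = c i)"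

lemma (in quasi_band_alg) segment_string:
  assumes "i \<le> j"
  shows "is_string Q I (Walk (map b [i..j]))"
proof -
  have "i + int (nat (j - i)) = j" using assms by simp
  then show ?thesis using string[of i "nat (j - i)"] by metis
qed

text \<open>The bound on N leaves at least one letter between \<open>b (l + 1)\<close> and
  \<open>b N\<close>, so that the third factor is a genuine nontrivial walk.\<close>

lemma (in quasi_band_alg) walk_concat_prefix:
  assumes N: "N \<ge> int l + 3"
  shows "walk_concat (lsrc Q) (ltgt Q)
      [word_prefix Q b l, Walk [b (int l + 1)], Walk (map b [int l + 2..N - 1]), Walk [b N]] =
    Some (Walk (map b [1..N]))"
proof -
  have last: "last (map f [i..j]) = f j" if "i \<le> j" for f :: "int \<Rightarrow> 'x" and i j
    using upto_rec2[OF that] by simp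
  have hd: "hd (map f [i..j]) = f i" if "i \<le> j" for f :: "int \<Rightarrow> 'x" and i j
    using upto_rec1[OF that] by simp
  have s1: "lsrc Q (last (map b [int l + 2..N - 1])) = ltgt Q (b N)"
    using composable[of "N - 1"] N by (simp add: last del: map_eq_conv)
  have s2: "lsrc Q (b (int l + 1)) = ltgt Q (hd (map b [int l + 2..N - 1] @ [b N]))"
    using composable[of "int l + 1"] N by (simp add: hd hd_append add.commute del: map_eq_conv)
  have s3: "walk_src (lsrc Q) (word_prefix Q b l) = ltgt Q (b (int l + 1))"
    using composable[of "int l"] by (auto simp: word_prefix_def last)
  have split: "map b [1..N] = map b [1..int l] @ b (int l + 1) # map b [int l + 2..N - 1] @ [b N]"
  proof -
    have "[1..N] = [1..int l] @ [int l + 1..N]" using N by (intro upto_split1[of _ "int l + 1", simplified]) auto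
    also have "[int l + 1..N] = (int l + 1) # [int l + 2..N - 1] @ [N]"
      using N upto_rec1[of "int l + 1" N] upto_rec2[of "int l + 2" N] by (simp add: add.assoc)
    finally show ?thesis by simp
  qed
  show ?thesis
    using s1 s2 s3 unfolding split
    by (cases "l = 0") (simp_all add: walk_comp_def word_prefix_def)
qed

section \<open>The periodic word cb and its two seams\<close>

locale quasi_band_pair = B: quasi_band_alg Q I b m + C: quasi_band_alg Q I c n
  for Q :: "('v, 'a) pre_digraph" and I :: "('v, 'a, 'k::field) kpath set"
    and b c :: "int \<Rightarrow> 'a letter" and m n :: nat
begin

abbreviation concat_word :: "int \<Rightarrow> 'a letter" where
  "concat_word \<equiv> fst (word_qband (map c [1..int n] @ map b [1..int m]))"

lemma concat_word_period: "concat_word (i + k * int (m + n)) = concat_word i"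
proof -
  have "(i + k * int (m + n) - 1) mod int (n + m) = (i - 1) mod int (n + m)"
    using mod_mult_self1[of "i - 1" k "int (n + m)"] by (simp add: algebra_simps)
  then show ?thesis by (simp add: word_qband_def)
qed

lemma concat_word_left: "1 \<le> i \<Longrightarrow> i \<le> int n \<Longrightarrow> concat_word i = c i"
  by (simp add: word_qband_def mod_pos_pos_trivial nth_append nth_upto nat_less_iff)

lemma concat_word_right:
  assumes "1 \<le> i" "i \<le> int m"
  shows "concat_word (int n + i) = b i"
proof -
  have "nat (int n + i - 1) = n + nat (i - 1)" using assms by simp
  then show ?thesis using assms by (simp add: word_qband_def mod_pos_pos_trivial nth_append nth_upto)
qed

lemma concat_word_next: "1 \<le> i \<Longrightarrow> i \<le> int n \<Longrightarrow> concat_word (int n + int m + i) = c i"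
  using concat_word_period[of i 1] concat_word_left[of i] by (simp add: algebra_simps)

lemma word_qband_eq: "word_qband (map c [1..int n] @ map b [1..int m]) = (concat_word, m + n)"
  by (simp add: word_qband_def)

text \<open>\<open>cb\<close> can only fail to be a quasi-band because of a relation that crosses one of the two
  seams between \<open>c\<close> and \<open>b\<close> and contains the whole common word.\<close>

definition bad_direct :: "nat \<Rightarrow> bool" where
  "bad_direct l \<longleftrightarrow> (\<exists>as p q. B.rel as \<and> length as = p + q \<and> p \<ge> 1 \<and> q \<ge> l + 1 \<and>
     (\<forall>r<p. c (int r - int p + 1) = Arr (as ! r)) \<and> (\<forall>r<q. b (int r + 1) = Arr (as ! (p + r))))"

text \<open>This is the seam from b to c. The relation is met there in inverse letters and hence
  backwards: it starts at position q of c, runs down to position 1 and continues in b from position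
  0.\<close>

definition bad_inverse :: "nat \<Rightarrow> bool" where
  "bad_inverse l \<longleftrightarrow> (\<exists>as p q. B.rel as \<and> length as = q + p \<and> p \<ge> 1 \<and> q \<ge> l + 1 \<and>
     (\<forall>r<q. c (int q - int r) = Inv (as ! r)) \<and> (\<forall>r<p. b (- int r) = Inv (as ! (q + r))))"

text \<open>The bad relation has to fit into one copy of c and one copy of b next to the seam. It
  does: direct letters cannot pass the inverse letter of \<alpha> in b or of \<delta> in c, inverse
  letters cannot pass \<gamma> in c or \<beta> in b, and each of these letters recurs with the
  period of its band.\<close>

lemma concat_quasi_band_imp:
  assumes ov: "overlap Q b c l" and qb: "quasi_band Q I (concat_word, m + n)"
  shows "\<not> bad_direct l" "\<not> bad_inverse l"
proof -
  interpret D: quasi_band_alg Q I concat_word "m + n" by unfold_locales (rule qb)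
  obtain \<alpha> \<beta> \<gamma> \<delta> where ends: "b 0 = Inv \<alpha>" "b (int l + 1) = Arr \<beta>" "c 0 = Arr \<gamma>" "c (int l + 1) = Inv \<delta>"
    using ov by (auto simp: overlap_def)
  have bm: "b (int m) = Inv \<alpha>" using B.shift[of 0 1] ends by simp
  have cn: "c (int n) = Arr \<gamma>" using C.shift[of 0 1] ends by simp
  show "\<not> bad_direct l"
  proof
    assume "bad_direct l"
    then obtain as p q where as: "B.rel as" "length as = p + q" "p \<ge> 1" "q \<ge> l + 1"
      and p: "\<And>r. r < p \<Longrightarrow> c (int r - int p + 1) = Arr (as ! r)"
      and q: "\<And>r. r < q \<Longrightarrow> b (int r + 1) = Arr (as ! (p + r))"
      by (auto simp: bad_direct_def)
    have "q < m"
    proof (rule ccontr)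
      assume "\<not> q < m"
      then have "b (int m) = Arr (as ! (p + (m - 1)))"
        using q[of "m - 1"] B.m_pos by (simp add: of_nat_diff)
      then show False using bm by simp
    qed
    moreover have "p \<le> n"
    proof (rule ccontr)
      assume "\<not> p \<le> n"
      \<comment> \<open>\<open>k - n\<close> is congruent to l + 1 modulo n and lies in the last
        period of c before the seam, so the inverse letter of \<delta> stands there.\<close>
      define k where "k = (int l + 1) mod int n"
      have k: "0 \<le> k" "k < int n" using C.m_pos by (simp_all add: k_def)
      have "(k - int n) - (int l + 1) = int n * (- 1 - (int l + 1) div int n)"
        unfolding k_def minus_mult_div_eq_mod[symmetric] by (simp add: algebra_simps)
      then have "int n dvd (k - int n) - (int l + 1)" by (rule dvdI)
      then have "c (k - int n) = Inv \<delta>" using C.cong[of "k - int n" "int l + 1"] ends(4) by simp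
      moreover have "c (k - int n) = Arr (as ! nat (k - int n + int p - 1))"
        using p[of "nat (k - int n + int p - 1)"] k \<open>\<not> p \<le> n\<close> by simp
      ultimately show False by simp
    qed
    ultimately have pq: "p \<le> n" "q \<le> m" by auto
    have "concat_word (int n - int p + 1 + int r) = Arr (as ! r)" if r: "r < length as" for r
    proof (cases "r < p")
      case True
      have "c (int n - int p + 1 + int r) = c (int r - int p + 1)"
        using C.shift[of "int r - int p + 1" 1] by (simp add: algebra_simps)
      then show ?thesis using True pq p[OF True] by (subst concat_word_left) auto
    next
      case False
      then have "int n - int p + 1 + int r = int n + (int (r - p) + 1)" by simp
      then have "concat_word (int n - int p + 1 + int r) = concat_word (int n + (int (r - p) + 1))"
        by (simp only:)
      also have "\<dots> = b (int (r - p) + 1)"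
        by (rule concat_word_right) (use False r as(2) pq in auto)
      also have "\<dots> = Arr (as ! r)" using q[of "r - p"] False r as(2) by auto
      finally show ?thesis .
    qed
    then have "\<not> B.rel as" using as by (intro D.no_rel_Arr[of as "int n - int p + 1"]) auto
    then show False using as(1) by blast
  qed
  show "\<not> bad_inverse l"
  proof
    assume "bad_inverse l"
    then obtain as p q where as: "B.rel as" "length as = q + p" "p \<ge> 1" "q \<ge> l + 1"
      and q: "\<And>r. r < q \<Longrightarrow> c (int q - int r) = Inv (as ! r)"
      and p: "\<And>r. r < p \<Longrightarrow> b (- int r) = Inv (as ! (q + r))"
      by (auto simp: bad_inverse_def)
    have "q < n"
    proof (rule ccontr)
      assume "\<not> q < n"
      then have "c (int n) = Inv (as ! (q - n))"
        using q[of "q - n"] C.m_pos by (simp add: of_nat_diff)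
      then show False using cn by simp
    qed
    moreover have "p \<le> m"
    proof (rule ccontr)
      assume "\<not> p \<le> m"
      define k where "k = (int l + 1) mod int m"
      have k: "0 \<le> k" "k < int m" using B.m_pos by (simp_all add: k_def)
      have "(k - int m) - (int l + 1) = int m * (- 1 - (int l + 1) div int m)"
        unfolding k_def minus_mult_div_eq_mod[symmetric] by (simp add: algebra_simps)
      then have "int m dvd (k - int m) - (int l + 1)" by (rule dvdI)
      then have "b (k - int m) = Arr \<beta>" using B.cong[of "k - int m" "int l + 1"] ends(2) by simp
      moreover have "b (k - int m) = Inv (as ! (q + nat (int m - k)))"
        using p[of "nat (int m - k)"] k \<open>\<not> p \<le> m\<close> by simp
      ultimately show False by simp
    qed
    ultimately have pq: "p \<le> m" "q \<le> n" by auto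
    have "concat_word (int n + int m + int q - int r) = Inv (as ! r)" if r: "r < length as" for r
    proof (cases "r < q")
      case True
      have "concat_word (int n + int m + (int q - int r)) = c (int q - int r)"
        using True pq by (intro concat_word_next) auto
      then show ?thesis using q[OF True] by (simp add: algebra_simps)
    next
      case False
      have "concat_word (int n + (int m + int q - int r)) = b (int m + int q - int r)"
        using False r as(2) pq by (intro concat_word_right) auto
      also have "\<dots> = b (- int (r - q))"
        using B.shift[of "- int (r - q)" 1] False by (simp add: algebra_simps)
      finally show ?thesis using p[of "r - q"] False r as(2) by (simp add: algebra_simps)
    qed
    then have "\<not> B.rel as" using as by (intro D.no_rel_Inv[of as "int n + int m + int q"]) auto
    then show False using as(1) by blast
  qed
qed

text \<open>A relation in cb that avoids the seams lies in b or in c. One that crosses a seam but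
  covers at most l letters behind it also lies in a single band, because b and c agree on these
  letters. The rest is excluded by \<open>good\<close>.\<close>

lemma concat_quasi_band:
  assumes ov: "overlap Q b c l" and good: "\<not> bad_direct l" "\<not> bad_inverse l"
  shows "quasi_band Q I (concat_word, m + n)"
proof -
  obtain \<alpha> \<beta> \<gamma> \<delta> where ends: "b 0 = Inv \<alpha>" "b (int l + 1) = Arr \<beta>" "c 0 = Arr \<gamma>" "c (int l + 1) = Inv \<delta>"
    and vert: "lsrc Q (b 0) = lsrc Q (c 0)" and eq: "\<And>i. 1 \<le> i \<Longrightarrow> i \<le> int l \<Longrightarrow> b i = c i"
    using ov by (auto simp: overlap_def)
  have bm: "b (int m) = Inv \<alpha>" "b (int m) = b 0" using B.shift[of 0 1] ends by simp_all
  have cn: "c (int n) = Arr \<gamma>" "c (int n) = c 0" using C.shift[of 0 1] ends by simp_all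
  have m: "m \<ge> 1" and n: "n \<ge> 1" using B.m_pos C.m_pos by auto
  have d_mn: "concat_word (int n + int m) = Inv \<alpha>" using concat_word_right[of "int m"] m bm by simp
  have d_n: "concat_word (int n) = Arr \<gamma>" using concat_word_left[of "int n"] n cn by simp
  \<comment> \<open>A period may be taken to start anywhere. Direct occurrences are placed in the
    window from 1, where the letter \<alpha> at n + m bounds them, inverse ones in the window from n
    + 1, where \<gamma> at n bounds them.\<close>
  have norm: "\<exists>j k. j0 \<le> j \<and> j < j0 + (int n + int m) \<and> i = j + k * int (m + n)" for i j0
  proof (intro exI conjI)
    let ?j = "j0 + (i - j0) mod (int n + int m)"
    show "j0 \<le> ?j" "?j < j0 + (int n + int m)" using m n by auto
    show "i = ?j + ((i - j0) div (int n + int m)) * int (m + n)"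
      using div_mult_mod_eq[of "i - j0" "int n + int m"] by (simp add: algebra_simps)
  qed
  have adj: "lsrc Q (concat_word j) = ltgt Q (concat_word (j + 1)) \<and> concat_word j \<noteq> linv (concat_word (j + 1))"
    if j: "1 \<le> j" "j < 1 + (int n + int m)" for j
  proof -
    consider "j < int n" | "j = int n" | "int n < j" "j < int n + int m" | "j = int n + int m"
      using j by linarith
    then show ?thesis
    proof cases
      case 1
      then show ?thesis using j C.composable[of j] C.reduced[of j] by (simp add: concat_word_left)
    next
      case 2
      have "concat_word (j + 1) = b 1" using 2 concat_word_right[of 1] m by simp
      moreover have "c 0 \<noteq> linv (b 1)" using eq[of 1] C.reduced[of 0] ends by (cases "l = 0") auto
      ultimately show ?thesis using 2 d_n cn vert B.composable[of 0] by simp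
    next
      case 3
      then have "concat_word j = b (j - int n)" "concat_word (j + 1) = b (j - int n + 1)"
        using concat_word_right[of "j - int n"] concat_word_right[of "j - int n + 1"] by (simp_all add: algebra_simps)
      then show ?thesis using B.composable[of "j - int n"] B.reduced[of "j - int n"] by simp
    next
      case 4
      have "concat_word (j + 1) = c 1" using 4 concat_word_next[of 1] n by simp
      moreover have "b 0 \<noteq> linv (c 1)" using eq[of 1] B.reduced[of 0] ends by (cases "l = 0") auto
      ultimately show ?thesis using 4 d_mn bm vert C.composable[of 0] by simp
    qed
  qed
  show ?thesis
  proof (rule B.quasi_bandI)
    show "m + n \<ge> 1" using m by simp
    show "concat_word (i + int (m + n)) = concat_word i" for i
      using concat_word_period[of i 1] by simp
    show "concat_word i \<in> letters Q" for i
    proof -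
      obtain j k where j: "1 \<le> j" "j < 1 + (int n + int m)" "i = j + k * int (m + n)" using norm[of 1 i] by auto
      then have "concat_word i = concat_word j" using concat_word_period by simp
      also have "\<dots> \<in> letters Q"
        using j concat_word_left[of j] concat_word_right[of "j - int n"] C.letter B.letter
        by (cases "j \<le> int n") auto
      finally show ?thesis .
    qed
    fix i
    obtain j k where j: "1 \<le> j" "j < 1 + (int n + int m)" "i = j + k * int (m + n)" using norm[of 1 i] by auto
    then have "concat_word i = concat_word j" "concat_word (i + 1) = concat_word (j + 1)"
      using concat_word_period[of j k] concat_word_period[of "j + 1" k] by (simp_all add: algebra_simps)
    then show "lsrc Q (concat_word i) = ltgt Q (concat_word (i + 1))" "concat_word i \<noteq> linv (concat_word (i + 1))"
      using adj[OF j(1,2)] by simp_all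
  next
    fix as i0 assume ne: "as \<noteq> []" and Arr0: "\<And>r. r < length as \<Longrightarrow> concat_word (i0 + int r) = Arr (as ! r)"
    obtain i k where i: "1 \<le> i" "i < 1 + (int n + int m)" "i0 = i + k * int (m + n)" using norm[of 1 i0] by auto
    have Arr: "concat_word (i + int r) = Arr (as ! r)" if "r < length as" for r
      using Arr0[OF that] concat_word_period[of "i + int r" k] by (simp add: i(3) algebra_simps)
    have short: "i + int (length as) \<le> int n + int m"
    proof (rule ccontr)
      assume "\<not> ?thesis"
      then have "nat (int n + int m - i) < length as" using i(2) by linarith
      then show False using Arr[of "nat (int n + int m - i)"] i d_mn by simp
    qed
    consider "i > int n" | "i + int (length as) \<le> int n + 1" | "i \<le> int n" "i + int (length as) > int n + 1" by linarith
    then show "\<not> B.rel as"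
    proof cases
      case 1
      have "b (i - int n + int r) = Arr (as ! r)" if "r < length as" for r
        using Arr[OF that] concat_word_right[of "i - int n + int r"] 1 short that by (simp add: algebra_simps)
      then show ?thesis using B.no_rel_Arr[OF ne] by blast
    next
      case 2
      have "c (i + int r) = Arr (as ! r)" if "r < length as" for r
        using Arr[OF that] concat_word_left[of "i + int r"] 2 i that by simp
      then show ?thesis using C.no_rel_Arr[OF ne] by blast
    next
      case 3
      define p where "p = nat (int n - i + 1)"
      define q where "q = length as - p"
      have pq: "p \<ge> 1" "q \<ge> 1" "length as = p + q" "int p = int n - i + 1" "q \<le> m"
        using 3 i short by (auto simp: p_def q_def)
      have P: "c (int r - int p + 1) = Arr (as ! r)" if r: "r < p" for r
      proof -
        have "c (i + int r) = Arr (as ! r)"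
          using Arr[of r] concat_word_left[of "i + int r"] i r pq by simp
        moreover have "i + int r = (int r - int p + 1) + 1 * int n" using pq(4) by simp
        then have "c (i + int r) = c (int r - int p + 1)" by (simp only: C.shift)
        ultimately show ?thesis by simp
      qed
      have Q': "b (int r + 1) = Arr (as ! (p + r))" if r: "r < q" for r
      proof -
        have "i + int (p + r) = int n + (int r + 1)" using pq(4) by simp
        then show ?thesis
          using Arr[of "p + r"] concat_word_right[of "int r + 1"] r pq by (simp add: add.commute[of 1])
      qed
      show ?thesis
      proof (cases "q \<ge> l + 1")
        case True
        then show ?thesis using good(1) pq P Q' unfolding bad_direct_def by blast
      next
        case False
        have "c (- int p + 1 + int r) = Arr (as ! r)" if r: "r < length as" for r
        proof (cases "r < p")
          case True
          then show ?thesis using P[OF True] by (simp add: algebra_simps)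
        next
          case F: False
          have "- int p + 1 + int r = int (r - p) + 1" using F by simp
          moreover have "c (int (r - p) + 1) = b (int (r - p) + 1)"
            by (rule eq[symmetric]) (use F False r pq(3) in linarith)+
          moreover have "r - p < q" "p + (r - p) = r" using F r pq(3) by linarith+
          then have "b (int (r - p) + 1) = Arr (as ! r)" using Q'[of "r - p"] by simp
          ultimately show ?thesis by (simp only:)
        qed
        then show ?thesis using C.no_rel_Arr[OF ne] by blast
      qed
    qed
  next
    fix as i0 assume ne: "as \<noteq> []" and Inv0: "\<And>r. r < length as \<Longrightarrow> concat_word (i0 - int r) = Inv (as ! r)"
    obtain i k where i: "int n + 1 \<le> i" "i < int n + 1 + (int n + int m)" "i0 = i + k * int (m + n)"
      using norm[of "int n + 1" i0] by auto
    have Inv: "concat_word (i - int r) = Inv (as ! r)" if "r < length as" for r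
      using Inv0[OF that] concat_word_period[of "i - int r" k] by (simp add: i(3) algebra_simps)
    have short: "i - int (length as) \<ge> int n"
    proof (rule ccontr)
      assume "\<not> ?thesis"
      then have "nat (i - int n) < length as" using i(1) by linarith
      then show False using Inv[of "nat (i - int n)"] i d_n by simp
    qed
    consider "i \<le> int n + int m" | "i - int (length as) \<ge> int n + int m" |
      "i > int n + int m" "i - int (length as) < int n + int m" by linarith
    then show "\<not> B.rel as"
    proof cases
      case 1
      have "b (i - int n - int r) = Inv (as ! r)" if "r < length as" for r
        using Inv[OF that] concat_word_right[of "i - int n - int r"] 1 short that by (simp add: algebra_simps)
      then show ?thesis using B.no_rel_Inv[OF ne] by blast
    next
      case 2
      have "c (i - int n - int m - int r) = Inv (as ! r)" if "r < length as" for r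
        using Inv[OF that] concat_word_next[of "i - int n - int m - int r"] 2 i that by (simp add: algebra_simps)
      then show ?thesis using C.no_rel_Inv[OF ne] by blast
    next
      case 3
      define q where "q = nat (i - int n - int m)"
      define p where "p = length as - q"
      have pq: "p \<ge> 1" "q \<ge> 1" "length as = q + p" "int q = i - int n - int m" "q \<le> n" "p \<le> m"
        using 3 i short by (auto simp: p_def q_def)
      have Q': "c (int q - int r) = Inv (as ! r)" if r: "r < q" for r
      proof -
        have "i - int r = int n + int m + (int q - int r)" using pq by simp
        then show ?thesis using Inv[of r] concat_word_next[of "int q - int r"] r pq by simp
      qed
      have P: "b (- int r) = Inv (as ! (q + r))" if r: "r < p" for r
      proof -
        have "i - int (q + r) = int n + (int m - int r)" using pq by simp
        then have "b (int m - int r) = Inv (as ! (q + r))"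
          using Inv[of "q + r"] concat_word_right[of "int m - int r"] r pq by simp
        then show ?thesis using B.shift[of "- int r" 1] by simp
      qed
      show ?thesis
      proof (cases "q \<ge> l + 1")
        case True
        then show ?thesis using good(2) pq P Q' unfolding bad_inverse_def by blast
      next
        case False
        have "b (int q - int r) = Inv (as ! r)" if r: "r < length as" for r
        proof (cases "r < q")
          case True
          then show ?thesis using Q'[OF True] eq[of "int q - int r"] False by simp
        next
          case F: False
          then have "int q - int r = - int (r - q)" by simp
          moreover have "r - q < p" "q + (r - q) = r" using F r pq(3) by linarith+
          then have "b (- int (r - q)) = Inv (as ! r)" using P[of "r - q"] by simp
          ultimately show ?thesis by (simp only:)
        qed
        then show ?thesis using B.no_rel_Inv[OF ne] by blast
      qed
    qed
  qed
qed

lemma extendable_imp: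
  assumes "extendable Q I (b, m) (c, n)"
  obtains l where "overlap Q b c l" "\<not> bad_direct l" "\<not> bad_inverse l"
proof -
  obtain s t u v w \<alpha> \<beta> \<gamma> \<delta> where st: "s \<ge> 1" "t \<ge> (1::nat)"
    and wb: "walk_concat (lsrc Q) (ltgt Q) [w, Walk [Arr \<beta>], u, Walk [Inv \<alpha>]] =
      Some (Walk (map b [1..int (s * m)]))"
    and wc: "walk_concat (lsrc Q) (ltgt Q) [w, Walk [Inv \<delta>], v, Walk [Arr \<gamma>]] =
      Some (Walk (map c [1..int (t * n)]))"
    and qb: "quasi_band Q I (word_qband (map c [1..int n] @ map b [1..int m]))"
    using assms unfolding extendable_def by auto
  let ?w = "walk_letters w"
  let ?l = "length ?w"
  have lb: "map b [1..int (s * m)] = ?w @ [Arr \<beta>] @ walk_letters u @ [Inv \<alpha>]"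
    using walk_letters_concat[OF wb] by simp
  have lc: "map c [1..int (t * n)] = ?w @ [Inv \<delta>] @ walk_letters v @ [Arr \<gamma>]"
    using walk_letters_concat[OF wc] by simp
  have nth: "f (1 + int r) = xs ! r" if "map f [1..N] = xs" "r < length xs" for f :: "int \<Rightarrow> 'a letter" and N xs r
    using nth_map_upto[of r 1 N f] that by (metis length_map)
  have bw: "b (1 + int r) = ?w ! r" "c (1 + int r) = ?w ! r" if "r < ?l" for r
    using nth[OF lb, of r] nth[OF lc, of r] that by (simp_all add: nth_append)
  have b1: "b (1 + int ?l) = Arr \<beta>" using nth[OF lb, of ?l] by simp
  have c1: "c (1 + int ?l) = Inv \<delta>" using nth[OF lc, of ?l] by simp
  have len_b: "s * m = ?l + length (walk_letters u) + 2" using arg_cong[OF lb, of length] by (simp del: of_nat_mult)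
  have len_c: "t * n = ?l + length (walk_letters v) + 2" using arg_cong[OF lc, of length] by (simp del: of_nat_mult)
  have "b (1 + int (?l + length (walk_letters u) + 1)) = Inv \<alpha>"
    using nth[OF lb, of "?l + length (walk_letters u) + 1"] by (simp add: nth_append)
  moreover have "1 + int (?l + length (walk_letters u) + 1) = 0 + int s * int m"
    using arg_cong[OF len_b, of int] by simp
  ultimately have b0: "b 0 = Inv \<alpha>" using B.shift[of 0 "int s"] by simp
  have "c (1 + int (?l + length (walk_letters v) + 1)) = Arr \<gamma>"
    using nth[OF lc, of "?l + length (walk_letters v) + 1"] by (simp add: nth_append)
  moreover have "1 + int (?l + length (walk_letters v) + 1) = 0 + int t * int n"
    using arg_cong[OF len_c, of int] by simp
  ultimately have c0: "c 0 = Arr \<gamma>" using C.shift[of 0 "int t"] by simp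
  have "lsrc Q (b 0) = lsrc Q (c 0)"
  proof (cases "?l = 0")
    case False
    then show ?thesis using bw[of 0] B.composable[of 0] C.composable[of 0] by simp
  next
    case True
    have "walk_src (lsrc Q) w = head Q \<beta>" "walk_src (lsrc Q) w = tail Q \<delta>"
      using walk_concat_src[OF wb] walk_concat_src[OF wc] by simp_all
    then show ?thesis using b1 c1 True B.composable[of 0] C.composable[of 0] by simp
  qed
  moreover have "b i = c i" if "i \<in> {1..int ?l}" for i
    using bw[of "nat (i - 1)"] that by (simp add: nat_less_iff)
  ultimately have ov: "overlap Q b c ?l"
    using b0 b1 c0 c1 by (auto simp: overlap_def add.commute)
  have "quasi_band Q I (concat_word, m + n)" using qb by (subst (asm) word_qband_eq)
  then show ?thesis
    using that[OF ov] concat_quasi_band_imp[OF ov] by blast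
qed

text \<open>Both s and t are chosen as l + 3. As the periods are at least 1, this leaves room for w,
  the letter behind it, a nonempty u or v, and the last letter.\<close>

lemma extendableI:
  assumes band: "band Q I (b, m)" "band Q I (c, n)"
    and ov: "overlap Q b c l" and good: "\<not> bad_direct l" "\<not> bad_inverse l"
  shows "extendable Q I (b, m) (c, n)"
proof -
  obtain \<alpha> \<beta> \<gamma> \<delta> where ends: "b 0 = Inv \<alpha>" "b (int l + 1) = Arr \<beta>" "c 0 = Arr \<gamma>" "c (int l + 1) = Inv \<delta>"
    and vert: "lsrc Q (b 0) = lsrc Q (c 0)" and eq: "\<And>i. 1 \<le> i \<Longrightarrow> i \<le> int l \<Longrightarrow> b i = c i"
    using ov by (auto simp: overlap_def)
  have prefix: "word_prefix Q b l = word_prefix Q c l"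
    using vert eq by (simp add: word_prefix_def)
  let ?u = "Walk (map b [int l + 2..int ((l + 3) * m) - 1])"
  let ?v = "Walk (map c [int l + 2..int ((l + 3) * n) - 1])"
  have Nb: "int ((l + 3) * m) \<ge> int l + 3" and Nc: "int ((l + 3) * n) \<ge> int l + 3"
    using B.m_pos C.m_pos by (metis Suc_leI mult.right_neutral mult_le_mono2 of_nat_add of_nat_le_iff of_nat_numeral One_nat_def)+
  have bN: "b (int ((l + 3) * m)) = Inv \<alpha>" using B.shift[of 0 "int (l + 3)"] ends by simp
  have cN: "c (int ((l + 3) * n)) = Arr \<gamma>" using C.shift[of 0 "int (l + 3)"] ends by simp
  have wb: "walk_concat (lsrc Q) (ltgt Q) [word_prefix Q b l, Walk [Arr \<beta>], ?u, Walk [Inv \<alpha>]] =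
      Some (Walk (map b [1..int ((l + 3) * m)]))"
    using B.walk_concat_prefix[OF Nb] unfolding bN ends by simp
  have wc: "walk_concat (lsrc Q) (ltgt Q) [word_prefix Q b l, Walk [Inv \<delta>], ?v, Walk [Arr \<gamma>]] =
      Some (Walk (map c [1..int ((l + 3) * n)]))"
    using C.walk_concat_prefix[OF Nc] unfolding cN ends prefix by simp
  have qb: "quasi_band Q I (word_qband (map c [1..int n] @ map b [1..int m]))"
    by (subst word_qband_eq) (rule concat_quasi_band[OF ov good])
  have "is_string Q I ?u"
    by (rule B.segment_string) (use Nb in linarith)
  moreover have "is_string Q I ?v"
    by (rule C.segment_string) (use Nc in linarith)
  moreover have "is_string Q I (word_prefix Q b l)"
    using B.segment_string[of 1 "int l"] B.vertex_in[of 0]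
    by (cases "l = 0") (auto simp: word_prefix_def simp del: is_string.simps(2))
  moreover have "\<alpha> \<in> arcs Q" "\<beta> \<in> arcs Q" "\<gamma> \<in> arcs Q" "\<delta> \<in> arcs Q"
    using ends B.arr_in B.inv_in C.arr_in C.inv_in by blast+
  ultimately have *: "\<exists>u v w. \<exists>\<alpha>\<in>arcs Q. \<exists>\<beta>\<in>arcs Q. \<exists>\<gamma>\<in>arcs Q. \<exists>\<delta>\<in>arcs Q.
      is_string Q I u \<and> is_string Q I v \<and> is_string Q I w \<and>
      walk_concat (lsrc Q) (ltgt Q) [w, Walk [Arr \<beta>], u, Walk [Inv \<alpha>]] =
        Some (Walk (map b [1..int ((l + 3) * m)])) \<and>
      walk_concat (lsrc Q) (ltgt Q) [w, Walk [Inv \<delta>], v, Walk [Arr \<gamma>]] =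
        Some (Walk (map c [1..int ((l + 3) * n)]))"
    by (intro exI conjI bexI) (rule wb | rule wc | assumption)+
  show ?thesis
    unfolding extendable_def prod.case
    by (intro conjI band qb exI[of _ "l + 3"] *) simp_all
qed

end

section \<open>Extendable pairs have nonsplit extensions\<close>

locale crossing = quasi_band_pair Q I b c m n
  for Q :: "('v, 'a) pre_digraph" and I :: "('v, 'a, 'k::field) kpath set"
    and b c :: "int \<Rightarrow> 'a letter" and m n :: nat +
  fixes l :: nat and \<alpha> \<beta> \<gamma> \<delta> :: 'a and lam mu :: 'k
  assumes b0: "b 0 = Inv \<alpha>" and bl: "b (int l + 1) = Arr \<beta>"
    and c0: "c 0 = Arr \<gamma>" and cl: "c (int l + 1) = Inv \<delta>"
    and vertex0: "lsrc Q (b 0) = lsrc Q (c 0)"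
    and agree: "\<And>i. 1 \<le> i \<Longrightarrow> i \<le> int l \<Longrightarrow> b i = c i"
    and not_bad: "\<not> bad_direct l" "\<not> bad_inverse l"
    and lam: "lam \<noteq> 0" and mu: "mu \<noteq> 0"
begin

lemma vertex_l: "B.vertex (int l) = C.vertex (int l)"
  using vertex0 agree[of "int l"] by (cases "l = 0") auto

text \<open>The gluing terms: \<beta> sends vector l + 1 of b additionally to vector l of c, and
  \<delta> sends vector l of b to vector l + 1 of c; the latter enters \<open>TE\<close> with a
  minus sign.\<close>

definition z\<beta> :: "'a \<Rightarrow> (int \<Rightarrow> 'k) \<Rightarrow> int \<Rightarrow> 'k" where
  "z\<beta> a \<phi> j = (if a = \<beta> then C.delta mu (int l) j * \<phi> (int l + 1) else 0)"

definition z\<delta> :: "'a \<Rightarrow> (int \<Rightarrow> 'k) \<Rightarrow> int \<Rightarrow> 'k" where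
  "z\<delta> a \<phi> j = (if a = \<delta> then C.delta mu (int l + 1) j * \<phi> (int l) else 0)"

text \<open>\<open>Inl\<close> marks the positions of c and \<open>Inr\<close> those of b. The
  submodule Y consists of the functions that vanish on all \<open>Inr\<close>.\<close>

definition \<nu>E :: "int + int \<Rightarrow> 'v" where
  "\<nu>E = case_sum C.vertex B.vertex"

definition TE :: "'a \<Rightarrow> (int + int \<Rightarrow> 'k) \<Rightarrow> int + int \<Rightarrow> 'k" where
  "TE a \<Phi> = case_sum
     (\<lambda>j. band_op c a (\<Phi> \<circ> Inl) j + (z\<beta> a (\<Phi> \<circ> Inr) j - z\<delta> a (\<Phi> \<circ> Inr) j)) (band_op b a (\<Phi> \<circ> Inr))"

definition SE :: "(int + int \<Rightarrow> 'k) set" where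
  "SE = {\<Phi>. \<Phi> \<circ> Inl \<in> quasi_periodic n mu \<and> \<Phi> \<circ> Inr \<in> quasi_periodic m lam}"

lemma delta_nonzeroD: "C.delta mu i j \<noteq> 0 \<Longrightarrow> int n dvd j - i"
  "B.delta lam i j \<noteq> 0 \<Longrightarrow> int m dvd j - i"
  by (auto simp: C.delta_def B.delta_def split: if_splits)

lemma quiver_rep_E: "quiver_rep Q \<nu>E TE"
proof (rule quiver_rep.intro)
  show "fin_digraph Q" by (rule B.fin_quiver)
  show "\<nu>E i \<in> verts Q" for i
    using B.vertex_in C.vertex_in by (cases i) (auto simp: \<nu>E_def)
  show "lin_op (TE a)" for a
  proof -
    have "TE a (\<Phi> + \<Phi>') x = TE a \<Phi> x + TE a \<Phi>' x" "TE a (fscale k \<Phi>) x = k * TE a \<Phi> x" for \<Phi> \<Phi>' k x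
      by (cases x; simp add: TE_def band_op_apply z\<beta>_def z\<delta>_def algebra_simps)+
    then show ?thesis by (simp add: lin_op_def fun_eq_iff)
  qed
  show "\<nu>E x = head Q a" if a: "a \<in> arcs Q" and nz: "TE a \<Phi> x \<noteq> 0" for a \<Phi> x
  proof (cases x)
    case (Inr i)
    then show ?thesis
      using quiver_rep.arrow_head[OF B.quiver_rep a, of "\<Phi> \<circ> Inr" i] nz by (simp add: TE_def \<nu>E_def)
  next
    case (Inl j)
    have "band_op c a (\<Phi> \<circ> Inl) j \<noteq> 0 \<or> z\<beta> a (\<Phi> \<circ> Inr) j \<noteq> 0 \<or> z\<delta> a (\<Phi> \<circ> Inr) j \<noteq> 0"
      using nz Inl by (auto simp: TE_def)
    then consider "band_op c a (\<Phi> \<circ> Inl) j \<noteq> 0" | "z\<beta> a (\<Phi> \<circ> Inr) j \<noteq> 0" | "z\<delta> a (\<Phi> \<circ> Inr) j \<noteq> 0"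
      by blast
    then show ?thesis
    proof cases
      case 1
      then show ?thesis using quiver_rep.arrow_head[OF C.quiver_rep a] Inl by (simp add: \<nu>E_def)
    next
      case 2
      then have "a = \<beta>" "C.delta mu (int l) j \<noteq> 0" by (auto simp: z\<beta>_def split: if_splits)
      then have "c j = c (int l)" using delta_nonzeroD C.cong by blast
      then show ?thesis
        using Inl \<open>a = \<beta>\<close> vertex_l B.vertex_Arr(1)[OF bl] by (simp add: \<nu>E_def)
    next
      case 3
      then have "a = \<delta>" "C.delta mu (int l + 1) j \<noteq> 0" by (auto simp: z\<delta>_def split: if_splits)
      then have "c j = c (int l + 1)" using delta_nonzeroD C.cong by blast
      then show ?thesis using Inl \<open>a = \<delta>\<close> cl by (simp add: \<nu>E_def)
    qed
  qed
  show "TE a \<Phi> = 0" if a: "a \<in> arcs Q" and *: "\<And>x. \<nu>E x = tail Q a \<Longrightarrow> \<Phi> x = 0" for a \<Phi>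
  proof
    fix x
    have bz: "band_op b a (\<Phi> \<circ> Inr) = 0"
      by (rule quiver_rep.arrow_tail[OF B.quiver_rep a]) (use *[of "Inr _"] in \<open>simp add: \<nu>E_def\<close>)
    have cz: "band_op c a (\<Phi> \<circ> Inl) = 0"
      by (rule quiver_rep.arrow_tail[OF C.quiver_rep a]) (use *[of "Inl _"] in \<open>simp add: \<nu>E_def\<close>)
    have "z\<beta> a (\<Phi> \<circ> Inr) j = 0" for j
      using *[of "Inr (int l + 1)"] bl by (simp add: z\<beta>_def \<nu>E_def)
    moreover have "z\<delta> a (\<Phi> \<circ> Inr) j = 0" for j
      using *[of "Inr (int l)"] vertex_l C.vertex_Inv(2)[OF cl] by (simp add: z\<delta>_def \<nu>E_def)
    ultimately show "TE a \<Phi> x = 0 x"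
      by (cases x) (simp_all add: TE_def bz cz)
  qed
qed

lemma quiver_subrep_E: "quiver_subrep Q \<nu>E TE SE"
proof (intro quiver_subrep.intro quiver_subrep_axioms.intro quiver_rep_E)
  have dmu: "C.delta mu i (j + int n) = mu * C.delta mu i j" for i j
    using C.delta_in[OF mu, of i] by (simp add: quasi_periodic_def)
  note subB = B.quiver_subrep[of lam] and subC = C.quiver_subrep[of mu]
  fix \<Phi> assume \<Phi>: "\<Phi> \<in> SE"
  then have in_C: "\<Phi> \<circ> Inl \<in> quasi_periodic n mu" and in_B: "\<Phi> \<circ> Inr \<in> quasi_periodic m lam"
    by (auto simp: SE_def)
  show "TE a \<Phi> \<in> SE" for a
  proof -
    have "band_op b a (\<Phi> \<circ> Inr) \<in> quasi_periodic m lam" "band_op c a (\<Phi> \<circ> Inl) \<in> quasi_periodic n mu"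
      using quiver_subrep.sub_arrow[OF subB in_B] quiver_subrep.sub_arrow[OF subC in_C] by auto
    then show ?thesis
      by (simp add: SE_def TE_def quasi_periodic_def comp_def z\<beta>_def z\<delta>_def dmu algebra_simps)
  qed
  show "(\<lambda>x. if \<nu>E x = u then \<Phi> x else 0) \<in> SE" for u
    using quiver_subrep.sub_vertex[OF subB in_B, of u] quiver_subrep.sub_vertex[OF subC in_C, of u]
    by (simp add: SE_def \<nu>E_def comp_def cong: if_cong)
qed (auto simp: SE_def quasi_periodic_def algebra_simps)

lemma foldr_TE_Inr: "foldr TE as \<Phi> \<circ> Inr = foldr (band_op b) as (\<Phi> \<circ> Inr)"
proof -
  have "TE a \<Psi> \<circ> Inr = band_op b a (\<Psi> \<circ> Inr)" for a \<Psi> by (simp add: TE_def fun_eq_iff)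
  then show ?thesis by (induction as) simp_all
qed

text \<open>One term of the Leibniz expansion of a path on the middle term: the arrows to the right
  of index r act on b, the arrow at r crosses to c by z, and the arrows to its left, which act
  later, move along c.\<close>

definition summand :: "('a \<Rightarrow> (int \<Rightarrow> 'k) \<Rightarrow> int \<Rightarrow> 'k) \<Rightarrow> 'a list \<Rightarrow> (int \<Rightarrow> 'k) \<Rightarrow> int \<Rightarrow> nat \<Rightarrow> 'k" where
  "summand z as \<phi> j r = (case pre c (take r as) j of None \<Rightarrow> 0
     | Some j' \<Rightarrow> z (as ! r) (foldr (band_op b) (drop (Suc r) as) \<phi>) j')"

lemma foldr_TE_Inl:
  "foldr TE as \<Phi> (Inl j) = foldr (band_op c) as (\<Phi> \<circ> Inl) j +
    ((\<Sum>r<length as. summand z\<beta> as (\<Phi> \<circ> Inr) j r) - (\<Sum>r<length as. summand z\<delta> as (\<Phi> \<circ> Inr) j r))"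
proof (induction as arbitrary: j)
  case (Cons a as)
  have bo: "band_op c a F j = F k" if "pre c [a] j = Some k" for F :: "int \<Rightarrow> 'k" and k
    using that by (simp add: band_op_def del: pre.simps)
  have head: "summand z (a # as) \<phi> j 0 = z a (foldr (band_op b) as \<phi>) j" for z \<phi>
    by (simp add: summand_def)
  have tail: "summand z (a # as) \<phi> j (Suc r) = (case pre c [a] j of None \<Rightarrow> 0 | Some j' \<Rightarrow> summand z as \<phi> j' r)"
    for z \<phi> r by (simp add: summand_def split: option.split)
  have "foldr TE (a # as) \<Phi> (Inl j) = band_op c a (foldr TE as \<Phi> \<circ> Inl) j +
      (z\<beta> a (foldr (band_op b) as (\<Phi> \<circ> Inr)) j - z\<delta> a (foldr (band_op b) as (\<Phi> \<circ> Inr)) j)"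
    by (simp add: TE_def foldr_TE_Inr)
  also have "band_op c a (foldr TE as \<Phi> \<circ> Inl) j = foldr (band_op c) (a # as) (\<Phi> \<circ> Inl) j +
      ((\<Sum>r<length as. summand z\<beta> (a # as) (\<Phi> \<circ> Inr) j (Suc r)) -
       (\<Sum>r<length as. summand z\<delta> (a # as) (\<Phi> \<circ> Inr) j (Suc r)))"
  proof (cases "pre c [a] j")
    case None
    then show ?thesis unfolding tail by (simp add: band_op_def del: pre.simps)
  next
    case (Some k)
    then show ?thesis
      unfolding tail
      by (simp add: bo[OF Some] Cons.IH comp_def del: pre.simps)
  qed
  finally show ?case
    unfolding length_Cons sum.lessThan_Suc_shift head by (simp add: algebra_simps comp_def)
qed simp

text \<open>If the crossing contributes, the arrows behind r continue b in direct letters after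
  \<beta>, and those in front of r arrive at position l of c. In inverse letters the last of the
  latter would be \<delta>. In direct letters the whole relation becomes a direct word, which lies
  inside b for r \<le> l and is a bad relation otherwise.\<close>

lemma summand_z\<beta>:
  assumes rel: "B.rel as" and r: "r < length as" and nz: "summand z\<beta> as \<phi> j r \<noteq> 0"
  shows "r > 0 \<and> as ! (r - 1) = \<delta>"
proof (rule ccontr)
  assume neg: "\<not> ?thesis"
  let ?P1 = "take r as" and ?P2 = "drop (Suc r) as"
  obtain j' where j': "pre c ?P1 j = Some j'" and a: "as ! r = \<beta>" and d: "C.delta mu (int l) j' \<noteq> 0"
    and nz2: "foldr (band_op b) ?P2 \<phi> (int l + 1) \<noteq> 0"
    using nz by (auto simp: summand_def z\<beta>_def split: option.splits if_splits)
  obtain i where i: "pre b ?P2 (int l + 1) = Some i"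
    using nz2 by (auto simp: foldr_band_op split: option.splits)
  have dvd: "int n dvd j' - int l" using d delta_nonzeroD by blast
  have len1: "length ?P1 = r" using r by simp
  have nth1: "?P1 ! t = as ! t" if "t < r" for t using that by simp
  have nth2: "?P2 ! t = as ! (Suc r + t)" if "t < length ?P2" for t using that r by simp
  have c_sh: "c (j' + x) = c (int l + x)" for x using C.cong[of "j' + x" "int l + x"] dvd by simp
  have P1: "c (int l - int r + 1 + int t) = Arr (as ! t)" if t: "t < r" for t
    using C.pre_word[OF j'] unfolding len1
  proof (elim disjE conjE)
    assume e: "j' = j + int r" and w: "\<forall>t<r. c (j + 1 + int t) = Arr (?P1 ! t)"
    have "c (int l + (1 + int t - int r)) = c (j' + (1 + int t - int r))" by (rule c_sh[symmetric])
    also have "j' + (1 + int t - int r) = j + 1 + int t" using e by simp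
    finally show ?thesis using w t nth1 by (simp add: algebra_simps)
  next
    assume e: "j' = j - int r" and w: "\<forall>t<r. c (j - int t) = Inv (?P1 ! t)"
    have "r - 1 < r" using t by simp
    then have "c (j - int (r - 1)) = Inv (as ! (r - 1))" using w nth1[of "r - 1"] by metis
    moreover have "j - int (r - 1) = j' + 1" using e t by (simp add: of_nat_diff)
    ultimately have "Inv \<delta> = Inv (as ! (r - 1))" using c_sh[of 1] cl by simp
    then show ?thesis using neg t by simp
  qed
  have P2: "b (int l + 2 + int t) = Arr (as ! (Suc r + t))" if t: "t < length ?P2" for t
    using B.pre_word[OF i]
  proof (elim disjE conjE)
    assume "\<forall>t<length ?P2. b (int l + 1 + 1 + int t) = Arr (?P2 ! t)"
    then show ?thesis using nth2[OF t] t by (simp add: add.assoc)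
  next
    assume "\<forall>t<length ?P2. b (int l + 1 - int t) = Inv (?P2 ! t)"
    moreover have "0 < length ?P2" using t by linarith
    ultimately have "b (int l + 1 - int 0) = Inv (?P2 ! 0)" by blast
    then show ?thesis using bl by simp
  qed
  have W: "b (int l + 1 + int t) = Arr (as ! (r + t))" if t: "r + t < length as" for t
  proof (cases t)
    case 0
    then show ?thesis using bl a by simp
  next
    case (Suc t')
    then show ?thesis using P2[of t'] t by (simp add: algebra_simps)
  qed
  show False
  proof (cases "r \<le> l")
    case True
    have "b (int l - int r + 1 + int t) = Arr (as ! t)" if t: "t < length as" for t
    proof (cases "t < r")
      case tr: True
      then have "b (int l - int r + 1 + int t) = c (int l - int r + 1 + int t)" using True by (intro agree) auto
      then show ?thesis using P1[OF tr] by simp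
    next
      case False
      then have "int l - int r + 1 + int t = int l + 1 + int (t - r)" "r + (t - r) = t" by simp_all
      moreover have "b (int l + 1 + int (t - r)) = Arr (as ! (r + (t - r)))"
        using \<open>r + (t - r) = t\<close> t by (intro W) simp
      ultimately show ?thesis by (simp only:)
    qed
    then have "\<not> B.rel as" using r by (intro B.no_rel_Arr[of as "int l - int r + 1"]) auto
    then show False using rel by blast
  next
    case False
    \<comment> \<open>The arrows in front of r reach p = r - l positions beyond the left end of the
      common word; as b and c agree on that word, everything behind the first p arrows can be read
      in b.\<close>
    define p where "p = r - l"
    define q where "q = length as - p"
    have p: "p \<ge> 1" "p + l = r" using False by (auto simp: p_def)
    have q: "length as = p + q" "q \<ge> l + 1" using p r by (auto simp: q_def)
    have "c (int t - int p + 1) = Arr (as ! t)" if "t < p" for t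
    proof -
      have "int t - int p + 1 = int l - int r + 1 + int t" using p by simp
      moreover have "c (int l - int r + 1 + int t) = Arr (as ! t)" using that p by (intro P1) simp
      ultimately show ?thesis by (simp only:)
    qed
    moreover have "b (int t + 1) = Arr (as ! (p + t))" if t: "t < q" for t
    proof (cases "t < l")
      case True
      then have "b (int t + 1) = c (int t + 1)" by (intro agree) auto
      moreover have "int t + 1 = int l - int r + 1 + int (p + t)" using p by simp
      moreover have "c (int l - int r + 1 + int (p + t)) = Arr (as ! (p + t))"
        using True p by (intro P1) simp
      ultimately show ?thesis by (simp only:)
    next
      case F: False
      then have "int t + 1 = int l + 1 + int (t - l)" "r + (t - l) = p + t" using p by simp_all
      moreover have "b (int l + 1 + int (t - l)) = Arr (as ! (r + (t - l)))"
        using \<open>r + (t - l) = p + t\<close> t q by (intro W) simp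
      ultimately show ?thesis by (simp only:)
    qed
    ultimately have "bad_direct l" unfolding bad_direct_def using rel p q by blast
    then show False using not_bad by blast
  qed
qed

text \<open>Mirror image: arrows behind \<delta> that do not start with \<beta> must run back along
  b in inverse letters. Together with the inverse letters of c in front of them they place the
  relation inside c or make it a bad one.\<close>

lemma summand_z\<delta>:
  assumes rel: "B.rel as" and r: "r < length as" and nz: "summand z\<delta> as \<phi> j r \<noteq> 0"
  shows "Suc r < length as \<and> as ! Suc r = \<beta>"
proof (rule ccontr)
  assume neg: "\<not> ?thesis"
  let ?P1 = "take r as" and ?P2 = "drop (Suc r) as"
  obtain j' where j': "pre c ?P1 j = Some j'" and a: "as ! r = \<delta>" and d: "C.delta mu (int l + 1) j' \<noteq> 0"
    and nz2: "foldr (band_op b) ?P2 \<phi> (int l) \<noteq> 0"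
    using nz by (auto simp: summand_def z\<delta>_def split: option.splits if_splits)
  obtain i where i: "pre b ?P2 (int l) = Some i"
    using nz2 by (auto simp: foldr_band_op split: option.splits)
  have dvd: "int n dvd j' - (int l + 1)" using d delta_nonzeroD by blast
  have len1: "length ?P1 = r" using r by simp
  have nth1: "?P1 ! t = as ! t" if "t < r" for t using that by simp
  have nth2: "?P2 ! t = as ! (Suc r + t)" if "t < length ?P2" for t using that r by simp
  have c_sh: "c (j' + x) = c (int l + 1 + x)" for x using C.cong[of "j' + x" "int l + 1 + x"] dvd by simp
  have P1: "c (int l + 1 + int r - int t) = Inv (as ! t)" if t: "t < r" for t
    using C.pre_word[OF j'] unfolding len1
  proof (elim disjE conjE)
    assume e: "j' = j + int r" and w: "\<forall>t<r. c (j + 1 + int t) = Arr (?P1 ! t)"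
    have "r - 1 < r" using t by simp
    then have "c (j + 1 + int (r - 1)) = Arr (?P1 ! (r - 1))" using w by blast
    moreover have "j + 1 + int (r - 1) = j' + 0" using e t by (simp add: of_nat_diff)
    ultimately show ?thesis using c_sh[of 0] cl by simp
  next
    assume e: "j' = j - int r" and w: "\<forall>t<r. c (j - int t) = Inv (?P1 ! t)"
    have "c (int l + 1 + (int r - int t)) = c (j' + (int r - int t))" by (rule c_sh[symmetric])
    also have "j' + (int r - int t) = j - int t" using e by simp
    finally show ?thesis using w t nth1 by (simp add: algebra_simps)
  qed
  have P2: "b (int l - int t) = Inv (as ! (Suc r + t))" if t: "t < length ?P2" for t
    using B.pre_word[OF i]
  proof (elim disjE conjE)
    assume "\<forall>t<length ?P2. b (int l + 1 + int t) = Arr (?P2 ! t)"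
    moreover have l2: "0 < length ?P2" using t by linarith
    ultimately have "b (int l + 1 + int 0) = Arr (?P2 ! 0)" by blast
    then have "as ! Suc r = \<beta>" using bl nth2[OF l2] by simp
    then show ?thesis using neg l2 by simp
  next
    assume "\<forall>t<length ?P2. b (int l - int t) = Inv (?P2 ! t)"
    then show ?thesis using nth2[OF t] t by simp
  qed
  have W: "c (int l + 1 + int r - int t) = Inv (as ! t)" if "t \<le> r" for t
    using P1[of t] that a cl by (cases "t = r") auto
  show False
  proof (cases "length ?P2 \<le> l")
    case True
    have "c (int l + 1 + int r - int t) = Inv (as ! t)" if t: "t < length as" for t
    proof (cases "t \<le> r")
      case False
      then have e: "int l + 1 + int r - int t = int l - int (t - Suc r)" "Suc r + (t - Suc r) = t"
        and lt: "t - Suc r < length ?P2" using t by auto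
      have "b (int l - int (t - Suc r)) = c (int l - int (t - Suc r))"
        using lt True by (intro agree) auto
      then show ?thesis using P2[OF lt] e by (simp only:)
    qed (use W in auto)
    then have "\<not> B.rel as" using r by (intro C.no_rel_Inv[of as "int l + 1 + int r"]) auto
    then show False using rel by blast
  next
    case False
    define q where "q = r + 1 + l"
    define p where "p = length as - q"
    have p: "p \<ge> 1" "length as = q + p" using False r by (auto simp: p_def q_def)
    have "c (int q - int t) = Inv (as ! t)" if t: "t < q" for t
    proof (cases "t \<le> r")
      case True
      have "int q - int t = int l + 1 + int r - int t" by (simp add: q_def)
      then show ?thesis using W[OF True] by (simp only:)
    next
      case F: False
      then have e: "int q - int t = int l - int (t - Suc r)" "Suc r + (t - Suc r) = t"
        and lt: "t - Suc r < length ?P2" using t p by (auto simp: q_def)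
      have "b (int l - int (t - Suc r)) = c (int l - int (t - Suc r))"
        using t F by (intro agree) (auto simp: q_def)
      then show ?thesis using P2[OF lt] e by (simp only:)
    qed
    moreover have "b (- int t) = Inv (as ! (q + t))" if t: "t < p" for t
    proof -
      have e: "- int t = int l - int (l + t)" "Suc r + (l + t) = q + t"
        and lt: "l + t < length ?P2" using t p by (auto simp: q_def)
      show ?thesis using P2[OF lt] e by (simp only:)
    qed
    moreover have "q \<ge> l + 1" by (simp add: q_def)
    ultimately have "bad_inverse l" unfolding bad_inverse_def using rel p by blast
    then show False using not_bad by blast
  qed
qed

text \<open>Both terms lead from vector l + 1 of b to vector l + 1 of c: one crosses by \<beta> and
  then moves by \<delta> in c, the other moves by \<beta> in b and then crosses by \<delta>. Here
  the minus sign in \<open>TE\<close> is needed.\<close>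

lemma summand_cancel:
  assumes r: "Suc r < length as" and a: "as ! r = \<delta>" "as ! Suc r = \<beta>"
  shows "summand z\<beta> as \<phi> j (Suc r) = summand z\<delta> as \<phi> j r"
proof -
  have take: "take (Suc r) as = take r as @ [\<delta>]" using r a by (simp add: take_Suc_conv_app_nth)
  have drop: "drop (Suc r) as = \<beta> # drop (Suc (Suc r)) as" using Cons_nth_drop_Suc[OF r] a by simp
  show ?thesis
  proof (cases "pre c (take r as) j")
    case None
    then show ?thesis by (simp add: summand_def take pre_append)
  next
    case (Some k)
    let ?v = "foldr (band_op b) (drop (Suc (Suc r)) as) \<phi> (int l + 1)"
    have "foldr (band_op b) (drop (Suc r) as) \<phi> (int l) = ?v"
      unfolding drop using bl by (simp add: band_op_apply)
    then have R: "summand z\<delta> as \<phi> j r = C.delta mu (int l + 1) k * ?v"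
      using Some a by (simp add: summand_def z\<delta>_def)
    have L: "summand z\<beta> as \<phi> j (Suc r) = (case pre c [\<delta>] k of None \<Rightarrow> 0 | Some j' \<Rightarrow> C.delta mu (int l) j' * ?v)"
      using Some a by (simp add: summand_def z\<beta>_def take pre_append)
    show ?thesis
    proof (cases "int n dvd k - (int l + 1)")
      case True
      then have "c k = Inv \<delta>" using C.cong cl by metis
      then have "pre c [\<delta>] k = Some (k - 1)" using C.reduced_Inv by simp
      moreover have "C.delta mu (int l) (k - 1) = C.delta mu (int l + 1) k"
        by (simp add: C.delta_def algebra_simps)
      ultimately show ?thesis using L R by simp
    next
      case False
      then have R0: "C.delta mu (int l + 1) k = 0" by (simp add: C.delta_def)
      have "C.delta mu (int l) (k - 1) = 0" using False by (simp add: C.delta_def algebra_simps)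
      moreover have "C.delta mu (int l) (k + 1) = 0" if "c (k + 1) = Arr \<delta>"
      proof (rule ccontr)
        assume "C.delta mu (int l) (k + 1) \<noteq> 0"
        then have "c (k + 1) = c (int l)" using delta_nonzeroD C.cong by blast
        then show False using that cl C.reduced_Arr[of "int l" \<delta>] by simp
      qed
      ultimately show ?thesis using L R R0 by simp
    qed
  qed
qed

text \<open>In a relation crossings contribute only at adjacent arrows \<delta>, \<beta>, where they
  cancel in pairs. Hence the two sums agree after an index shift, and the terms left over at both
  ends vanish.\<close>

lemma rel_acts_zero:
  assumes rel: "B.rel as" and ne: "as \<noteq> []"
  shows "foldr TE as \<Phi> = 0"
proof
  fix x
  show "foldr TE as \<Phi> x = 0 x"
  proof (cases x)
    case (Inr i)
    have "(foldr TE as \<Phi> \<circ> Inr) i = 0"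
      unfolding foldr_TE_Inr by (simp add: foldr_band_op B.pre_rel[OF rel ne])
    then show ?thesis using Inr by simp
  next
    case (Inl j)
    let ?f = "summand z\<beta> as (\<Phi> \<circ> Inr) j" and ?g = "summand z\<delta> as (\<Phi> \<circ> Inr) j"
    obtain k where k: "length as = Suc k" using ne by (cases as) auto
    have step: "?f (Suc r) = ?g r" if r: "Suc r < length as" for r
    proof (cases "as ! r = \<delta> \<and> as ! Suc r = \<beta>")
      case True
      then show ?thesis using summand_cancel r by blast
    next
      case False
      have "?f (Suc r) = 0"
      proof (rule ccontr)
        assume nz: "?f (Suc r) \<noteq> 0"
        then have "as ! Suc r = \<beta>"
          by (auto simp: summand_def z\<beta>_def split: option.splits if_splits)
        then show False using summand_z\<beta>[OF rel r nz] False by simp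
      qed
      moreover have "?g r = 0"
      proof (rule ccontr)
        assume nz: "?g r \<noteq> 0"
        then have "as ! r = \<delta>"
          by (auto simp: summand_def z\<delta>_def split: option.splits if_splits)
        then show False using summand_z\<delta>[OF rel _ nz] r False by simp
      qed
      ultimately show ?thesis by simp
    qed
    have "?f 0 = 0" using summand_z\<beta>[OF rel, of 0] ne by blast
    then have "(\<Sum>r<length as. ?f r) = (\<Sum>r<k. ?f (Suc r))"
      unfolding k sum.lessThan_Suc_shift by simp
    also have "\<dots> = (\<Sum>r<k. ?g r)" by (intro sum.cong) (auto simp: step k)
    also have "\<dots> = (\<Sum>r<length as. ?g r)"
      using summand_z\<delta>[OF rel, of k] k by (auto simp: k)
    finally have "foldr TE as \<Phi> (Inl j) = foldr (band_op c) as (\<Phi> \<circ> Inl) j"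
      unfolding foldr_TE_Inl by simp
    also have "\<dots> = 0" by (simp add: foldr_band_op C.pre_rel[OF rel ne])
    finally show ?thesis using Inl by simp
  qed
qed

lemma ideal_acts_zero_E: "x \<in> I \<Longrightarrow> \<Phi> \<in> SE \<Longrightarrow> act \<nu>E TE x \<Phi> = 0"
  by (rule B.ideal_acts_zero[OF quiver_subrep_E]) (auto intro: rel_acts_zero)

lemma path_act_E_Inr: "path_act \<nu>E TE p \<Phi> \<circ> Inr = path_act B.vertex (band_op b) p (\<Phi> \<circ> Inr)"
  by (cases p) (simp_all add: foldr_TE_Inr, simp add: fun_eq_iff \<nu>E_def)

lemma act_E_Inr: "act \<nu>E TE x \<Phi> \<circ> Inr = act B.vertex (band_op b) x (\<Phi> \<circ> Inr)"
  using path_act_E_Inr by (simp add: act_def fun_eq_iff)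

lemma path_act_E_Inl:
  assumes "\<Phi> \<circ> Inr = 0"
  shows "path_act \<nu>E TE p \<Phi> \<circ> Inl = path_act C.vertex (band_op c) p (\<Phi> \<circ> Inl)"
proof (cases p)
  case (Walk as)
  have "foldr (band_op b) bs 0 i = (0::'k)" for bs i
    by (simp add: foldr_band_op split: option.split)
  then have "summand z\<beta> as 0 j r = 0" "summand z\<delta> as 0 j r = 0" for j r
    by (simp_all add: summand_def z\<beta>_def z\<delta>_def split: option.split)
  then show ?thesis using Walk by (intro ext) (simp add: foldr_TE_Inl assms)
qed (simp add: fun_eq_iff \<nu>E_def)

lemma act_E_Inl:
  "\<Phi> \<circ> Inr = 0 \<Longrightarrow> act \<nu>E TE x \<Phi> \<circ> Inl = act C.vertex (band_op c) x (\<Phi> \<circ> Inl)"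
  using path_act_E_Inl by (simp add: act_def fun_eq_iff)

text \<open>The matrix h of a section would be constant along the common word, but \<alpha> forces
  the value 0 at its left end and \<beta> the value 1 at its right end. Most of the work is to see
  that the periodic copies of the gluing terms do not interfere with these equations.\<close>

lemma no_section:
  assumes sect: "\<And>a i j. a \<in> arcs Q \<Longrightarrow>
    band_op c a (h i) j + (z\<beta> a (B.delta lam i) j - z\<delta> a (B.delta lam i) j) =
    (case B.post a i of None \<Rightarrow> 0 | Some i' \<Rightarrow> h i' j)"
  shows False
proof -
  have arcs: "\<alpha> \<in> arcs Q" "\<beta> \<in> arcs Q" "\<delta> \<in> arcs Q"
    using B.inv_in[OF b0] B.arr_in[OF bl] C.inv_in[OF cl] by auto
  have c1: "c 1 \<noteq> Arr \<alpha>"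
    using agree[of 1] cl B.reduced_Inv[OF b0] by (cases "l = 0") auto
  have clb: "c (int l) \<noteq> Inv \<beta>"
  proof (cases "l = 0")
    case False
    then have "c (int l) = b (int l)" using agree[of "int l"] by simp
    then show ?thesis using B.reduced_Inv[of "int l" \<beta>] bl by auto
  qed (use c0 in auto)
  have start: "h 0 0 = 0"
  proof -
    have "z\<beta> \<alpha> (B.delta lam (-1)) 0 = 0"
    proof (rule ccontr)
      assume "z\<beta> \<alpha> (B.delta lam (-1)) 0 \<noteq> 0"
      then have "\<alpha> = \<beta>" "B.delta lam (-1) (int l + 1) \<noteq> 0" by (auto simp: z\<beta>_def split: if_splits)
      then have "b (int l + 1) = b (-1)" using delta_nonzeroD(2) B.cong by blast
      then show False using \<open>\<alpha> = \<beta>\<close> bl b0 B.reduced_Arr[of "-1" \<beta>] by simp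
    qed
    moreover have "z\<delta> \<alpha> (B.delta lam (-1)) 0 = 0"
    proof (rule ccontr)
      assume "z\<delta> \<alpha> (B.delta lam (-1)) 0 \<noteq> 0"
      then have "B.delta lam (-1) (int l) \<noteq> 0" by (auto simp: z\<delta>_def split: if_splits)
      then have "int m dvd int l + 1 - 0" using delta_nonzeroD(2) by fastforce
      then have "b (int l + 1) = b 0" by (rule B.cong)
      then show False using bl b0 by simp
    qed
    ultimately show ?thesis
      using sect[OF arcs(1), of "-1" 0] c1 c0 b0 by (simp add: band_op_apply)
  qed
  have step: "h (int r + 1) (int r + 1) = h (int r) (int r)" if r: "r < l" for r
  proof -
    have e: "b (int r + 1) = c (int r + 1)" using r by (intro agree) auto
    show ?thesis
    proof (cases "b (int r + 1)")
      case (Arr a)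
      have a: "a \<in> arcs Q" using B.arr_in[OF Arr] .
      have "z\<beta> a (B.delta lam (int r + 1)) (int r) = 0"
      proof (rule ccontr)
        assume "z\<beta> a (B.delta lam (int r + 1)) (int r) \<noteq> 0"
        then have "C.delta mu (int l) (int r) \<noteq> 0" by (auto simp: z\<beta>_def split: if_splits)
        then have "int n dvd (int r + 1) - (int l + 1)" using delta_nonzeroD(1) by fastforce
        then have "c (int r + 1) = c (int l + 1)" by (rule C.cong)
        then show False using e Arr cl by simp
      qed
      moreover have "z\<delta> a (B.delta lam (int r + 1)) (int r) = 0"
      proof (rule ccontr)
        assume "z\<delta> a (B.delta lam (int r + 1)) (int r) \<noteq> 0"
        then have "a = \<delta>" "C.delta mu (int l + 1) (int r) \<noteq> 0" by (auto simp: z\<delta>_def split: if_splits)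
        then have "c (int r) = c (int l + 1)" using delta_nonzeroD(1) C.cong by blast
        then show False using e Arr cl \<open>a = \<delta>\<close> C.reduced_Inv[of "int r" \<delta>] by simp
      qed
      ultimately show ?thesis
        using sect[OF a, of "int r + 1" "int r"] Arr e B.reduced_Arr[OF Arr] by (simp add: band_op_apply)
    next
      case (Inv a)
      have a: "a \<in> arcs Q" using B.inv_in[OF Inv] .
      have "z\<beta> a (B.delta lam (int r)) (int r + 1) = 0"
      proof (rule ccontr)
        assume "z\<beta> a (B.delta lam (int r)) (int r + 1) \<noteq> 0"
        then have "a = \<beta>" "B.delta lam (int r) (int l + 1) \<noteq> 0" by (auto simp: z\<beta>_def split: if_splits)
        then have "b (int l + 1) = b (int r)" using delta_nonzeroD(2) B.cong by blast
        then show False using Inv bl \<open>a = \<beta>\<close> B.reduced_Arr[of "int r" \<beta>] by simp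
      qed
      moreover have "z\<delta> a (B.delta lam (int r)) (int r + 1) = 0"
      proof (rule ccontr)
        assume "z\<delta> a (B.delta lam (int r)) (int r + 1) \<noteq> 0"
        then have "B.delta lam (int r) (int l) \<noteq> 0" by (auto simp: z\<delta>_def split: if_splits)
        then have "int m dvd (int l + 1) - (int r + 1)" using delta_nonzeroD(2) by fastforce
        then have "b (int l + 1) = b (int r + 1)" by (rule B.cong)
        then show False using Inv bl by simp
      qed
      ultimately show ?thesis
        using sect[OF a, of "int r" "int r + 1"] Inv e C.reduced_Inv[of "int r + 1" a] by (simp add: band_op_apply)
    qed
  qed
  have "h (int r) (int r) = 0" if "r \<le> l" for r
    using that
  proof (induction r)
    case (Suc r)
    then show ?case using step[of r] by (simp add: add.commute)
  qed (simp add: start)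
  then have "h (int l) (int l) = 0" by simp
  moreover have "h (int l) (int l) = 1"
  proof -
    have "z\<beta> \<beta> (B.delta lam (int l + 1)) (int l) = 1" by (simp add: z\<beta>_def)
    moreover have "z\<delta> \<beta> (B.delta lam (int l + 1)) (int l) = 0"
    proof (rule ccontr)
      assume "z\<delta> \<beta> (B.delta lam (int l + 1)) (int l) \<noteq> 0"
      then have "\<beta> = \<delta>" "C.delta mu (int l + 1) (int l) \<noteq> 0" by (auto simp: z\<delta>_def split: if_splits)
      then have "c (int l) = c (int l + 1)" using delta_nonzeroD(1) C.cong by blast
      then show False using cl clb \<open>\<beta> = \<delta>\<close> by simp
    qed
    ultimately show ?thesis
      using sect[OF arcs(2), of "int l + 1" "int l"] bl cl clb B.reduced_Arr[OF bl] by (simp add: band_op_apply)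
  qed
  ultimately show False by simp
qed

text \<open>Extensions have their middle term on pairs, so the module structure of the function
  space \<open>SE\<close> is transported to the product of the carriers of Y and X along \<Psi>.
  Evaluating a section on the vectors \<open>delta lam i\<close> gives the matrix refuted by
  \<open>no_section\<close>.\<close>

lemma nonsplit_extension:
  fixes X :: "(('v, 'a, 'k) quot_elt, 'x) module" and Y :: "(('v, 'a, 'k) quot_elt, 'y) module"
  assumes cX: "B.coords B.vertex (band_op b) (quasi_periodic m lam) X \<Psi>X"
    and cY: "B.coords C.vertex (band_op c) (quasi_periodic n mu) Y \<Psi>Y"
  obtains E f g where "(E, f, g) \<in> extensions (string_alg Q I) X Y"
    "\<not> (\<exists>s\<in>lmod_hom (string_alg Q I) X E. \<forall>x\<in>carrier X. g (s x) = x)"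
proof -
  let ?R = "string_alg Q I"
  let ?kQ = "path_algebra Q :: ('k, ('v, 'a, 'k) kpath) module"
  note subB = B.quiver_subrep[of lam] and subC = C.quiver_subrep[of mu]
  interpret SE: quiver_subrep Q \<nu>E TE SE by (rule quiver_subrep_E)
  interpret X: left_module ?R X by (rule B.coords_left_module[OF subB cX])
  interpret Y: left_module ?R Y by (rule B.coords_left_module[OF subC cY])
  have bX: "bij_betw \<Psi>X (carrier X) (quasi_periodic m lam)" and \<Psi>Xz: "\<Psi>X \<zero>\<^bsub>X\<^esub> = 0"
    and \<Psi>Xa: "\<And>v w. v \<in> carrier X \<Longrightarrow> w \<in> carrier X \<Longrightarrow> \<Psi>X (v \<oplus>\<^bsub>X\<^esub> w) = \<Psi>X v + \<Psi>X w"
    and \<Psi>Xm: "\<And>x v. x \<in> carrier ?kQ \<Longrightarrow> v \<in> carrier X \<Longrightarrow>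
      \<Psi>X (B.coset x \<odot>\<^bsub>X\<^esub> v) = act B.vertex (band_op b) x (\<Psi>X v)"
    using cX by (auto simp: B.coords_def)
  have bY: "bij_betw \<Psi>Y (carrier Y) (quasi_periodic n mu)" and \<Psi>Yz: "\<Psi>Y \<zero>\<^bsub>Y\<^esub> = 0"
    and \<Psi>Ya: "\<And>v w. v \<in> carrier Y \<Longrightarrow> w \<in> carrier Y \<Longrightarrow> \<Psi>Y (v \<oplus>\<^bsub>Y\<^esub> w) = \<Psi>Y v + \<Psi>Y w"
    and \<Psi>Ym: "\<And>x v. x \<in> carrier ?kQ \<Longrightarrow> v \<in> carrier Y \<Longrightarrow>
      \<Psi>Y (B.coset x \<odot>\<^bsub>Y\<^esub> v) = act C.vertex (band_op c) x (\<Psi>Y v)"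
    using cY by (auto simp: B.coords_def)
  have \<Psi>Y_eqI: "v = w" if "v \<in> carrier Y" "w \<in> carrier Y" "\<Psi>Y v = \<Psi>Y w" for v w
    using that bY by (auto simp: bij_betw_def inj_on_def)
  have \<Psi>X_eqI: "v = w" if "v \<in> carrier X" "w \<in> carrier X" "\<Psi>X v = \<Psi>X w" for v w
    using that bX by (auto simp: bij_betw_def inj_on_def)
  define C where "C = carrier Y \<times> carrier X"
  define \<Psi> where "\<Psi> = (\<lambda>(y, x). case_sum (\<Psi>Y y) (\<Psi>X x))"
  have \<Psi>_Inl: "\<Psi> e \<circ> Inl = \<Psi>Y (fst e)" and \<Psi>_Inr: "\<Psi> e \<circ> Inr = \<Psi>X (snd e)" for e
    by (auto simp: \<Psi>_def fun_eq_iff split: prod.split)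
  have bij: "bij_betw \<Psi> C SE"
  proof (rule bij_betwI[where g = "\<lambda>\<Phi>. (inv_into (carrier Y) \<Psi>Y (\<Phi> \<circ> Inl), inv_into (carrier X) \<Psi>X (\<Phi> \<circ> Inr))"])
    show "\<Psi> \<in> C \<rightarrow> SE"
      using bX bY by (auto simp: C_def SE_def \<Psi>_Inl \<Psi>_Inr bij_betw_def)
    show "(\<lambda>\<Phi>. (inv_into (carrier Y) \<Psi>Y (\<Phi> \<circ> Inl), inv_into (carrier X) \<Psi>X (\<Phi> \<circ> Inr))) \<in> SE \<rightarrow> C"
      using bX bY by (auto simp: C_def SE_def bij_betw_def inv_into_into)
    show "(inv_into (carrier Y) \<Psi>Y (\<Psi> e \<circ> Inl), inv_into (carrier X) \<Psi>X (\<Psi> e \<circ> Inr)) = e" if "e \<in> C" for e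
      using that bX bY by (auto simp: C_def \<Psi>_Inl \<Psi>_Inr bij_betw_def)
    show "\<Psi> (inv_into (carrier Y) \<Psi>Y (\<Phi> \<circ> Inl), inv_into (carrier X) \<Psi>X (\<Phi> \<circ> Inr)) = \<Phi>" if "\<Phi> \<in> SE" for \<Phi>
    proof
      fix x
      have "\<Psi>Y (inv_into (carrier Y) \<Psi>Y (\<Phi> \<circ> Inl)) = \<Phi> \<circ> Inl"
        "\<Psi>X (inv_into (carrier X) \<Psi>X (\<Phi> \<circ> Inr)) = \<Phi> \<circ> Inr"
        using that bX bY by (auto simp: SE_def bij_betw_def f_inv_into_f)
      then show "\<Psi> (inv_into (carrier Y) \<Psi>Y (\<Phi> \<circ> Inl), inv_into (carrier X) \<Psi>X (\<Phi> \<circ> Inr)) x = \<Phi> x"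
        by (cases x) (simp_all add: \<Psi>_def)
    qed
  qed
  define J where "J = inv_into C \<Psi>"
  have J: "J \<Phi> \<in> C" "\<Psi> (J \<Phi>) = \<Phi>" if "\<Phi> \<in> SE" for \<Phi>
    using bij that unfolding J_def bij_betw_def by (auto intro: inv_into_into f_inv_into_f)
  have \<Psi>_in: "\<Psi> e \<in> SE" if "e \<in> C" for e using bij that by (auto simp: bij_betw_def)
  have \<Psi>_eqI: "e = e'" if "e \<in> C" "e' \<in> C" "\<Psi> e = \<Psi> e'" for e e'
    using that bij by (auto simp: bij_betw_def inj_on_def)
  define E :: "(('v, 'a, 'k) quot_elt, 'y \<times> 'x) module" where "E = \<lparr>carrier = C, mult = undefined, one = undefined, zero = (\<zero>\<^bsub>Y\<^esub>, \<zero>\<^bsub>X\<^esub>),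
    add = (\<lambda>(y, x) (y', x'). (y \<oplus>\<^bsub>Y\<^esub> y', x \<oplus>\<^bsub>X\<^esub> x')),
    smult = (\<lambda>A e. J (act \<nu>E TE (SOME x. x \<in> A) (\<Psi> e)))\<rparr>"
  have smult: "B.coset x \<odot>\<^bsub>E\<^esub> e = J (act \<nu>E TE x (\<Psi> e))" if x: "x \<in> carrier ?kQ" and e: "e \<in> C" for x e
  proof -
    have "(SOME y. y \<in> B.coset x) \<in> B.coset x" using B.coset_self[OF x] by (rule someI)
    then obtain z where z: "z \<in> I" "(SOME y. y \<in> B.coset x) = z + x" using B.coset_elem[OF x] by blast
    have "act \<nu>E TE (z + x) (\<Psi> e) = act \<nu>E TE x (\<Psi> e)"
      unfolding act_add_left ideal_acts_zero_E[OF z(1) \<Psi>_in[OF e]] by simp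
    then show ?thesis by (simp add: E_def z(2))
  qed
  have coE: "B.coords \<nu>E TE SE E \<Psi>"
    unfolding B.coords_def
  proof (intro conjI ballI)
    have cE: "carrier E = C" by (simp add: E_def)
    show "bij_betw \<Psi> (carrier E) SE" unfolding cE by (rule bij)
    show "\<zero>\<^bsub>E\<^esub> \<in> carrier E" by (simp add: E_def C_def)
    show "\<Psi> \<zero>\<^bsub>E\<^esub> = 0" by (auto simp: E_def \<Psi>_def \<Psi>Xz \<Psi>Yz fun_eq_iff split: sum.split)
    fix v assume v: "v \<in> carrier E"
    show "v \<oplus>\<^bsub>E\<^esub> w \<in> carrier E" if "w \<in> carrier E" for w using v that by (auto simp: E_def C_def)
    show "\<Psi> (v \<oplus>\<^bsub>E\<^esub> w) = \<Psi> v + \<Psi> w" if "w \<in> carrier E" for w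
      using v that by (auto simp: E_def C_def \<Psi>_def \<Psi>Xa \<Psi>Ya fun_eq_iff split: sum.split)
    fix x assume x: "x \<in> carrier ?kQ"
    have "act \<nu>E TE x (\<Psi> v) \<in> SE" using v \<Psi>_in SE.sub_act unfolding cE by blast
    then show "B.coset x \<odot>\<^bsub>E\<^esub> v \<in> carrier E" "\<Psi> (B.coset x \<odot>\<^bsub>E\<^esub> v) = act \<nu>E TE x (\<Psi> v)"
      using smult[OF x] J v unfolding cE by auto
  qed
  interpret E: left_module ?R E by (rule B.coords_left_module[OF quiver_subrep_E coE])
  have cE: "carrier E = C" by (simp add: E_def)
  have Em: "B.coset x \<odot>\<^bsub>E\<^esub> e \<in> C" "\<Psi> (B.coset x \<odot>\<^bsub>E\<^esub> e) = act \<nu>E TE x (\<Psi> e)"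
    if "x \<in> carrier ?kQ" "e \<in> C" for x e
    using coE that unfolding B.coords_def cE by blast+
  let ?f = "\<lambda>y. (y, \<zero>\<^bsub>X\<^esub>)"
  have f: "?f \<in> lmod_hom ?R Y E"
    unfolding lmod_hom_def
  proof (intro CollectI conjI ballI Pi_I)
    fix y assume y: "y \<in> carrier Y"
    then show "?f y \<in> carrier E" by (simp add: E_def C_def)
    show "?f (y \<oplus>\<^bsub>Y\<^esub> y') = ?f y \<oplus>\<^bsub>E\<^esub> ?f y'" for y' by (simp add: E_def)
  next
    fix A y assume A: "A \<in> carrier ?R" and y: "y \<in> carrier Y"
    obtain x where x: "x \<in> carrier ?kQ" "A = B.coset x" using A by (rule B.cosetE)
    have fy: "?f y \<in> C" using y by (simp add: C_def)
    have Ay: "A \<odot>\<^bsub>Y\<^esub> y \<in> carrier Y" using A y by (rule Y.lsmult_closed)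
    have zero: "\<Psi> (?f y) \<circ> Inr = 0" using \<Psi>_Inr \<Psi>Xz by simp
    show "?f (A \<odot>\<^bsub>Y\<^esub> y) = A \<odot>\<^bsub>E\<^esub> ?f y"
    proof (rule \<Psi>_eqI)
      show "?f (A \<odot>\<^bsub>Y\<^esub> y) \<in> C" using Ay by (simp add: C_def)
      show "A \<odot>\<^bsub>E\<^esub> ?f y \<in> C" using Em(1)[OF x(1) fy] x by simp
      have "act \<nu>E TE x (\<Psi> (?f y)) \<circ> Inl = \<Psi> (?f (A \<odot>\<^bsub>Y\<^esub> y)) \<circ> Inl"
        unfolding act_E_Inl[OF zero] \<Psi>_Inl using x y by (simp add: \<Psi>Ym)
      moreover have "act \<nu>E TE x (\<Psi> (?f y)) \<circ> Inr = \<Psi> (?f (A \<odot>\<^bsub>Y\<^esub> y)) \<circ> Inr"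
        unfolding act_E_Inr zero \<Psi>_Inr
        by (simp only: snd_conv \<Psi>Xz lin_op_zero[OF quiver_rep.act_lin[OF B.quiver_rep]])
      ultimately have "act \<nu>E TE x (\<Psi> (?f y)) v = \<Psi> (?f (A \<odot>\<^bsub>Y\<^esub> y)) v" for v
        by (cases v) (auto simp: fun_eq_iff)
      then show "\<Psi> (?f (A \<odot>\<^bsub>Y\<^esub> y)) = \<Psi> (A \<odot>\<^bsub>E\<^esub> ?f y)"
        using Em(2)[OF x(1) fy] x by (simp add: fun_eq_iff)
    qed
  qed
  have g: "snd \<in> lmod_hom ?R E X"
    unfolding lmod_hom_def
  proof (intro CollectI conjI ballI Pi_I)
    fix e assume e: "e \<in> carrier E"
    then show "snd e \<in> carrier X" by (auto simp: E_def C_def)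
    show "snd (e \<oplus>\<^bsub>E\<^esub> e') = snd e \<oplus>\<^bsub>X\<^esub> snd e'" for e' by (simp add: E_def case_prod_unfold)
  next
    fix A e assume A: "A \<in> carrier ?R" and e: "e \<in> carrier E"
    obtain x where x: "x \<in> carrier ?kQ" "A = B.coset x" using A by (rule B.cosetE)
    have eC: "e \<in> C" using e unfolding cE .
    have se: "snd e \<in> carrier X" using eC by (auto simp: C_def)
    show "snd (A \<odot>\<^bsub>E\<^esub> e) = A \<odot>\<^bsub>X\<^esub> snd e"
    proof (rule \<Psi>X_eqI)
      show "snd (A \<odot>\<^bsub>E\<^esub> e) \<in> carrier X" using Em(1)[OF x(1) eC] x by (auto simp: C_def)
      show "A \<odot>\<^bsub>X\<^esub> snd e \<in> carrier X" using A se by (rule X.lsmult_closed)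
      have "\<Psi>X (snd (A \<odot>\<^bsub>E\<^esub> e)) = act \<nu>E TE x (\<Psi> e) \<circ> Inr"
        unfolding \<Psi>_Inr[symmetric] x(2) Em(2)[OF x(1) eC] ..
      also have "\<dots> = \<Psi>X (A \<odot>\<^bsub>X\<^esub> snd e)"
        unfolding act_E_Inr \<Psi>_Inr x(2) \<Psi>Xm[OF x(1) se] ..
      finally show "\<Psi>X (snd (A \<odot>\<^bsub>E\<^esub> e)) = \<Psi>X (A \<odot>\<^bsub>X\<^esub> snd e)" .
    qed
  qed
  have "(E, ?f, snd) \<in> extensions ?R X Y"
  proof -
    have "snd ` carrier E = carrier X"
      using Y.M.zero_closed unfolding cE C_def by force
    moreover have "?f ` carrier Y = {e \<in> carrier E. snd e = \<zero>\<^bsub>X\<^esub>}"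
      unfolding cE C_def by auto
    ultimately show ?thesis
      using f g E.left_module_axioms by (auto simp: extensions_def inj_on_def)
  qed
  moreover have "\<not> (\<exists>s\<in>lmod_hom ?R X E. \<forall>x\<in>carrier X. snd (s x) = x)"
  proof
    assume "\<exists>s\<in>lmod_hom ?R X E. \<forall>x\<in>carrier X. snd (s x) = x"
    then obtain s where s: "s \<in> lmod_hom ?R X E" and ss: "\<And>x. x \<in> carrier X \<Longrightarrow> snd (s x) = x" by blast
    define ev where "ev i = inv_into (carrier X) \<Psi>X (B.delta lam i)" for i
    have ev: "ev i \<in> carrier X" "\<Psi>X (ev i) = B.delta lam i" for i
      using bX B.delta_in[OF lam, of i] unfolding ev_def bij_betw_def
      by (auto intro: inv_into_into f_inv_into_f)
    have sC: "s (ev i) \<in> C" for i using lmod_hom_closed[OF s ev(1)] unfolding cE .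
    define h where "h i = \<Psi>Y (fst (s (ev i)))" for i
    have \<Psi>s: "\<Psi> (s (ev i)) \<circ> Inl = h i" "\<Psi> (s (ev i)) \<circ> Inr = B.delta lam i" for i
      unfolding \<Psi>_Inl \<Psi>_Inr h_def by (simp_all add: ss ev)
    show False
    proof (rule no_section[of h])
      fix a i j assume a: "a \<in> arcs Q"
      let ?x = "basis_path (Walk [a]) :: ('v, 'a, 'k) kpath"
      have x: "?x \<in> carrier ?kQ" using a by (simp add: basis_path_def)
      have act: "act \<nu> T ?x \<phi> = T a \<phi>" for \<nu> :: "'j \<Rightarrow> 'v" and T \<phi>
        by (simp add: basis_path_def act_single)
      have "\<Psi> (s (B.coset ?x \<odot>\<^bsub>X\<^esub> ev i)) = TE a (\<Psi> (s (ev i)))"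
        using lmod_hom_smult[OF s B.coset_in[OF x] ev(1)] Em(2)[OF x sC]
        by (simp only: act)
      then have "(\<Psi> (s (B.coset ?x \<odot>\<^bsub>X\<^esub> ev i)) \<circ> Inl) j =
          band_op c a (h i) j + (z\<beta> a (B.delta lam i) j - z\<delta> a (B.delta lam i) j)"
        by (simp only: TE_def comp_apply sum.case \<Psi>s)
      moreover have "(\<Psi> (s (B.coset ?x \<odot>\<^bsub>X\<^esub> ev i)) \<circ> Inl) j =
          (case B.post a i of None \<Rightarrow> 0 | Some i' \<Rightarrow> h i' j)"
      proof -
        have xe: "B.coset ?x \<odot>\<^bsub>X\<^esub> ev i \<in> carrier X" using B.coset_in[OF x] ev(1) by (rule X.lsmult_closed)
        have P: "\<Psi>X (B.coset ?x \<odot>\<^bsub>X\<^esub> ev i) = (case B.post a i of None \<Rightarrow> 0 | Some i' \<Rightarrow> B.delta lam i')"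
          unfolding \<Psi>Xm[OF x ev(1)] ev(2) act B.band_op_delta ..
        show ?thesis
        proof (cases "B.post a i")
          case None
          then have "B.coset ?x \<odot>\<^bsub>X\<^esub> ev i = \<zero>\<^bsub>X\<^esub>"
            using P \<Psi>Xz by (intro \<Psi>X_eqI xe) (simp_all del: B.post.simps)
          then have "s (B.coset ?x \<odot>\<^bsub>X\<^esub> ev i) = \<zero>\<^bsub>E\<^esub>"
            using lmod_hom_zero[OF X.left_module_axioms E.left_module_axioms s] by simp
          then have "\<Psi> (s (B.coset ?x \<odot>\<^bsub>X\<^esub> ev i)) \<circ> Inl = 0"
            unfolding \<Psi>_Inl by (simp add: E_def \<Psi>Yz)
          then show ?thesis using None by simp
        next
          case (Some i')
          then have "B.coset ?x \<odot>\<^bsub>X\<^esub> ev i = ev i'"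
            using P ev by (intro \<Psi>X_eqI xe) (simp_all del: B.post.simps)
          then show ?thesis using Some \<Psi>s(1) by (simp del: B.post.simps)
        qed
      qed
      ultimately show "band_op c a (h i) j + (z\<beta> a (B.delta lam i) j - z\<delta> a (B.delta lam i) j) =
          (case B.post a i of None \<Rightarrow> 0 | Some i' \<Rightarrow> h i' j)" by simp
    qed
  qed
  ultimately show ?thesis using that by blast
qed

end

section \<open>Solving the coboundary equation\<close>

fun posts :: "(int \<Rightarrow> 'a letter) \<Rightarrow> 'a list \<Rightarrow> int \<Rightarrow> int option" where
  "posts b [] i = Some i"
| "posts b (a # as) i = Option.bind (posts b as i)
    (\<lambda>i. if b (i + 1) = Inv a then Some (i + 1) else if b i = Arr a then Some (i - 1) else None)"

text \<open>The Leibniz expansion of a cocycle with values Z on arrows: the coefficient at j of the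
  cocycle of a path, applied to basis vector i. In each term the right part of the path acts on b,
  one arrow crosses to c, and the left part acts on c.\<close>

fun path_coeff :: "(int \<Rightarrow> 'a letter) \<Rightarrow> (int \<Rightarrow> 'a letter) \<Rightarrow> ('a \<Rightarrow> int \<Rightarrow> int \<Rightarrow> 'k) \<Rightarrow>
    'a list \<Rightarrow> int \<Rightarrow> int \<Rightarrow> 'k::field" where
  "path_coeff b c Z [] i j = 0"
| "path_coeff b c Z (a # as) i j =
    (case posts b as i of None \<Rightarrow> 0 | Some i' \<Rightarrow> Z a i' j) +
    (case pre c [a] j of None \<Rightarrow> 0 | Some j' \<Rightarrow> path_coeff b c Z as i j')"

lemma posts_append: "posts b (as @ bs) i = Option.bind (posts b bs i) (posts b as)"
  by (induction as) (auto split: bind_split)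

lemma (in quasi_band_alg) no_rel2_Arr: "b i = Arr x \<Longrightarrow> b (i + 1) = Arr y \<Longrightarrow> \<not> rel [x, y]"
  by (rule no_rel_Arr[of "[x, y]" i]) (auto simp: less_Suc_eq)

lemma (in quasi_band_alg) no_rel2_Inv: "b (i + 1) = Inv x \<Longrightarrow> b i = Inv y \<Longrightarrow> \<not> rel [x, y]"
  by (rule no_rel_Inv[of "[x, y]" "i + 1"]) (auto simp: less_Suc_eq)

text \<open>\<open>Z a i j\<close> is the coefficient at j of the cocycle of a on
  \<open>delta lam i\<close>; the division in \<open>Z_left\<close> reflects
  \<open>delta_shift\<close>. Non-extendability is assumed for all shifts because a common word may
  start anywhere. The inverse of c is covered by a second instance of the locale.\<close>

locale band_cocycle = quasi_band_pair Q I b c m n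
  for Q :: "('v, 'a) pre_digraph" and I :: "('v, 'a, 'k::field) kpath set"
    and b c :: "int \<Rightarrow> 'a letter" and m n :: nat +
  fixes lam mu :: 'k and Z :: "'a \<Rightarrow> int \<Rightarrow> int \<Rightarrow> 'k"
  assumes lam: "lam \<noteq> 0" and mu: "mu \<noteq> 0" and lam_mu: "mu \<noteq> lam"
    and bands: "band Q I (b, m)" "band Q I (c, n)"
    and Z_left: "Z a (i + int m) j = Z a i j / lam"
    and Z_right: "Z a i (j + int n) = mu * Z a i j"
    and Z_graded: "Z a i j \<noteq> 0 \<Longrightarrow> tail Q a = B.vertex i \<and> head Q a = C.vertex j"
    and Z_rel: "B.rel as \<Longrightarrow> as \<noteq> [] \<Longrightarrow> path_coeff b c Z as i j = 0"
    and not_ext: "\<not> extendable Q I (\<lambda>x. b (k + x), m) (\<lambda>x. c (k' + x), n)"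
begin

abbreviation "pc \<equiv> path_coeff b c Z"

text \<open>The difference \<open>h (i + 1) (j + 1) - h i j\<close> imposed by a common letter of \<open>b\<close> and \<open>c\<close>.\<close>

definition step :: "int \<Rightarrow> int \<Rightarrow> 'k" where
  "step i j = (case b (i + 1) of Arr a \<Rightarrow> - Z a (i + 1) j | Inv a \<Rightarrow> Z a i (j + 1))"

definition run :: "int \<Rightarrow> int \<Rightarrow> nat \<Rightarrow> 'k" where
  "run i j r = (\<Sum>t<r. step (i + int t) (j + int t))"

text \<open>The coboundary equation of a compares h at the end of a move along b with h at the start
  of a move along c. Hence \<open>h i j\<close> is involved through the arrows that enter i on b and
  those that leave j on c.\<close>

definition in_b :: "'a \<Rightarrow> int \<Rightarrow> int \<Rightarrow> bool" where
  "in_b a i i' \<longleftrightarrow> b i = Inv a \<and> i' = i - 1 \<or> b (i + 1) = Arr a \<and> i' = i + 1"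

definition out_c :: "'a \<Rightarrow> int \<Rightarrow> int \<Rightarrow> bool" where
  "out_c a j j' \<longleftrightarrow> c j = Arr a \<and> j' = j - 1 \<or> c (j + 1) = Inv a \<and> j' = j + 1"

text \<open>The coboundary equation of an arrow that moves only one of the two positions prescribes \<open>h i j\<close>.\<close>

definition demand :: "int \<Rightarrow> int \<Rightarrow> 'k \<Rightarrow> bool" where
  "demand i j v \<longleftrightarrow> (\<exists>a i'. in_b a i i' \<and> pre c [a] j = None \<and> v = Z a i' j) \<or>
    (\<exists>a j'. out_c a j j' \<and> posts b [a] i = None \<and> v = - Z a i j')"

lemma posts_in_b: "in_b a i i' \<Longrightarrow> posts b [a] i' = Some i"
  using B.reduced_Arr[of "i + 1" a] by (auto simp: in_b_def)

lemma pre_out_c: "out_c a j j' \<Longrightarrow> pre c [a] j' = Some j"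
  using C.reduced_Inv[of "j + 1" a] by (auto simp: out_c_def)

lemma in_b_vertex: "in_b a i i' \<Longrightarrow> a \<in> arcs Q \<and> head Q a = B.vertex i"
  using B.inv_in B.arr_in B.vertex_Arr(1)[of i a] by (auto simp: in_b_def)

lemma out_c_vertex: "out_c a j j' \<Longrightarrow> a \<in> arcs Q \<and> tail Q a = C.vertex j"
  using C.inv_in C.arr_in C.vertex_Inv(2)[of j a] by (auto simp: out_c_def)

text \<open>The expansion of the relation has just two terms: \<alpha> moves along b and \<gamma>
  crosses, or \<alpha> crosses and \<gamma> moves along c. The third possibility is excluded because
  \<alpha> does not act on c at j.\<close>

lemma two_step:
  assumes "in_b \<alpha> i i'" "out_c \<gamma> j j'" "pre c [\<alpha>] j = None" "B.rel [\<gamma>, \<alpha>]"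
  shows "Z \<alpha> i' j = - Z \<gamma> i j'"
proof -
  have "pc [\<gamma>, \<alpha>] i' j' = Z \<gamma> i j' + Z \<alpha> i' j"
    unfolding path_coeff.simps posts_in_b[OF assms(1)] pre_out_c[OF assms(2)] assms(3)
      option.case posts.simps(1) by simp
  then show ?thesis
    using Z_rel[OF assms(4)] by (simp del: path_coeff.simps add: eq_neg_iff_add_eq_0 add.commute)
qed

text \<open>The arrow \<rho> by which b leaves i has a product with \<alpha> outside I. By the
  string algebra axioms it is the only such arrow, and \<gamma> is a different one.\<close>

lemma rel_if_outgoing:
  assumes i: "in_b \<alpha> i i'" and \<rho>: "posts b [\<rho>] i \<noteq> None" and \<gamma>: "posts b [\<gamma>] i = None"
    and arc: "\<gamma> \<in> arcs Q" "tail Q \<gamma> = B.vertex i"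
  shows "B.rel [\<gamma>, \<alpha>]"
proof (rule ccontr)
  assume nr: "\<not> B.rel [\<gamma>, \<alpha>]"
  have \<rho>': "b (i + 1) = Inv \<rho> \<or> b i = Arr \<rho>" using \<rho> by (auto split: if_splits)
  have "\<not> B.rel [\<rho>, \<alpha>]"
  proof (cases "b i = Inv \<alpha>")
    case True
    then have "b (i + 1) = Inv \<rho>" using \<rho>' by auto
    then show ?thesis using True by (intro B.no_rel2_Inv[of i]) auto
  next
    case False
    then have "b (i + 1) = Arr \<alpha>" using i by (auto simp: in_b_def)
    moreover from this have "b i = Arr \<rho>" using \<rho>' by auto
    ultimately show ?thesis by (intro B.no_rel2_Arr[of i]) auto
  qed
  moreover have "\<rho> \<in> arcs Q" "tail Q \<rho> = B.vertex i"
    using \<rho>' B.inv_in B.arr_in B.vertex_Inv(2)[of i \<rho>] by auto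
  ultimately have "\<rho> = \<gamma>"
    using B.unique_after[of \<alpha> \<rho> \<gamma>] nr arc in_b_vertex[OF i] by auto
  then show False using \<rho> \<gamma> by simp
qed

lemma rel_if_incoming:
  assumes j: "out_c \<gamma> j j'" and \<sigma>: "pre c [\<sigma>] j \<noteq> None" and \<alpha>: "pre c [\<alpha>] j = None"
    and arc: "\<alpha> \<in> arcs Q" "head Q \<alpha> = C.vertex j"
  shows "B.rel [\<gamma>, \<alpha>]"
proof (rule ccontr)
  assume nr: "\<not> B.rel [\<gamma>, \<alpha>]"
  have \<sigma>': "c (j + 1) = Arr \<sigma> \<or> c j = Inv \<sigma>" using \<sigma> by (auto split: if_splits)
  have "\<not> B.rel [\<gamma>, \<sigma>]"
  proof (cases "c j = Arr \<gamma>")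
    case True
    then have "c (j + 1) = Arr \<sigma>" using \<sigma>' by auto
    then show ?thesis using True by (intro C.no_rel2_Arr[of j]) auto
  next
    case False
    then have "c (j + 1) = Inv \<gamma>" using j by (auto simp: out_c_def)
    moreover from this have "c j = Inv \<sigma>" using \<sigma>' by auto
    ultimately show ?thesis by (intro C.no_rel2_Inv[of j]) auto
  qed
  moreover have "\<sigma> \<in> arcs Q" "head Q \<sigma> = C.vertex j"
    using \<sigma>' C.inv_in C.arr_in C.vertex_Arr(1)[of j \<sigma>] by auto
  ultimately have "\<sigma> = \<alpha>"
    using B.unique_before[of \<gamma> \<sigma> \<alpha>] nr arc out_c_vertex[OF j] by auto
  then show False using \<sigma> \<alpha> by simp
qed

text \<open>Some arrow \<alpha> by which b enters i satisfies \<open>a\<alpha> \<in> I\<close>, and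
  \<open>Z a i j\<close> is the only term in the expansion of this relation. If b does not enter i
  at all, two of its arrows leave i and a would be a third one starting there.\<close>

lemma isolated_zero:
  assumes a: "a \<in> arcs Q" and post: "posts b [a] i = None" and pre: "pre c [a] j = None"
  shows "Z a i j = 0"
proof (cases "tail Q a = B.vertex i")
  case False
  then show ?thesis using Z_graded by blast
next
  case True
  have key: "Z a i j = 0" if "in_b \<alpha> i i'" "B.rel [a, \<alpha>]" for \<alpha> i'
  proof -
    have "pc [a, \<alpha>] i' j = Z a i j"
      unfolding path_coeff.simps posts_in_b[OF that(1)] pre option.case by simp
    then show ?thesis using Z_rel[OF that(2)] by (simp del: path_coeff.simps)
  qed
  have left: "in_b \<alpha> i (i - 1)" if "b i = Inv \<alpha>" for \<alpha> using that by (simp add: in_b_def)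
  have right: "in_b \<alpha> i (i + 1)" if "b (i + 1) = Arr \<alpha>" for \<alpha> using that by (simp add: in_b_def)
  show ?thesis
  proof (cases "b i")
    case (Inv \<alpha>)
    show ?thesis
    proof (cases "b (i + 1)")
      case (Inv \<rho>)
      then show ?thesis
        using key[OF left] rel_if_outgoing[OF left _ post a True, of \<alpha> \<rho>] \<open>b i = Inv \<alpha>\<close> by simp
    next
      case (Arr \<alpha>')
      have "\<alpha> \<noteq> \<alpha>'" using B.reduced_Inv[OF Inv] Arr by auto
      then have "B.rel [a, \<alpha>] \<or> B.rel [a, \<alpha>']"
        using B.unique_before[of a \<alpha> \<alpha>'] a True in_b_vertex[OF left[OF Inv]] in_b_vertex[OF right[OF Arr]] by auto
      then show ?thesis using key[OF left[OF Inv]] key[OF right[OF Arr]] by blast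
    qed
  next
    case (Arr \<rho>)
    show ?thesis
    proof (cases "b (i + 1)")
      case (Arr \<alpha>)
      then show ?thesis
        using key[OF right] rel_if_outgoing[OF right _ post a True, of \<alpha> \<rho>] \<open>b i = Arr \<rho>\<close> by simp
    next
      case (Inv \<rho>')
      have "\<rho> \<noteq> \<rho>'" using B.reduced_Arr[OF Arr] Inv by auto
      moreover have "a \<noteq> \<rho>" "a \<noteq> \<rho>'" using post Arr Inv by (auto split: if_splits)
      ultimately show ?thesis
        using B.at_most_two_out[of a \<rho> \<rho>'] a True B.arr_in[OF Arr] B.inv_in[OF Inv] B.vertex_Inv(2)[OF Inv] Arr by auto
    qed
  qed
qed

section \<open>Evaluating the Leibniz expansion along a word\<close>

lemma posts_direct:
  "(\<And>r. r < length as \<Longrightarrow> b (i + 1 + int r) = Arr (as ! r)) \<Longrightarrow> posts b as (i + int (length as)) = Some i"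
proof (induction as arbitrary: i)
  case (Cons a as)
  have "posts b as (i + 1 + int (length as)) = Some (i + 1)"
    using Cons.prems[of "Suc _"] by (intro Cons.IH) (simp add: algebra_simps)
  moreover have "b (i + 1) = Arr a" using Cons.prems[of 0] by simp
  moreover from this have "b (i + 1 + 1) \<noteq> Inv a" by (rule B.reduced_Arr)
  moreover have "i + int (length (a # as)) = i + 1 + int (length as)" by simp
  ultimately show ?case by (simp only: posts.simps bind.simps) simp
qed simp

lemma posts_inverse:
  "(\<And>r. r < length as \<Longrightarrow> b (i - int r) = Inv (as ! r)) \<Longrightarrow> posts b as (i - int (length as)) = Some i"
proof (induction as arbitrary: i)
  case (Cons a as)
  have "posts b as (i - 1 - int (length as)) = Some (i - 1)"
    using Cons.prems[of "Suc _"] by (intro Cons.IH) (simp add: algebra_simps)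
  moreover have "b i = Inv a" using Cons.prems[of 0] by simp
  moreover have "i - int (length (a # as)) = i - 1 - int (length as)" by simp
  ultimately show ?case by (simp only: posts.simps bind.simps) simp
qed simp

text \<open>A crossing at an arrow of ps would require \<open>rest\<close> to act on b first, which
  it does not. So the leading arrows only shift the position on c.\<close>

lemma pc_peel_direct:
  assumes "\<And>r. r < length ps \<Longrightarrow> c (j + 1 + int r) = Arr (ps ! r)" "posts b rest i = None"
  shows "pc (ps @ rest) i j = pc rest i (j + int (length ps))"
  using assms(1)
proof (induction ps arbitrary: j)
  case (Cons p ps)
  have none: "posts b (ps @ rest) i = None" by (simp add: posts_append assms(2))
  have "c (j + 1) = Arr p" using Cons.prems[of 0] by simp
  moreover have "pc (ps @ rest) i (j + 1) = pc rest i (j + 1 + int (length ps))"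
    using Cons.prems[of "Suc _"] by (intro Cons.IH) (simp add: algebra_simps)
  moreover have "j + int (length (p # ps)) = j + 1 + int (length ps)" by simp
  ultimately show ?case using none by (simp only: append_Cons path_coeff.simps pre.simps) simp
qed simp

lemma pc_peel_inverse:
  assumes "\<And>r. r < length ps \<Longrightarrow> c (j - int r) = Inv (ps ! r)" "posts b rest i = None"
  shows "pc (ps @ rest) i j = pc rest i (j - int (length ps))"
  using assms(1)
proof (induction ps arbitrary: j)
  case (Cons p ps)
  have none: "posts b (ps @ rest) i = None" by (simp add: posts_append assms(2))
  have "c j = Inv p" using Cons.prems[of 0] by simp
  moreover from this have "c (j + 1) \<noteq> Arr p" by (rule C.reduced_Inv)
  moreover have "pc (ps @ rest) i (j - 1) = pc rest i (j - 1 - int (length ps))"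
    using Cons.prems[of "Suc _"] by (intro Cons.IH) (simp add: algebra_simps)
  moreover have "j - int (length (p # ps)) = j - 1 - int (length ps)" by simp
  ultimately show ?case using none by (simp only: append_Cons path_coeff.simps pre.simps) simp
qed simp

text \<open>Along the common word each arrow acts on b and on c, so each may be the crossing one and
  contributes one summand of \<open>run\<close>. Direct letters enter \<open>step\<close> with a
  minus sign, inverse ones with a plus sign, hence the opposite sign in
  \<open>pc_run_inverse\<close>.\<close>

lemma pc_run_direct:
  assumes "length ws = l"
    and "\<And>r. r < length (ws @ rest) \<Longrightarrow> b (i + 1 + int r) = Arr ((ws @ rest) ! r)"
    and "\<And>r. r < l \<Longrightarrow> c (j + 1 + int r) = Arr (ws ! r)"
  shows "pc (ws @ rest) (i + int (length (ws @ rest))) j =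
    pc rest (i + int (length (ws @ rest))) (j + int l) - run i j l"
  using assms
proof (induction ws arbitrary: i j l)
  case (Cons a ws)
  let ?e = "i + int (length ((a # ws) @ rest))"
  obtain l' where l: "l = Suc l'" "length ws = l'" using Cons.prems(1) by auto
  have e: "?e = i + 1 + int (length (ws @ rest))" by simp
  have b: "b (i + 1 + 1 + int r) = Arr ((ws @ rest) ! r)" if "r < length (ws @ rest)" for r
    using Cons.prems(2)[of "Suc r"] that by (simp add: algebra_simps)
  have ba: "b (i + 1) = Arr a" using Cons.prems(2)[of 0] by simp
  have st: "step i j = - Z a (i + 1) j" by (simp add: step_def ba)
  have ca: "c (j + 1) = Arr a" using Cons.prems(3)[of 0] l by simp
  have "posts b (ws @ rest) ?e = Some (i + 1)"
    unfolding e by (rule posts_direct[OF b])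
  then have "pc ((a # ws) @ rest) ?e j = Z a (i + 1) j + pc (ws @ rest) ?e (j + 1)"
    using ca by simp
  also have "pc (ws @ rest) ?e (j + 1) = pc rest ?e (j + 1 + int l') - run (i + 1) (j + 1) l'"
    unfolding e
  proof (rule Cons.IH[OF l(2) b])
    show "c (j + 1 + 1 + int r) = Arr (ws ! r)" if "r < l'" for r
      using Cons.prems(3)[of "Suc r"] that l by (simp add: algebra_simps)
  qed
  also have "run (i + 1) (j + 1) l' = run i j l + Z a (i + 1) j"
    unfolding run_def l(1) sum.lessThan_Suc_shift by (simp add: st algebra_simps)
  finally show ?case by (simp add: l(1) algebra_simps)
qed (simp add: run_def)

lemma pc_run_inverse:
  assumes "length ws = l"
    and "\<And>r. r < length (ws @ rest) \<Longrightarrow> b (i + int l - int r) = Inv ((ws @ rest) ! r)"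
    and "\<And>r. r < l \<Longrightarrow> c (j + int l - int r) = Inv (ws ! r)"
  shows "pc (ws @ rest) (i + int l - int (length (ws @ rest))) (j + int l) =
    pc rest (i + int l - int (length (ws @ rest))) j + run i j l"
  using assms
proof (induction ws arbitrary: l)
  case (Cons a ws)
  let ?e = "i + int l - int (length ((a # ws) @ rest))"
  obtain l' where l: "l = Suc l'" "length ws = l'" using Cons.prems(1) by auto
  have e: "?e = i + int l' - int (length (ws @ rest))" by (simp add: l)
  have b: "b (i + int l' - int r) = Inv ((ws @ rest) ! r)" if "r < length (ws @ rest)" for r
    using Cons.prems(2)[of "Suc r"] that by (simp add: l algebra_simps)
  have c: "c (j + int l' - int r) = Inv (ws ! r)" if "r < l'" for r
    using Cons.prems(3)[of "Suc r"] that by (simp add: l algebra_simps)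
  have ba: "b (i + int l' + 1) = Inv a" using Cons.prems(2)[of 0] by (simp add: l algebra_simps)
  have ca: "c (j + int l) = Inv a" using Cons.prems(3)[of 0] l by simp
  then have ca': "c (j + int l + 1) \<noteq> Arr a" by (rule C.reduced_Inv)
  have "posts b (ws @ rest) ?e = Some (i + int l')"
    unfolding e by (rule posts_inverse[OF b])
  moreover have "pre c [a] (j + int l) = Some (j + int l')" using ca ca' by (simp add: l)
  ultimately have "pc ((a # ws) @ rest) ?e (j + int l) =
      Z a (i + int l') (j + int l) + pc (ws @ rest) ?e (j + int l')"
    by (simp only: append_Cons path_coeff.simps option.case)
  also have "pc (ws @ rest) ?e (j + int l') = pc rest ?e j + run i j l'"
    unfolding e by (rule Cons.IH[OF l(2) b c])
  also have "Z a (i + int l') (j + int l) = step (i + int l') (j + int l')"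
    using ba by (simp add: step_def l algebra_simps)
  finally show ?case by (simp add: l(1) run_def algebra_simps)
qed (simp add: run_def)

text \<open>This is where non-extendability enters: the relation that prevents the two bands from being
  crossed along their common word forces the prescribed values at its two ends to fit together.\<close>

lemma segment:
  assumes bi: "b i = Inv \<alpha>" and br: "b (i + int l + 1) = Arr \<beta>"
    and cj: "c j = Arr \<gamma>" and cr: "c (j + int l + 1) = Inv \<delta>"
    and vert: "B.vertex i = C.vertex j"
    and eq: "\<And>r. 1 \<le> r \<Longrightarrow> r \<le> int l \<Longrightarrow> b (i + r) = c (j + r)"
  shows "- Z \<gamma> i (j - 1) + run i j l = Z \<beta> (i + int l + 1) (j + int l) \<or>
    Z \<alpha> (i - 1) j + run i j l = - Z \<delta> (i + int l) (j + int l + 1)"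
proof -
  let ?b = "\<lambda>x. b (i + x)" and ?c = "\<lambda>x. c (j + x)"
  interpret S: quasi_band_pair Q I ?b ?c m n
    by (intro quasi_band_pair.intro quasi_band_alg.intro quasi_band_alg_axioms.intro
        B.string_quiver_axioms B.quasi_band_shift B.quasi_band C.quasi_band)
  have ov: "overlap Q ?b ?c l"
    using bi br cj cr vert eq by (auto simp: overlap_def add.assoc)
  \<comment> \<open>The shifted bands meet all other requirements of extendability, so only a bad
    relation can be the obstruction.\<close>
  have "S.bad_direct l \<or> S.bad_inverse l"
    using S.extendableI[OF B.band_shift[OF bands(1)] B.band_shift[OF bands(2)] ov] not_ext by blast
  then show ?thesis
  proof
    assume "S.bad_direct l"
    then obtain as p q where as: "B.rel as" "length as = p + q" "p \<ge> 1" "q \<ge> l + 1"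
      and p: "\<And>r. r < p \<Longrightarrow> c (j + (int r - int p + 1)) = Arr (as ! r)"
      and q: "\<And>r. r < q \<Longrightarrow> b (i + (int r + 1)) = Arr (as ! (p + r))"
      by (auto simp: S.bad_direct_def)
    \<comment> \<open>The relation has the form \<open>ps \<gamma> ws \<beta> rs\<close> with the
      common word ws. Crossings in ps vanish because \<gamma> does not act on b at i, those in rs
      because \<beta> does not act on c at j + l. The crossings at \<gamma>, in ws and at \<beta>
      remain and add up to 0.\<close>
    define ps where "ps = take (p - 1) as"
    define ws where "ws = take l (drop p as)"
    define rs where "rs = drop (Suc l) (drop p as)"
    have \<gamma>: "as ! (p - 1) = \<gamma>" using p[of "p - 1"] as cj by (simp add: of_nat_diff)
    have \<beta>: "as ! (p + l) = \<beta>" using q[of l] as br by (simp add: algebra_simps)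
    have dr: "drop p as = ws @ \<beta> # rs"
      using id_take_nth_drop[of l "drop p as"] as \<beta> by (simp add: ws_def rs_def)
    have split: "as = ps @ \<gamma> # ws @ \<beta> # rs"
      using id_take_nth_drop[of "p - 1" as] as \<gamma> dr by (simp add: ps_def)
    have lws: "length ws = l" and lps: "length ps = p - 1" using as by (auto simp: ws_def ps_def)
    have lrest: "length (ws @ \<beta> # rs) = q" using as by (simp flip: dr)
    have bq: "b (i + 1 + int r) = Arr ((ws @ \<beta> # rs) ! r)" if "r < length (ws @ \<beta> # rs)" for r
      using q[of r] that as by (simp flip: dr add: lrest[folded dr] algebra_simps)
    have ca: "c (j + 1 + int r) = Arr (ws ! r)" if "r < l" for r
      using eq[of "1 + int r"] bq[of r] that lws by (simp add: nth_append add.assoc)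
    let ?e = "i + int (length (ws @ \<beta> # rs))"
    have post_w: "posts b (ws @ \<beta> # rs) ?e = Some i" by (rule posts_direct[OF bq])
    have b1: "b (i + 1) = Arr (as ! p)" using q[of 0] as by simp
    have none: "posts b (\<gamma> # ws @ \<beta> # rs) ?e = None"
      unfolding posts.simps(2) post_w using bi b1 by simp
    have "pc as ?e (j - int p) = pc (\<gamma> # ws @ \<beta> # rs) ?e (j - int p + int (length ps))"
      unfolding split
    proof (rule pc_peel_direct[OF _ none])
      show "c (j - int p + 1 + int r) = Arr (ps ! r)" if r: "r < length ps" for r
      proof -
        have "r < p" "r < p - 1" using r lps by linarith+
        then show ?thesis using p[of r] by (simp add: ps_def algebra_simps)
      qed
    qed
    also have "j - int p + int (length ps) = j - 1" using lps as by simp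
    also have "pc (\<gamma> # ws @ \<beta> # rs) ?e (j - 1) = Z \<gamma> i (j - 1) + pc (ws @ \<beta> # rs) ?e j"
      using cj by (simp only: path_coeff.simps post_w option.case pre.simps) simp
    also have "pc (ws @ \<beta> # rs) ?e j = pc (\<beta> # rs) ?e (j + int l) - run i j l"
      by (rule pc_run_direct[OF lws bq ca])
    also have "pc (\<beta> # rs) ?e (j + int l) = Z \<beta> (i + int l + 1) (j + int l)"
    proof -
      have "posts b rs (i + int l + 1 + int (length rs)) = Some (i + int l + 1)"
      proof (rule posts_direct)
        fix r assume "r < length rs"
        then show "b (i + int l + 1 + 1 + int r) = Arr (rs ! r)"
          using bq[of "l + Suc r"] lws by (simp add: nth_append algebra_simps)
      qed
      moreover have "i + int l + 1 + int (length rs) = ?e" using lws by simp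
      moreover have "c (j + int l) \<noteq> Inv \<beta>"
      proof (cases "l = 0")
        case False
        then have "c (j + int l) = b (i + int l)" using eq[of "int l"] by simp
        then show ?thesis using B.reduced_Inv[of "i + int l" \<beta>] br by auto
      qed (use cj in auto)
      ultimately show ?thesis using cr by simp
    qed
    finally show ?thesis using Z_rel[OF as(1)] split by (simp add: algebra_simps)
  next
    assume "S.bad_inverse l"
    then obtain as p q where as: "B.rel as" "length as = q + p" "p \<ge> 1" "q \<ge> l + 1"
      and q: "\<And>r. r < q \<Longrightarrow> c (j + (int q - int r)) = Inv (as ! r)"
      and p: "\<And>r. r < p \<Longrightarrow> b (i + (- int r)) = Inv (as ! (q + r))"
      by (auto simp: S.bad_inverse_def)
    \<comment> \<open>Now the relation has the form \<open>ps \<delta> ws \<alpha> rs\<close>, where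
      \<delta> has index k and ws is the common word read backwards.\<close>
    define k where "k = q - Suc l"
    have k: "q = k + Suc l" using as by (simp add: k_def)
    define ps where "ps = take k as"
    define ws where "ws = take l (drop (Suc k) as)"
    define rs where "rs = drop (Suc q) as"
    have \<delta>: "as ! k = \<delta>" using q[of k] cr k by (simp add: algebra_simps)
    have \<alpha>: "as ! q = \<alpha>" using p[of 0] as bi by simp
    have dq: "drop q as = \<alpha> # rs" using Cons_nth_drop_Suc[of q as] as \<alpha> by (simp add: rs_def)
    have dk: "drop (Suc k) as = ws @ \<alpha> # rs"
      using append_take_drop_id[of l "drop (Suc k) as"] dq k by (simp add: ws_def add.commute)
    have split: "as = ps @ \<delta> # ws @ \<alpha> # rs"
      using id_take_nth_drop[of k as] as \<delta> dk k by (simp add: ps_def)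
    have lws: "length ws = l" and lps: "length ps = k" using as k by (auto simp: ws_def ps_def)
    have nth_rest: "(ws @ \<alpha> # rs) ! r = as ! (Suc k + r)" for r
      using as k by (cases "Suc k + r < length as") (simp_all flip: dk)
    have lrest: "length (ws @ \<alpha> # rs) = l + p" using as k by (simp flip: dk)
    have cw: "c (j + int l - int r) = Inv (ws ! r)" if "r < l" for r
    proof -
      have "int q - int (Suc k + r) = int l - int r" using k by simp
      then have "c (j + (int l - int r)) = Inv (as ! (Suc k + r))" using q[of "Suc k + r"] that k by simp
      then show ?thesis using nth_rest[of r] that lws by (simp add: nth_append algebra_simps)
    qed
    have bw: "b (i + int l - int r) = Inv ((ws @ \<alpha> # rs) ! r)" if r: "r < length (ws @ \<alpha> # rs)" for r
    proof (cases "r < l")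
      case True
      then show ?thesis using cw[OF True] eq[of "int l - int r"] lws by (simp add: nth_append algebra_simps)
    next
      case False
      then have "i + int l - int r = i + (- int (r - l))" "q + (r - l) = Suc k + r" using k by simp_all
      moreover have "r - l < p" using r lrest False by linarith
      ultimately show ?thesis using p[of "r - l"] nth_rest[of r] by (simp only:)
    qed
    let ?e = "i + int l - int (length (ws @ \<alpha> # rs))"
    have post_w: "posts b (ws @ \<alpha> # rs) ?e = Some (i + int l)" by (rule posts_inverse[OF bw])
    have bl: "b (i + int l) = Inv ((ws @ \<alpha> # rs) ! 0)" using bw[of 0] by simp
    have none: "posts b (\<delta> # ws @ \<alpha> # rs) ?e = None"
      unfolding posts.simps(2) post_w using br bl by simp
    have "pc as ?e (j + int q) = pc (\<delta> # ws @ \<alpha> # rs) ?e (j + int q - int (length ps))"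
      unfolding split
    proof (rule pc_peel_inverse[OF _ none])
      show "c (j + int q - int r) = Inv (ps ! r)" if r: "r < length ps" for r
        using q[of r] r lps k by (simp add: ps_def algebra_simps)
    qed
    also have "j + int q - int (length ps) = j + int l + 1" using lps k by simp
    also have "pc (\<delta> # ws @ \<alpha> # rs) ?e (j + int l + 1) =
        Z \<delta> (i + int l) (j + int l + 1) + pc (ws @ \<alpha> # rs) ?e (j + int l)"
      using cr C.reduced_Inv[OF cr] by (simp only: path_coeff.simps post_w option.case pre.simps) simp
    also have "pc (ws @ \<alpha> # rs) ?e (j + int l) = pc (\<alpha> # rs) ?e j + run i j l"
      by (rule pc_run_inverse[OF lws bw cw])
    also have "pc (\<alpha> # rs) ?e j = Z \<alpha> (i - 1) j"
    proof -
      have "posts b rs (i - 1 - int (length rs)) = Some (i - 1)"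
      proof (rule posts_inverse)
        fix r assume "r < length rs"
        then show "b (i - 1 - int r) = Inv (rs ! r)"
          using bw[of "l + Suc r"] lws by (simp add: nth_append algebra_simps)
      qed
      moreover have "i - 1 - int (length rs) = ?e" using lws by simp
      moreover have "c (j + 1) \<noteq> Arr \<alpha>"
        using eq[of 1] cr B.reduced_Inv[OF bi] by (cases "l = 0") auto
      ultimately show ?thesis using cj by simp
    qed
    finally show ?thesis using Z_rel[OF as(1)] split by (simp add: eq_neg_iff_add_eq_0 algebra_simps)
  qed
qed

section \<open>Compatibility of the prescribed values\<close>

lemma demand_cases:
  assumes "demand i j v"
  obtains (X) a i' where "in_b a i i'" "pre c [a] j = None" "v = Z a i' j"
  | (Y) a j' where "out_c a j j'" "posts b [a] i = None" "v = - Z a i j'"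
  using assms by (auto simp: demand_def simp del: pre.simps posts.simps)

text \<open>An arrow entering i and one leaving j give the same value if their product is a
  relation. If it is not, or if two different arrows of the same kind prescribe a value, then both
  letters of b around i enter it and both letters of c around j leave it. This position with four
  demands is settled by non-extendability for the empty common word, used for c and, through
  \<open>flip\<close>, for its inverse.\<close>

lemma demand_unique:
  assumes flip: "\<And>\<alpha> \<beta> \<gamma> \<delta>. b i = Inv \<alpha> \<Longrightarrow> b (i + 1) = Arr \<beta> \<Longrightarrow> c j = Arr \<gamma> \<Longrightarrow> c (j + 1) = Inv \<delta> \<Longrightarrow>
      - Z \<delta> i (j + 1) = Z \<beta> (i + 1) j \<or> Z \<alpha> (i - 1) j = - Z \<gamma> i (j - 1)"
    and vert: "B.vertex i = C.vertex j"
    and v: "demand i j v" and v': "demand i j v'"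
  shows "v = v'"
proof -
  have both: "v = v'" if ii: "\<And>\<rho>. posts b [\<rho>] i = None" and jj: "\<And>\<sigma>. pre c [\<sigma>] j = None"
  proof -
    have nb: "b i \<noteq> Arr \<rho>" "b (i + 1) \<noteq> Inv \<rho>" for \<rho> using ii[of \<rho>] by (auto split: if_splits)
    have nc: "c (j + 1) \<noteq> Arr \<sigma>" "c j \<noteq> Inv \<sigma>" for \<sigma> using jj[of \<sigma>] by (auto split: if_splits)
    obtain \<alpha> where \<alpha>: "b i = Inv \<alpha>" using nb by (cases "b i") auto
    obtain \<beta> where \<beta>: "b (i + 1) = Arr \<beta>" using nb by (cases "b (i + 1)") auto
    obtain \<gamma> where \<gamma>: "c j = Arr \<gamma>" using nc by (cases "c j") auto
    obtain \<delta> where \<delta>: "c (j + 1) = Inv \<delta>" using nc by (cases "c (j + 1)") auto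
    let ?A = "Z \<alpha> (i - 1) j" and ?B = "Z \<beta> (i + 1) j" and ?C = "- Z \<gamma> i (j - 1)" and ?D = "- Z \<delta> i (j + 1)"
    have i\<alpha>: "in_b \<alpha> i (i - 1)" and i\<beta>: "in_b \<beta> i (i + 1)" and j\<gamma>: "out_c \<gamma> j (j - 1)" and j\<delta>: "out_c \<delta> j (j + 1)"
      using \<alpha> \<beta> \<gamma> \<delta> by (auto simp: in_b_def out_c_def)
    have rels: "B.rel [\<gamma>, \<alpha>] \<longrightarrow> ?A = ?C" "B.rel [\<gamma>, \<beta>] \<longrightarrow> ?B = ?C"
      "B.rel [\<delta>, \<alpha>] \<longrightarrow> ?A = ?D" "B.rel [\<delta>, \<beta>] \<longrightarrow> ?B = ?D"
      using two_step[OF i\<alpha> j\<gamma> jj] two_step[OF i\<beta> j\<gamma> jj] two_step[OF i\<alpha> j\<delta> jj] two_step[OF i\<beta> j\<delta> jj] by auto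
    note arcs = in_b_vertex[OF i\<alpha>] in_b_vertex[OF i\<beta>] out_c_vertex[OF j\<gamma>] out_c_vertex[OF j\<delta>]
    have ne: "\<alpha> \<noteq> \<beta>" "\<gamma> \<noteq> \<delta>" using B.reduced_Inv[OF \<alpha>] \<beta> C.reduced_Arr[OF \<gamma>] \<delta> by auto
    have uniq: "B.rel [\<gamma>, \<alpha>] \<or> B.rel [\<gamma>, \<beta>]" "B.rel [\<delta>, \<alpha>] \<or> B.rel [\<delta>, \<beta>]"
      "B.rel [\<gamma>, \<alpha>] \<or> B.rel [\<delta>, \<alpha>]" "B.rel [\<gamma>, \<beta>] \<or> B.rel [\<delta>, \<beta>]"
      using B.unique_before[of \<gamma> \<alpha> \<beta>] B.unique_before[of \<delta> \<alpha> \<beta>]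
        B.unique_after[of \<alpha> \<gamma> \<delta>] B.unique_after[of \<beta> \<gamma> \<delta>] arcs ne vert by auto
    have "?C = ?B \<or> ?A = ?D"
      using segment[of i \<alpha> 0 \<beta> j \<gamma> \<delta>] \<alpha> \<beta> \<gamma> \<delta> vert by (simp add: run_def)
    moreover have "?D = ?B \<or> ?A = ?C" by (rule flip[OF \<alpha> \<beta> \<gamma> \<delta>])
    \<comment> \<open>The branching conditions provide a perfect matching between the values
      \<open>?A\<close>, \<open>?B\<close> and the values \<open>?C\<close>, \<open>?D\<close>.
      Whichever of the two matchings it is, one of the two disjunctions links its edges.\<close>
    ultimately have all: "?A = ?B" "?B = ?C" "?C = ?D" using rels uniq by metis+
    have "w = ?A" if "demand i j w" for w
      using that
    proof (cases rule: demand_cases)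
      case (X a i')
      then have "w = ?A \<or> w = ?B" using \<alpha> \<beta> by (auto simp: in_b_def)
      then show ?thesis using all by auto
    next
      case (Y a j')
      then have "w = ?C \<or> w = ?D" using \<gamma> \<delta> by (auto simp: out_c_def)
      then show ?thesis using all by auto
    qed
    then show ?thesis using v v' by metis
  qed
  have XY: "w = w'" if X: "in_b \<alpha> i i'" "pre c [\<alpha>] j = None" "w = Z \<alpha> i' j"
    and Y: "out_c \<gamma> j j'" "posts b [\<gamma>] i = None" "w' = - Z \<gamma> i j'" and vv: "w = v \<and> w' = v' \<or> w = v' \<and> w' = v"
    for \<alpha> i' \<gamma> j' w w'
  proof (cases "B.rel [\<gamma>, \<alpha>]")
    case True
    then show ?thesis using two_step[OF X(1) Y(1) X(2)] X Y by simp
  next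
    case False
    have "posts b [\<rho>] i = None" for \<rho>
      using rel_if_outgoing[OF X(1) _ Y(2)] out_c_vertex[OF Y(1)] vert False by metis
    moreover have "pre c [\<sigma>] j = None" for \<sigma>
      using rel_if_incoming[OF Y(1) _ X(2)] in_b_vertex[OF X(1)] vert False by metis
    ultimately have "v = v'" by (rule both)
    then show ?thesis using vv by auto
  qed
  from v show ?thesis
  proof (cases rule: demand_cases)
    case v: (X \<alpha> i')
    from v' show ?thesis
    proof (cases rule: demand_cases)
      case v': (X \<alpha>' i'')
      show ?thesis
      proof (cases "\<alpha> = \<alpha>'")
        case True
        have "i' = i''" using v(1) v'(1) True B.reduced_Inv[of i \<alpha>] by (auto simp: in_b_def)
        then show ?thesis using True v v' by simp
      next
        case False
        \<comment> \<open>Two different arrows entering i use up both letters of b around i, so none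
          leaves it; an arrow entering j on c would be a third one ending at that vertex.\<close>
        have "posts b [\<rho>] i = None" for \<rho>
          using v(1) v'(1) False by (auto simp: in_b_def)
        moreover have "pre c [\<sigma>] j = None" for \<sigma>
        proof (rule ccontr)
          assume *: "pre c [\<sigma>] j \<noteq> None"
          then have "c (j + 1) = Arr \<sigma> \<or> c j = Inv \<sigma>" by (auto split: if_splits)
          then have "\<sigma> \<in> arcs Q" "head Q \<sigma> = C.vertex j"
            using C.inv_in C.arr_in C.vertex_Arr(1)[of j \<sigma>] by auto
          moreover have "\<sigma> \<noteq> \<alpha>" "\<sigma> \<noteq> \<alpha>'" using * v v' by metis+
          ultimately show False
            using B.at_most_two_in[of \<sigma> \<alpha> \<alpha>'] False vert in_b_vertex[OF v(1)] in_b_vertex[OF v'(1)] by auto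
        qed
        ultimately show ?thesis by (rule both)
      qed
    next
      case v': (Y \<gamma> j')
      show ?thesis by (rule XY[OF v v']) simp
    qed
  next
    case v: (Y \<gamma> j')
    from v' show ?thesis
    proof (cases rule: demand_cases)
      case v': (X \<alpha> i')
      show ?thesis by (rule XY[OF v' v, symmetric]) simp
    next
      case v': (Y \<gamma>' j'')
      show ?thesis
      proof (cases "\<gamma> = \<gamma>'")
        case True
        have "j' = j''" using v(1) v'(1) True C.reduced_Arr[of j \<gamma>] by (auto simp: out_c_def)
        then show ?thesis using True v v' by simp
      next
        case False
        have "pre c [\<sigma>] j = None" for \<sigma>
          using v(1) v'(1) False by (auto simp: out_c_def)
        moreover have "posts b [\<rho>] i = None" for \<rho>
        proof (rule ccontr)
          assume *: "posts b [\<rho>] i \<noteq> None"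
          then have "b (i + 1) = Inv \<rho> \<or> b i = Arr \<rho>" by (auto split: if_splits)
          then have "\<rho> \<in> arcs Q" "tail Q \<rho> = B.vertex i"
            using B.inv_in B.arr_in B.vertex_Inv(2)[of i \<rho>] by auto
          moreover have "\<rho> \<noteq> \<gamma>" "\<rho> \<noteq> \<gamma>'" using * v v' by metis+
          ultimately show False
            using B.at_most_two_out[of \<rho> \<gamma> \<gamma>'] False vert out_c_vertex[OF v(1)] out_c_vertex[OF v'(1)] by auto
        qed
        ultimately show ?thesis using both by blast
      qed
    qed
  qed
qed

text \<open>Left letters that differ but have the same direction contradict the branching
  conditions, given the common letter on the right. A direct \<open>b i\<close> with an inverse
  \<open>c j\<close> produces no demand. What remains is the configuration at the left end of w in
  an extendable pair.\<close>

lemma demand_left_end: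
  assumes d: "demand i j v" and match: "b (i + 1) = c (j + 1)" and end': "b i \<noteq> c j"
  shows "\<exists>\<alpha> \<gamma>. b i = Inv \<alpha> \<and> c j = Arr \<gamma> \<and> demand i j (Z \<alpha> (i - 1) j) \<and> demand i j (- Z \<gamma> i (j - 1))"
proof -
  have vert: "B.vertex i = C.vertex j" using match B.composable[of i] C.composable[of j] by simp
  show ?thesis
  proof (cases "b i")
    case (Inv \<alpha>)
    show ?thesis
    proof (cases "c j")
      case (Arr \<gamma>)
      have "pre c [\<alpha>] j = None" using Arr B.reduced_Inv[OF Inv] match by simp
      moreover have "posts b [\<gamma>] i = None" using Inv C.reduced_Arr[OF Arr] match by simp
      ultimately show ?thesis
        using Inv Arr by (auto simp: demand_def in_b_def out_c_def simp del: pre.simps posts.simps)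
    next
      case (Inv \<sigma>)
      have ne: "\<alpha> \<noteq> \<sigma>" using end' Inv \<open>b i = Inv \<alpha>\<close> by auto
      show ?thesis
      proof (cases "b (i + 1)")
        case (Arr \<rho>)
        then have "\<rho> \<noteq> \<alpha>" "\<rho> \<noteq> \<sigma>" using match B.reduced_Inv[OF \<open>b i = Inv \<alpha>\<close>] C.reduced_Inv[OF Inv] by auto
        then show ?thesis
          using B.at_most_two_in[of \<rho> \<alpha> \<sigma>] ne B.arr_in[OF Arr] B.inv_in[OF \<open>b i = Inv \<alpha>\<close>] C.inv_in[OF Inv]
            B.vertex_Arr(1)[OF Arr] vert Inv \<open>b i = Inv \<alpha>\<close> by auto
      next
        case Inv': (Inv \<rho>)
        have "\<not> B.rel [\<rho>, \<alpha>]"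
          using Inv' \<open>b i = Inv \<alpha>\<close> by (intro B.no_rel2_Inv[of i]) auto
        moreover have "\<not> B.rel [\<rho>, \<sigma>]"
          using Inv' match Inv by (intro C.no_rel2_Inv[of j]) auto
        ultimately show ?thesis
          using B.unique_before[of \<rho> \<alpha> \<sigma>] ne B.inv_in[OF Inv'] B.inv_in[OF \<open>b i = Inv \<alpha>\<close>] C.inv_in[OF Inv]
            B.vertex_Inv(2)[OF Inv'] vert Inv \<open>b i = Inv \<alpha>\<close> by auto
      qed
    qed
  next
    case (Arr a)
    show ?thesis
    proof (cases "c j")
      case (Inv \<sigma>)
      from d show ?thesis
      proof (cases rule: demand_cases)
        case (X a' i')
        then show ?thesis using Arr Inv match by (auto simp: in_b_def)
      next
        case (Y a' j')
        then show ?thesis using Arr Inv match by (auto simp: out_c_def)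
      qed
    next
      case Arr': (Arr a')
      have ne: "a \<noteq> a'" using end' Arr Arr' by auto
      show ?thesis
      proof (cases "b (i + 1)")
        case (Inv \<rho>)
        then have "\<rho> \<noteq> a" "\<rho> \<noteq> a'" using match B.reduced_Arr[OF Arr] C.reduced_Arr[OF Arr'] by auto
        then show ?thesis
          using B.at_most_two_out[of \<rho> a a'] ne B.inv_in[OF Inv] B.arr_in[OF Arr] C.arr_in[OF Arr']
            B.vertex_Inv(2)[OF Inv] vert Arr Arr' by auto
      next
        case Arr'': (Arr \<rho>)
        have "\<not> B.rel [a, \<rho>]"
          using Arr Arr'' by (intro B.no_rel2_Arr[of i]) auto
        moreover have "\<not> B.rel [a', \<rho>]"
          using Arr' Arr'' match by (intro C.no_rel2_Arr[of j]) auto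
        moreover have "tail Q a = head Q \<rho>"
          using B.vertex_Arr(1)[OF Arr''] B.vertex_Arr(2)[OF Arr] by simp
        moreover have "tail Q a' = head Q \<rho>"
          using B.vertex_Arr(1)[OF Arr''] C.vertex_Arr(2)[OF Arr'] vert by simp
        ultimately have "a = a'"
          using B.unique_after[OF B.arr_in[OF Arr''] B.arr_in[OF Arr] C.arr_in[OF Arr']] by blast
        then show ?thesis using ne by blast
      qed
    qed
  qed
qed

lemma demand_right_end:
  assumes d: "demand i j v" and match: "b i = c j" and end': "b (i + 1) \<noteq> c (j + 1)"
  shows "\<exists>\<beta> \<delta>. b (i + 1) = Arr \<beta> \<and> c (j + 1) = Inv \<delta> \<and> demand i j (Z \<beta> (i + 1) j) \<and> demand i j (- Z \<delta> i (j + 1))"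
proof -
  have vert: "B.vertex i = C.vertex j" using match by simp
  show ?thesis
  proof (cases "b (i + 1)")
    case (Arr \<beta>)
    show ?thesis
    proof (cases "c (j + 1)")
      case (Inv \<delta>)
      have "c j \<noteq> Inv \<beta>" using match B.reduced_Inv[of i \<beta>] Arr by auto
      then have "pre c [\<beta>] j = None" using Inv by simp
      moreover have "b i \<noteq> Arr \<delta>" using match C.reduced_Arr[of j \<delta>] Inv by auto
      then have "posts b [\<delta>] i = None" using Arr by simp
      ultimately show ?thesis
        using Inv Arr by (auto simp: demand_def in_b_def out_c_def simp del: pre.simps posts.simps)
    next
      case Arr': (Arr \<sigma>)
      have ne: "\<beta> \<noteq> \<sigma>" using end' Arr Arr' by auto
      show ?thesis
      proof (cases "b i")
        case (Inv \<rho>)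
        then have "\<rho> \<noteq> \<beta>" "\<rho> \<noteq> \<sigma>" using match B.reduced_Inv[OF Inv] C.reduced_Inv[of j \<rho>] Arr Arr' by auto
        then show ?thesis
          using B.at_most_two_in[of \<rho> \<beta> \<sigma>] ne B.inv_in[OF Inv] B.arr_in[OF Arr] C.arr_in[OF Arr']
            B.vertex_Arr(1)[OF Arr] C.vertex_Arr(1)[OF Arr'] vert Inv by auto
      next
        case Arr'': (Arr \<rho>)
        have "\<not> B.rel [\<rho>, \<beta>]"
          using Arr Arr'' by (intro B.no_rel2_Arr[of i]) auto
        moreover have "\<not> B.rel [\<rho>, \<sigma>]"
          using Arr' Arr'' match by (intro C.no_rel2_Arr[of j]) auto
        ultimately show ?thesis
          using B.unique_before[of \<rho> \<beta> \<sigma>] ne B.arr_in[OF Arr''] B.arr_in[OF Arr] C.arr_in[OF Arr']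
            B.vertex_Arr(1)[OF Arr] C.vertex_Arr(1)[OF Arr'] vert Arr'' by auto
      qed
    qed
  next
    case (Inv a)
    show ?thesis
    proof (cases "c (j + 1)")
      case (Arr \<sigma>)
      from d show ?thesis
      proof (cases rule: demand_cases)
        case (X a' i')
        then show ?thesis using Arr Inv match by (auto simp: in_b_def split: if_splits)
      next
        case (Y a' j')
        then show ?thesis using Arr Inv match by (auto simp: out_c_def split: if_splits)
      qed
    next
      case Inv': (Inv a')
      have ne: "a \<noteq> a'" using end' Inv Inv' by auto
      show ?thesis
      proof (cases "b i")
        case (Arr \<rho>)
        then have "\<rho> \<noteq> a" "\<rho> \<noteq> a'" using match B.reduced_Arr[OF Arr] C.reduced_Arr[of j \<rho>] Inv Inv' by auto
        then show ?thesis
          using B.at_most_two_out[of \<rho> a a'] ne B.arr_in[OF Arr] B.inv_in[OF Inv] C.inv_in[OF Inv']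
            B.vertex_Inv(2)[OF Inv] C.vertex_Inv(2)[OF Inv'] vert Arr by auto
      next
        case Inv'': (Inv \<rho>)
        have "\<not> B.rel [a, \<rho>]"
          using Inv Inv'' by (intro B.no_rel2_Inv[of i]) auto
        moreover have "\<not> B.rel [a', \<rho>]"
          using Inv' Inv'' match by (intro C.no_rel2_Inv[of j]) auto
        moreover have "tail Q a = head Q \<rho>"
          using B.vertex_Inv(1)[OF Inv''] B.vertex_Inv(2)[OF Inv] by simp
        moreover have "tail Q a' = head Q \<rho>"
          using B.vertex_Inv(1)[OF Inv''] C.vertex_Inv(2)[OF Inv'] vert by simp
        ultimately have "a = a'"
          using B.unique_after[OF B.inv_in[OF Inv''] B.inv_in[OF Inv] C.inv_in[OF Inv']] by blast
        then show ?thesis using ne by blast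
      qed
    qed
  qed
qed

lemma demand_not_interior:
  assumes "demand i j v" "b i = c j" "b (i + 1) = c (j + 1)"
  shows False
  using assms(1)
proof (cases rule: demand_cases)
  case (X a i')
  then show ?thesis using assms by (auto simp: in_b_def split: if_splits)
next
  case (Y a j')
  then show ?thesis using assms by (auto simp: out_c_def split: if_splits)
qed

end

section \<open>The solution on maximal common segments\<close>

context band_cocycle
begin

definition full :: "int \<Rightarrow> int \<Rightarrow> bool" where
  "full i j \<longleftrightarrow> (\<forall>x. b (i + x) = c (j + x))"

definition left_len :: "int \<Rightarrow> int \<Rightarrow> nat" where
  "left_len i j = (LEAST r. b (i - int r) \<noteq> c (j - int r))"

definition right_len :: "int \<Rightarrow> int \<Rightarrow> nat" where
  "right_len i j = (LEAST r. b (i + 1 + int r) \<noteq> c (j + 1 + int r))"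

text \<open>Each word inherits the period of the other, and a band is not a quasi-band for any
  smaller period.\<close>

lemma full_imp_eq_length:
  assumes "full i j"
  shows "m = n"
proof -
  have eq: "b y = c (j + (y - i))" for y using assms[unfolded full_def, rule_format, of "y - i"] by simp
  have eq': "c y = b (i + (y - j))" for y using assms[unfolded full_def, rule_format, of "y - j"] by simp
  have "b (y + int n) = b y" for y
    using C.shift[of "j + (y - i)" 1] unfolding eq[of "y + int n"] eq[of y] by (simp add: algebra_simps)
  then have "quasi_band Q I (b, n)"
    using B.quasi_band C.m_pos unfolding quasi_band.simps by (simp del: is_string.simps)
  then have "\<not> n < m" using bands(1) C.m_pos unfolding band.simps by blast
  moreover have "c (y + int m) = c y" for y
    using B.shift[of "i + (y - j)" 1] unfolding eq'[of "y + int m"] eq'[of y] by (simp add: algebra_simps)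
  then have "quasi_band Q I (c, m)"
    using C.quasi_band B.m_pos unfolding quasi_band.simps by (simp del: is_string.simps)
  then have "\<not> m < n" using bands(2) B.m_pos unfolding band.simps by blast
  ultimately show ?thesis by simp
qed

text \<open>N is a common period larger than the absolute value of x, so a single mismatch reappears
  on both sides of the given position.\<close>

lemma mismatch:
  assumes "\<not> full i j"
  shows "\<exists>r. b (i - int r) \<noteq> c (j - int r)" "\<exists>r. b (i + 1 + int r) \<noteq> c (j + 1 + int r)"
proof -
  obtain x where x: "b (i + x) \<noteq> c (j + x)" using assms by (auto simp: full_def)
  define N where "N = (\<bar>x\<bar> + 1) * (int m * int n)"
  have "1 \<le> int m * int n" using B.m_pos C.m_pos by (simp add: mult_pos_pos Suc_le_eq flip: of_nat_mult)
  then have N: "\<bar>x\<bar> + 1 \<le> N" unfolding N_def by (metis abs_ge_zero add_nonneg_nonneg mult.right_neutral mult_left_mono zero_le_one)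
  have per: "b (y + k * N) = b y" "c (y + k * N) = c y" for y k
    using B.shift[of y "k * (\<bar>x\<bar> + 1) * int n"] C.shift[of y "k * (\<bar>x\<bar> + 1) * int m"]
    by (simp_all add: N_def mult_ac)
  have "i - int (nat (N - x)) = (i + x) + (-1) * N" "j - int (nat (N - x)) = (j + x) + (-1) * N"
    using N by simp_all
  then have "b (i - int (nat (N - x))) \<noteq> c (j - int (nat (N - x)))" using x by (simp only: per not_False_eq_True)
  then show "\<exists>r. b (i - int r) \<noteq> c (j - int r)" by blast
  have "i + 1 + int (nat (N + x - 1)) = (i + x) + 1 * N" "j + 1 + int (nat (N + x - 1)) = (j + x) + 1 * N"
    using N by simp_all
  then have "b (i + 1 + int (nat (N + x - 1))) \<noteq> c (j + 1 + int (nat (N + x - 1)))" using x by (simp only: per not_False_eq_True)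
  then show "\<exists>r. b (i + 1 + int r) \<noteq> c (j + 1 + int r)" by blast
qed

lemma left_len:
  assumes "\<not> full i j"
  shows "b (i - int (left_len i j)) \<noteq> c (j - int (left_len i j))"
    "r < left_len i j \<Longrightarrow> b (i - int r) = c (j - int r)"
  unfolding left_len_def by (rule LeastI_ex[OF mismatch(1)[OF assms]]) (use not_less_Least in blast)

lemma right_len:
  assumes "\<not> full i j"
  shows "b (i + 1 + int (right_len i j)) \<noteq> c (j + 1 + int (right_len i j))"
    "r < right_len i j \<Longrightarrow> b (i + 1 + int r) = c (j + 1 + int r)"
  unfolding right_len_def by (rule LeastI_ex[OF mismatch(2)[OF assms]]) (use not_less_Least in blast)

lemma left_vertex:
  assumes "\<not> full i j" "B.vertex i = C.vertex j"
  shows "B.vertex (i - int (left_len i j)) = C.vertex (j - int (left_len i j))"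
proof (cases "left_len i j")
  case (Suc r)
  then have "b (i - int r) = c (j - int r)" using left_len(2)[OF assms(1)] by simp
  moreover have e: "i - int (left_len i j) + 1 = i - int r" "j - int (left_len i j) + 1 = j - int r" using Suc by simp_all
  ultimately show ?thesis
    using B.composable[of "i - int (left_len i j)"] C.composable[of "j - int (left_len i j)"] unfolding e by simp
qed (use assms in simp)

lemma right_vertex:
  assumes "\<not> full i j" "B.vertex i = C.vertex j"
  shows "B.vertex (i + int (right_len i j)) = C.vertex (j + int (right_len i j))"
proof (cases "right_len i j")
  case (Suc r)
  then have "b (i + 1 + int r) = c (j + 1 + int r)" using right_len(2)[OF assms(1)] by simp
  moreover have e: "i + int (right_len i j) = i + 1 + int r" "j + int (right_len i j) = j + 1 + int r" using Suc by simp_all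
  ultimately show ?thesis unfolding e by (simp only:)
qed (use assms in simp)

definition demanded :: "int \<Rightarrow> int \<Rightarrow> 'k" where
  "demanded i j = (SOME v. demand i j v)"

text \<open>If \<open>b\<close> and \<open>c\<close> agree along the whole diagonal, then \<open>m = n\<close> and going around once gives
  \<open>h i j + run i j m = h (i + m) (j + m) = (mu / lam) h i j\<close>. The value \<open>0\<close> is chosen at the left end of
  a segment that prescribes no value at either end.\<close>

definition sol :: "int \<Rightarrow> int \<Rightarrow> 'k" where
  "sol i j = (if full i j then run i j m / (mu / lam - 1) else
    (let l = left_len i j; r = right_len i j; i0 = i - int l; j0 = j - int l in
     if \<exists>v. demand i0 j0 v then demanded i0 j0 + run i0 j0 l
     else if \<exists>v. demand (i + int r) (j + int r) v then demanded (i + int r) (j + int r) - run i j r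
     else run i0 j0 l))"

lemma run_Suc: "run i j (Suc r) = run i j r + step (i + int r) (j + int r)"
  by (simp add: run_def)

lemma run_Suc': "run i j (Suc r) = step i j + run (i + 1) (j + 1) r"
  unfolding run_def sum.lessThan_Suc_shift by (simp add: algebra_simps)

lemma step_scale:
  assumes "\<And>x. b (x + d) = b x" "\<And>a x y. Z a (x + d) (y + e) = \<kappa> * Z a x y"
  shows "step (i + d) (j + e) = \<kappa> * step i j"
proof -
  have "b (i + d + 1) = b (i + 1)" using assms(1)[of "i + 1"] by (simp add: algebra_simps)
  moreover have "Z a (i + d + 1) (j + e) = \<kappa> * Z a (i + 1) j" "Z a (i + d) (j + e + 1) = \<kappa> * Z a i (j + 1)" for a
    using assms(2)[of a "i + 1" j] assms(2)[of a i "j + 1"] by (simp_all add: algebra_simps)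
  ultimately show ?thesis by (simp add: step_def split: letter.split)
qed

text \<open>On a cyclic chain, moving the base point by one drops the first summand of the run and
  appends mu / lam times the same summand, which the denominator compensates. Otherwise (i, j) and
  its successor have the same segment ends, so \<open>sol\<close> uses the same case for
  both.\<close>

lemma sol_step:
  assumes match: "b (i + 1) = c (j + 1)"
  shows "sol (i + 1) (j + 1) = sol i j + step i j"
proof (cases "full i j")
  case True
  have full': "full (i + 1) (j + 1)"
    unfolding full_def
  proof
    fix x
    show "b (i + 1 + x) = c (j + 1 + x)"
      using True[unfolded full_def, rule_format, of "1 + x"] by (simp add: add.assoc)
  qed
  have mn: "m = n" by (rule full_imp_eq_length[OF True])
  have "Z a (x + int m) (y + int m) = (mu / lam) * Z a x y" for a x y
    using Z_left[of a x "y + int m"] Z_right[of a x y] mn by simp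
  then have "step (i + int m) (j + int m) = (mu / lam) * step i j"
    using B.shift[of _ 1] by (intro step_scale) simp_all
  then have "run (i + 1) (j + 1) m = run i j m + (mu / lam - 1) * step i j"
    using run_Suc[of i j m] run_Suc'[of i j m] by (simp add: algebra_simps)
  moreover have "mu / lam - 1 \<noteq> 0" using lam lam_mu by simp
  ultimately show ?thesis using True full' by (simp add: sol_def add_divide_distrib)
next
  case False
  have not_full': "\<not> full (i + 1) (j + 1)"
  proof
    assume "full (i + 1) (j + 1)"
    then have "b (i + x) = c (j + x)" for x
      unfolding full_def by (metis (no_types, opaque_lifting) add.assoc add.commute diff_add_cancel)
    then show False using False by (simp add: full_def)
  qed
  have L: "left_len (i + 1) (j + 1) = Suc (left_len i j)"
    using Least_Suc[of "\<lambda>r. b (i + 1 - int r) \<noteq> c (j + 1 - int r)"] mismatch(1)[OF not_full'] match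
    unfolding left_len_def by auto
  have R: "right_len i j = Suc (right_len (i + 1) (j + 1))"
    using Least_Suc[of "\<lambda>r. b (i + 1 + int r) \<noteq> c (j + 1 + int r)"] mismatch(2)[OF False] match
    unfolding right_len_def by (auto simp: algebra_simps)
  have e: "i + 1 - int (left_len (i + 1) (j + 1)) = i - int (left_len i j)"
    "j + 1 - int (left_len (i + 1) (j + 1)) = j - int (left_len i j)"
    "i + 1 + int (right_len (i + 1) (j + 1)) = i + int (right_len i j)"
    "j + 1 + int (right_len (i + 1) (j + 1)) = j + int (right_len i j)"
    by (simp_all add: L R)
  have runL: "run (i - int (left_len i j)) (j - int (left_len i j)) (left_len (i + 1) (j + 1)) =
      run (i - int (left_len i j)) (j - int (left_len i j)) (left_len i j) + step i j"
    unfolding L run_Suc by simp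
  have runR: "run i j (right_len i j) = step i j + run (i + 1) (j + 1) (right_len (i + 1) (j + 1))"
    unfolding R run_Suc' ..
  define D0 where "D0 \<longleftrightarrow> (\<exists>v. demand (i - int (left_len i j)) (j - int (left_len i j)) v)"
  define D1 where "D1 \<longleftrightarrow> (\<exists>v. demand (i + int (right_len i j)) (j + int (right_len i j)) v)"
  show ?thesis
    using False not_full'
    unfolding sol_def Let_def e runL runR D0_def[symmetric] D1_def[symmetric] by simp
qed

text \<open>Kept as a hypothesis here because its proof needs non-extendability for both
  orientations of c, and this locale provides one.\<close>

definition consistent :: bool where
  "consistent \<longleftrightarrow> (\<forall>i j v v'. B.vertex i = C.vertex j \<longrightarrow> demand i j v \<longrightarrow> demand i j v' \<longrightarrow> v = v')"

lemma demanded_eq: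
  assumes "consistent" "B.vertex i = C.vertex j" "demand i j v"
  shows "demanded i j = v"
  using assms someI[of "demand i j" v] unfolding demanded_def consistent_def by blast

text \<open>Demands occur only at ends of segments, and \<open>sol\<close> gives priority to the
  left end. The case with content is a segment of positive length with demands at both ends: by
  consistency the two demands at each end are equal, so either alternative of \<open>segment\<close>
  carries the left value to the right one.\<close>

lemma sol_demand:
  assumes cons: "consistent" and vert: "B.vertex i = C.vertex j" and d: "demand i j v"
  shows "sol i j = v"
proof -
  have nf: "\<not> full i j"
  proof
    assume f: "full i j"
    have "b i = c j" "b (i + 1) = c (j + 1)"
      using f[unfolded full_def, rule_format, of 0] f[unfolded full_def, rule_format, of 1] by simp_all
    then show False using demand_not_interior[OF d] by blast
  qed
  note dem = demanded_eq[OF cons vert d]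
  show ?thesis
  proof (cases "left_len i j")
    case 0
    then show ?thesis using nf d dem by (auto simp: sol_def Let_def run_def)
  next
    case (Suc l')
    define l where "l = left_len i j"
    define i0 where "i0 = i - int l"
    define j0 where "j0 = j - int l"
    have ij: "i0 + int l = i" "j0 + int l = j" by (simp_all add: i0_def j0_def)
    have l: "l = Suc l'" using Suc by (simp add: l_def)
    have left: "b (i - int r) = c (j - int r)" if "r < l" for r
      using left_len(2)[OF nf] that by (simp add: l_def)
    have bij: "b i = c j" using left[of 0] l by simp
    have end_r: "b (i + 1) \<noteq> c (j + 1)" using demand_not_interior[OF d bij] by blast
    have "right_len i j = 0"
      using right_len(2)[OF nf, of 0] end_r by (cases "right_len i j = 0") auto
    show ?thesis
    proof (cases "\<exists>v0. demand i0 j0 v0")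
      case False
      then show ?thesis
        using nf d dem \<open>right_len i j = 0\<close>
        by (auto simp: sol_def Let_def run_def i0_def j0_def l_def)
    next
      case True
      then obtain v0 where v0: "demand i0 j0 v0" by blast
      have end_l: "b i0 \<noteq> c j0" using left_len(1)[OF nf] by (simp add: i0_def j0_def l_def)
      have match_l: "b (i0 + 1) = c (j0 + 1)" using left[of l'] l by (simp add: i0_def j0_def)
      obtain \<alpha> \<gamma> where \<alpha>: "b i0 = Inv \<alpha>" "c j0 = Arr \<gamma>"
        "demand i0 j0 (Z \<alpha> (i0 - 1) j0)" "demand i0 j0 (- Z \<gamma> i0 (j0 - 1))"
        using demand_left_end[OF v0 match_l end_l] by blast
      obtain \<beta> \<delta> where \<beta>: "b (i + 1) = Arr \<beta>" "c (j + 1) = Inv \<delta>"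
        "demand i j (Z \<beta> (i + 1) j)" "demand i j (- Z \<delta> i (j + 1))"
        using demand_right_end[OF d bij end_r] by blast
      have vert0: "B.vertex i0 = C.vertex j0"
        using left_vertex[OF nf vert] by (simp add: i0_def j0_def l_def)
      have "- Z \<gamma> i0 (j0 - 1) + run i0 j0 l = Z \<beta> (i + 1) j \<or> Z \<alpha> (i0 - 1) j0 + run i0 j0 l = - Z \<delta> i (j + 1)"
      proof -
        have "b (i0 + r) = c (j0 + r)" if "1 \<le> r" "r \<le> int l" for r
          using left[of "l - nat r"] that by (simp add: i0_def j0_def of_nat_diff algebra_simps)
        then show ?thesis
          using segment[of i0 \<alpha> l \<beta> j0 \<gamma> \<delta>, unfolded ij] \<alpha> \<beta> vert0 by blast
      qed
      moreover have "Z \<alpha> (i0 - 1) j0 = demanded i0 j0" "- Z \<gamma> i0 (j0 - 1) = demanded i0 j0"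
        using demanded_eq[OF cons vert0 \<alpha>(3)] demanded_eq[OF cons vert0 \<alpha>(4)] by simp_all
      moreover have "Z \<beta> (i + 1) j = v" "- Z \<delta> i (j + 1) = v"
        using demanded_eq[OF cons vert \<beta>(3)] demanded_eq[OF cons vert \<beta>(4)] dem by simp_all
      ultimately have "demanded i0 j0 + run i0 j0 l = v" by metis
      then show ?thesis
        using nf True by (simp add: sol_def Let_def i0_def j0_def l_def)
    qed
  qed
qed

lemma demand_scale:
  assumes "\<And>x. b (x + d) = b x" "\<And>x. c (x + e) = c x" "\<And>a x y. Z a (x + d) (y + e) = \<kappa> * Z a x y"
    and "demand i j v"
  shows "demand (i + d) (j + e) (\<kappa> * v)"
proof -
  have b1: "b (i + d + 1) = b (i + 1)" using assms(1)[of "i + 1"] by (simp add: algebra_simps)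
  have c1: "c (j + e + 1) = c (j + 1)" using assms(2)[of "j + 1"] by (simp add: algebra_simps)
  from assms(4) show ?thesis
  proof (cases rule: demand_cases)
    case (X a i')
    have "in_b a (i + d) (i' + d)" using X(1) assms(1) b1 by (auto simp: in_b_def)
    moreover have "pre c [a] (j + e) = None" using X(2) assms(2) c1 by (auto split: if_splits)
    moreover have "\<kappa> * v = Z a (i' + d) (j + e)" using X(3) assms(3) by simp
    ultimately show ?thesis unfolding demand_def by blast
  next
    case (Y a j')
    have "out_c a (j + e) (j' + e)" using Y(1) assms(2) c1 by (auto simp: out_c_def)
    moreover have "posts b [a] (i + d) = None" using Y(2) assms(1) b1 by (auto split: if_splits)
    moreover have "\<kappa> * v = - Z a (i + d) (j' + e)" using Y(3) assms(3) by simp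
    ultimately show ?thesis unfolding demand_def by blast
  qed
qed

text \<open>Every ingredient of \<open>sol\<close> is equivariant under a shift of the two positions
  that preserves the words and scales Z. The inverse shift is used as well, to see that no demand
  arises at the shifted position which was not there before.\<close>

lemma sol_scale:
  assumes cons: "consistent" and vert: "B.vertex i = C.vertex j" and \<kappa>: "\<kappa> \<noteq> 0"
    and b: "\<And>x. b (x + d) = b x" and c: "\<And>x. c (x + e) = c x"
    and Z: "\<And>a x y. Z a (x + d) (y + e) = \<kappa> * Z a x y"
  shows "sol (i + d) (j + e) = \<kappa> * sol i j"
proof -
  have bb: "b (x + d + y) = b (x + y)" "b (x + d - y) = b (x - y)" for x y
    using b[of "x + y"] b[of "x - y"] by (simp_all add: algebra_simps)
  have cc: "c (x + e + y) = c (x + y)" "c (x + e - y) = c (x - y)" for x y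
    using c[of "x + y"] c[of "x - y"] by (simp_all add: algebra_simps)
  have full: "full (i + d) (j + e) = full i j" by (simp add: full_def bb cc)
  have L: "left_len (i + d) (j + e) = left_len i j" by (simp add: left_len_def bb cc)
  have R: "right_len (i + d) (j + e) = right_len i j"
    using bb(1)[of i "1 + _"] cc(1)[of j "1 + _"] by (simp add: right_len_def add.assoc)
  have run: "run (x + d) (y + e) r = \<kappa> * run x y r" for x y r
  proof -
    have "step (x + d + int t) (y + e + int t) = \<kappa> * step (x + int t) (y + int t)" for t
      using step_scale[OF b Z, of "x + int t" "y + int t"] by (simp add: algebra_simps)
    then show ?thesis by (simp add: run_def sum_distrib_left)
  qed
  have Z': "Z a (x + - d) (y + - e) = inverse \<kappa> * Z a x y" for a x y
    using Z[of a "x - d" "y - e"] \<kappa> by (simp add: field_simps)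
  have b': "b (x + - d) = b x" "c (x + - e) = c x" for x
    using b[of "x - d"] c[of "x - e"] by simp_all
  have ex: "(\<exists>v. demand (x + d) (y + e) v) = (\<exists>v. demand x y v)" for x y
    using demand_scale[OF b c Z] demand_scale[OF b' Z', of "x + d" "y + e"] by fastforce
  have dem: "demanded (x + d) (y + e) = \<kappa> * demanded x y"
    if v: "B.vertex x = C.vertex y" and ne: "\<exists>v. demand x y v" for x y
  proof -
    obtain w where w: "demand x y w" using ne by blast
    have "B.vertex (x + d) = C.vertex (y + e)" using v b c by simp
    then have "demanded (x + d) (y + e) = \<kappa> * w"
      using demanded_eq[OF cons] demand_scale[OF b c Z w] by blast
    then show ?thesis using demanded_eq[OF cons v w] by simp
  qed
  show ?thesis
  proof (cases "full i j")
    case True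
    then show ?thesis by (simp add: sol_def full run)
  next
    case False
    define i0 where "i0 = i - int (left_len i j)"
    define j0 where "j0 = j - int (left_len i j)"
    define i1 where "i1 = i + int (right_len i j)"
    define j1 where "j1 = j + int (right_len i j)"
    have e: "i + d - int (left_len i j) = i0 + d" "j + e - int (left_len i j) = j0 + e"
      "i + d + int (right_len i j) = i1 + d" "j + e + int (right_len i j) = j1 + e"
      by (simp_all add: i0_def j0_def i1_def j1_def)
    have v0: "B.vertex i0 = C.vertex j0" and v1: "B.vertex i1 = C.vertex j1"
      using left_vertex[OF False vert] right_vertex[OF False vert] by (simp_all add: i0_def j0_def i1_def j1_def)
    have "sol (i + d) (j + e) =
        (if \<exists>v. demand i0 j0 v then demanded (i0 + d) (j0 + e) + \<kappa> * run i0 j0 (left_len i j)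
         else if \<exists>v. demand i1 j1 v then demanded (i1 + d) (j1 + e) - \<kappa> * run i j (right_len i j)
         else \<kappa> * run i0 j0 (left_len i j))"
      using False unfolding sol_def Let_def full L R e run ex by simp
    moreover have "sol i j =
        (if \<exists>v. demand i0 j0 v then demanded i0 j0 + run i0 j0 (left_len i j)
         else if \<exists>v. demand i1 j1 v then demanded i1 j1 - run i j (right_len i j)
         else run i0 j0 (left_len i j))"
      using False unfolding sol_def Let_def i0_def j0_def i1_def j1_def by simp
    ultimately show ?thesis
      using dem[OF v0] dem[OF v1] by (auto simp: algebra_simps)
  qed
qed

lemma sol_left:
  assumes "consistent" "B.vertex i = C.vertex j"
  shows "sol (i + int m) j = sol i j / lam"
  using sol_scale[OF assms, of "1 / lam" "int m" 0] lam Z_left B.shift[of _ 1] by simp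

lemma sol_right:
  assumes "consistent" "B.vertex i = C.vertex j"
  shows "sol i (j + int n) = mu * sol i j"
  using sol_scale[OF assms, of mu 0 "int n"] mu Z_right C.shift[of _ 1] by simp

end

section \<open>Combining both orientations of c\<close>

definition flip_word :: "(int \<Rightarrow> 'a letter) \<Rightarrow> int \<Rightarrow> 'a letter" where
  "flip_word c = (\<lambda>j. linv (c (1 - j)))"

lemma (in quasi_band_alg) pre_flip:
  "pre (flip_word b) [a] j = map_option uminus (pre b [a] (- j))"
proof -
  have "flip_word b (j + 1) = linv (b (- j))" "flip_word b j = linv (b (- j + 1))"
    by (simp_all add: flip_word_def)
  moreover have "b (- j) \<noteq> Inv a \<or> b (- j + 1) \<noteq> Arr a" using reduced_Inv[of "- j" a] by blast
  ultimately show ?thesis by (cases "b (- j) = Inv a"; cases "b (- j + 1) = Arr a") simp_all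
qed

lemma (in quasi_band_alg) path_coeff_flip:
  "path_coeff d (flip_word b) (\<lambda>a i j. Z a i (- j)) as i j = path_coeff d b Z as i (- j)"
  by (induction as arbitrary: j)
    (auto simp: pre_flip simp del: pre.simps split: option.splits)

text \<open>\<open>flip_word c\<close> indexes the vertices of \<open>c\<inverse>\<close> such that vertex \<open>-j\<close> of it is vertex \<open>j\<close> of \<open>c\<close>;
  its scalar is \<open>1 / mu\<close>.\<close>

locale flip_cocycle = S: band_cocycle Q I b c m n lam mu Z +
  F: band_cocycle Q I b "flip_word c" m n lam "1 / mu" "\<lambda>a i j. Z a i (- j)"
  for Q :: "('v, 'a) pre_digraph" and I :: "('v, 'a, 'k::field) kpath set"
    and b c :: "int \<Rightarrow> 'a letter" and m n :: nat
    and lam mu :: 'k and Z :: "'a \<Rightarrow> int \<Rightarrow> int \<Rightarrow> 'k"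
begin

lemma flip_simps: "flip_word c (- j) = linv (c (j + 1))" "flip_word c (- j + 1) = linv (c j)"
  "flip_word c (1 - j) = linv (c j)"
  by (simp_all add: flip_word_def add.commute)

lemma flip_vertex: "lsrc Q (flip_word c (- j)) = S.C.vertex j"
  using S.C.composable[of j] by (simp add: flip_simps)

text \<open>Inverting c leaves the arrows around a vertex unchanged, so both orientations prescribe
  the same values. Hence consistency transfers to the flipped instance.\<close>

lemma flip_demand: "F.demand i (- j) v \<longleftrightarrow> S.demand i j v"
proof -
  have o: "F.out_c a (- j) j' \<longleftrightarrow> S.out_c a j (- j')" for a j'
    by (auto simp: F.out_c_def S.out_c_def flip_simps)
  have p: "pre (flip_word c) [a] (- j) = None \<longleftrightarrow> pre c [a] j = None" for a
    unfolding S.C.pre_flip by simp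
  have "(\<exists>j'. S.out_c a j (- j') \<and> posts b [a] i = None \<and> v = - Z a i (- j')) \<longleftrightarrow>
      (\<exists>j'. S.out_c a j j' \<and> posts b [a] i = None \<and> v = - Z a i j')" for a
    by (metis minus_minus)
  then show ?thesis
    unfolding F.demand_def S.demand_def o p by (simp del: posts.simps pre.simps)
qed

lemma consistent_S: "S.consistent"
  unfolding S.consistent_def
proof (intro allI impI)
  fix i j v v'
  assume vert: "S.B.vertex i = S.C.vertex j" and d: "S.demand i j v" "S.demand i j v'"
  show "v = v'"
  proof (rule S.demand_unique[OF _ vert d])
    fix \<alpha> \<beta> \<gamma> \<delta>
    assume ends: "b i = Inv \<alpha>" "b (i + 1) = Arr \<beta>" "c j = Arr \<gamma>" "c (j + 1) = Inv \<delta>"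
    have "S.B.vertex i = lsrc Q (flip_word c (- j))" using vert flip_vertex[of j] by simp
    \<comment> \<open>The empty common word of b and the inverse of c, for which \<gamma> and
      \<delta> exchange their roles.\<close>
    note F.segment[of i \<alpha> 0 \<beta> "- j" \<delta> \<gamma>, OF _ _ _ _ this]
    with ends show "- Z \<delta> i (j + 1) = Z \<beta> (i + 1) j \<or> Z \<alpha> (i - 1) j = - Z \<gamma> i (j - 1)"
      by (simp add: flip_simps F.run_def add.commute)
  qed
qed

lemma consistent_F: "F.consistent"
  unfolding F.consistent_def
proof (intro allI impI)
  fix i j v v'
  assume vert: "S.B.vertex i = lsrc Q (flip_word c j)" and d: "F.demand i j v" "F.demand i j v'"
  have "S.B.vertex i = S.C.vertex (- j)" using vert flip_vertex[of "- j"] by simp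
  moreover have "S.demand i (- j) v" "S.demand i (- j) v'"
    using d flip_demand[of i "- j"] by simp_all
  ultimately show "v = v'" using consistent_S unfolding S.consistent_def by blast
qed

text \<open>Tells whether the chain of (i, j) continues along the inverse of c; reducedness of both
  words then prevents it from continuing along c (\<open>h_straight\<close>). Where it continues in
  neither way, only demands matter, and both solutions meet them.\<close>

definition flip_match :: "int \<Rightarrow> int \<Rightarrow> bool" where
  "flip_match i j \<longleftrightarrow> b i = linv (c (j + 1)) \<or> b (i + 1) = linv (c j)"

definition h :: "int \<Rightarrow> int \<Rightarrow> 'k" where
  "h i j = (if S.B.vertex i \<noteq> S.C.vertex j then 0 else if flip_match i j then F.sol i (- j) else S.sol i j)"

lemma h_vertex: "h i j \<noteq> 0 \<Longrightarrow> S.B.vertex i = S.C.vertex j"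
  by (auto simp: h_def split: if_splits)

lemma h_left: "h (i + int m) j = h i j / lam"
proof -
  have b: "b (i + int m) = b i" "b (i + int m + 1) = b (i + 1)"
    using S.B.shift[of i 1] S.B.shift[of "i + 1" 1] by (simp_all add: algebra_simps)
  show ?thesis
    using S.sol_left[OF consistent_S, of i j] F.sol_left[OF consistent_F, of i "- j"]
    by (auto simp: h_def flip_match_def b flip_vertex)
qed

lemma h_right: "h i (j + int n) = mu * h i j"
proof -
  have c: "c (j + int n) = c j" "c (j + int n + 1) = c (j + 1)"
    using S.C.shift[of j 1] S.C.shift[of "j + 1" 1] by (simp_all add: algebra_simps)
  have "F.sol i (- j - int n) = mu * F.sol i (- j)" if "S.B.vertex i = S.C.vertex j"
  proof -
    have "S.B.vertex i = lsrc Q (flip_word c (- (j + int n)))"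
      unfolding flip_vertex using that c by simp
    then have "F.sol i (- (j + int n) + int n) = 1 / mu * F.sol i (- (j + int n))"
      by (rule F.sol_right[OF consistent_F])
    then show ?thesis using S.mu by simp
  qed
  then show ?thesis
    using S.sol_right[OF consistent_S, of i j]
    by (auto simp: h_def flip_match_def c)
qed

lemma h_demand:
  assumes d: "S.demand i j v" and vert: "S.B.vertex i = S.C.vertex j"
  shows "h i j = v"
  using S.sol_demand[OF consistent_S vert d] F.sol_demand[OF consistent_F, of i "- j" v] d vert
  by (simp add: h_def flip_demand flip_vertex)

lemma h_straight:
  assumes match: "b (i + 1) = c (j + 1)"
  shows "h (i + 1) (j + 1) = h i j + S.step i j"
proof -
  have v: "S.B.vertex i = S.C.vertex j" "S.B.vertex (i + 1) = S.C.vertex (j + 1)"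
    using match S.B.composable[of i] S.C.composable[of j] by simp_all
  have "\<not> flip_match i j" "\<not> flip_match (i + 1) (j + 1)"
    using match S.B.reduced[of i] S.B.reduced[of "i + 1"] S.C.reduced[of j] S.C.reduced[of "j + 1"]
    by (auto simp: flip_match_def)
  then show ?thesis using S.sol_step[OF match] v by (simp add: h_def)
qed

lemma h_flipped:
  assumes match: "b (i + 1) = linv (c j)"
  shows "h (i + 1) (j - 1) = h i j + F.step i (- j)"
proof -
  have v: "S.B.vertex i = S.C.vertex j" "S.B.vertex (i + 1) = S.C.vertex (j - 1)"
    using match S.B.composable[of i] S.C.composable[of "j - 1"] by simp_all
  have "flip_match i j" "flip_match (i + 1) (j - 1)" using match by (auto simp: flip_match_def)
  moreover have "F.sol (i + 1) (- j + 1) = F.sol i (- j) + F.step i (- j)"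
    by (rule F.sol_step) (simp add: match flip_simps)
  ultimately show ?thesis using v by (simp add: h_def)
qed

text \<open>If a acts neither on b at i nor on c at j, the coefficient is zero; if it acts on one of
  them, the equation is a demand; if on both, the letters agree directly or up to inversion and the
  equation is one step of a chain. A demand at positions with different vertices is harmless, as h
  and Z both vanish there.\<close>

theorem coboundary:
  assumes a: "a \<in> arcs Q"
  shows "(case posts b [a] i of None \<Rightarrow> 0 | Some i' \<Rightarrow> h i' j) =
    Z a i j + (case pre c [a] j of None \<Rightarrow> 0 | Some j' \<Rightarrow> h i j')"
proof -
  have postD: "S.in_b a i' i" if "posts b [a] i = Some i'" for i'
    using that by (auto simp: S.in_b_def split: if_splits)
  have preD: "S.out_c a j' j" if "pre c [a] j = Some j'" for j'
    using that by (auto simp: S.out_c_def split: if_splits)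
  show ?thesis
  proof (cases "posts b [a] i")
    case post: None
    show ?thesis
    proof (cases "pre c [a] j")
      case None
      then show ?thesis using post S.isolated_zero[OF a post None] by (simp del: pre.simps posts.simps)
    next
      case (Some j')
      have d: "S.demand i j' (- Z a i j)" using preD[OF Some] post unfolding S.demand_def by blast
      have "h i j' = - Z a i j"
      proof (cases "S.B.vertex i = S.C.vertex j'")
        case True
        then show ?thesis by (rule h_demand[OF d])
      next
        case False
        then have "Z a i j = 0" using S.Z_graded[of a i j] S.out_c_vertex[OF preD[OF Some]] by metis
        then show ?thesis using False by (simp add: h_def)
      qed
      then show ?thesis using post Some by (simp del: pre.simps posts.simps)
    qed
  next
    case post: (Some i')
    show ?thesis
    proof (cases "pre c [a] j")
      case None
      have d: "S.demand i' j (Z a i j)" using postD[OF post] None unfolding S.demand_def by blast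
      have "h i' j = Z a i j"
      proof (cases "S.B.vertex i' = S.C.vertex j")
        case True
        then show ?thesis by (rule h_demand[OF d])
      next
        case False
        then have "Z a i j = 0" using S.Z_graded[of a i j] S.in_b_vertex[OF postD[OF post]] by metis
        then show ?thesis using False by (simp add: h_def)
      qed
      then show ?thesis using post None by (simp del: pre.simps posts.simps)
    next
      case (Some j')
      have "h i' j = Z a i j + h i j'"
      proof -
        consider (II) "b (i + 1) = Inv a" "i' = i + 1" "c j = Inv a" "j' = j - 1"
          | (IA) "b (i + 1) = Inv a" "i' = i + 1" "c (j + 1) = Arr a" "j' = j + 1"
          | (AI) "b i = Arr a" "i' = i - 1" "c j = Inv a" "j' = j - 1"
          | (AA) "b i = Arr a" "i' = i - 1" "c (j + 1) = Arr a" "j' = j + 1"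
          using post Some by (auto split: if_splits)
        then show ?thesis
        proof cases
          case II
          then show ?thesis using h_straight[of i "j - 1"] by (simp add: S.step_def)
        next
          case AA
          then show ?thesis using h_straight[of "i - 1" j] by (simp add: S.step_def)
        next
          case IA
          then show ?thesis using h_flipped[of i "j + 1"] by (simp add: F.step_def)
        next
          case AI
          then show ?thesis using h_flipped[of "i - 1" j] by (simp add: F.step_def)
        qed
      qed
      then show ?thesis using post Some by (simp del: pre.simps posts.simps)
    qed
  qed
qed

end

section \<open>The vanishing criterion\<close>

lemma (in quiver_quotient) coords_reindex:
  fixes \<sigma> :: "'j \<Rightarrow> 'i"
  assumes co: "coords \<nu> T S M \<Psi>" and \<sigma>: "surj \<sigma>"
    and \<nu>: "\<And>j. \<nu>' j = \<nu> (\<sigma> j)" and T: "\<And>a \<phi>. T' a (\<phi> \<circ> \<sigma>) = T a \<phi> \<circ> \<sigma>"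
    and S: "(\<lambda>\<phi>. \<phi> \<circ> \<sigma>) ` S = S'"
  shows "coords \<nu>' T' S' M (\<lambda>v. \<Psi> v \<circ> \<sigma>)"
proof -
  have "path_act \<nu>' T' p (\<phi> \<circ> \<sigma>) = path_act \<nu> T p \<phi> \<circ> \<sigma>" for p \<phi>
  proof (cases p)
    case (Walk as)
    have "foldr T' as (\<phi> \<circ> \<sigma>) = foldr T as \<phi> \<circ> \<sigma>"
      by (induction as) (simp_all only: foldr.simps id_apply comp_apply[of _ "foldr _ _"] T)
    then show ?thesis using Walk by simp
  qed (simp add: fun_eq_iff \<nu>)
  then have act: "act \<nu>' T' x (\<phi> \<circ> \<sigma>) = act \<nu> T x \<phi> \<circ> \<sigma>" for x \<phi>
    by (simp add: act_def fun_eq_iff)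
  have "inj_on (\<lambda>\<phi>. \<phi> \<circ> \<sigma>) S"
    using \<sigma> by (intro inj_onI) (metis comp_def surjD ext)
  then have "bij_betw (\<lambda>\<phi>. \<phi> \<circ> \<sigma>) S S'" using S by (simp add: bij_betw_def)
  moreover have "bij_betw \<Psi> (carrier M) S" using co by (simp add: coords_def)
  ultimately have "bij_betw (\<lambda>v. \<Psi> v \<circ> \<sigma>) (carrier M) S'"
    using bij_betw_trans[of \<Psi> "carrier M" S "\<lambda>\<phi>. \<phi> \<circ> \<sigma>" S'] by (simp add: comp_def)
  moreover have "\<Psi> (v \<oplus>\<^bsub>M\<^esub> w) \<circ> \<sigma> = (\<Psi> v \<circ> \<sigma>) + (\<Psi> w \<circ> \<sigma>)" if "v \<in> carrier M" "w \<in> carrier M" for v w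
    using co that by (simp add: coords_def fun_eq_iff)
  moreover have "\<Psi> \<zero>\<^bsub>M\<^esub> \<circ> \<sigma> = 0" using co by (simp add: coords_def fun_eq_iff)
  ultimately show ?thesis
    using co unfolding coords_def by (simp add: act)
qed

text \<open>A change of representative only renames the positions. For an inverse the vertex of
  position j is the source of \<open>linv (b (k - j))\<close>, that is the target of
  \<open>b (k - j)\<close>, which belongs to position k - 1 - j of b; this explains the offset.
  Reversing the direction inverts the multiplier.\<close>

lemma (in string_quiver) class_coords:
  assumes b: "quasi_band Q I (b, m)" and cl: "(b', m') \<in> qband_class Q I (b, m)" and l: "l \<noteq> 0"
    and co: "coords (\<lambda>i. lsrc Q (b i)) (band_op b) (quasi_periodic m l) M \<Psi>"
  obtains l' \<Psi>' where "l' \<noteq> 0"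
    "coords (\<lambda>i. lsrc Q (b' i)) (band_op b') (quasi_periodic m' l') M \<Psi>'"
proof -
  interpret B: quasi_band_alg Q I b m by unfold_locales (rule b)
  from cl show ?thesis
  proof (cases rule: in_classE)
    case (shift k)
    let ?\<sigma> = "\<lambda>j. k + j"
    have "coords (\<lambda>i. lsrc Q (b' i)) (band_op b') (quasi_periodic m l) M (\<lambda>v. \<Psi> v \<circ> ?\<sigma>)"
    proof (rule coords_reindex[OF co])
      show "surj ?\<sigma>" by (metis add_minus_cancel surjI)
      show "band_op b' a (\<phi> \<circ> ?\<sigma>) = band_op b a \<phi> \<circ> ?\<sigma>" for a and \<phi> :: "int \<Rightarrow> 'k"
      proof
        fix j
        have e: "k + j + 1 = k + (j + 1)" "k + j - 1 = k + (j - 1)" by simp_all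
        show "band_op b' a (\<phi> \<circ> ?\<sigma>) j = (band_op b a \<phi> \<circ> ?\<sigma>) j"
          unfolding comp_apply band_op_apply shift e ..
      qed
      show "(\<lambda>\<phi>. \<phi> \<circ> ?\<sigma>) ` quasi_periodic m l = quasi_periodic m l"
      proof (intro equalityI subsetI)
        fix \<phi> assume \<phi>: "\<phi> \<in> quasi_periodic m l"
        have "(\<lambda>j. \<phi> (j - k)) \<in> quasi_periodic m l"
          unfolding quasi_periodic_def
        proof (intro CollectI allI)
          fix i
          have "i + int m - k = (i - k) + int m" by simp
          then show "\<phi> (i + int m - k) = l * \<phi> (i - k)"
            using \<phi> unfolding quasi_periodic_def by (simp only: mem_Collect_eq)
        qed
        moreover have "\<phi> = (\<lambda>j. \<phi> (j - k)) \<circ> ?\<sigma>" by (simp add: fun_eq_iff)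
        ultimately show "\<phi> \<in> (\<lambda>\<phi>. \<phi> \<circ> ?\<sigma>) ` quasi_periodic m l" by blast
      qed (auto simp: quasi_periodic_def add.assoc[symmetric])
    qed (simp add: shift)
    then show ?thesis using that[OF l] shift by blast
  next
    case (inverse k)
    let ?\<sigma> = "\<lambda>j. k - 1 - j"
    have per: "\<phi> (x - int m) = inverse l * \<phi> x" if "\<phi> \<in> quasi_periodic m l" for \<phi> x
    proof -
      have "\<phi> (x - int m + int m) = l * \<phi> (x - int m)" using that unfolding quasi_periodic_def by blast
      then show ?thesis using l by (simp add: field_simps)
    qed
    have per': "\<phi> (x - int m) = l * \<phi> x" if "\<phi> \<in> quasi_periodic m (inverse l)" for \<phi> x
    proof -
      have "\<phi> (x - int m + int m) = inverse l * \<phi> (x - int m)" using that unfolding quasi_periodic_def by blast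
      then show ?thesis using l by (simp add: field_simps)
    qed
    have "coords (\<lambda>i. lsrc Q (b' i)) (band_op b') (quasi_periodic m (inverse l)) M (\<lambda>v. \<Psi> v \<circ> ?\<sigma>)"
    proof (rule coords_reindex[OF co])
      show "surj ?\<sigma>" by (rule surjI[of _ ?\<sigma>]) simp
      show "lsrc Q (b' j) = lsrc Q (b (?\<sigma> j))" for j
        using B.composable[of "k - 1 - j"] by (simp add: inverse algebra_simps)
      show "band_op b' a (\<phi> \<circ> ?\<sigma>) = band_op b a \<phi> \<circ> ?\<sigma>" for a and \<phi> :: "int \<Rightarrow> 'k"
      proof
        fix j
        have e: "k - (j + 1) = k - 1 - j" "k - 1 - j + 1 = k - j" by simp_all
        have "b' (j + 1) = linv (b (k - 1 - j))" "b' j = linv (b (k - 1 - j + 1))"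
          unfolding inverse e by simp_all
        then show "band_op b' a (\<phi> \<circ> ?\<sigma>) j = (band_op b a \<phi> \<circ> ?\<sigma>) j"
          using B.reduced_Inv[of "k - 1 - j" a] by (auto simp: band_op_apply algebra_simps)
      qed
      show "(\<lambda>\<phi>. \<phi> \<circ> ?\<sigma>) ` quasi_periodic m l = quasi_periodic m (inverse l)"
      proof (intro equalityI subsetI)
        fix \<phi> assume \<phi>: "\<phi> \<in> quasi_periodic m (inverse l)"
        have "\<phi> \<circ> ?\<sigma> \<in> quasi_periodic m l"
          unfolding quasi_periodic_def
        proof (intro CollectI allI)
          fix i
          have "k - 1 - (i + int m) = k - 1 - i - int m" by simp
          then show "(\<phi> \<circ> ?\<sigma>) (i + int m) = l * (\<phi> \<circ> ?\<sigma>) i" unfolding comp_apply by (simp only: per'[OF \<phi>])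
        qed
        moreover have "\<phi> = (\<phi> \<circ> ?\<sigma>) \<circ> ?\<sigma>" by (simp add: fun_eq_iff)
        ultimately show "\<phi> \<in> (\<lambda>\<phi>. \<phi> \<circ> ?\<sigma>) ` quasi_periodic m l" by blast
      next
        fix \<psi> assume "\<psi> \<in> (\<lambda>\<phi>. \<phi> \<circ> ?\<sigma>) ` quasi_periodic m l"
        then obtain \<phi> where \<phi>: "\<phi> \<in> quasi_periodic m l" "\<psi> = \<phi> \<circ> ?\<sigma>" by blast
        show "\<psi> \<in> quasi_periodic m (inverse l)"
          unfolding quasi_periodic_def \<phi>(2)
        proof (intro CollectI allI)
          fix i
          have "k - 1 - (i + int m) = k - 1 - i - int m" by simp
          then show "(\<phi> \<circ> ?\<sigma>) (i + int m) = inverse l * (\<phi> \<circ> ?\<sigma>) i" unfolding comp_apply by (simp only: per[OF \<phi>(1)])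
        qed
      qed
    qed
    then show ?thesis using that[of "inverse l"] l inverse by simp
  qed
qed

section \<open>Splitting and extendability for fixed words\<close>

context quasi_band_pair
begin

lemma extendable_imp_nonsplit:
  fixes X :: "(('v, 'a, 'k) quot_elt, 'x) module" and Y :: "(('v, 'a, 'k) quot_elt, 'y) module"
  assumes ext: "extendable Q I (b, m) (c, n)"
    and cX: "B.coords B.vertex (band_op b) (quasi_periodic m lam) X \<Psi>X" and lam: "lam \<noteq> 0"
    and cY: "B.coords C.vertex (band_op c) (quasi_periodic n mu) Y \<Psi>Y" and mu: "mu \<noteq> 0"
  shows "\<not> (\<forall>(E, f, g)\<in>extensions (string_alg Q I) X Y.
    \<exists>s\<in>lmod_hom (string_alg Q I) X E. \<forall>x\<in>carrier X. g (s x) = x)"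
proof -
  obtain l where ov: "overlap Q b c l" and bad: "\<not> bad_direct l" "\<not> bad_inverse l"
    using extendable_imp[OF ext] by blast
  obtain \<alpha> \<beta> \<gamma> \<delta> where ends: "b 0 = Inv \<alpha>" "b (int l + 1) = Arr \<beta>" "c 0 = Arr \<gamma>" "c (int l + 1) = Inv \<delta>"
    and vert: "lsrc Q (b 0) = lsrc Q (c 0)" and eq: "\<And>i. 1 \<le> i \<Longrightarrow> i \<le> int l \<Longrightarrow> b i = c i"
    using ov by (auto simp: overlap_def)
  interpret crossing Q I b c m n l \<alpha> \<beta> \<gamma> \<delta> lam mu
    by (intro crossing.intro quasi_band_pair_axioms crossing_axioms.intro) (fact ends vert eq bad lam mu | (rule eq; assumption))+
  obtain E f g where E: "(E, f, g) \<in> extensions (string_alg Q I) X Y"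
      and no: "\<not> (\<exists>s\<in>lmod_hom (string_alg Q I) X E. \<forall>x\<in>carrier X. g (s x) = x)"
    by (rule nonsplit_extension[OF cX cY])
  show ?thesis
  proof
    assume "\<forall>(E, f, g)\<in>extensions (string_alg Q I) X Y.
      \<exists>s\<in>lmod_hom (string_alg Q I) X E. \<forall>x\<in>carrier X. g (s x) = x"
    from bspec[OF this E] show False using no by simp
  qed
qed

text \<open>The two conditions on the scalars belong to the two orientations: the inverse of c has
  multiplier \<open>1 / mu\<close>, so cyclic chains along it require
  \<open>1 / mu \<noteq> lam\<close>, those along c require \<open>mu \<noteq> lam\<close>.\<close>

lemma nonextendable_imp_split:
  fixes X :: "(('v, 'a, 'k) quot_elt, 'x) module" and Y :: "(('v, 'a, 'k) quot_elt, 'y) module"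
  assumes bands: "band Q I (b, m)" "band Q I (c, n)"
    and not_ext: "\<not> extendable_classes Q I (qband_class Q I (b, m)) (qband_class Q I (c, n))"
    and cX: "B.coords B.vertex (band_op b) (quasi_periodic m lam) X \<Psi>X" and lam: "lam \<noteq> 0"
    and cY: "B.coords C.vertex (band_op c) (quasi_periodic n mu) Y \<Psi>Y" and mu: "mu \<noteq> 0"
    and generic: "mu \<noteq> lam" "mu * lam \<noteq> 1"
    and ext: "(E, f, g) \<in> extensions (string_alg Q I) X Y"
  shows "\<exists>s\<in>lmod_hom (string_alg Q I) X E. \<forall>x\<in>carrier X. g (s x) = x"
proof -
  let ?kQ = "path_algebra Q :: ('k, ('v, 'a, 'k) kpath) module"
  obtain D where "cocycle Q I B.vertex (band_op b) (quasi_periodic m lam)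
      C.vertex (band_op c) (quasi_periodic n mu) D"
    and split: "(\<exists>H. lin_op H \<and> (\<forall>\<phi>\<in>quasi_periodic m lam. H \<phi> \<in> quasi_periodic n mu) \<and>
        (\<forall>x\<in>carrier ?kQ. \<forall>\<phi>\<in>quasi_periodic m lam.
          H (act B.vertex (band_op b) x \<phi>) = D x \<phi> + act C.vertex (band_op c) x (H \<phi>))) \<Longrightarrow>
      (\<exists>s\<in>lmod_hom (string_alg Q I) X E. \<forall>x\<in>carrier X. g (s x) = x)"
    by (rule B.extension_cocycle[OF ext B.quiver_subrep cX C.quiver_subrep cY, of "{0..<int m}" "B.delta lam"])
      (use B.delta_in[OF lam] B.delta_basis[OF _ lam] B.delta_graded in auto)
  then interpret D: cocycle Q I B.vertex "band_op b" "quasi_periodic m lam"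
    C.vertex "band_op c" "quasi_periodic n mu" D by blast
  note d_in = B.delta_in[OF lam]
  have arrow_in: "basis_path (Walk [a]) \<in> carrier ?kQ" if "a \<in> arcs Q" for a
    using that by (simp add: basis_path_def)
  \<comment> \<open>The value 0 off the arrows of Q makes the scaling rules hold for every
    a.\<close>
  define Z where "Z a i j = (if a \<in> arcs Q then D (basis_path (Walk [a])) (B.delta lam i) j else 0)" for a i j
  have D_path: "D (basis_path (Walk as)) (B.delta lam i) j = path_coeff b c Z as i j"
    if "is_path Q (Walk as)" for as i j
    using that
  proof (induction as arbitrary: j)
    case (Cons a as)
    then have a: "a \<in> arcs Q" by simp
    have single: "D (basis_path (Walk [a])) (foldr (band_op b) as (B.delta lam i)) j =
        (case posts b as i of None \<Rightarrow> 0 | Some i' \<Rightarrow> Z a i' j)"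
    proof -
      have "foldr (band_op b) as (B.delta lam i) = (case posts b as i of None \<Rightarrow> 0 | Some i' \<Rightarrow> B.delta lam i')"
      proof (induction as)
        case (Cons a as)
        then show ?case
          by (cases "posts b as i") (simp_all only: foldr.simps comp_apply posts.simps option.case Option.bind.simps
              lin_op_zero[OF B.band_op_lin] B.band_op_delta B.post.simps)
      qed simp
      moreover have "D (basis_path (Walk [a])) 0 = 0"
        using D.D_scale_right[OF arrow_in[OF a] d_in, of 0] by simp
      ultimately show ?thesis by (simp add: Z_def a split: option.split)
    qed
    show ?case
    proof (cases "as = []")
      case True
      then show ?thesis using single by (simp split: option.split)
    next
      case False
      then have path: "is_path Q (Walk as)" using Cons.prems by (auto simp: successively_Cons)
      show ?thesis
        using Cons.IH[OF path]
        unfolding D.D_Cons[OF Cons.prems False d_in] plus_fun_apply single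
        by (simp add: band_op_apply)
    qed
  qed simp
  have Z_left: "Z a (i + int m) j = Z a i j / lam" for a i j
  proof (cases "a \<in> arcs Q")
    case True
    have "D (basis_path (Walk [a])) (B.delta lam i) = fscale lam (D (basis_path (Walk [a])) (B.delta lam (i + int m)))"
      unfolding B.delta_shift[OF lam, of i] by (rule D.D_scale_right[OF arrow_in[OF True] d_in])
    then show ?thesis using True lam by (simp add: Z_def)
  qed (simp add: Z_def)
  have Z_right: "Z a i (j + int n) = mu * Z a i j" for a i j
    using D.D_in[OF arrow_in d_in, of a i] by (simp add: Z_def quasi_periodic_def)
  \<comment> \<open>An arrow equals its product with the trivial path at either end, and D vanishes
    on trivial paths. The Leibniz rule then confines the coefficients to the head and the tail of
    the arrow.\<close>
  have Z_graded: "tail Q a = B.vertex i \<and> head Q a = C.vertex j" if nz: "Z a i j \<noteq> 0" for a i j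
  proof -
    have a: "a \<in> arcs Q" using nz by (auto simp: Z_def split: if_splits)
    let ?p = "basis_path (Walk [a]) :: ('v, 'a, 'k) kpath"
    have verts: "tail Q a \<in> verts Q" "head Q a \<in> verts Q" using a B.arcs_in_verts by auto
    have tc: "basis_path (Triv u) \<in> carrier ?kQ" if "u \<in> verts Q" for u using that by (simp add: basis_path_def)
    have act_triv: "act \<nu> T (basis_path (Triv u)) \<phi> = path_act \<nu> T (Triv u) \<phi>"
      for \<nu> :: "int \<Rightarrow> 'v" and T u and \<phi> :: "int \<Rightarrow> 'k"
      by (simp only: basis_path_def act_single fscale_simps)
    have "mult ?kQ (basis_path (Triv (head Q a))) ?p = ?p"
      unfolding basis_path_def single_mult_single by (simp add: path_prod_def walk_comp_def)
    then have "D ?p (B.delta lam i) = path_act C.vertex (band_op c) (Triv (head Q a)) (D ?p (B.delta lam i)) +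
        D (basis_path (Triv (head Q a))) (act B.vertex (band_op b) ?p (B.delta lam i))"
      using D.D_mult[OF tc[OF verts(2)] arrow_in[OF a] d_in, of i] by (simp only: act_triv)
    also have "D (basis_path (Triv (head Q a))) (act B.vertex (band_op b) ?p (B.delta lam i)) = 0"
      by (rule D.D_vertex[OF verts(2) D.X.sub_act[OF d_in]])
    finally have eq: "D ?p (B.delta lam i) = path_act C.vertex (band_op c) (Triv (head Q a)) (D ?p (B.delta lam i))"
      unfolding add_0_right .
    have nz': "D ?p (B.delta lam i) j \<noteq> 0" using nz a unfolding Z_def by simp
    have "D ?p (B.delta lam i) j = (if C.vertex j = head Q a then D ?p (B.delta lam i) j else 0)"
      using fun_cong[OF eq, of j] by (simp only: path_act.simps)
    then have head: "head Q a = C.vertex j" using nz' by metis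
    have "mult ?kQ ?p (basis_path (Triv (tail Q a))) = ?p"
      unfolding basis_path_def single_mult_single by (simp add: path_prod_def walk_comp_def)
    then have "D ?p (B.delta lam i) = act C.vertex (band_op c) ?p (D (basis_path (Triv (tail Q a))) (B.delta lam i)) +
        D ?p (path_act B.vertex (band_op b) (Triv (tail Q a)) (B.delta lam i))"
      using D.D_mult[OF arrow_in[OF a] tc[OF verts(1)] d_in, of i] by (simp only: act_triv)
    also have "act C.vertex (band_op c) ?p (D (basis_path (Triv (tail Q a))) (B.delta lam i)) = 0"
      unfolding D.D_vertex[OF verts(1) d_in] by (rule lin_op_zero[OF D.Y.act_lin])
    finally have eq': "D ?p (B.delta lam i) = D ?p (path_act B.vertex (band_op b) (Triv (tail Q a)) (B.delta lam i))"
      unfolding add_0_left .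
    have "D ?p (path_act B.vertex (band_op b) (Triv (tail Q a)) (B.delta lam i)) j \<noteq> 0"
      using nz' unfolding eq'[symmetric] .
    moreover have "D ?p 0 = 0"
      using D.D_scale_right[OF arrow_in[OF a] d_in, of 0] by simp
    ultimately have "path_act B.vertex (band_op b) (Triv (tail Q a)) (B.delta lam i) \<noteq> 0" by fastforce
    then obtain x where "path_act B.vertex (band_op b) (Triv (tail Q a)) (B.delta lam i) x \<noteq> 0"
      by (auto simp: fun_eq_iff)
    then have "B.vertex x = tail Q a" "B.delta lam i x \<noteq> 0" by (auto split: if_splits)
    then have "tail Q a = B.vertex i"
      using B.cong[of x i] by (auto simp: B.delta_def split: if_splits)
    then show ?thesis using head by simp
  qed
  have Z_rel: "path_coeff b c Z as i j = 0" if rel: "B.rel as" and ne: "as \<noteq> []" for as i j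
  proof -
    have mem: "basis_path (Walk as) \<in> I" using rel by (simp add: B.rel_def)
    then have "basis_path (Walk as) \<in> carrier ?kQ" by (rule B.I.a_Hcarr)
    then have "is_path Q (Walk as)" by (simp add: basis_path_def path_algebra_simps)
    from D_path[OF this, of i j] show ?thesis using D.D_ideal[OF mem d_in, of i] by simp
  qed
  have ne1: "\<not> extendable Q I (\<lambda>x. b (k + x), m) (\<lambda>x. c (k' + x), n)" for k k'
    using not_ext B.shift_in_class[OF B.quasi_band] B.shift_in_class[OF C.quasi_band]
    unfolding extendable_classes_def by blast
  have ne2: "\<not> extendable Q I (\<lambda>x. b (k + x), m) (\<lambda>x. flip_word c (k' + x), n)" for k k'
  proof -
    have "(\<lambda>x. flip_word c (k' + x)) = (\<lambda>x. linv (c ((1 - k') - x)))" by (simp add: flip_word_def fun_eq_iff algebra_simps)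
    then show ?thesis
      using not_ext B.shift_in_class[OF B.quasi_band] B.inverse_in_class[OF C.quasi_band]
      unfolding extendable_classes_def by metis
  qed
  have qb_flip: "quasi_band Q I (flip_word c, n)"
    unfolding flip_word_def by (rule B.quasi_band_inverse[OF C.quasi_band])
  have S: "band_cocycle Q I b c m n lam mu Z"
    by unfold_locales (fact lam mu generic(1) bands Z_left Z_right Z_graded Z_rel ne1 | (rule Z_graded[THEN conjunct1] Z_graded[THEN conjunct2]; assumption))+
  have F: "band_cocycle Q I b (flip_word c) m n lam (1 / mu) (\<lambda>a i j. Z a i (- j))"
  proof (intro band_cocycle.intro quasi_band_pair.intro B.quasi_band_alg_axioms band_cocycle_axioms.intro)
    show "quasi_band_alg Q I (flip_word c) n" by unfold_locales (rule qb_flip)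
    show "1 / mu \<noteq> lam" "1 / mu \<noteq> 0" "lam \<noteq> 0" using generic(2) mu lam by (auto simp: field_simps)
    show "band Q I (b, m)" by (fact bands)
    show "band Q I (flip_word c, n)" unfolding flip_word_def by (rule B.band_inverse[OF bands(2)])
    show "Z a (i + int m) (- j) = Z a i (- j) / lam" for a i j by (rule Z_left)
    show "Z a i (- (j + int n)) = 1 / mu * Z a i (- j)" for a i j
      using Z_right[of a i "- j - int n"] mu by simp
    show "tail Q a = lsrc Q (b i) \<and> head Q a = lsrc Q (flip_word c j)" if "Z a i (- j) \<noteq> 0" for a i j
    proof -
      have "C.vertex (- j) = lsrc Q (flip_word c j)"
        using C.composable[of "- j"] by (simp add: flip_word_def)
      then show ?thesis using Z_graded[OF that] by simp
    qed
    show "path_coeff b (flip_word c) (\<lambda>a i j. Z a i (- j)) as i j = 0" if "B.rel as" "as \<noteq> []" for as i j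
      unfolding C.path_coeff_flip by (rule Z_rel[OF that])
    show "\<not> extendable Q I (\<lambda>x. b (k + x), m) (\<lambda>x. flip_word c (k' + x), n)" for k k' by (rule ne2)
  qed
  interpret FC: flip_cocycle Q I b c m n lam mu Z
    by (intro flip_cocycle.intro S F)
  \<comment> \<open>H sends \<open>delta lam i\<close> to the row \<open>FC.h i\<close>. Summing
    over one period is consistent because \<phi> has multiplier lam while h has multiplier 1 / lam
    in its first argument.\<close>
  define H where "H \<phi> = (\<lambda>j. \<Sum>i\<in>{0..<int m}. \<phi> i * FC.h i j)" for \<phi> :: "int \<Rightarrow> 'k"
  have H_lin: "lin_op H"
    by (simp add: lin_op_def H_def fun_eq_iff distrib_right sum.distrib sum_distrib_left mult.assoc)
  have H_in: "H \<phi> \<in> quasi_periodic n mu" for \<phi>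
    by (simp add: H_def quasi_periodic_def FC.h_right sum_distrib_left mult.left_commute)
  have H_delta: "H (B.delta lam i) = FC.h i" for i
  proof
    fix j
    let ?r = "i mod int m"
    have r: "?r \<in> {0..<int m}" using B.m_pos by simp
    have "H (B.delta lam i) j = (\<Sum>x\<in>{0..<int m}. if x = ?r then B.delta lam i x * FC.h x j else 0)"
      unfolding H_def using r
      by (intro sum.cong) (auto simp: B.delta_def mod_eq_dvd_iff[symmetric])
    also have "\<dots> = B.delta lam i ?r * FC.h ?r j" using r by simp
    also have "B.delta lam i ?r = lam powi (- (i div int m))"
    proof -
      have "?r - i = (- (i div int m)) * int m" by (simp add: minus_div_mult_eq_mod[symmetric])
      then show ?thesis using B.m_pos by (simp add: B.delta_def del: mult_minus_left)
    qed
    also have "FC.h ?r j = lam powi (i div int m) * FC.h i j"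
    proof -
      have "(\<lambda>i. FC.h i j) \<in> quasi_periodic m (1 / lam)" by (simp add: quasi_periodic_def FC.h_left)
      from quasi_periodic_shift[OF this, of ?r "i div int m"]
      have "FC.h i j = (1 / lam) powi (i div int m) * FC.h ?r j" using lam by simp
      then show ?thesis using lam by (simp add: power_int_divide_distrib)
    qed
    also have "lam powi (- (i div int m)) * (lam powi (i div int m) * FC.h i j) = FC.h i j"
      using lam by (simp add: power_int_minus)
    finally show "H (B.delta lam i) j = FC.h i j" .
  qed
  have H_arrow: "H (band_op b a \<phi>) = D (basis_path (Walk [a])) \<phi> + band_op c a (H \<phi>)"
    if \<phi>: "\<phi> \<in> quasi_periodic m lam" and a: "a \<in> arcs Q" for a \<phi>
  proof -
    have on_delta: "H (band_op b a (B.delta lam i)) =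
        D (basis_path (Walk [a])) (B.delta lam i) + band_op c a (H (B.delta lam i))" for i
    proof
      fix j
      have "H (band_op b a (B.delta lam i)) j = (case posts b [a] i of None \<Rightarrow> 0 | Some i' \<Rightarrow> FC.h i' j)"
        unfolding B.band_op_delta using lin_op_zero[OF H_lin] by (simp add: H_delta)
      also have "\<dots> = Z a i j + band_op c a (FC.h i) j"
        unfolding FC.coboundary[OF a] band_op_def ..
      finally show "H (band_op b a (B.delta lam i)) j =
          (D (basis_path (Walk [a])) (B.delta lam i) + band_op c a (H (B.delta lam i))) j"
        by (simp add: Z_def a H_delta)
    qed
    let ?L = "\<lambda>\<phi>. H (band_op b a \<phi>)"
      and ?R = "\<lambda>\<phi>. D (basis_path (Walk [a])) \<phi> + band_op c a (H \<phi>)"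
    have sum_in: "(\<Sum>i\<in>A. fscale (\<phi> i) (B.delta lam i)) \<in> quasi_periodic m lam" if "finite A" for A
      using that
    proof (induction A rule: finite_induct)
      case empty
      show ?case unfolding sum.empty by (rule D.X.sub_zero)
    next
      case (insert x A)
      show ?case unfolding sum.insert[OF insert(1,2)]
        by (rule D.X.sub_add[OF D.X.sub_scale[OF d_in] insert(3)])
    qed
    have "?L (\<Sum>i\<in>A. fscale (\<phi> i) (B.delta lam i)) = ?R (\<Sum>i\<in>A. fscale (\<phi> i) (B.delta lam i))"
      if "finite A" for A
      using that
    proof (induction A rule: finite_induct)
      case empty
      have "D (basis_path (Walk [a])) 0 = 0"
        using D.D_scale_right[OF arrow_in[OF a] d_in, of 0] by simp
      then show ?case
        by (simp only: sum.empty lin_op_zero[OF H_lin] lin_op_zero[OF B.band_op_lin] lin_op_zero[OF C.band_op_lin] add_0_left)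
    next
      case (insert x A)
      let ?d = "B.delta lam x" and ?s = "\<Sum>i\<in>A. fscale (\<phi> i) (B.delta lam i)"
      have s: "?s \<in> quasi_periodic m lam" "fscale (\<phi> x) ?d \<in> quasi_periodic m lam"
        using sum_in[OF insert(1)] D.X.sub_scale[OF d_in] by auto
      have "?L (fscale (\<phi> x) ?d + ?s) = fscale (\<phi> x) (?L ?d) + ?L ?s"
        by (simp only: lin_op_add[OF H_lin] lin_op_add[OF B.band_op_lin] lin_op_scale[OF H_lin] lin_op_scale[OF B.band_op_lin])
      also have "\<dots> = fscale (\<phi> x) (?R ?d) + ?R ?s" unfolding on_delta insert(3) ..
      also have "\<dots> = ?R (fscale (\<phi> x) ?d + ?s)"
        unfolding D.D_add_right[OF arrow_in[OF a] s(2,1)] D.D_scale_right[OF arrow_in[OF a] d_in]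
          lin_op_add[OF H_lin] lin_op_add[OF C.band_op_lin] lin_op_scale[OF H_lin] lin_op_scale[OF C.band_op_lin]
        by (simp add: fun_eq_iff algebra_simps)
      finally show ?case unfolding sum.insert[OF insert(1,2)] .
    qed
    from this[of "{0..<int m}"] show ?thesis unfolding B.delta_basis[OF \<phi> lam, symmetric] by simp
  qed
  have H_vertex: "H (path_act B.vertex (band_op b) (Triv u) \<phi>) = path_act C.vertex (band_op c) (Triv u) (H \<phi>)" for u \<phi>
  proof
    fix j
    have "(if B.vertex i = u then \<phi> i else 0) * FC.h i j = (if C.vertex j = u then \<phi> i * FC.h i j else 0)" for i
      using FC.h_vertex[of i j] by auto
    then show "H (path_act B.vertex (band_op b) (Triv u) \<phi>) j = path_act C.vertex (band_op c) (Triv u) (H \<phi>) j"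
      by (simp add: H_def)
  qed
  show ?thesis
  proof (rule split, intro exI[of _ H] conjI ballI H_lin H_in)
    fix x \<phi> assume "x \<in> carrier ?kQ" "\<phi> \<in> quasi_periodic m lam"
    then show "H (act B.vertex (band_op b) x \<phi>) = D x \<phi> + act C.vertex (band_op c) x (H \<phi>)"
      by (intro D.coboundary_from_arrows H_in H_lin H_vertex H_arrow)
  qed
qed

end

text \<open>A root of \<open>x^2 - x - 1\<close>, a polynomial with value -1 at both 0 and 1. With
  lam = 1 both conditions on the scalars reduce to \<open>mu \<noteq> 1\<close>.\<close>

lemma exists_generic_scalar:
  obtains \<mu> :: "'k::alg_closed_field" where "\<mu> \<noteq> 0" "\<mu> \<noteq> 1"
proof -
  obtain \<mu> :: 'k where "poly [:-1, -1, 1:] \<mu> = 0"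
    using alg_closed_imp_poly_has_root[of "[:-1, -1, 1 :: 'k:]"] by auto
  then have "\<mu> \<noteq> 0" "\<mu> \<noteq> 1" by auto
  then show ?thesis by (rule that)
qed

theorem proposition1p2:
  fixes Q :: "('v, 'a) pre_digraph"
    and I :: "('v, 'a, 'k::alg_closed_field) kpath set"
    and b c :: "int \<Rightarrow> 'a letter"
    and m n :: nat
  assumes "string_algebra Q I"
    and "band Q I (b, m)"
    and "band Q I (c, n)"
  shows "(\<exists>X\<in>band_family Q I b m. \<exists>Y\<in>band_family Q I c n.
            Ext1 (string_alg Q I) (point_module m X) (point_module n Y) =
            {Ext1_zero (string_alg Q I) (point_module m X) (point_module n Y)})
         \<longleftrightarrow> \<not> extendable_classes Q I (qband_class Q I (b, m)) (qband_class Q I (c, n))"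
proof -
  have qb: "quasi_band Q I (b, m)" "quasi_band Q I (c, n)"
    using assms(2,3) unfolding band.simps by blast+
  interpret string_quiver Q I by unfold_locales (rule assms(1))
  interpret quasi_band_pair Q I b c m n
    by (intro quasi_band_pair.intro quasi_band_alg.intro quasi_band_alg_axioms.intro string_quiver_axioms qb)
  show ?thesis
  proof
    assume "\<exists>X\<in>band_family Q I b m. \<exists>Y\<in>band_family Q I c n.
      Ext1 (string_alg Q I) (point_module m X) (point_module n Y) =
      {Ext1_zero (string_alg Q I) (point_module m X) (point_module n Y)}"
    then obtain X Y where X: "X \<in> band_family Q I b m" and Y: "Y \<in> band_family Q I c n"
      and Ext: "Ext1 (string_alg Q I) (point_module m X) (point_module n Y) =
        {Ext1_zero (string_alg Q I) (point_module m X) (point_module n Y)}" by blast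
    obtain lam \<Psi>X where lam: "lam \<noteq> 0"
      and cX: "coords B.vertex (band_op b) (quasi_periodic m lam) (point_module m X) \<Psi>X"
      using B.family_coords[OF X] by blast
    obtain mu \<Psi>Y where mu: "mu \<noteq> 0"
      and cY: "coords C.vertex (band_op c) (quasi_periodic n mu) (point_module n Y) \<Psi>Y"
      using C.family_coords[OF Y] by blast
    have split: "\<forall>(E, f, g)\<in>extensions (string_alg Q I) (point_module m X) (point_module n Y).
        \<exists>s\<in>lmod_hom (string_alg Q I) (point_module m X) E. \<forall>x\<in>carrier (point_module m X). g (s x) = x"
      by (rule iffD1[OF Ext1_trivial_iff[OF coords_left_module[OF B.quiver_subrep cX]
            coords_left_module[OF C.quiver_subrep cY]] Ext])
    show "\<not> extendable_classes Q I (qband_class Q I (b, m)) (qband_class Q I (c, n))"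
    proof
      assume "extendable_classes Q I (qband_class Q I (b, m)) (qband_class Q I (c, n))"
      then obtain B' C' where "B' \<in> qband_class Q I (b, m)" "C' \<in> qband_class Q I (c, n)" "extendable Q I B' C'"
        unfolding extendable_classes_def by blast
      then obtain b' m' c' n' where b': "(b', m') \<in> qband_class Q I (b, m)"
        and c': "(c', n') \<in> qband_class Q I (c, n)" and ext: "extendable Q I (b', m') (c', n')"
        by (cases B', cases C') simp
      have qb': "quasi_band Q I (b', m')" "quasi_band Q I (c', n')"
        using b' c' by (auto simp: qband_class_def qband_rel_def simp del: quasi_band.simps)
      interpret P: quasi_band_pair Q I b' c' m' n'
        by (intro quasi_band_pair.intro quasi_band_alg.intro quasi_band_alg_axioms.intro string_quiver_axioms qb')
      \<comment> \<open>The extendable representatives may differ from (b, m) and (c, n); the same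
        two modules are now described in terms of the new words.\<close>
      obtain lam' \<Psi>X' where lam': "lam' \<noteq> 0"
        and cX': "coords P.B.vertex (band_op b') (quasi_periodic m' lam') (point_module m X) \<Psi>X'"
        by (rule class_coords[OF qb(1) b' lam cX])
      obtain mu' \<Psi>Y' where mu': "mu' \<noteq> 0"
        and cY': "coords P.C.vertex (band_op c') (quasi_periodic n' mu') (point_module n Y) \<Psi>Y'"
        by (rule class_coords[OF qb(2) c' mu cY])
      show False
        by (rule notE[OF P.extendable_imp_nonsplit[OF ext cX' lam' cY' mu'] split])
    qed
  next
    assume not_ext: "\<not> extendable_classes Q I (qband_class Q I (b, m)) (qband_class Q I (c, n))"
    obtain \<mu> :: 'k where \<mu>: "\<mu> \<noteq> 0" "\<mu> \<noteq> 1" by (rule exists_generic_scalar)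
    obtain X \<Psi>X where X: "X \<in> band_family Q I b m"
      and cX: "coords B.vertex (band_op b) (quasi_periodic m 1) (point_module m X) \<Psi>X"
      using B.family_exists[of 1] by auto
    obtain Y \<Psi>Y where Y: "Y \<in> band_family Q I c n"
      and cY: "coords C.vertex (band_op c) (quasi_periodic n \<mu>) (point_module n Y) \<Psi>Y"
      using C.family_exists[OF \<mu>(1)] by auto
    have "\<exists>s\<in>lmod_hom (string_alg Q I) (point_module m X) E. \<forall>x\<in>carrier (point_module m X). g (s x) = x"
      if "(E, f, g) \<in> extensions (string_alg Q I) (point_module m X) (point_module n Y)" for E f g
      by (rule nonextendable_imp_split[OF assms(2,3) not_ext cX _ cY \<mu>(1) _ _ that]) (use \<mu> in auto)
    then have "\<forall>(E, f, g)\<in>extensions (string_alg Q I) (point_module m X) (point_module n Y).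
        \<exists>s\<in>lmod_hom (string_alg Q I) (point_module m X) E. \<forall>x\<in>carrier (point_module m X). g (s x) = x"
      by (intro ballI) (simp only: split_paired_all prod.case)
    then have "Ext1 (string_alg Q I) (point_module m X) (point_module n Y) =
        {Ext1_zero (string_alg Q I) (point_module m X) (point_module n Y)}"
      by (rule iffD2[OF Ext1_trivial_iff[OF coords_left_module[OF B.quiver_subrep cX]
            coords_left_module[OF C.quiver_subrep cY]]])
    then show "\<exists>X\<in>band_family Q I b m. \<exists>Y\<in>band_family Q I c n.
        Ext1 (string_alg Q I) (point_module m X) (point_module n Y) =
        {Ext1_zero (string_alg Q I) (point_module m X) (point_module n Y)}"
      using X Y by blast
  qed
qed

end
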